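(* Let $(M,g)$ be a (timelike) quaternionic (para)Kähler Heisenberg four-manifold (that is, either quaternionic Kähler, $\varepsilon=1$, or timelike quaternionic paraKähler, $\varepsilon=-1$) with Einstein constant $\Lambda\neq0$. Then the metric takes the form $$g=-\frac{3}{2 \varepsilon \Lambda \rho^2}\, \frac{\rho+2\gamma}{\rho+\gamma} \left ( \varepsilon\, d\rho^2+\frac{\varepsilon}{k^2} \left( \frac{\rho+\gamma}{\rho+2\gamma}\right)^2 \mathfrak{e}_{t_0}^1\otimes \mathfrak{e}_{t_0}^1+2(\rho+\gamma) \left (\mathfrak{e}_{t_0}^2\otimes \mathfrak{e}_{t_0}^2+\mathfrak{e}_{t_0}^3\otimes \mathfrak{e}_{t_0}^3 \right)\right),$$ where $(\mathfrak{e}^i_{t_0})$ is a left-invariant coframe of $\mathrm{H}$ whose dual frame has only non-vanishing bracket $[\mathfrak{e}_2^{t_0},\mathfrak{e}_3^{t_0}]=-2k\, \mathfrak{e}_1^{t_0}$ with $k > 0$, and $\rho\in\mathcal I$ for an open interval $\mathcal I\subseteq\mathbb R$ and a constant $\gamma\in\mathbb{R}$ specified as follows. Let $$\rho_l=-\frac{e^{-(4-2l)i \pi/3}}{2k (\varepsilon \Lambda)^{1/3}(9k+\sqrt{81k^2+ \varepsilon\Lambda})^{1/3}}+e^{(4-2l)i \pi/3}\, \frac{(9k+\sqrt{81k^2+ \varepsilon\Lambda})^{1/3}}{2k (\varepsilon\Lambda)^{2/3}},\qquad l=1,2,3,$$ $$\rho_4=\frac{\varepsilon \Lambda }{2k\,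 \big(-9 k \Lambda^4+\sqrt{ \Lambda^8 (81 k^2+\varepsilon\Lambda)}\big)^{1/3}} - \frac{1}{2k \Lambda^2} \big(-9 k \Lambda^4+\sqrt{\Lambda^8(81 k^2+\varepsilon\Lambda) } \big)^{1/3}$$ (considered whenever real). For a real number $\rho_0$ put $2\gamma=-\rho_0\left(1+\frac{\varepsilon\Lambda}{3}\rho_0\right)$ and, for $j\in\{1,2\}$, let $I^j_{\rho_0}$ be the connected component containing $\rho_0$ of $$\{\rho \in \mathbb{R}\, |\, \rho \neq0,\ \rho+\gamma >0 \ \text{and}\ (-1)^{j+1}(\rho+2\gamma)>0\}.$$ Then: 1. Setting $\mathcal{I}= I^1_{\rho_l}$, $l=1,2,3$ (with the $\gamma$ associated with $\rho_0=\rho_l$), one obtains all (timelike) quaternionic (para)Kähler Heisenberg four-manifolds with $\varepsilon\Lambda<0$. The solution given by $\rho_1$ is defined for all $\varepsilon\Lambda < 0$, while the other two are defined for all $\varepsilon\Lambda \leq -81k^2$. The manifolds arising from $\rho_2$ and $\rho_3$, together with those arising from $\rho_1$ for $\varepsilon\Lambda > -6k^2$, are incomplete, while the one arising from $\rho_1$ for $\varepsilon=1$ and $\Lambda < -6k^2$ is complete. 2. Setting $\mathcal{I}= I^2_{\rho_4}$ (with the $\gamma$ associated with $\rho_0=\rho_4$), one obtains all (timelike) quaternionic (para)Kähler Heisenberg four-manifolds with $\varepsilon\Lambda>0$. They are all incomplete. Here "one obtains all" is meant for maximal solutions, i.e. every such manifold has metric $$g=-\frac{3}{2 \varepsilon \Lambda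 \rho^2}\, \frac{\rho+2\gamma}{\rho+\gamma} \left ( \varepsilon\, d\rho^2+\frac{\varepsilon}{k^2} \left( \frac{\rho+\gamma}{\rho+2\gamma}\right)^2 \mathfrak{e}_{t_0}^1\otimes \mathfrak{e}_{t_0}^1+2(\rho+\gamma) \left (\mathfrak{e}_{t_0}^2\otimes \mathfrak{e}_{t_0}^2+\mathfrak{e}_{t_0}^3\otimes \mathfrak{e}_{t_0}^3 \right)\right)$$ with $\rho$ ranging over an open subinterval of $I^1_{\rho_l}$ for some $l\in\{1,2,3\}$ (if $\varepsilon\Lambda<0$) or of $I^2_{\rho_4}$ (if $\varepsilon\Lambda>0$), with the associated $\gamma$.
   Context: $\mathrm{H}$ is the three-dimensional Heisenberg group (the connected, simply connected, non-abelian nilpotent three-dimensional Lie group), with Lie algebra $\mathfrak h$ and one-dimensional center $\mathcal Z\subset\mathfrak h$. A Heisenberg four-manifold is a four-dimensional pseudo-Riemannian manifold $(M,g)$ foliated by the orbits of a principal isometric action of $\mathrm{H}$. Standing assumptions: the orbits are non-degenerate and (after passing to the universal covering and up to an overall sign of the metric) $M\cong\mathcal J\times \mathrm{H}$ with $\mathcal J\subset\mathbb R$ an open interval and $g=\varepsilon\, dt^2+\chi_t$, $\varepsilon=\pm1$, where $\{\chi_t\}$ is a family of left-invariant metrics on $\mathrm{H}$, Riemannian if $\varepsilon=1$ (so $g$ is Riemannian) and Lorentzian of signature $(-,+,+)$ if $\varepsilon=-1$ (so $g$ is of neutral signature). For $\varepsilon=-1$, $(M,g)$ is called timelike if $\mathcal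 Z$ is timelike with respect to $\chi_t$ for every $t$. A Riemannian (resp. neutral-signature) orientable four-manifold is quaternionic Kähler (resp. quaternionic paraKähler) if $\mathrm{Ric}^g=\Lambda g$ with $\Lambda\ne0$ and $g$ is half-conformally flat (its Weyl tensor is self-dual for one of the two orientations). A time $t_0\in\mathcal J$ is fixed, and $(\mathfrak e_i^{t_0})$ is a left-invariant $\chi_{t_0}$-orthonormal frame with $\mathfrak e_1^{t_0}$ spanning the center, $\chi_{t_0}(\mathfrak e_1^{t_0},\mathfrak e_1^{t_0})=\varepsilon$. Convention for roots: $z^{1/3}=|z|^{1/3}e^{\frac i3\arg z}$ for $z\in\mathbb C$, with $\arg z\in(-\pi,\pi]$ (so $\arg z=\pi$ for $z<0$), $z^{2/3}=(z^{1/3})^2$, and $\sqrt{x}=i\sqrt{|x|}$ for $x<0$. (In)complete means geodesically (in)complete. *)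

theory Defs
  imports "HOL-Analysis.Analysis"
begin

section \<open>Pseudo-Riemannian metrics on open subsets of coordinate space\<close>

text \<open>
  All manifolds below are diffeomorphic to an open subset of \<open>real ^ 'n\<close>, so they are
  described in one global chart. A field of bilinear forms \<open>g\<close> assigns to a point \<open>x\<close> and to
  two tangent vectors \<open>u\<close>, \<open>v\<close> the number \<open>g x u v\<close>.
\<close>

type_synonym 'n form_field = "real ^ 'n \<Rightarrow> real ^ 'n \<Rightarrow> real ^ 'n \<Rightarrow> real"

definition partial_deriv :: "'n::finite \<Rightarrow> (real ^ 'n \<Rightarrow> real) \<Rightarrow> real ^ 'n \<Rightarrow> real" where
  "partial_deriv i f x = deriv (\<lambda>s. f (x + s *\<^sub>R axis i 1)) 0"

primrec times_differentiable_on ::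
    "nat \<Rightarrow> (real ^ 'n::finite \<Rightarrow> real) \<Rightarrow> (real ^ 'n) set \<Rightarrow> bool" where
  "times_differentiable_on 0 f U \<longleftrightarrow> continuous_on U f"
| "times_differentiable_on (Suc m) f U \<longleftrightarrow>
     (\<forall>x\<in>U. f differentiable (at x)) \<and>
     (\<forall>i. times_differentiable_on m (partial_deriv i f) U)"

definition smooth_fun_on :: "(real ^ 'n::finite \<Rightarrow> real) \<Rightarrow> (real ^ 'n) set \<Rightarrow> bool" where
  "smooth_fun_on f U \<longleftrightarrow> (\<forall>m. times_differentiable_on m f U)"

definition orthonormal_basis ::
    "(real ^ 'n \<Rightarrow> real ^ 'n \<Rightarrow> real) \<Rightarrow> real ^ 'n \<Rightarrow> real ^ 'n ^ 'n::finite \<Rightarrow> bool" where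
  \<comment> \<open>The basis vectors are the rows of \<open>b\<close>; the entries of \<open>d\<close> are meant to be \<open>1\<close> or \<open>-1\<close>,
      and then the rows are automatically linearly independent when \<open>q\<close> is bilinear.\<close>
  "orthonormal_basis q d b \<longleftrightarrow> (\<forall>i j. q (b $ i) (b $ j) = (if i = j then d $ i else 0))"

definition has_signature ::
    "(real ^ 'n \<Rightarrow> real ^ 'n \<Rightarrow> real) \<Rightarrow> real ^ 'n::finite \<Rightarrow> bool" where
  "has_signature q d \<longleftrightarrow> bilinear q \<and> (\<exists>b. orthonormal_basis q d b)"

definition metric_component :: "'n form_field \<Rightarrow> 'n \<Rightarrow> 'n \<Rightarrow> real ^ 'n::finite \<Rightarrow> real" where
  "metric_component g i j x = g x (axis i 1) (axis j 1)"

definition pseudo_riemannian_metric ::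
    "(real ^ 'n) set \<Rightarrow> real ^ 'n \<Rightarrow> ('n::finite) form_field \<Rightarrow> bool" where
  "pseudo_riemannian_metric U d g \<longleftrightarrow>
     open U \<and> (\<forall>x\<in>U. has_signature (g x) d) \<and>
     (\<forall>i j. smooth_fun_on (metric_component g i j) U)"

definition metric_matrix :: "'n form_field \<Rightarrow> real ^ 'n \<Rightarrow> real ^ 'n ^ 'n::finite" where
  "metric_matrix g x = (\<chi> i j. metric_component g i j x)"

definition inverse_metric :: "'n form_field \<Rightarrow> 'n \<Rightarrow> 'n \<Rightarrow> real ^ 'n::finite \<Rightarrow> real" where
  "inverse_metric g i j x = matrix_inv (metric_matrix g x) $ i $ j"

definition christoffel :: "'n form_field \<Rightarrow> 'n \<Rightarrow> 'n \<Rightarrow> 'n \<Rightarrow> real ^ 'n::finite \<Rightarrow> real" where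
  \<comment> \<open>The first index is the upper one.\<close>
  "christoffel g k i j x = (\<Sum>l\<in>UNIV. inverse_metric g k l x *
     (partial_deriv i (metric_component g j l) x + partial_deriv j (metric_component g i l) x
      - partial_deriv l (metric_component g i j) x)) / 2"

definition riemann :: "'n form_field \<Rightarrow> 'n \<Rightarrow> 'n \<Rightarrow> 'n \<Rightarrow> 'n \<Rightarrow> real ^ 'n::finite \<Rightarrow> real" where
  \<comment> \<open>The \<open>l\<close>-th component of
      \<open>\<nabla>\<^sub>i \<nabla>\<^sub>j \<partial>\<^sub>k - \<nabla>\<^sub>j \<nabla>\<^sub>i \<partial>\<^sub>k\<close>.\<close>
  "riemann g l k i j x =
     partial_deriv i (christoffel g l j k) x - partial_deriv j (christoffel g l i k) x
     + (\<Sum>m\<in>UNIV. christoffel g l i m x * christoffel g m j k x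
                 - christoffel g l j m x * christoffel g m i k x)"

definition ricci :: "'n form_field \<Rightarrow> 'n \<Rightarrow> 'n \<Rightarrow> real ^ 'n::finite \<Rightarrow> real" where
  "ricci g k j x = (\<Sum>i\<in>UNIV. riemann g i k i j x)"

definition scalar_curvature :: "('n::finite) form_field \<Rightarrow> real ^ 'n \<Rightarrow> real" where
  "scalar_curvature g x = (\<Sum>i\<in>UNIV. \<Sum>j\<in>UNIV. inverse_metric g i j x * ricci g i j x)"

definition einstein :: "(real ^ 'n) set \<Rightarrow> ('n::finite) form_field \<Rightarrow> real \<Rightarrow> bool" where
  "einstein U g \<Lambda> \<longleftrightarrow>
     (\<forall>x\<in>U. \<forall>i j. ricci g i j x = \<Lambda> * metric_component g i j x)"

subsection \<open>Geodesics\<close>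

definition geodesic_with_velocity ::
    "(real ^ 'n) set \<Rightarrow> ('n::finite) form_field \<Rightarrow> (real \<Rightarrow> real ^ 'n) \<Rightarrow> (real \<Rightarrow> real ^ 'n) \<Rightarrow> bool" where
  "geodesic_with_velocity U g c v \<longleftrightarrow>
     (\<forall>s. c s \<in> U \<and> (c has_vector_derivative v s) (at s) \<and>
          (v has_vector_derivative
             (\<chi> k. - (\<Sum>i\<in>UNIV. \<Sum>j\<in>UNIV. christoffel g k i j (c s) * v s $ i * v s $ j))) (at s))"

definition geodesically_complete :: "(real ^ 'n) set \<Rightarrow> ('n::finite) form_field \<Rightarrow> bool" where
  "geodesically_complete U g \<longleftrightarrow>
     (\<forall>p\<in>U. \<forall>w. \<exists>c v. geodesic_with_velocity U g c v \<and> c 0 = p \<and> v 0 = w)"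

subsection \<open>Isometries\<close>

definition smooth_map_on :: "(real ^ 'n::finite \<Rightarrow> real ^ 'm) \<Rightarrow> (real ^ 'n) set \<Rightarrow> bool" where
  "smooth_map_on \<phi> U \<longleftrightarrow> (\<forall>i. smooth_fun_on (\<lambda>x. \<phi> x $ i) U)"

definition diffeomorphism_between ::
    "(real ^ 'n) set \<Rightarrow> (real ^ 'n) set \<Rightarrow> (real ^ 'n::finite \<Rightarrow> real ^ 'n) \<Rightarrow> bool" where
  "diffeomorphism_between U V \<phi> \<longleftrightarrow>
     bij_betw \<phi> U V \<and> smooth_map_on \<phi> U \<and> smooth_map_on (inv_into U \<phi>) V"

definition isometry_between ::
    "(real ^ 'n) set \<Rightarrow> ('n::finite) form_field \<Rightarrow> (real ^ 'n) set \<Rightarrow> 'n form_field \<Rightarrow>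
     (real ^ 'n \<Rightarrow> real ^ 'n) \<Rightarrow> bool" where
  "isometry_between U g V h \<phi> \<longleftrightarrow>
     diffeomorphism_between U V \<phi> \<and>
     (\<forall>x\<in>U. \<forall>u v. g x u v =
        h (\<phi> x) (frechet_derivative \<phi> (at x) u) (frechet_derivative \<phi> (at x) v))"

subsection \<open>Half-conformally flat metrics in dimension four\<close>

definition weyl :: "4 form_field \<Rightarrow> 4 \<Rightarrow> 4 \<Rightarrow> 4 \<Rightarrow> 4 \<Rightarrow> real ^ 4 \<Rightarrow> real" where
  \<comment> \<open>All indices lowered; contracting the first and third index of the lowered curvature
      tensor gives \<open>ricci\<close>.\<close>
  "weyl g l k i j x =
     (\<Sum>m\<in>UNIV. metric_component g l m x * riemann g m k i j x)
     - (metric_component g l i x * ricci g k j x - metric_component g l j x * ricci g k i x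
        - metric_component g k i x * ricci g l j x + metric_component g k j x * ricci g l i x) / 2
     + scalar_curvature g x / 6 *
       (metric_component g l i x * metric_component g k j x
        - metric_component g l j x * metric_component g k i x)"

definition levi_civita :: "4 \<Rightarrow> 4 \<Rightarrow> 4 \<Rightarrow> 4 \<Rightarrow> real" where
  "levi_civita i j k l = det (vector [axis i 1, axis j 1, axis k 1, axis l 1] :: real ^ 4 ^ 4)"

definition volume_form :: "4 form_field \<Rightarrow> 4 \<Rightarrow> 4 \<Rightarrow> 4 \<Rightarrow> 4 \<Rightarrow> real ^ 4 \<Rightarrow> real" where
  "volume_form g i j k l x = sqrt \<bar>det (metric_matrix g x)\<bar> * levi_civita i j k l"

definition hodge_weyl :: "4 form_field \<Rightarrow> 4 \<Rightarrow> 4 \<Rightarrow> 4 \<Rightarrow> 4 \<Rightarrow> real ^ 4 \<Rightarrow> real" where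
  \<comment> \<open>The Hodge star, for the standard orientation of the chart, applied to the first pair of
      indices of the Weyl tensor.\<close>
  "hodge_weyl g i j k l x =
     (\<Sum>a\<in>UNIV. \<Sum>b\<in>UNIV. \<Sum>m\<in>UNIV. \<Sum>n\<in>UNIV.
        volume_form g i j a b x * inverse_metric g a m x * inverse_metric g b n x
        * weyl g m n k l x) / 2"

definition half_conformally_flat :: "(real ^ 4) set \<Rightarrow> 4 form_field \<Rightarrow> bool" where
  \<comment> \<open>Reversing the orientation changes the sign of the Hodge star; on a connected \<open>U\<close> there
      are exactly two orientations, which correspond to the two values of \<open>\<sigma>\<close>.\<close>
  "half_conformally_flat U g \<longleftrightarrow>
     (\<exists>\<sigma>\<in>{1, -1}. \<forall>x\<in>U. \<forall>i j k l. hodge_weyl g i j k l x = \<sigma> * weyl g i j k l x)"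

definition quaternionic_kaehler :: "(real ^ 4) set \<Rightarrow> 4 form_field \<Rightarrow> real \<Rightarrow> bool" where
  "quaternionic_kaehler U g \<Lambda> \<longleftrightarrow>
     pseudo_riemannian_metric U (vector [1, 1, 1, 1]) g \<and>
     \<Lambda> \<noteq> 0 \<and> einstein U g \<Lambda> \<and> half_conformally_flat U g"

definition quaternionic_parakaehler :: "(real ^ 4) set \<Rightarrow> 4 form_field \<Rightarrow> real \<Rightarrow> bool" where
  "quaternionic_parakaehler U g \<Lambda> \<longleftrightarrow>
     pseudo_riemannian_metric U (vector [-1, -1, 1, 1]) g \<and>
     \<Lambda> \<noteq> 0 \<and> einstein U g \<Lambda> \<and> half_conformally_flat U g"

section \<open>The Heisenberg group\<close>

text \<open>The Heisenberg group is \<open>real ^ 3\<close> with the following multiplication and neutral element \<open>0\<close>.\<close>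

definition heis_mult :: "real ^ 3 \<Rightarrow> real ^ 3 \<Rightarrow> real ^ 3" where
  "heis_mult p q =
     vector [p $ 1 + q $ 1, p $ 2 + q $ 2, p $ 3 + q $ 3 + (p $ 1 * q $ 2 - p $ 2 * q $ 1) / 2]"

definition left_translation_deriv :: "real ^ 3 \<Rightarrow> real ^ 3 \<Rightarrow> real ^ 3 \<Rightarrow> real ^ 3" where
  "left_translation_deriv a p = frechet_derivative (heis_mult a) (at p)"

text \<open>The Lie algebra is the tangent space \<open>real ^ 3\<close> at \<open>0\<close>, with the bracket of left-invariant
  vector fields.\<close>

definition left_invariant_field :: "real ^ 3 \<Rightarrow> real ^ 3 \<Rightarrow> real ^ 3" where
  "left_invariant_field v p = left_translation_deriv p 0 v"

definition vector_field_bracket ::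
    "(real ^ 'n \<Rightarrow> real ^ 'n) \<Rightarrow> (real ^ 'n \<Rightarrow> real ^ 'n) \<Rightarrow> real ^ 'n::finite \<Rightarrow> real ^ 'n" where
  "vector_field_bracket X Y p =
     frechet_derivative Y (at p) (X p) - frechet_derivative X (at p) (Y p)"

definition heis_bracket :: "real ^ 3 \<Rightarrow> real ^ 3 \<Rightarrow> real ^ 3" where
  "heis_bracket v w = vector_field_bracket (left_invariant_field v) (left_invariant_field w) 0"

definition heis_center :: "(real ^ 3) set" where
  "heis_center = {v. \<forall>w. heis_bracket v w = 0}"

definition left_invariant :: "3 form_field \<Rightarrow> bool" where
  "left_invariant h \<longleftrightarrow>
     (\<forall>a p u v. h (heis_mult a p) (left_translation_deriv a p u) (left_translation_deriv a p v)
                = h p u v)"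

text \<open>A left-invariant frame is given by the rows of a matrix \<open>e\<close>, viewed as elements of the Lie
  algebra.\<close>

definition heis_frame :: "real \<Rightarrow> real ^ 3 ^ 3 \<Rightarrow> bool" where
  "heis_frame k e \<longleftrightarrow>
     invertible e \<and> span {e $ 1} = heis_center \<and>
     heis_bracket (e $ 2) (e $ 3) = (-2 * k) *\<^sub>R e $ 1 \<and>
     heis_bracket (e $ 1) (e $ 2) = 0 \<and> heis_bracket (e $ 1) (e $ 3) = 0"

definition left_invariant_coframe :: "real ^ 3 ^ 3 \<Rightarrow> 3 \<Rightarrow> real ^ 3 \<Rightarrow> real ^ 3 \<Rightarrow> real" where
  \<comment> \<open>The \<open>i\<close>-th coefficient of \<open>v\<close> in the basis of the tangent space at \<open>p\<close> given by the
      left-invariant fields, which are the columns of the matrix that is inverted.\<close>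
  "left_invariant_coframe e i p v =
     (matrix_inv (transpose (\<chi> j. left_invariant_field (e $ j) p)) *v v) $ i"

section \<open>Heisenberg four-manifolds\<close>

text \<open>Coordinates on the product of an interval and the Heisenberg group: the first coordinate of
  \<open>real ^ 4\<close> belongs to the interval.\<close>

definition group_part :: "real ^ 4 \<Rightarrow> real ^ 3" where
  "group_part x = vector [x $ 2, x $ 3, x $ 4]"

definition interval_times_heis :: "real set \<Rightarrow> (real ^ 4) set" where
  "interval_times_heis J = {x. x $ 1 \<in> J}"

definition heis_metric :: "real \<Rightarrow> (real \<Rightarrow> 3 form_field) \<Rightarrow> 4 form_field" where
  "heis_metric \<epsilon> h x u v =
     \<epsilon> * u $ 1 * v $ 1 + h (x $ 1) (group_part x) (group_part u) (group_part v)"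

definition heisenberg_four_manifold :: "real \<Rightarrow> real set \<Rightarrow> (real \<Rightarrow> 3 form_field) \<Rightarrow> bool" where
  \<comment> \<open>The signature of the metrics on the group is Riemannian for \<open>\<epsilon> = 1\<close> and
      Lorentzian for \<open>\<epsilon> = -1\<close>.\<close>
  "heisenberg_four_manifold \<epsilon> J h \<longleftrightarrow>
     (\<epsilon> = 1 \<or> \<epsilon> = -1) \<and> open J \<and> is_interval J \<and> J \<noteq> {} \<and>
     (\<forall>t\<in>J. left_invariant (h t) \<and> (\<forall>p. has_signature (h t p) (vector [\<epsilon>, 1, 1]))) \<and>
     (\<forall>i j. smooth_fun_on (metric_component (heis_metric \<epsilon> h) i j) (interval_times_heis J))"

definition timelike_center :: "real set \<Rightarrow> (real \<Rightarrow> 3 form_field) \<Rightarrow> bool" where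
  "timelike_center J h \<longleftrightarrow>
     (\<forall>t\<in>J. \<forall>p. \<forall>z\<in>heis_center - {0}.
        h t p (left_invariant_field z p) (left_invariant_field z p) < 0)"

definition quaternionic_heisenberg ::
    "real \<Rightarrow> real \<Rightarrow> real set \<Rightarrow> (real \<Rightarrow> 3 form_field) \<Rightarrow> bool" where
  "quaternionic_heisenberg \<epsilon> \<Lambda> J h \<longleftrightarrow>
     heisenberg_four_manifold \<epsilon> J h \<and>
     (\<epsilon> = 1 \<and> quaternionic_kaehler (interval_times_heis J) (heis_metric \<epsilon> h) \<Lambda> \<or>
      \<epsilon> = -1 \<and> timelike_center J h \<and>
        quaternionic_parakaehler (interval_times_heis J) (heis_metric \<epsilon> h) \<Lambda>)"

definition adapted_frame :: "real \<Rightarrow> 3 form_field \<Rightarrow> real \<Rightarrow> real ^ 3 ^ 3 \<Rightarrow> bool" where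
  "adapted_frame \<epsilon> q k e \<longleftrightarrow>
     0 < k \<and> heis_frame k e \<and> orthonormal_basis (q 0) (vector [\<epsilon>, 1, 1]) e"

definition model_metric :: "real \<Rightarrow> real \<Rightarrow> real \<Rightarrow> real \<Rightarrow> real ^ 3 ^ 3 \<Rightarrow> 4 form_field" where
  "model_metric \<epsilon> \<Lambda> k \<gamma> e x u v =
     (let \<rho> = x $ 1;
          \<theta> = (\<lambda>i w. left_invariant_coframe e i (group_part x) (group_part w))
      in - (3 / (2 * \<epsilon> * \<Lambda> * \<rho>\<^sup>2)) * ((\<rho> + 2 * \<gamma>) / (\<rho> + \<gamma>)) *
         (\<epsilon> * u $ 1 * v $ 1
          + \<epsilon> / k\<^sup>2 * ((\<rho> + \<gamma>) / (\<rho> + 2 * \<gamma>))\<^sup>2 * \<theta> 1 u * \<theta> 1 v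
          + 2 * (\<rho> + \<gamma>) * (\<theta> 2 u * \<theta> 2 v + \<theta> 3 u * \<theta> 3 v)))"

definition takes_model_form ::
    "real \<Rightarrow> real \<Rightarrow> real \<Rightarrow> real ^ 3 ^ 3 \<Rightarrow> real \<Rightarrow>
     real set \<Rightarrow> (real \<Rightarrow> 3 form_field) \<Rightarrow> real \<Rightarrow> real set \<Rightarrow> real \<Rightarrow> bool" where
  \<comment> \<open>A change of the interval coordinate \<open>t \<mapsto> \<rho>\<close> from \<open>J\<close> onto \<open>I\<close>, with
      \<open>\<rho>(t\<^sub>0) = \<rho>\<^sub>0\<close>, turns the given metric into the model metric; the
      group coordinates stay the same.\<close>
  "takes_model_form \<epsilon> \<Lambda> k e \<gamma> J h t\<^sub>0 I \<rho>\<^sub>0 \<longleftrightarrow>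
     (\<exists>r. r t\<^sub>0 = \<rho>\<^sub>0 \<and>
        isometry_between
          (interval_times_heis J) (heis_metric \<epsilon> h)
          (interval_times_heis I) (model_metric \<epsilon> \<Lambda> k \<gamma> e)
          (\<lambda>x. vector [r (x $ 1), x $ 2, x $ 3, x $ 4]))"

section \<open>The constants and intervals\<close>

definition cube_root :: "complex \<Rightarrow> complex" where
  "cube_root z = complex_of_real (root 3 (cmod z)) * exp (\<i> * complex_of_real (Arg z) / 3)"

definition rho_root :: "real \<Rightarrow> real \<Rightarrow> real \<Rightarrow> nat \<Rightarrow> complex" where
  \<comment> \<open>For \<open>l = 1, 2, 3\<close>. Note that \<open>csqrt x = \<i> * sqrt \<bar>x\<bar>\<close> for negative real \<open>x\<close>.\<close>
  "rho_root \<epsilon> \<Lambda> k l =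
     (let \<omega> = (\<lambda>s::real. exp (complex_of_real (s * (4 - 2 * real l)) * \<i> * complex_of_real pi / 3));
          A = cube_root (complex_of_real (9 * k) + csqrt (complex_of_real (81 * k\<^sup>2 + \<epsilon> * \<Lambda>)));
          B = cube_root (complex_of_real (\<epsilon> * \<Lambda>))
      in - (\<omega> (-1) / (complex_of_real (2 * k) * B * A))
         + \<omega> 1 * (A / (complex_of_real (2 * k) * B\<^sup>2)))"

definition rho_root4 :: "real \<Rightarrow> real \<Rightarrow> real \<Rightarrow> complex" where
  "rho_root4 \<epsilon> \<Lambda> k =
     (let A = cube_root (complex_of_real (- 9 * k * \<Lambda> ^ 4)
                + csqrt (complex_of_real (\<Lambda> ^ 8 * (81 * k\<^sup>2 + \<epsilon> * \<Lambda>))))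
      in complex_of_real (\<epsilon> * \<Lambda>) / (complex_of_real (2 * k) * A)
         - 1 / complex_of_real (2 * k * \<Lambda>\<^sup>2) * A)"

definition gamma_of :: "real \<Rightarrow> real \<Rightarrow> real \<Rightarrow> real" where
  "gamma_of \<epsilon> \<Lambda> \<rho>\<^sub>0 = - (\<rho>\<^sub>0 * (1 + \<epsilon> * \<Lambda> / 3 * \<rho>\<^sub>0)) / 2"

definition rho_interval :: "real \<Rightarrow> real \<Rightarrow> nat \<Rightarrow> real \<Rightarrow> real set" where
  "rho_interval \<epsilon> \<Lambda> j \<rho>\<^sub>0 =
     (let \<gamma> = gamma_of \<epsilon> \<Lambda> \<rho>\<^sub>0
      in connected_component_set
           {\<rho>. \<rho> \<noteq> 0 \<and> \<rho> + \<gamma> > 0 \<and> (-1) ^ (j + 1) * (\<rho> + 2 * \<gamma>) > 0} \<rho>\<^sub>0)"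

end

theory Submission
  imports Defs
begin

text \<open>
  In an orthonormal frame adapted to the center the curvature is a polynomial in the structure constant
  \<open>\<kappa>\<close>, the second fundamental form of the orbit and its derivative. Half-conformal flatness and the Einstein
  equation force the second fundamental form to be diagonal with equal entries on the plane, so the adapted
  frame is only rescaled in time: the metric on the group is \<open>\<epsilon> F1\<close> on the center and \<open>F2\<close> on the plane. With
  \<open>l\<^sub>i = F\<^sub>i' / (2 F\<^sub>i)\<close>, \<open>q = \<epsilon> \<Lambda> / 3\<close> and a sign \<open>s\<close> the remaining first-order equations are
  \<open>(\<kappa> - s l1) (\<kappa> + s l2) = q\<close> and \<open>(\<kappa> + s l2)\<^sup>2 + 2 \<kappa> (\<kappa> - s l1) = - q\<close>. The function \<open>a = (\<kappa> - s l1) \<surd>F1\<close>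
  then satisfies \<open>a' = s q \<surd>F1\<close>, so \<open>\<rho> = - 1 / (2 k a)\<close> is a coordinate, \<open>- (q \<rho>\<^sup>2 F2 + \<rho>) / 2\<close> is a first
  integral \<open>\<gamma>\<close>, and \<open>F1\<close>, \<open>F2\<close> are rational functions of \<open>\<rho>\<close>. The normalization \<open>F1 = F2 = 1\<close> at \<open>t\<^sub>0\<close> becomes
  the cubic equation \<open>4 k\<^sup>2 q\<^sup>2 \<rho>\<^sup>3 + q \<rho> = 1\<close>, whose real roots are the numbers \<open>\<rho>\<^sub>l\<close>.

  If \<open>\<gamma> < 0\<close> or \<open>\<rho>\<^sub>0 < 0\<close>, the interval ends at finite distance on the left, and the geodesics orthogonal to the
  orbits are incomplete. If \<open>\<rho>\<^sub>0 > 0\<close> and \<open>\<gamma> > 0\<close>, the interval is \<open>(0, \<infinity>)\<close>, where the arc length is at least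
  a multiple of \<open>\<bar>ln \<rho>\<bar>\<close> near both ends; for \<open>\<epsilon> = 1\<close> conservation of energy then confines a geodesic to a
  compact set during every finite time.
\<close>

subsection \<open>Smooth functions\<close>

text \<open>The curvature of the statement is written in coordinates, while the adapted frame is
  left-invariant and not a coordinate frame. The bridge: at a point the lowered curvature tensor
  depends only on the metric and its first two derivatives there, and multilinearly on its four
  arguments. Frame vectors can thus be inserted as constant vectors, and no frame is ever
  differentiated. Half-flatness over-determines the second fundamental form: each entry mixing
  center and plane obeys two equations with different coefficients, and
  \<open>\<Lambda> \<noteq> 0\<close> makes the factor common to the remaining equations invertible.
  The factor in \<open>\<rho> = - 1 / (2 k a)\<close> is the one for which
  \<open>q \<rho> \<rho> F2 + \<rho>\<close> is constant. The bound \<open>- 81 k k\<close> for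
  \<open>\<epsilon> \<Lambda>\<close> is the zero of the discriminant of the cubic;
  \<open>- 6 k k\<close> is where \<open>\<gamma>\<close> changes sign, since
  \<open>q \<rho> = - 1\<close> turns the cubic at \<rho> into \<open>2 k k \<rho> = 1\<close>, that
  is \<open>q = - 2 k k\<close>. Completeness needs geodesics for all times; they come from a Picard
  iteration on a whole half-line combined with a priori bounds, and the other half-line follows by
  reversing the velocity.\<close>

lemma partial_deriv_eqI:
  "((\<lambda>s. f (x + s *\<^sub>R axis i 1)) has_real_derivative d) (at 0) \<Longrightarrow> partial_deriv i f x = d"
  unfolding partial_deriv_def by (rule DERIV_imp_deriv)

lemma has_derivative_along:
  fixes f :: "real ^ 'n::finite \<Rightarrow> real"
  assumes "(f has_derivative D) (at x)"
  shows "((\<lambda>s. f (x + s *\<^sub>R v)) has_real_derivative D v) (at 0)"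
proof -
  interpret bounded_linear D using assms by (rule has_derivative_bounded_linear)
  have "((\<lambda>s. x + s *\<^sub>R v) has_derivative (\<lambda>s. s *\<^sub>R v)) (at 0)"
    by (auto intro!: derivative_eq_intros)
  then have "((\<lambda>s. f (x + s *\<^sub>R v)) has_derivative (\<lambda>s. D (s *\<^sub>R v))) (at 0)"
    using has_derivative_compose[of "\<lambda>s. x + s *\<^sub>R v" "\<lambda>s. s *\<^sub>R v" 0 UNIV f D] assms by simp
  then show ?thesis
    by (simp add: has_field_derivative_def scaleR mult_commute_abs)
qed

lemma partial_deriv_has_derivative:
  fixes f :: "real ^ 'n::finite \<Rightarrow> real"
  assumes "(f has_derivative D) (at x)"
  shows "partial_deriv i f x = D (axis i 1)"
  by (rule partial_deriv_eqI, rule has_derivative_along, rule assms)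

lemma linear_sum_axis:
  fixes D :: "real ^ 'n::finite \<Rightarrow> real"
  assumes "linear D"
  shows "(\<Sum>i\<in>UNIV. v $ i * D (axis i 1)) = D v"
proof -
  have "D v = D (\<Sum>i\<in>UNIV. v $ i *\<^sub>R axis i 1)"
    by (simp add: basis_expansion flip: scalar_mult_eq_scaleR)
  also have "\<dots> = (\<Sum>i\<in>UNIV. v $ i * D (axis i 1))"
    using assms by (simp add: linear_sum linear_cmul)
  finally show ?thesis ..
qed

text \<open>A derivative is linear, hence determined by its values on the axes. This turns
  differentiability into a formula to which the rules for derivatives apply.\<close>

lemma has_derivative_partial_deriv:
  fixes f :: "real ^ 'n::finite \<Rightarrow> real"
  assumes "f differentiable (at x)"
  shows "(f has_derivative (\<lambda>v. \<Sum>i\<in>UNIV. v $ i * partial_deriv i f x)) (at x)"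
proof -
  obtain D where D: "(f has_derivative D) (at x)" using assms by (auto simp: differentiable_def)
  have "linear D" using D by (simp add: has_derivative_linear)
  then have "D = (\<lambda>v. \<Sum>i\<in>UNIV. v $ i * partial_deriv i f x)"
    by (simp add: fun_eq_iff partial_deriv_has_derivative[OF D] linear_sum_axis)
  then show ?thesis using D by simp
qed

text \<open>A partial derivative sees only a neighbourhood of the point. All later replacements of a
  metric by a formula valid only on an open set rest on this.\<close>

lemma partial_deriv_cong_open:
  fixes f :: "real ^ 'n::finite \<Rightarrow> real"
  assumes "open U" "x \<in> U" "\<And>y. y \<in> U \<Longrightarrow> f y = g y"
  shows "partial_deriv i f x = partial_deriv i g x"
proof -
  have "((\<lambda>s::real. x + s *\<^sub>R axis i 1) \<longlongrightarrow> x + 0 *\<^sub>R axis i 1) (nhds 0)"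
    by (intro tendsto_intros filterlim_ident)
  then have "\<forall>\<^sub>F s in nhds 0. x + s *\<^sub>R axis i 1 \<in> U"
    using assms(1,2) by (auto elim!: topological_tendstoD)
  then have "\<forall>\<^sub>F s in nhds 0. f (x + s *\<^sub>R axis i 1) = g (x + s *\<^sub>R axis i 1)"
    by eventually_elim (rule assms(3))
  then show ?thesis unfolding partial_deriv_def by (rule deriv_cong_ev) simp
qed

lemma times_differentiable_on_cong:
  assumes "open U" "\<And>y. y \<in> U \<Longrightarrow> f y = g y"
  shows "times_differentiable_on m f U \<longleftrightarrow> times_differentiable_on m g U"
  using assms(2)
proof (induction m arbitrary: f g)
  case 0
  then show ?case by (simp cong: continuous_on_cong)
next
  case (Suc m)
  have d: "f differentiable (at x) \<longleftrightarrow> g differentiable (at x)" if "x \<in> U" for x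
  proof -
    have "(f has_derivative D) (at x) \<longleftrightarrow> (g has_derivative D) (at x)" for D
      using has_derivative_transform_within_open[OF _ assms(1) that] Suc.prems by metis
    then show ?thesis by (simp add: differentiable_def)
  qed
  have "times_differentiable_on m (partial_deriv i f) U \<longleftrightarrow> times_differentiable_on m (partial_deriv i g) U" for i
    by (rule Suc.IH, rule partial_deriv_cong_open[OF assms(1)]) (use Suc.prems in auto)
  with d show ?case by simp
qed

lemma times_differentiable_on_Suc_imp:
  "times_differentiable_on (Suc m) f U \<Longrightarrow> times_differentiable_on m f U"
proof (induction m arbitrary: f)
  case 0
  then show ?case
    by (auto intro!: continuous_at_imp_continuous_on differentiable_imp_continuous_within)
next
  case (Suc m)
  then show ?case by auto
qed

lemma times_differentiable_on_const: "times_differentiable_on m (\<lambda>x. c) U"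
proof (induction m arbitrary: c)
  case (Suc m)
  have "partial_deriv i (\<lambda>x. c) = (\<lambda>x. 0)" for i :: 'a
    by (simp add: fun_eq_iff partial_deriv_def)
  with Suc show ?case by simp
qed simp

lemma times_differentiable_on_nth: "times_differentiable_on m (\<lambda>x. x $ j) U"
proof (cases m)
  case (Suc n)
  have d: "((\<lambda>x. x $ j) has_derivative (\<lambda>x. x $ j)) (at x)" for x :: "real ^ 'a"
    by (intro bounded_linear_imp_has_derivative bounded_linear_vec_nth)
  have "partial_deriv i (\<lambda>x. x $ j) = (\<lambda>x. axis i 1 $ j)" for i :: 'a
    by (rule ext, rule partial_deriv_has_derivative[OF d])
  moreover have "(\<lambda>x. x $ j) differentiable (at x)" for x :: "real ^ 'a"
    using d by (auto simp: differentiable_def)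
  ultimately show ?thesis using Suc by (simp add: times_differentiable_on_const)
qed (simp add: continuous_on_component)

lemma times_differentiable_on_add:
  assumes "open U"
  shows "times_differentiable_on m f U \<Longrightarrow> times_differentiable_on m g U \<Longrightarrow>
    times_differentiable_on m (\<lambda>x. f x + g x) U"
proof (induction m arbitrary: f g)
  case 0
  then show ?case by (auto intro: continuous_intros)
next
  case (Suc m)
  have "times_differentiable_on m (partial_deriv i (\<lambda>x. f x + g x)) U" for i
  proof (subst times_differentiable_on_cong[OF assms])
    fix x assume "x \<in> U"
    with Suc.prems have "f differentiable at x" "g differentiable at x" by auto
    then have "((\<lambda>x. f x + g x) has_derivative (\<lambda>v. (\<Sum>i\<in>UNIV. v $ i * partial_deriv i f x)
       + (\<Sum>i\<in>UNIV. v $ i * partial_deriv i g x))) (at x)"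
      by (intro has_derivative_add has_derivative_partial_deriv)
    then have "partial_deriv i (\<lambda>x. f x + g x) x = (\<Sum>j\<in>UNIV. axis i 1 $ j * partial_deriv j f x)
       + (\<Sum>j\<in>UNIV. axis i 1 $ j * partial_deriv j g x)"
      by (rule partial_deriv_has_derivative)
    then show "partial_deriv i (\<lambda>x. f x + g x) x = partial_deriv i f x + partial_deriv i g x"
      by (simp add: axis_def if_distrib[of "\<lambda>x. x * _"] cong: if_cong)
  next
    show "times_differentiable_on m (\<lambda>x. partial_deriv i f x + partial_deriv i g x) U"
      using Suc by auto
  qed
  then show ?case using Suc.prems by (auto intro: differentiable_add)
qed

lemma times_differentiable_on_mult:
  assumes "open U"
  shows "times_differentiable_on m f U \<Longrightarrow> times_differentiable_on m g U \<Longrightarrow>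
    times_differentiable_on m (\<lambda>x. f x * g x) U"
proof (induction m arbitrary: f g)
  case 0
  then show ?case by (auto intro: continuous_intros)
next
  case (Suc m)
  have "times_differentiable_on m (partial_deriv i (\<lambda>x. f x * g x)) U" for i
  proof (subst times_differentiable_on_cong[OF assms])
    fix x assume "x \<in> U"
    with Suc.prems have "f differentiable at x" "g differentiable at x" by auto
    then have "((\<lambda>x. f x * g x) has_derivative (\<lambda>v. f x * (\<Sum>i\<in>UNIV. v $ i * partial_deriv i g x)
       + (\<Sum>i\<in>UNIV. v $ i * partial_deriv i f x) * g x)) (at x)"
      by (intro has_derivative_mult has_derivative_partial_deriv)
    then have "partial_deriv i (\<lambda>x. f x * g x) x = f x * (\<Sum>j\<in>UNIV. axis i 1 $ j * partial_deriv j g x)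
       + (\<Sum>j\<in>UNIV. axis i 1 $ j * partial_deriv j f x) * g x"
      by (rule partial_deriv_has_derivative)
    then show "partial_deriv i (\<lambda>x. f x * g x) x = f x * partial_deriv i g x + partial_deriv i f x * g x"
      by (simp add: axis_def if_distrib[of "\<lambda>x. x * _"] cong: if_cong)
  next
    \<comment> \<open>Each product pairs a function of order \<open>Suc m\<close> with a partial
      derivative of order \<open>m\<close>, so the function is first lowered by one order.\<close>
    show "times_differentiable_on m (\<lambda>x. f x * partial_deriv i g x + partial_deriv i f x * g x) U"
      using times_differentiable_on_Suc_imp[OF Suc.prems(1)] times_differentiable_on_Suc_imp[OF Suc.prems(2)]
        Suc.prems by (intro times_differentiable_on_add assms Suc.IH) (simp_all del: times_differentiable_on.simps(1))
  qed
  then show ?case using Suc.prems by auto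
qed

lemma times_differentiable_on_inverse:
  assumes "open U" "\<And>x. x \<in> U \<Longrightarrow> f x \<noteq> 0"
  shows "times_differentiable_on m f U \<Longrightarrow> times_differentiable_on m (\<lambda>x. inverse (f x)) U"
proof (induction m)
  case 0
  then show ?case using assms by (auto intro: continuous_intros)
next
  case (Suc m)
  have "times_differentiable_on m (partial_deriv i (\<lambda>x. inverse (f x))) U" for i
  proof (subst times_differentiable_on_cong[OF assms(1)])
    fix x assume x: "x \<in> U"
    with Suc.prems have "f differentiable at x" by auto
    then have "((\<lambda>x. inverse (f x)) has_derivative
       (\<lambda>v. - (inverse (f x) * (\<Sum>i\<in>UNIV. v $ i * partial_deriv i f x) * inverse (f x)))) (at x)"
      using Deriv.has_derivative_inverse[of f x _ UNIV] assms(2)[OF x] has_derivative_partial_deriv by blast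
    then have "partial_deriv i (\<lambda>x. inverse (f x)) x =
       - (inverse (f x) * (\<Sum>j\<in>UNIV. axis i 1 $ j * partial_deriv j f x) * inverse (f x))"
      by (rule partial_deriv_has_derivative)
    then show "partial_deriv i (\<lambda>x. inverse (f x)) x
        = (- 1) * (inverse (f x) * partial_deriv i f x * inverse (f x))"
      by (simp add: axis_def if_distrib[of "\<lambda>x. x * _"] cong: if_cong)
  next
    show "times_differentiable_on m (\<lambda>x. (- 1) * (inverse (f x) * partial_deriv i f x * inverse (f x))) U"
      using Suc.IH[OF times_differentiable_on_Suc_imp[OF Suc.prems]] Suc.prems
      by (intro times_differentiable_on_mult times_differentiable_on_const assms(1)) simp_all
  qed
  then show ?case using Suc.prems assms by (auto intro!: differentiable_inverse)
qed

lemma smooth_fun_on_cong: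
  "open U \<Longrightarrow> (\<And>y. y \<in> U \<Longrightarrow> f y = g y) \<Longrightarrow> smooth_fun_on f U \<longleftrightarrow> smooth_fun_on g U"
  unfolding smooth_fun_on_def using times_differentiable_on_cong by blast

lemma smooth_fun_on_const: "smooth_fun_on (\<lambda>x. c) U"
  by (simp add: smooth_fun_on_def times_differentiable_on_const)

lemma smooth_fun_on_nth: "smooth_fun_on (\<lambda>x. x $ j) U"
  by (simp add: smooth_fun_on_def times_differentiable_on_nth)

lemma smooth_fun_on_add:
  "open U \<Longrightarrow> smooth_fun_on f U \<Longrightarrow> smooth_fun_on g U \<Longrightarrow> smooth_fun_on (\<lambda>x. f x + g x) U"
  by (simp add: smooth_fun_on_def times_differentiable_on_add)

lemma smooth_fun_on_mult:
  "open U \<Longrightarrow> smooth_fun_on f U \<Longrightarrow> smooth_fun_on g U \<Longrightarrow> smooth_fun_on (\<lambda>x. f x * g x) U"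
  by (simp add: smooth_fun_on_def times_differentiable_on_mult)

lemma smooth_fun_on_uminus:
  "open U \<Longrightarrow> smooth_fun_on f U \<Longrightarrow> smooth_fun_on (\<lambda>x. - f x) U"
  using smooth_fun_on_mult[OF _ smooth_fun_on_const[of "-1"]] by force

lemma smooth_fun_on_diff:
  "open U \<Longrightarrow> smooth_fun_on f U \<Longrightarrow> smooth_fun_on g U \<Longrightarrow> smooth_fun_on (\<lambda>x. f x - g x) U"
  using smooth_fun_on_add[OF _ _ smooth_fun_on_uminus] by force

lemma smooth_fun_on_divide:
  "open U \<Longrightarrow> smooth_fun_on f U \<Longrightarrow> smooth_fun_on g U \<Longrightarrow> (\<And>x. x \<in> U \<Longrightarrow> g x \<noteq> 0) \<Longrightarrow>
   smooth_fun_on (\<lambda>x. f x / g x) U"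
  unfolding divide_inverse
  by (intro smooth_fun_on_mult) (auto simp: smooth_fun_on_def times_differentiable_on_inverse)

lemma smooth_fun_on_sum:
  "open U \<Longrightarrow> (\<And>a. a \<in> S \<Longrightarrow> smooth_fun_on (f a) U) \<Longrightarrow> smooth_fun_on (\<lambda>x. \<Sum>a\<in>S. f a x) U"
  by (induction S rule: infinite_finite_induct) (auto intro: smooth_fun_on_const smooth_fun_on_add)

lemma smooth_fun_on_prod:
  "open U \<Longrightarrow> (\<And>a. a \<in> S \<Longrightarrow> smooth_fun_on (f a) U) \<Longrightarrow> smooth_fun_on (\<lambda>x. \<Prod>a\<in>S. f a x) U"
  by (induction S rule: infinite_finite_induct) (auto intro: smooth_fun_on_const smooth_fun_on_mult)

lemma smooth_fun_on_differentiable: "smooth_fun_on f U \<Longrightarrow> x \<in> U \<Longrightarrow> f differentiable (at x)"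
  unfolding smooth_fun_on_def by (metis times_differentiable_on.simps(2))

lemma smooth_fun_on_partial_deriv: "smooth_fun_on f U \<Longrightarrow> smooth_fun_on (partial_deriv i f) U"
  unfolding smooth_fun_on_def by (metis times_differentiable_on.simps(2))

lemma smooth_fun_on_continuous: "smooth_fun_on f U \<Longrightarrow> continuous_on U f"
  unfolding smooth_fun_on_def by (metis times_differentiable_on.simps(1))

lemma smooth_fun_on_det:
  fixes A :: "real ^ 'n::finite \<Rightarrow> real ^ 'm ^ 'm::finite"
  assumes "open U" "\<And>i j. smooth_fun_on (\<lambda>x. A x $ i $ j) U"
  shows "smooth_fun_on (\<lambda>x. det (A x)) U"
  unfolding det_def
  by (intro smooth_fun_on_sum smooth_fun_on_mult smooth_fun_on_prod smooth_fun_on_const assms)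

section \<open>Matrix inverses and smoothness of the Christoffel symbols\<close>

lemma matrix_inv_works:
  fixes A :: "real ^ 'n ^ 'n::finite"
  assumes "invertible A"
  shows "A ** matrix_inv A = mat 1" "matrix_inv A ** A = mat 1"
proof -
  have "\<exists>A'. A ** A' = mat 1 \<and> A' ** A = mat 1" using assms by (simp add: invertible_def)
  then have "A ** matrix_inv A = mat 1 \<and> matrix_inv A ** A = mat 1"
    unfolding matrix_inv_def by (rule someI_ex)
  then show "A ** matrix_inv A = mat 1" "matrix_inv A ** A = mat 1" by auto
qed

lemma matrix_inv_unique:
  fixes A B :: "real ^ 'n ^ 'n::finite"
  assumes "B ** A = mat 1"
  shows "matrix_inv A = B"
proof -
  have "invertible A" using assms by (auto simp: invertible_left_inverse)
  then have "B ** (A ** matrix_inv A) = B" by (simp add: matrix_inv_works)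
  then show ?thesis using assms by (simp add: matrix_mul_assoc)
qed

text \<open>Cramer's rule applied to the equation \<open>A *v x = axis j 1\<close>. The entries of
  the inverse become quotients of determinants, so their smoothness follows from that of the entries
  of \<open>A\<close>.\<close>

lemma matrix_inv_component:
  fixes A :: "real ^ 'n ^ 'n::finite"
  assumes "det A \<noteq> 0"
  shows "matrix_inv A $ i $ j = det (\<chi> k l. if l = i then axis j 1 $ k else A $ k $ l) / det A"
proof -
  have inv: "invertible A" using assms by (simp add: invertible_det_nz)
  let ?x = "matrix_inv A *v axis j 1"
  have "A *v ?x = axis j 1"
    by (simp add: matrix_vector_mul_assoc matrix_inv_works[OF inv])
  then have "?x = (\<chi> i. det (\<chi> k l. if l = i then axis j 1 $ k else A $ k $ l) / det A)"
    using cramer[OF assms] by blast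
  then have "?x $ i = det (\<chi> k l. if l = i then axis j 1 $ k else A $ k $ l) / det A" by simp
  moreover have "?x $ i = matrix_inv A $ i $ j"
    by (simp add: matrix_vector_mult_def axis_def if_distrib[of "\<lambda>x. _ * x"] cong: if_cong)
  ultimately show ?thesis by simp
qed

lemma smooth_fun_on_inverse_metric:
  assumes "open U" "\<And>i j. smooth_fun_on (metric_component g i j) U"
    "\<And>x. x \<in> U \<Longrightarrow> det (metric_matrix g x) \<noteq> 0"
  shows "smooth_fun_on (inverse_metric g i j) U"
proof -
  have m: "smooth_fun_on (\<lambda>x. metric_matrix g x $ i $ j) U" for i j
    using assms(2) by (simp add: metric_matrix_def)
  have "smooth_fun_on (\<lambda>x. det (\<chi> k l. if l = i then axis j 1 $ k else metric_matrix g x $ k $ l)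
      / det (metric_matrix g x)) U"
  proof (intro smooth_fun_on_divide smooth_fun_on_det assms(1) m assms(3))
    fix k l show "smooth_fun_on (\<lambda>x. (\<chi> k l. if l = i then axis j 1 $ k else metric_matrix g x $ k $ l) $ k $ l) U"
      using m by (cases "l = i") (simp_all add: smooth_fun_on_const)
  qed
  then show ?thesis
    by (subst smooth_fun_on_cong[OF assms(1)]) (auto simp: inverse_metric_def matrix_inv_component assms(3))
qed

lemma smooth_fun_on_christoffel:
  assumes "open U" "\<And>i j. smooth_fun_on (metric_component g i j) U"
    "\<And>x. x \<in> U \<Longrightarrow> det (metric_matrix g x) \<noteq> 0"
  shows "smooth_fun_on (christoffel g k i j) U"
proof -
  have "smooth_fun_on (\<lambda>x. christoffel g k i j x) U"
    unfolding christoffel_def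
    by (intro smooth_fun_on_divide smooth_fun_on_const smooth_fun_on_sum smooth_fun_on_mult smooth_fun_on_diff
      smooth_fun_on_add smooth_fun_on_inverse_metric smooth_fun_on_partial_deriv assms) auto
  then show ?thesis by simp
qed

subsection \<open>Smooth functions of one real variable\<close>

text \<open>The derivative is existentially quantified so that any explicit formula can serve as a
  witness. It is two-sided, so the notion is meant for open sets; uniqueness of derivatives
  reconciles different witnesses in \<open>Ck_on_deriv\<close>.\<close>

primrec Ck_on :: "nat \<Rightarrow> (real \<Rightarrow> real) \<Rightarrow> real set \<Rightarrow> bool" where
  "Ck_on 0 f I \<longleftrightarrow> continuous_on I f"
| "Ck_on (Suc m) f I \<longleftrightarrow>
     (\<exists>f'. (\<forall>t\<in>I. (f has_real_derivative f' t) (at t)) \<and> Ck_on m f' I)"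

definition smooth_real_on :: "(real \<Rightarrow> real) \<Rightarrow> real set \<Rightarrow> bool" where
  "smooth_real_on f I \<longleftrightarrow> (\<forall>m. Ck_on m f I)"

lemma Ck_on_cong:
  "open I \<Longrightarrow> (\<And>t. t \<in> I \<Longrightarrow> f t = g t) \<Longrightarrow> Ck_on m f I \<longleftrightarrow> Ck_on m g I"
proof (cases m)
  case (Suc n)
  assume o: "open I" and eq: "\<And>t. t \<in> I \<Longrightarrow> f t = g t"
  have "(f has_real_derivative d) (at t) \<longleftrightarrow> (g has_real_derivative d) (at t)" if "t \<in> I" for t d
    using has_field_derivative_transform_within_open[OF _ o that] eq by metis
  then show ?thesis using Suc by simp
qed (simp cong: continuous_on_cong)

lemma Ck_on_Suc_imp: "Ck_on (Suc m) f I \<Longrightarrow> Ck_on m f I"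
proof (induction m arbitrary: f)
  case 0
  then show ?case
    by (auto intro!: continuous_at_imp_continuous_on dest!: bspec DERIV_isCont)
next
  case (Suc m)
  then show ?case by (metis Ck_on.simps(2))
qed

lemma Ck_on_deriv:
  assumes "open I" "Ck_on (Suc m) f I" "\<And>t. t \<in> I \<Longrightarrow> (f has_real_derivative f' t) (at t)"
  shows "Ck_on m f' I"
proof -
  obtain d where d: "\<And>t. t \<in> I \<Longrightarrow> (f has_real_derivative d t) (at t)" "Ck_on m d I"
    using assms(2) by auto
  have "d t = f' t" if "t \<in> I" for t using d(1)[OF that] assms(3)[OF that] by (rule DERIV_unique)
  then show ?thesis using d(2) Ck_on_cong[OF assms(1), of d f'] by blast
qed

lemma Ck_on_const: "Ck_on m (\<lambda>x. c) I"
  by (induction m arbitrary: c) (auto intro!: exI[of _ "\<lambda>_. 0"])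

lemma Ck_on_ident: "Ck_on m (\<lambda>x. x) I"
  by (cases m) (auto intro!: exI[of _ "\<lambda>_. 1"] simp: Ck_on_const)

lemma Ck_on_add: "Ck_on m f I \<Longrightarrow> Ck_on m g I \<Longrightarrow> Ck_on m (\<lambda>x. f x + g x) I"
proof (induction m arbitrary: f g)
  case (Suc m)
  then obtain f' g' where "\<forall>t\<in>I. (f has_real_derivative f' t) (at t)" "Ck_on m f' I"
    "\<forall>t\<in>I. (g has_real_derivative g' t) (at t)" "Ck_on m g' I" by auto
  then show ?case using Suc.IH by (auto intro!: exI[of _ "\<lambda>t. f' t + g' t"] derivative_intros)
qed (auto intro: continuous_intros)

lemma Ck_on_mult: "Ck_on m f I \<Longrightarrow> Ck_on m g I \<Longrightarrow> Ck_on m (\<lambda>x. f x * g x) I"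
proof (induction m arbitrary: f g)
  case (Suc m)
  then obtain f' g' where f: "\<forall>t\<in>I. (f has_real_derivative f' t) (at t)" "Ck_on m f' I"
    "\<forall>t\<in>I. (g has_real_derivative g' t) (at t)" "Ck_on m g' I" by auto
  have "Ck_on m (\<lambda>t. f' t * g t + g' t * f t) I"
    using Suc.IH[OF f(2) Ck_on_Suc_imp[OF Suc.prems(2)]] Suc.IH[OF f(4) Ck_on_Suc_imp[OF Suc.prems(1)]]
    by (rule Ck_on_add)
  then show ?case using f by (auto intro!: exI[of _ "\<lambda>t. f' t * g t + g' t * f t"] DERIV_mult)
qed (auto intro: continuous_intros)

lemma Ck_on_inverse:
  "(\<And>t. t \<in> I \<Longrightarrow> f t \<noteq> 0) \<Longrightarrow> Ck_on m f I \<Longrightarrow> Ck_on m (\<lambda>x. inverse (f x)) I"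
proof (induction m)
  case (Suc m)
  then obtain f' where f: "\<forall>t\<in>I. (f has_real_derivative f' t) (at t)" "Ck_on m f' I" by auto
  have "Ck_on m (\<lambda>t. (- 1) * (inverse (f t) * f' t * inverse (f t))) I"
    by (intro Ck_on_mult Ck_on_const f Suc.IH Suc.prems(1) Ck_on_Suc_imp[OF Suc.prems(2)])
  then show ?case using f Suc.prems(1)
    by (auto intro!: exI[of _ "\<lambda>t. - (inverse (f t) * f' t * inverse (f t))"] DERIV_inverse')
qed (auto intro: continuous_intros)

lemma Ck_on_compose:
  "Ck_on m g K \<Longrightarrow> Ck_on m f I \<Longrightarrow> f ` I \<subseteq> K \<Longrightarrow> Ck_on m (\<lambda>x. g (f x)) I"
proof (induction m arbitrary: g f)
  case 0
  then show ?case using continuous_on_compose2[of K g I f] by auto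
next
  case (Suc m)
  then obtain f' g' where f: "\<forall>t\<in>I. (f has_real_derivative f' t) (at t)" "Ck_on m f' I"
    "\<forall>t\<in>K. (g has_real_derivative g' t) (at t)" "Ck_on m g' K" by auto
  have "Ck_on m (\<lambda>t. g' (f t) * f' t) I"
    using Suc.IH[OF f(4) Ck_on_Suc_imp[OF Suc.prems(2)] Suc.prems(3)] f(2)
    by (rule Ck_on_mult)
  then show ?case using f Suc.prems(3)
    by (intro Ck_on.simps(2)[THEN iffD2] exI[of _ "\<lambda>t. g' (f t) * f' t"] conjI ballI)
      (auto intro!: DERIV_chain2[where f = g and g = f])
qed

lemma smooth_real_on_deriv:
  assumes "open I" "smooth_real_on f I" "\<And>t. t \<in> I \<Longrightarrow> (f has_real_derivative f' t) (at t)"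
  shows "smooth_real_on f' I"
  using assms Ck_on_deriv by (metis smooth_real_on_def)

lemma smooth_real_on_obtain_deriv:
  assumes "open I" "smooth_real_on f I"
  obtains f' where "\<And>t. t \<in> I \<Longrightarrow> (f has_real_derivative f' t) (at t)" "smooth_real_on f' I"
proof -
  have "Ck_on (Suc 0) f I" using assms(2) by (simp add: smooth_real_on_def)
  then obtain f' where "\<forall>t\<in>I. (f has_real_derivative f' t) (at t)" by auto
  then show ?thesis using that smooth_real_on_deriv[OF assms] by blast
qed

lemma smooth_real_on_const: "smooth_real_on (\<lambda>x. c) I"
  by (simp add: smooth_real_on_def Ck_on_const)

lemma smooth_real_on_ident: "smooth_real_on (\<lambda>x. x) I"
  by (simp add: smooth_real_on_def Ck_on_ident)

lemma smooth_real_on_add: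
  "smooth_real_on f I \<Longrightarrow> smooth_real_on g I \<Longrightarrow> smooth_real_on (\<lambda>x. f x + g x) I"
  by (simp add: smooth_real_on_def Ck_on_add)

lemma smooth_real_on_mult:
  "smooth_real_on f I \<Longrightarrow> smooth_real_on g I \<Longrightarrow> smooth_real_on (\<lambda>x. f x * g x) I"
  by (simp add: smooth_real_on_def Ck_on_mult)

lemma smooth_real_on_uminus: "smooth_real_on f I \<Longrightarrow> smooth_real_on (\<lambda>x. - f x) I"
  using smooth_real_on_mult[OF smooth_real_on_const[of "-1"]] by force

lemma smooth_real_on_diff:
  "smooth_real_on f I \<Longrightarrow> smooth_real_on g I \<Longrightarrow> smooth_real_on (\<lambda>x. f x - g x) I"
  using smooth_real_on_add[OF _ smooth_real_on_uminus] by force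

lemma smooth_real_on_divide:
  "smooth_real_on f I \<Longrightarrow> smooth_real_on g I \<Longrightarrow> (\<And>x. x \<in> I \<Longrightarrow> g x \<noteq> 0) \<Longrightarrow>
   smooth_real_on (\<lambda>x. f x / g x) I"
  unfolding divide_inverse
  by (intro smooth_real_on_mult) (auto simp: smooth_real_on_def Ck_on_inverse)

lemma smooth_real_on_power: "smooth_real_on f I \<Longrightarrow> smooth_real_on (\<lambda>x. f x ^ n) I"
  by (induction n) (auto intro: smooth_real_on_const smooth_real_on_mult)

lemma smooth_real_on_compose:
  "smooth_real_on g K \<Longrightarrow> smooth_real_on f I \<Longrightarrow> f ` I \<subseteq> K \<Longrightarrow> smooth_real_on (\<lambda>x. g (f x)) I"
  unfolding smooth_real_on_def using Ck_on_compose by blast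

lemma smooth_real_on_cong:
  "open I \<Longrightarrow> (\<And>t. t \<in> I \<Longrightarrow> f t = g t) \<Longrightarrow> smooth_real_on f I \<longleftrightarrow> smooth_real_on g I"
  unfolding smooth_real_on_def using Ck_on_cong by blast

lemma smooth_real_on_antiderivative:
  assumes "\<And>t. t \<in> I \<Longrightarrow> (f has_real_derivative f' t) (at t)" "smooth_real_on f' I"
  shows "smooth_real_on f I"
  unfolding smooth_real_on_def
proof
  fix m show "Ck_on m f I"
  proof (cases m)
    case 0
    then show ?thesis using assms(1)
      by (auto intro!: continuous_at_imp_continuous_on dest!: bspec DERIV_isCont)
  qed (use assms in \<open>auto simp: smooth_real_on_def\<close>)
qed

text \<open>The derivative of the square root is half its own inverse, so order \<open>m\<close> of
  \<open>sqrt\<close> yields order \<open>m + 1\<close>.\<close>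

lemma smooth_real_on_sqrt:
  assumes "smooth_real_on f I" "\<And>t. t \<in> I \<Longrightarrow> f t > 0"
  shows "smooth_real_on (\<lambda>t. sqrt (f t)) I"
proof -
  have "Ck_on m sqrt {0<..}" for m
  proof (induction m)
    case 0
    show ?case by (auto intro: continuous_intros)
  next
    case (Suc m)
    have "Ck_on m (\<lambda>t. inverse (sqrt t) * (1/2)) {0<..}"
      by (intro Ck_on_mult Ck_on_inverse Suc Ck_on_const) auto
    moreover have "(sqrt has_real_derivative inverse (sqrt t) * (1/2)) (at t)" if "t > 0" for t
      using DERIV_real_sqrt[OF that] by simp
    ultimately show ?case by (auto intro!: exI[of _ "\<lambda>t. inverse (sqrt t) * (1/2)"])
  qed
  then have "smooth_real_on sqrt {0<..}" by (simp add: smooth_real_on_def)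
  then show ?thesis by (rule smooth_real_on_compose[OF _ assms(1)]) (use assms(2) in auto)
qed

lemma inverse_function_derivative:
  assumes "open K" "y \<in> K" "continuous_on K g" "\<And>y. y \<in> K \<Longrightarrow> f (g y) = y"
    "(f has_real_derivative d) (at (g y))" "d \<noteq> 0"
  shows "(g has_real_derivative inverse d) (at y)"
proof -
  obtain e where e: "e > 0" "ball y e \<subseteq> K" using assms(1,2) openE by blast
  then have K: "z \<in> K" if "y - e < z" "z < y + e" for z
    using that by (auto simp: dist_real_def subset_iff)
  show ?thesis
  proof (rule DERIV_inverse_function[of f d g y, OF assms(5,6), of "y - e" "y + e"])
    show "isCont g y" using assms(1-3) by (simp add: continuous_on_eq_continuous_at)
  qed (use e K assms(4) in auto)
qed

text \<open>Bootstrapping: the derivative of \<open>g\<close> is \<open>inverse (f' (g y))\<close>,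
  which has order \<open>m\<close> as soon as \<open>g\<close> has, so \<open>g\<close> gains one
  order at each step.\<close>

lemma smooth_real_on_inverse_function:
  assumes "open I" "open K" "smooth_real_on f I" "continuous_on K g" "g ` K \<subseteq> I"
    "\<And>y. y \<in> K \<Longrightarrow> f (g y) = y"
    "\<And>t. t \<in> I \<Longrightarrow> (f has_real_derivative f' t) (at t)" "\<And>t. t \<in> I \<Longrightarrow> f' t \<noteq> 0"
  shows "smooth_real_on g K"
  unfolding smooth_real_on_def
proof
  have g': "(g has_real_derivative inverse (f' (g y))) (at y)" if "y \<in> K" for y
    using assms(5) that by (intro inverse_function_derivative[OF assms(2) that assms(4,6)] assms(7,8)) auto
  have f': "smooth_real_on f' I" by (rule smooth_real_on_deriv[OF assms(1,3,7)])
  fix m show "Ck_on m g K"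
  proof (induction m)
    case (Suc m)
    have "Ck_on m (\<lambda>y. inverse (f' (g y))) K"
    proof (rule Ck_on_inverse)
      show "f' (g y) \<noteq> 0" if "y \<in> K" for y using assms(5,8) that by blast
      have "Ck_on m f' I" using f' by (simp add: smooth_real_on_def)
      then show "Ck_on m (\<lambda>y. f' (g y)) K" using Suc assms(5) by (rule Ck_on_compose)
    qed
    then show ?case using g'
      by (intro Ck_on.simps(2)[THEN iffD2] exI[of _ "\<lambda>y. inverse (f' (g y))"]) auto
  qed (use assms(4) in simp)
qed

lemma times_differentiable_on_real_comp_nth:
  fixes j :: "'n::finite"
  assumes "open I"
  shows "Ck_on m \<psi> I \<Longrightarrow> times_differentiable_on m (\<lambda>x. \<psi> (x $ j)) {x. x $ j \<in> I}"
proof (induction m arbitrary: \<psi>)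
  case 0
  then show ?case by (auto intro!: continuous_on_compose2[of I \<psi>] continuous_intros)
next
  case (Suc m)
  have o: "open {x :: real ^ 'n. x $ j \<in> I}"
    using open_vimage_vec_nth[OF assms] by (simp add: vimage_def)
  obtain f' where f: "\<forall>t\<in>I. (\<psi> has_real_derivative f' t) (at t)" "Ck_on m f' I" using Suc by auto
  have d: "((\<lambda>x. \<psi> (x $ j)) has_derivative (\<lambda>v. f' (x $ j) * v $ j)) (at x)"
    if "x \<in> {x. x $ j \<in> I}" for x :: "real ^ 'n"
  proof -
    have "(\<psi> has_derivative (*) (f' (x $ j))) (at (x $ j))"
      using f(1) that by (simp add: has_field_derivative_def)
    from has_derivative_compose[OF bounded_linear_imp_has_derivative[OF bounded_linear_vec_nth] this]
    show ?thesis .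
  qed
  have "times_differentiable_on m (partial_deriv i (\<lambda>x. \<psi> (x $ j))) {x. x $ j \<in> I}" for i
  proof (subst times_differentiable_on_cong[OF o])
    show "partial_deriv i (\<lambda>x. \<psi> (x $ j)) y = f' (y $ j) * axis i 1 $ j" if "y \<in> {x. x $ j \<in> I}" for y
      by (rule partial_deriv_has_derivative[OF d[OF that]])
    show "times_differentiable_on m (\<lambda>y. f' (y $ j) * axis i 1 $ j) {x. x $ j \<in> I}"
      by (rule times_differentiable_on_mult[OF o Suc.IH[OF f(2)] times_differentiable_on_const])
  qed
  moreover have "(\<lambda>x. \<psi> (x $ j)) differentiable (at x)" if "x \<in> {x. x $ j \<in> I}" for x :: "real ^ 'n"
    using d[OF that] by (auto simp: differentiable_def)
  ultimately show ?case by simp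
qed

lemma smooth_fun_on_real_comp_nth:
  "open I \<Longrightarrow> smooth_real_on \<psi> I \<Longrightarrow> smooth_fun_on (\<lambda>x. \<psi> (x $ j)) {x. x $ j \<in> I}"
  by (simp add: smooth_fun_on_def smooth_real_on_def times_differentiable_on_real_comp_nth)

text \<open>The converse direction to \<open>smooth_fun_on_real_comp_nth\<close>: restriction to a
  coordinate axis. It recovers smoothness in time of the group metrics from smoothness of the
  components of the four-dimensional metric.\<close>

lemma smooth_real_on_line:
  assumes "smooth_fun_on f U" "\<And>t. t \<in> I \<Longrightarrow> t *\<^sub>R axis j 1 \<in> U"
  shows "smooth_real_on (\<lambda>t. f (t *\<^sub>R axis j 1)) I"
  unfolding smooth_real_on_def
proof
  fix m
  have "times_differentiable_on m f U" using assms(1) by (simp add: smooth_fun_on_def)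
  then show "Ck_on m (\<lambda>t. f (t *\<^sub>R axis j 1)) I"
  proof (induction m arbitrary: f)
    case 0
    then show ?case using assms(2) by (auto intro!: continuous_on_compose2[of U f] continuous_intros)
  next
    case (Suc m)
    have "((\<lambda>t. f (t *\<^sub>R axis j 1)) has_real_derivative partial_deriv j f (t *\<^sub>R axis j 1)) (at t)" if "t \<in> I" for t
    proof -
      have "f differentiable at (t *\<^sub>R axis j 1)" using Suc.prems assms(2) that by auto
      then obtain D where D: "(f has_derivative D) (at (t *\<^sub>R axis j 1))" by (auto simp: differentiable_def)
      from has_derivative_along[OF this, of "axis j 1"] partial_deriv_has_derivative[OF D, of j]
      have "((\<lambda>s. f (t *\<^sub>R axis j 1 + s *\<^sub>R axis j 1)) has_real_derivative partial_deriv j f (t *\<^sub>R axis j 1)) (at 0)"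
        by simp
      then show ?thesis
        using DERIV_at_within_shift[of "\<lambda>s. f (s *\<^sub>R axis j 1)" _ t 0 UNIV]
        by (simp add: scaleR_left_distrib)
    qed
    moreover have "Ck_on m (\<lambda>t. partial_deriv j f (t *\<^sub>R axis j 1)) I" using Suc by auto
    ultimately show ?case
      by (intro Ck_on.simps(2)[THEN iffD2] exI[of _ "\<lambda>t. partial_deriv j f (t *\<^sub>R axis j 1)"]) auto
  qed
qed

subsection \<open>Curvature in a frame\<close>

lemma linear_mult_right: "linear f \<Longrightarrow> linear (\<lambda>v. f v * (c::real))"
  by (auto simp: linear_iff algebra_simps)

lemma linear_mult_left: "linear f \<Longrightarrow> linear (\<lambda>v. (c::real) * f v)"
  by (auto simp: linear_iff algebra_simps)

lemma linear_divide_const: "linear f \<Longrightarrow> linear (\<lambda>v. f v / (c::real))"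
  by (auto simp: linear_iff add_divide_distrib)

lemmas linear_intros = linear_compose_add linear_compose_sub linear_compose_sum linear_mult_left
  linear_mult_right linear_divide_const ballI linear_compose_neg

text \<open>Christoffel symbols of the first kind, the lowered index first. \<open>D w u v\<close>
  stands for the derivative along \<open>w\<close> of the metric evaluated on constant vectors
  \<open>u\<close> and \<open>v\<close>; the expression is trilinear whenever \<open>D\<close> is,
  and accepts frame vectors.\<close>

definition christoffel_first ::
    "(real ^ 'n \<Rightarrow> real ^ 'n \<Rightarrow> real ^ 'n \<Rightarrow> real) \<Rightarrow> real ^ 'n \<Rightarrow> real ^ 'n \<Rightarrow> real ^ 'n \<Rightarrow> real" where
  "christoffel_first D l u v = (D u v l + D v u l - D l u v) / 2"

definition christoffel_first_deriv ::
    "(real ^ 'n \<Rightarrow> real ^ 'n \<Rightarrow> real ^ 'n \<Rightarrow> real ^ 'n \<Rightarrow> real) \<Rightarrow>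
     real ^ 'n \<Rightarrow> real ^ 'n \<Rightarrow> real ^ 'n \<Rightarrow> real ^ 'n \<Rightarrow> real" where
  "christoffel_first_deriv D w l u v = (D w u v l + D w v u l - D w l u v) / 2"

text \<open>The lowered curvature tensor. The quadratic terms have the sign opposite to that in
  \<open>riemann\<close>, because lowering the index under the derivative also differentiates the
  metric. The sum over \<open>f\<close> and \<open>\<eta>\<close> is the contraction with the
  inverse metric, evaluated in an orthogonal frame.\<close>

definition curvature_form ::
    "(real ^ 'n \<Rightarrow> real ^ 'n \<Rightarrow> real ^ 'n \<Rightarrow> real) \<Rightarrow>
     (real ^ 'n \<Rightarrow> real ^ 'n \<Rightarrow> real ^ 'n \<Rightarrow> real ^ 'n \<Rightarrow> real) \<Rightarrow>
     ('n \<Rightarrow> real ^ 'n) \<Rightarrow> ('n \<Rightarrow> real) \<Rightarrow>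
     real ^ 'n::finite \<Rightarrow> real ^ 'n \<Rightarrow> real ^ 'n \<Rightarrow> real ^ 'n \<Rightarrow> real" where
  "curvature_form D DD f \<eta> l k u v =
     christoffel_first_deriv DD u l v k - christoffel_first_deriv DD v l u k
     - (\<Sum>a\<in>UNIV. (christoffel_first D (f a) u l * christoffel_first D (f a) v k
                 - christoffel_first D (f a) v l * christoffel_first D (f a) u k) / \<eta> a)"

text \<open>On axis vectors \<open>Dg\<close> is fixed by \<open>partial\<close>; multilinearity
  extends it to all vectors, which is what allows frame vectors as arguments.\<close>

locale metric_jet =
  fixes U :: "(real ^ 'n::finite) set" and g :: "'n form_field"
    and Dg :: "real ^ 'n \<Rightarrow> real ^ 'n \<Rightarrow> real ^ 'n \<Rightarrow> real ^ 'n \<Rightarrow> real"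
  assumes open_U: "open U"
    and smooth: "\<And>i j. smooth_fun_on (metric_component g i j) U"
    and nondeg: "\<And>x. x \<in> U \<Longrightarrow> det (metric_matrix g x) \<noteq> 0"
    and bilin: "\<And>x. x \<in> U \<Longrightarrow> bilinear (g x)"
    and sym: "\<And>x u v. x \<in> U \<Longrightarrow> g x u v = g x v u"
    and partial: "\<And>x i j k. x \<in> U \<Longrightarrow>
      partial_deriv i (metric_component g j k) x = Dg x (axis i 1) (axis j 1) (axis k 1)"
    and lin: "\<And>x u v. x \<in> U \<Longrightarrow> linear (\<lambda>w. Dg x w u v)"
      "\<And>x u v. x \<in> U \<Longrightarrow> linear (\<lambda>w. Dg x u w v)"
      "\<And>x u v. x \<in> U \<Longrightarrow> linear (\<lambda>w. Dg x u v w)"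
    and Dg_sym: "\<And>x u v w. x \<in> U \<Longrightarrow> Dg x w u v = Dg x w v u"
begin

lemma g_lin1: "x \<in> U \<Longrightarrow> linear (\<lambda>w. g x w v)"
  using bilin by (simp add: bilinear_def)

lemma g_lin2: "x \<in> U \<Longrightarrow> linear (g x v)"
  using bilin by (simp add: bilinear_def)

lemma cf_lin:
  assumes "x \<in> U"
  shows "linear (\<lambda>w. christoffel_first (Dg x) w u v)" "linear (\<lambda>w. christoffel_first (Dg x) u w v)"
    "linear (\<lambda>w. christoffel_first (Dg x) u v w)"
  unfolding christoffel_first_def by (intro linear_intros lin assms)+

lemma inv_metric:
  assumes "x \<in> U"
  shows "(\<Sum>m\<in>UNIV. metric_component g l m x * inverse_metric g m n x) = (if l = n then 1 else 0)"
    "(\<Sum>m\<in>UNIV. inverse_metric g l m x * metric_component g m n x) = (if l = n then 1 else 0)"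
proof -
  have "invertible (metric_matrix g x)" using nondeg[OF assms] by (simp add: invertible_det_nz)
  then have "(metric_matrix g x ** matrix_inv (metric_matrix g x)) $ l $ n = mat 1 $ l $ n"
    "(matrix_inv (metric_matrix g x) ** metric_matrix g x) $ l $ n = mat 1 $ l $ n"
    by (simp_all add: matrix_inv_works)
  then show "(\<Sum>m\<in>UNIV. metric_component g l m x * inverse_metric g m n x) = (if l = n then 1 else 0)"
    "(\<Sum>m\<in>UNIV. inverse_metric g l m x * metric_component g m n x) = (if l = n then 1 else 0)"
    by (simp_all add: matrix_matrix_mult_def metric_matrix_def inverse_metric_def mat_def)
qed

lemma christoffel_eq:
  assumes "x \<in> U"
  shows "christoffel g k i j x =
    (\<Sum>l\<in>UNIV. inverse_metric g k l x * christoffel_first (Dg x) (axis l 1) (axis i 1) (axis j 1))"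
  unfolding christoffel_def christoffel_first_def by (simp add: partial assms sum_divide_distrib)

lemma lower_inverse:
  assumes "x \<in> U"
  shows "(\<Sum>m\<in>UNIV. metric_component g l m x * (\<Sum>n\<in>UNIV. inverse_metric g m n x * c n)) = c l"
proof -
  have "(\<Sum>m\<in>UNIV. metric_component g l m x * (\<Sum>n\<in>UNIV. inverse_metric g m n x * c n))
      = (\<Sum>n\<in>UNIV. (\<Sum>m\<in>UNIV. metric_component g l m x * inverse_metric g m n x) * c n)"
    unfolding sum_distrib_left sum_distrib_right by (subst sum.swap) (simp add: mult.assoc)
  then show ?thesis by (simp add: inv_metric assms if_distrib[of "\<lambda>x. x * _"] cong: if_cong)
qed

lemma inverse_lower:
  assumes "x \<in> U"
  shows "(\<Sum>m\<in>UNIV. inverse_metric g l m x * (\<Sum>n\<in>UNIV. metric_component g m n x * c n)) = c l"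
proof -
  have "(\<Sum>m\<in>UNIV. inverse_metric g l m x * (\<Sum>n\<in>UNIV. metric_component g m n x * c n))
      = (\<Sum>n\<in>UNIV. (\<Sum>m\<in>UNIV. inverse_metric g l m x * metric_component g m n x) * c n)"
    unfolding sum_distrib_left sum_distrib_right by (subst sum.swap) (simp add: mult.assoc)
  then show ?thesis by (simp add: inv_metric assms if_distrib[of "\<lambda>x. x * _"] cong: if_cong)
qed

lemma christoffel_lower:
  assumes "x \<in> U"
  shows "(\<Sum>m\<in>UNIV. metric_component g l m x * christoffel g m i j x) =
    christoffel_first (Dg x) (axis l 1) (axis i 1) (axis j 1)"
  by (simp add: christoffel_eq lower_inverse assms)

lemma christoffel_smooth: "smooth_fun_on (christoffel g k i j) U"
  by (rule smooth_fun_on_christoffel[OF open_U smooth nondeg])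

text \<open>Pairing with \<open>w\<close> removes the inverse metric from the quadratic term of the
  geodesic equation; energy and momentum are computed in this form.\<close>

lemma metric_christoffel:
  assumes "x \<in> U"
  shows "g x (\<chi> k. \<Sum>i\<in>UNIV. \<Sum>j\<in>UNIV. christoffel g k i j x * u $ i * v $ j) w =
    christoffel_first (Dg x) w u v"
proof -
  have "g x (\<chi> k. \<Sum>i\<in>UNIV. \<Sum>j\<in>UNIV. christoffel g k i j x * u $ i * v $ j) (axis l 1) =
    christoffel_first (Dg x) (axis l 1) u v" for l
  proof -
    have "g x (\<chi> k. \<Sum>i\<in>UNIV. \<Sum>j\<in>UNIV. christoffel g k i j x * u $ i * v $ j) (axis l 1)
      = (\<Sum>m\<in>UNIV. (\<Sum>i\<in>UNIV. \<Sum>j\<in>UNIV. christoffel g m i j x * u $ i * v $ j) * metric_component g l m x)"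
      unfolding linear_sum_axis[OF g_lin1[OF assms], symmetric, of "\<chi> k. _ k"]
      by (simp add: metric_component_def sym[OF assms, of "axis l 1"])
    also have "\<dots> = (\<Sum>i\<in>UNIV. \<Sum>j\<in>UNIV. \<Sum>m\<in>UNIV. metric_component g l m x * christoffel g m i j x * u $ i * v $ j)"
      unfolding sum_distrib_right
      by (subst sum.swap, subst (2) sum.swap) (simp add: algebra_simps)
    also have "\<dots> = (\<Sum>i\<in>UNIV. u $ i * (\<Sum>j\<in>UNIV. v $ j * christoffel_first (Dg x) (axis l 1) (axis i 1) (axis j 1)))"
      unfolding christoffel_lower[OF assms, symmetric] sum_distrib_left by (simp add: algebra_simps)
    also have "\<dots> = christoffel_first (Dg x) (axis l 1) u v"
      by (simp only: linear_sum_axis[OF cf_lin(3)[OF assms]] linear_sum_axis[OF cf_lin(2)[OF assms]])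
    finally show ?thesis .
  qed
  then have "(\<Sum>l\<in>UNIV. w $ l * g x (\<chi> k. \<Sum>i\<in>UNIV. \<Sum>j\<in>UNIV. christoffel g k i j x * u $ i * v $ j) (axis l 1))
     = (\<Sum>l\<in>UNIV. w $ l * christoffel_first (Dg x) (axis l 1) u v)" by simp
  then show ?thesis
    by (simp only: linear_sum_axis[OF g_lin2[OF assms]] linear_sum_axis[OF cf_lin(1)[OF assms]])
qed

end

text \<open>Second derivatives are required at the single point \<open>x\<close>, and
  \<open>f\<close> is a basis of one tangent space, not a frame field.\<close>

locale metric_frame = metric_jet +
  fixes x :: "real ^ 'n::finite" and f :: "'n \<Rightarrow> real ^ 'n" and \<eta> :: "'n \<Rightarrow> real"
    and DDg :: "real ^ 'n \<Rightarrow> real ^ 'n \<Rightarrow> real ^ 'n \<Rightarrow> real ^ 'n \<Rightarrow> real"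
  assumes x: "x \<in> U"
    and frame: "\<And>a b. g x (f a) (f b) = (if a = b then \<eta> a else 0)"
    and eta: "\<And>a. \<eta> a \<noteq> 0"
    and partial2: "\<And>i m j k. ((\<lambda>s. Dg (x + s *\<^sub>R axis i 1) (axis m 1) (axis j 1) (axis k 1))
       has_real_derivative DDg (axis i 1) (axis m 1) (axis j 1) (axis k 1)) (at 0)"
    and lin2: "\<And>u v w. linear (\<lambda>z. DDg z u v w)" "\<And>u v w. linear (\<lambda>z. DDg u z v w)"
      "\<And>u v w. linear (\<lambda>z. DDg u v z w)" "\<And>u v w. linear (\<lambda>z. DDg u v w z)"
begin

abbreviation "\<Phi> \<equiv> curvature_form (Dg x) DDg f \<eta>"

text \<open>With the frame vectors as rows of F, G the metric matrix and E the rows of F divided by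
  \<eta>, orthogonality says that E G is a left inverse of the transpose of F. For square matrices
  it is also a right inverse; this gives both the inverse metric and the expansion of a
  vector.\<close>

lemma frame_matrices:
  shows "inverse_metric g m n x = (\<Sum>a\<in>UNIV. f a $ m * f a $ n / \<eta> a)"
    and "v = (\<Sum>a\<in>UNIV. (g x (f a) v / \<eta> a) *\<^sub>R f a)"
proof -
  let ?F = "(\<chi> a m. f a $ m) :: real ^ 'n ^ 'n"
  let ?E = "(\<chi> a m. f a $ m / \<eta> a) :: real ^ 'n ^ 'n"
  let ?G = "metric_matrix g x"
  have gv: "(\<Sum>n\<in>UNIV. (\<Sum>m\<in>UNIV. f a $ m * metric_component g m n x) * v $ n) = g x (f a) v" for a v
    unfolding metric_component_def linear_sum_axis[OF g_lin1[OF x]]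
    using linear_sum_axis[OF g_lin2[OF x], of v "f a"] by (simp add: mult.commute)
  have E: "?E ** ?G = (\<chi> a n. (\<Sum>m\<in>UNIV. f a $ m * metric_component g m n x) / \<eta> a)"
    by (simp add: matrix_matrix_mult_def metric_matrix_def sum_divide_distrib vec_eq_iff)
  have "(?E ** ?G) ** transpose ?F = mat 1"
  proof -
    have "(\<Sum>k\<in>UNIV. (\<Sum>m\<in>UNIV. f i $ m * metric_component g m k x) / \<eta> i * f j $ k) = g x (f i) (f j) / \<eta> i" for i j
      by (simp only: times_divide_eq_left sum_divide_distrib[symmetric] gv)
    then show ?thesis
      unfolding E using eta by (simp add: matrix_matrix_mult_def transpose_def vec_eq_iff mat_def frame)
  qed
  then have 1: "transpose ?F ** (?E ** ?G) = mat 1" by (simp add: matrix_left_right_inverse)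
  then have "matrix_inv ?G = transpose ?F ** ?E"
    by (intro matrix_inv_unique) (simp add: matrix_mul_assoc)
  then have "matrix_inv ?G $ m $ n = (transpose ?F ** ?E) $ m $ n" by simp
  then show "inverse_metric g m n x = (\<Sum>a\<in>UNIV. f a $ m * f a $ n / \<eta> a)"
    by (simp add: inverse_metric_def matrix_matrix_mult_def transpose_def)
  have "v = (transpose ?F ** (?E ** ?G)) *v v" using 1 by simp
  then have "v = transpose ?F *v ((?E ** ?G) *v v)" by (simp add: matrix_vector_mul_assoc)
  also have "(?E ** ?G) *v v = (\<chi> a. g x (f a) v / \<eta> a)"
    unfolding E by (simp only: matrix_vector_mult_def vec_lambda_beta times_divide_eq_left
      sum_divide_distrib[symmetric] gv)
  also have "transpose ?F *v (\<chi> a. g x (f a) v / \<eta> a) = (\<Sum>a\<in>UNIV. (g x (f a) v / \<eta> a) *\<^sub>R f a)"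
    by (simp add: matrix_vector_mult_def transpose_def vec_eq_iff mult.commute)
  finally show "v = (\<Sum>a\<in>UNIV. (g x (f a) v / \<eta> a) *\<^sub>R f a)" .
qed

lemma linear_eq_on_frame:
  fixes \<phi> \<psi> :: "real ^ 'n \<Rightarrow> real"
  assumes "linear \<phi>" "linear \<psi>" "\<And>a. \<phi> (f a) = \<psi> (f a)"
  shows "\<phi> v = \<psi> v"
proof -
  have "\<phi> v = (\<Sum>a\<in>UNIV. (g x (f a) v / \<eta> a) * \<phi> (f a))"
    by (subst frame_matrices(2)[of v]) (simp add: linear_sum[OF assms(1)] linear_cmul[OF assms(1)])
  also have "\<dots> = (\<Sum>a\<in>UNIV. (g x (f a) v / \<eta> a) * \<psi> (f a))" by (simp add: assms(3))
  also have "\<dots> = \<psi> v"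
    by (subst (2) frame_matrices(2)[of v]) (simp add: linear_sum[OF assms(2)] linear_cmul[OF assms(2)])
  finally show ?thesis .
qed

text \<open>The passage from coordinate indices to frame indices: every contraction with the inverse
  metric becomes a single sum over the frame.\<close>

lemma inverse_metric_contract:
  assumes "linear \<alpha>" "linear \<beta>"
  shows "(\<Sum>m\<in>UNIV. \<Sum>n\<in>UNIV. inverse_metric g m n x * \<alpha> (axis m 1) * \<beta> (axis n 1)) =
    (\<Sum>a\<in>UNIV. \<alpha> (f a) * \<beta> (f a) / \<eta> a)"
proof -
  have "(\<Sum>m\<in>UNIV. \<Sum>n\<in>UNIV. inverse_metric g m n x * \<alpha> (axis m 1) * \<beta> (axis n 1)) =
    (\<Sum>m\<in>UNIV. \<Sum>a\<in>UNIV. \<Sum>n\<in>UNIV. f a $ m * \<alpha> (axis m 1) * (f a $ n * \<beta> (axis n 1)) / \<eta> a)"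
    unfolding frame_matrices(1) sum_distrib_right
    by (subst (2) sum.swap) (simp add: algebra_simps)
  also have "\<dots> = (\<Sum>a\<in>UNIV. \<Sum>m\<in>UNIV. \<Sum>n\<in>UNIV. f a $ m * \<alpha> (axis m 1) * (f a $ n * \<beta> (axis n 1)) / \<eta> a)"
    by (rule sum.swap)
  also have "\<dots> = (\<Sum>a\<in>UNIV. (\<Sum>m\<in>UNIV. f a $ m * \<alpha> (axis m 1)) * (\<Sum>n\<in>UNIV. f a $ n * \<beta> (axis n 1)) / \<eta> a)"
    unfolding sum_product sum_divide_distrib ..
  also have "\<dots> = (\<Sum>a\<in>UNIV. \<alpha> (f a) * \<beta> (f a) / \<eta> a)"
    by (simp only: linear_sum_axis[OF assms(1)] linear_sum_axis[OF assms(2)])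
  finally show ?thesis .
qed

lemma curvature_lin:
  "linear (\<lambda>z. \<Phi> z u v w)" "linear (\<lambda>z. \<Phi> u z v w)" "linear (\<lambda>z. \<Phi> u v z w)" "linear (\<lambda>z. \<Phi> u v w z)"
  unfolding curvature_form_def christoffel_first_deriv_def
  by (intro linear_intros lin2 cf_lin x)+

text \<open>Instead of differentiating the inverse metric, the identity
  \<open>christoffel_lower\<close> is differentiated: the lowered derivative of a Christoffel symbol
  is the derivative of the symbol of the first kind minus a term with the derivative of the metric.
  That term joins the quadratic ones.\<close>

lemma riemann_lower:
  "(\<Sum>m\<in>UNIV. metric_component g l m x * riemann g m k i j x) =
    \<Phi> (axis l 1) (axis k 1) (axis i 1) (axis j 1)"
proof -
  let ?c = "\<lambda>l i j. christoffel_first (Dg x) (axis l 1) (axis i 1) (axis j 1)"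
  have dch: "(\<Sum>m\<in>UNIV. metric_component g l m x * partial_deriv i (christoffel g m j k) x) =
     christoffel_first_deriv DDg (axis i 1) (axis l 1) (axis j 1) (axis k 1)
     - (\<Sum>m\<in>UNIV. Dg x (axis i 1) (axis l 1) (axis m 1) * christoffel g m j k x)" for i j
  proof -
    have "partial_deriv i (\<lambda>y. \<Sum>m\<in>UNIV. metric_component g l m y * christoffel g m j k y) x =
       (\<Sum>m\<in>UNIV. metric_component g l m x * partial_deriv i (christoffel g m j k) x
         + Dg x (axis i 1) (axis l 1) (axis m 1) * christoffel g m j k x)"
    proof -
      have "((\<lambda>y. \<Sum>m\<in>UNIV. metric_component g l m y * christoffel g m j k y) has_derivative
         (\<lambda>v. \<Sum>m\<in>UNIV. metric_component g l m x * (\<Sum>i\<in>UNIV. v $ i * partial_deriv i (christoffel g m j k) x)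
         + (\<Sum>i\<in>UNIV. v $ i * partial_deriv i (metric_component g l m) x) * christoffel g m j k x)) (at x)"
        by (intro has_derivative_sum has_derivative_mult has_derivative_partial_deriv
            smooth_fun_on_differentiable[OF smooth x] smooth_fun_on_differentiable[OF christoffel_smooth x])
      from partial_deriv_has_derivative[OF this, of i] show ?thesis
        by (simp add: axis_def[of i] if_distrib[of "\<lambda>x. x * _"] partial[OF x] cong: if_cong)
    qed
    moreover have "partial_deriv i (\<lambda>y. \<Sum>m\<in>UNIV. metric_component g l m y * christoffel g m j k y) x =
       partial_deriv i (\<lambda>y. christoffel_first (Dg y) (axis l 1) (axis j 1) (axis k 1)) x"
      by (rule partial_deriv_cong_open[OF open_U x christoffel_lower])
    moreover have "partial_deriv i (\<lambda>y. christoffel_first (Dg y) (axis l 1) (axis j 1) (axis k 1)) x =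
       christoffel_first_deriv DDg (axis i 1) (axis l 1) (axis j 1) (axis k 1)"
      unfolding christoffel_first_def christoffel_first_deriv_def
      by (rule partial_deriv_eqI) (intro DERIV_cdivide DERIV_diff DERIV_add partial2)
    ultimately show ?thesis by (simp add: sum.distrib)
  qed
  have gg: "(\<Sum>m\<in>UNIV. metric_component g l m x * (\<Sum>n\<in>UNIV. christoffel g m i n x * d n)) =
     (\<Sum>n\<in>UNIV. ?c l i n * d n)" for i d
  proof -
    have "(\<Sum>m\<in>UNIV. metric_component g l m x * (\<Sum>n\<in>UNIV. christoffel g m i n x * d n)) =
       (\<Sum>n\<in>UNIV. (\<Sum>m\<in>UNIV. metric_component g l m x * christoffel g m i n x) * d n)"
      unfolding sum_distrib_left sum_distrib_right by (subst sum.swap) (simp add: mult.assoc)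
    then show ?thesis by (simp add: christoffel_lower[OF x])
  qed
  have cc: "(\<Sum>m\<in>UNIV. (Dg x (axis i 1) (axis l 1) (axis m 1) - ?c l i m) * christoffel g m j k x) =
     (\<Sum>a\<in>UNIV. christoffel_first (Dg x) (f a) (axis i 1) (axis l 1) *
        christoffel_first (Dg x) (f a) (axis j 1) (axis k 1) / \<eta> a)" for i j
  proof -
    \<comment> \<open>Compatibility of the connection with the metric: the derivative of the metric
      is the sum of two symbols of the first kind.\<close>
    have "Dg x (axis i 1) (axis l 1) (axis m 1) - ?c l i m = ?c m i l" for m
      using Dg_sym[OF x, of "axis i 1" "axis l 1" "axis m 1"] Dg_sym[OF x, of "axis l 1" "axis i 1" "axis m 1"]
        Dg_sym[OF x, of "axis m 1" "axis i 1" "axis l 1"]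
      by (simp add: christoffel_first_def field_simps)
    then have "(\<Sum>m\<in>UNIV. (Dg x (axis i 1) (axis l 1) (axis m 1) - ?c l i m) * christoffel g m j k x) =
      (\<Sum>m\<in>UNIV. \<Sum>n\<in>UNIV. inverse_metric g m n x * ?c m i l * ?c n j k)"
      by (simp add: christoffel_eq[OF x] sum_distrib_left mult_ac)
    then show ?thesis by (simp add: inverse_metric_contract[OF cf_lin(1)[OF x] cf_lin(1)[OF x]])
  qed
  have "(\<Sum>m\<in>UNIV. metric_component g l m x * riemann g m k i j x) =
     (\<Sum>m\<in>UNIV. metric_component g l m x * partial_deriv i (christoffel g m j k) x)
     - (\<Sum>m\<in>UNIV. metric_component g l m x * partial_deriv j (christoffel g m i k) x)
     + ((\<Sum>m\<in>UNIV. metric_component g l m x * (\<Sum>n\<in>UNIV. christoffel g m i n x * christoffel g n j k x))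
     - (\<Sum>m\<in>UNIV. metric_component g l m x * (\<Sum>n\<in>UNIV. christoffel g m j n x * christoffel g n i k x)))"
    unfolding riemann_def by (simp add: algebra_simps sum.distrib sum_subtractf)
  also have "\<dots> = christoffel_first_deriv DDg (axis i 1) (axis l 1) (axis j 1) (axis k 1)
     - christoffel_first_deriv DDg (axis j 1) (axis l 1) (axis i 1) (axis k 1)
     - ((\<Sum>m\<in>UNIV. (Dg x (axis i 1) (axis l 1) (axis m 1) - ?c l i m) * christoffel g m j k x)
        - (\<Sum>m\<in>UNIV. (Dg x (axis j 1) (axis l 1) (axis m 1) - ?c l j m) * christoffel g m i k x))"
    unfolding dch gg by (simp add: left_diff_distrib sum_subtractf)
  also have "\<dots> = \<Phi> (axis l 1) (axis k 1) (axis i 1) (axis j 1)"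
    unfolding cc curvature_form_def by (simp add: sum_subtractf diff_divide_distrib)
  finally show ?thesis .
qed

lemma ricci_eq: "ricci g k j x = (\<Sum>a\<in>UNIV. \<Phi> (f a) (axis k 1) (f a) (axis j 1) / \<eta> a)"
proof -
  have "riemann g m k i j x =
    (\<Sum>n\<in>UNIV. inverse_metric g m n x * \<Phi> (axis n 1) (axis k 1) (axis i 1) (axis j 1))" for m i
    unfolding riemann_lower[symmetric] by (rule inverse_lower[OF x, symmetric])
  then have "ricci g k j x =
     (\<Sum>i\<in>UNIV. \<Sum>n\<in>UNIV. \<Phi> (axis n 1) (axis k 1) (axis i 1) (axis j 1) * inverse_metric g i n x)"
    unfolding ricci_def by (simp add: mult.commute)
  also have "\<dots> = (\<Sum>i\<in>UNIV. \<Sum>n\<in>UNIV. \<Sum>a\<in>UNIV. f a $ i * (f a $ n * \<Phi> (axis n 1) (axis k 1) (axis i 1) (axis j 1)) / \<eta> a)"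
    unfolding frame_matrices(1) sum_distrib_left by (simp add: algebra_simps)
  also have "\<dots> = (\<Sum>i\<in>UNIV. \<Sum>a\<in>UNIV. \<Sum>n\<in>UNIV. f a $ i * (f a $ n * \<Phi> (axis n 1) (axis k 1) (axis i 1) (axis j 1)) / \<eta> a)"
    by (intro sum.cong refl sum.swap)
  also have "\<dots> = (\<Sum>a\<in>UNIV. \<Sum>i\<in>UNIV. \<Sum>n\<in>UNIV. f a $ i * (f a $ n * \<Phi> (axis n 1) (axis k 1) (axis i 1) (axis j 1)) / \<eta> a)"
    by (rule sum.swap)
  also have "\<dots> = (\<Sum>a\<in>UNIV. (\<Sum>i\<in>UNIV. f a $ i * (\<Sum>n\<in>UNIV. f a $ n * \<Phi> (axis n 1) (axis k 1) (axis i 1) (axis j 1))) / \<eta> a)"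
    unfolding sum_distrib_left sum_divide_distrib ..
  also have "\<dots> = (\<Sum>a\<in>UNIV. \<Phi> (f a) (axis k 1) (f a) (axis j 1) / \<eta> a)"
    by (simp only: linear_sum_axis[OF curvature_lin(1)] linear_sum_axis[OF curvature_lin(3)])
  finally show ?thesis .
qed

text \<open>Both sides are bilinear, so the Einstein equation can be tested on the frame.\<close>

lemma einstein_at_frame:
  assumes "\<And>b d. (\<Sum>a\<in>UNIV. \<Phi> (f a) (f b) (f a) (f d) / \<eta> a) = (if b = d then \<Lambda> * \<eta> b else 0)"
  shows "ricci g k j x = \<Lambda> * metric_component g k j x"
proof -
  have l: "linear (\<lambda>v. \<Sum>a\<in>UNIV. \<Phi> (f a) v (f a) w / \<eta> a)" "linear (\<lambda>v. \<Sum>a\<in>UNIV. \<Phi> (f a) w (f a) v / \<eta> a)" for w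
    by (intro linear_intros curvature_lin)+
  have "(\<Sum>a\<in>UNIV. \<Phi> (f a) (f b) (f a) w / \<eta> a) = \<Lambda> * g x (f b) w" for b w
    by (rule linear_eq_on_frame[OF l(2) linear_mult_left[OF g_lin2[OF x]]]) (simp add: assms frame)
  then have "(\<Sum>a\<in>UNIV. \<Phi> (f a) v (f a) w / \<eta> a) = \<Lambda> * g x v w" for v w
    by (rule linear_eq_on_frame[OF l(1) linear_mult_left[OF g_lin1[OF x]]])
  then show ?thesis by (simp add: ricci_eq metric_component_def)
qed

end

section \<open>Volume form, Weyl tensor and Hodge star in dimension four\<close>

lemma vector_4 [simp]:
  "(vector [a, b, c, d] :: 'a::zero ^ 4) $ 1 = a" "(vector [a, b, c, d] :: 'a ^ 4) $ 2 = b"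
  "(vector [a, b, c, d] :: 'a ^ 4) $ 3 = c" "(vector [a, b, c, d] :: 'a ^ 4) $ 4 = d"
  by (simp_all add: vector_def)

lemma det_4:
  "det (A :: 'a::comm_ring_1 ^ 4 ^ 4) =
     A$1$1 * A$2$2 * A$3$3 * A$4$4 - A$1$1 * A$2$2 * A$3$4 * A$4$3
   - A$1$1 * A$2$3 * A$3$2 * A$4$4 + A$1$1 * A$2$3 * A$3$4 * A$4$2
   + A$1$1 * A$2$4 * A$3$2 * A$4$3 - A$1$1 * A$2$4 * A$3$3 * A$4$2
   - A$1$2 * A$2$1 * A$3$3 * A$4$4 + A$1$2 * A$2$1 * A$3$4 * A$4$3
   + A$1$2 * A$2$3 * A$3$1 * A$4$4 - A$1$2 * A$2$3 * A$3$4 * A$4$1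
   - A$1$2 * A$2$4 * A$3$1 * A$4$3 + A$1$2 * A$2$4 * A$3$3 * A$4$1
   + A$1$3 * A$2$1 * A$3$2 * A$4$4 - A$1$3 * A$2$1 * A$3$4 * A$4$2
   - A$1$3 * A$2$2 * A$3$1 * A$4$4 + A$1$3 * A$2$2 * A$3$4 * A$4$1
   + A$1$3 * A$2$4 * A$3$1 * A$4$2 - A$1$3 * A$2$4 * A$3$2 * A$4$1
   - A$1$4 * A$2$1 * A$3$2 * A$4$3 + A$1$4 * A$2$1 * A$3$3 * A$4$2
   + A$1$4 * A$2$2 * A$3$1 * A$4$3 - A$1$4 * A$2$2 * A$3$3 * A$4$1
   - A$1$4 * A$2$3 * A$3$1 * A$4$2 + A$1$4 * A$2$3 * A$3$2 * A$4$1"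
proof -
  have f1: "finite {2::4, 3, 4}" "1 \<notin> {2::4, 3, 4}" by auto
  have f2: "finite {3::4, 4}" "2 \<notin> {3::4, 4}" by auto
  have f3: "finite {4::4}" "3 \<notin> {4::4}" by auto
  show ?thesis
    unfolding det_def UNIV_4
    unfolding sum_over_permutations_insert[OF f1] sum_over_permutations_insert[OF f2]
      sum_over_permutations_insert[OF f3] permutes_sing
    by (simp add: sign_swap_id permutation_swap_id permutation_compose sign_compose sign_id swap_id_eq)
qed

abbreviation vol4 :: "real ^ 4 \<Rightarrow> real ^ 4 \<Rightarrow> real ^ 4 \<Rightarrow> real ^ 4 \<Rightarrow> real" where
  "vol4 u v w z \<equiv> det (vector [u, v, w, z])"

lemma vol4_lin:
  "linear (\<lambda>t. vol4 t u v w)" "linear (\<lambda>t. vol4 u t v w)"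
  "linear (\<lambda>t. vol4 u v t w)" "linear (\<lambda>t. vol4 u v w t)"
  by (simp_all add: linear_iff det_4 algebra_simps)

text \<open>Multiplicativity of the determinant: on frame vectors the volume form is the Levi-Civita
  symbol times one common factor.\<close>

lemma vol4_frame:
  "vol4 (f p) (f q) (f r) (f s) = levi_civita p q r s * det (\<chi> a. f a)"
proof -
  have "vector [f p, f q, f r, f s] = (vector [axis p 1, axis q 1, axis r 1, axis s 1] :: real ^ 4 ^ 4) ** (\<chi> a. f a)"
    by (simp add: vec_eq_iff forall_4 matrix_matrix_mult_def axis_def if_distrib[of "\<lambda>x. x * _"] cong: if_cong)
  then show ?thesis by (simp add: det_mul levi_civita_def)
qed

lemma multilinear4_eq_axis:
  fixes M N :: "real ^ 'n::finite \<Rightarrow> real ^ 'n \<Rightarrow> real ^ 'n \<Rightarrow> real ^ 'n \<Rightarrow> real"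
  assumes M: "\<And>u v w. linear (\<lambda>z. M z u v w)" "\<And>u v w. linear (\<lambda>z. M u z v w)"
      "\<And>u v w. linear (\<lambda>z. M u v z w)" "\<And>u v w. linear (\<lambda>z. M u v w z)"
    and N: "\<And>u v w. linear (\<lambda>z. N z u v w)" "\<And>u v w. linear (\<lambda>z. N u z v w)"
      "\<And>u v w. linear (\<lambda>z. N u v z w)" "\<And>u v w. linear (\<lambda>z. N u v w z)"
    and eq: "\<And>i j k l. M (axis i 1) (axis j 1) (axis k 1) (axis l 1) = N (axis i 1) (axis j 1) (axis k 1) (axis l 1)"
  shows "M u v w z = N u v w z"
proof -
  have ext: "\<phi> t = \<psi> t" if "linear \<phi>" "linear \<psi>" "\<And>i. \<phi> (axis i 1) = \<psi> (axis i 1)"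
    for \<phi> \<psi> :: "real ^ 'n \<Rightarrow> real" and t
    using linear_sum_axis[OF that(1), of t] linear_sum_axis[OF that(2), of t] that(3) by simp
  show ?thesis
    by (rule ext[OF M(1) N(1)], rule ext[OF M(2) N(2)], rule ext[OF M(3) N(3)], rule ext[OF M(4) N(4)], rule eq)
qed

locale metric_frame4 = metric_frame U g Dg x f \<eta> DDg
  for U :: "(real ^ 4) set" and g Dg x f \<eta> DDg +
  fixes \<Lambda> :: real
  assumes einstein_x: "\<And>i j. ricci g i j x = \<Lambda> * metric_component g i j x"
begin

text \<open>The Weyl tensor of an Einstein metric as a multilinear form: the scalar curvature is
  \<open>4 * \<Lambda>\<close>, and the Ricci and scalar terms of \<open>weyl\<close> combine into
  the curvature of a space of constant sectional curvature \<open>\<Lambda> / 3\<close>.\<close>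

definition W :: "real ^ 4 \<Rightarrow> real ^ 4 \<Rightarrow> real ^ 4 \<Rightarrow> real ^ 4 \<Rightarrow> real" where
  "W l k i j = \<Phi> l k i j - \<Lambda> / 3 * (g x l i * g x k j - g x l j * g x k i)"

text \<open>The value of the volume form on the frame. It is a sign when all \<open>\<eta>\<close>
  are signs, by \<open>orientation_factor_sq\<close>.\<close>

definition orientation_factor :: real where
  "orientation_factor = sqrt \<bar>det (metric_matrix g x)\<bar> * det (\<chi> a. f a)"

lemma W_lin:
  "linear (\<lambda>z. W z u v w)" "linear (\<lambda>z. W u z v w)" "linear (\<lambda>z. W u v z w)" "linear (\<lambda>z. W u v w z)"
  unfolding W_def by (intro linear_intros curvature_lin g_lin1 g_lin2 x)+

lemma scalar_curvature_eq: "scalar_curvature g x = 4 * \<Lambda>"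
proof -
  have "scalar_curvature g x = \<Lambda> * (\<Sum>i\<in>UNIV. \<Sum>j\<in>UNIV. inverse_metric g i j x * metric_component g j i x)"
    unfolding scalar_curvature_def einstein_x sum_distrib_left
  proof (intro sum.cong refl)
    fix i j
    have "metric_component g i j x = metric_component g j i x"
      unfolding metric_component_def by (rule sym[OF x])
    then show "inverse_metric g i j x * (\<Lambda> * metric_component g i j x) =
      \<Lambda> * (inverse_metric g i j x * metric_component g j i x)" by simp
  qed
  also have "\<dots> = \<Lambda> * 4" unfolding inv_metric[OF x] by simp
  finally show ?thesis by simp
qed

lemma weyl_eq: "weyl g l k i j x = W (axis l 1) (axis k 1) (axis i 1) (axis j 1)"
  unfolding weyl_def riemann_lower einstein_x scalar_curvature_eq
  unfolding W_def metric_component_def by (simp add: field_simps)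

lemma hodge_weyl_eq:
  "hodge_weyl g i j k l x = sqrt \<bar>det (metric_matrix g x)\<bar> *
     (\<Sum>s\<in>UNIV. (\<Sum>r\<in>UNIV. vol4 (axis i 1) (axis j 1) (f r) (f s) * W (f r) (f s) (axis k 1) (axis l 1) / \<eta> r) / \<eta> s) / 2"
    (is "_ = ?S * _ / 2")
proof -
  let ?V = "\<lambda>a b. vol4 (axis i 1) (axis j 1) a b"
  let ?W = "\<lambda>m n. W m n (axis k 1) (axis l 1)"
  have "2 * hodge_weyl g i j k l x = (\<Sum>a\<in>UNIV. \<Sum>b\<in>UNIV. \<Sum>m\<in>UNIV. \<Sum>n\<in>UNIV.
      ?S * (inverse_metric g a m x * (inverse_metric g b n x * ?V (axis a 1) (axis b 1) * ?W (axis m 1) (axis n 1))))"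
    unfolding hodge_weyl_def weyl_eq volume_form_def levi_civita_def by (simp add: mult_ac)
  also have "\<dots> = ?S * (\<Sum>a\<in>UNIV. \<Sum>m\<in>UNIV. inverse_metric g a m x * (\<Sum>b\<in>UNIV. \<Sum>n\<in>UNIV.
      inverse_metric g b n x * ?V (axis a 1) (axis b 1) * ?W (axis m 1) (axis n 1)))"
    unfolding sum_distrib_left by (intro sum.cong refl sum.swap)
  also have "\<dots> = ?S * (\<Sum>a\<in>UNIV. \<Sum>m\<in>UNIV. inverse_metric g a m x *
      (\<Sum>s\<in>UNIV. ?V (axis a 1) (f s) * ?W (axis m 1) (f s) / \<eta> s))"
    by (simp only: inverse_metric_contract[OF vol4_lin(4) W_lin(2)])
  also have "\<dots> = ?S * (\<Sum>a\<in>UNIV. \<Sum>m\<in>UNIV. \<Sum>s\<in>UNIV.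
      inverse_metric g a m x * ?V (axis a 1) (f s) * ?W (axis m 1) (f s) / \<eta> s)"
    unfolding sum_distrib_left by (simp add: mult.assoc)
  also have "(\<Sum>a\<in>UNIV. \<Sum>m\<in>UNIV. \<Sum>s\<in>UNIV.
      inverse_metric g a m x * ?V (axis a 1) (f s) * ?W (axis m 1) (f s) / \<eta> s)
    = (\<Sum>a\<in>UNIV. \<Sum>s\<in>UNIV. \<Sum>m\<in>UNIV.
      inverse_metric g a m x * ?V (axis a 1) (f s) * ?W (axis m 1) (f s) / \<eta> s)"
    by (intro sum.cong refl sum.swap)
  also have "\<dots> = (\<Sum>s\<in>UNIV. \<Sum>a\<in>UNIV. \<Sum>m\<in>UNIV.
      inverse_metric g a m x * ?V (axis a 1) (f s) * ?W (axis m 1) (f s) / \<eta> s)"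
    by (rule sum.swap)
  also have "\<dots> = (\<Sum>s\<in>UNIV. (\<Sum>a\<in>UNIV. \<Sum>m\<in>UNIV.
      inverse_metric g a m x * ?V (axis a 1) (f s) * ?W (axis m 1) (f s)) / \<eta> s)"
    unfolding sum_divide_distrib ..
  also have "\<dots> = (\<Sum>s\<in>UNIV. (\<Sum>r\<in>UNIV. ?V (f r) (f s) * ?W (f r) (f s) / \<eta> r) / \<eta> s)"
    by (simp only: inverse_metric_contract[OF vol4_lin(3) W_lin(1)])
  finally show ?thesis by simp
qed

text \<open>Both sides of the duality equation are multilinear in four vectors, so validity on the
  axes, on all vectors and on the frame is the same.\<close>

lemma half_flat_iff_frame:
  "(\<forall>i j k l. hodge_weyl g i j k l x = \<sigma> * weyl g i j k l x) \<longleftrightarrow>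
   (\<forall>p q k l. orientation_factor * (\<Sum>s\<in>UNIV. \<Sum>r\<in>UNIV. levi_civita p q r s * W (f r) (f s) (f k) (f l) / (\<eta> r * \<eta> s)) / 2
      = \<sigma> * W (f p) (f q) (f k) (f l))"
proof -
  define M where "M = (\<lambda>u v w z. sqrt \<bar>det (metric_matrix g x)\<bar> *
     (\<Sum>s\<in>UNIV. (\<Sum>r\<in>UNIV. vol4 u v (f r) (f s) * W (f r) (f s) w z / \<eta> r) / \<eta> s) / 2)"
  define N where "N = (\<lambda>u v w z. \<sigma> * W u v w z)"
  have M: "linear (\<lambda>z. M z u v w)" "linear (\<lambda>z. M u z v w)" "linear (\<lambda>z. M u v z w)" "linear (\<lambda>z. M u v w z)" for u v w
    unfolding M_def by (intro linear_intros vol4_lin W_lin)+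
  have N: "linear (\<lambda>z. N z u v w)" "linear (\<lambda>z. N u z v w)" "linear (\<lambda>z. N u v z w)" "linear (\<lambda>z. N u v w z)" for u v w
    unfolding N_def by (intro linear_intros W_lin)+
  have 1: "(\<forall>i j k l. hodge_weyl g i j k l x = \<sigma> * weyl g i j k l x) \<longleftrightarrow> (\<forall>u v w z. M u v w z = N u v w z)"
  proof
    assume "\<forall>i j k l. hodge_weyl g i j k l x = \<sigma> * weyl g i j k l x"
    then have "M (axis i 1) (axis j 1) (axis k 1) (axis l 1) = N (axis i 1) (axis j 1) (axis k 1) (axis l 1)" for i j k l
      by (simp add: hodge_weyl_eq weyl_eq M_def N_def)
    then show "\<forall>u v w z. M u v w z = N u v w z" using multilinear4_eq_axis[OF M N] by blast
  qed (simp add: hodge_weyl_eq weyl_eq M_def N_def)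
  have 2: "(\<forall>u v w z. M u v w z = N u v w z) \<longleftrightarrow> (\<forall>p q k l. M (f p) (f q) (f k) (f l) = N (f p) (f q) (f k) (f l))"
  proof (intro iffI allI)
    fix u v w z
    assume eq: "\<forall>p q k l. M (f p) (f q) (f k) (f l) = N (f p) (f q) (f k) (f l)"
    show "M u v w z = N u v w z"
      by (rule linear_eq_on_frame[OF M(1) N(1)], rule linear_eq_on_frame[OF M(2) N(2)],
          rule linear_eq_on_frame[OF M(3) N(3)], rule linear_eq_on_frame[OF M(4) N(4)]) (use eq in blast)
  qed blast
  have 3: "M (f p) (f q) (f k) (f l) =
    orientation_factor * (\<Sum>s\<in>UNIV. \<Sum>r\<in>UNIV. levi_civita p q r s * W (f r) (f s) (f k) (f l) / (\<eta> r * \<eta> s)) / 2" for p q k l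
    unfolding M_def orientation_factor_def vol4_frame sum_divide_distrib sum_distrib_left by (simp add: mult_ac)
  show ?thesis unfolding 1 2 unfolding 3 unfolding N_def ..
qed

text \<open>Determinant of the Gram matrix of the frame, computed as a product of three
  matrices.\<close>

lemma orientation_factor_sq: "orientation_factor\<^sup>2 = \<bar>\<eta> 1 * \<eta> 2 * \<eta> 3 * \<eta> 4\<bar>"
proof -
  let ?F = "(\<chi> a. f a) :: real ^ 4 ^ 4" and ?G = "metric_matrix g x"
  have "(?F ** ?G ** transpose ?F) $ a $ b = (if a = b then \<eta> a else 0)" for a b
  proof -
    have "(?F ** ?G ** transpose ?F) $ a $ b = (\<Sum>n\<in>UNIV. f b $ n * (\<Sum>m\<in>UNIV. f a $ m * g x (axis m 1) (axis n 1)))"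
      by (simp add: matrix_matrix_mult_def transpose_def metric_matrix_def metric_component_def mult.commute)
    also have "\<dots> = g x (f a) (f b)"
      by (simp only: linear_sum_axis[OF g_lin1[OF x]] linear_sum_axis[OF g_lin2[OF x]])
    finally show ?thesis by (simp add: frame)
  qed
  then have "det (?F ** ?G ** transpose ?F) = \<eta> 1 * \<eta> 2 * \<eta> 3 * \<eta> 4"
    by (simp add: det_4)
  then have "\<eta> 1 * \<eta> 2 * \<eta> 3 * \<eta> 4 = det ?G * (det ?F)\<^sup>2"
    by (simp add: det_mul power2_eq_square) algebra
  then have "\<bar>\<eta> 1 * \<eta> 2 * \<eta> 3 * \<eta> 4\<bar> = \<bar>det ?G\<bar> * (det ?F)\<^sup>2"
    by (simp add: abs_mult)
  then show ?thesis by (simp add: orientation_factor_def power_mult_distrib)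
qed

end

subsection \<open>Invariant metrics\<close>

text \<open>The closed form of the bracket; \<open>heis_bracket_eq\<close> identifies it with the
  bracket of left-invariant fields.\<close>

definition heis_br :: "real ^ 3 \<Rightarrow> real ^ 3 \<Rightarrow> real ^ 3" where
  "heis_br v w = vector [0, 0, v $ 1 * w $ 2 - v $ 2 * w $ 1]"

text \<open>The bracket of the group parts. Minus one half of it is the derivative of
  \<open>mc_form\<close> in the base point, see \<open>mc_form_line\<close>.\<close>

definition br4 :: "real ^ 4 \<Rightarrow> real ^ 4 \<Rightarrow> real ^ 3" where
  "br4 u v = vector [0, 0, u $ 2 * v $ 3 - u $ 3 * v $ 2]"

definition mc_form :: "real ^ 4 \<Rightarrow> real ^ 4 \<Rightarrow> real ^ 3" where
  \<comment> \<open>the Maurer-Cartan form of the Heisenberg group\<close>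
  "mc_form x u = vector [u $ 2, u $ 3, u $ 4 - (x $ 2 * u $ 3 - x $ 3 * u $ 2) / 2]"

text \<open>The left-invariant field of \<open>w\<close> as a vector tangent to the orbit; it is
  sent to \<open>w\<close> by the Maurer-Cartan form.\<close>

definition inv_lift :: "real ^ 4 \<Rightarrow> real ^ 3 \<Rightarrow> real ^ 4" where
  "inv_lift x w = vector [0, w $ 1, w $ 2, w $ 3 + (x $ 2 * w $ 2 - x $ 3 * w $ 1) / 2]"

text \<open>A free coefficient \<open>P\<close> covers both coordinates of the interval: the
  constant \<epsilon> for the time t, and the coefficient of the model metric for \<rho>.\<close>

definition hmet ::
    "(real \<Rightarrow> real) \<Rightarrow> (real \<Rightarrow> real ^ 3 \<Rightarrow> real ^ 3 \<Rightarrow> real) \<Rightarrow> 4 form_field" where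
  "hmet P H x u v = P (x $ 1) * u $ 1 * v $ 1 + H (x $ 1) (mc_form x u) (mc_form x v)"

text \<open>The first term is the time derivative; the terms with \<open>br4\<close> come from the
  dependence of the Maurer-Cartan form on the point.\<close>

definition hmetD where
  "hmetD P' H H' x m u v =
     m $ 1 * (P' (x $ 1) * u $ 1 * v $ 1 + H' (x $ 1) (mc_form x u) (mc_form x v))
     - (H (x $ 1) (br4 m u) (mc_form x v) + H (x $ 1) (mc_form x u) (br4 m v)) / (2::real)"

text \<open>The second derivative for constant \<open>P\<close>. As \<open>mc_form\<close> is affine
  in the point, \<open>br4\<close> is not differentiated again.\<close>

definition hmetDD where
  "hmetDD H H' H'' x n m u v =
     n $ 1 * (m $ 1 * H'' (x $ 1) (mc_form x u) (mc_form x v)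
       - (H' (x $ 1) (br4 m u) (mc_form x v) + H' (x $ 1) (mc_form x u) (br4 m v)) / 2)
     - m $ 1 * (H' (x $ 1) (br4 n u) (mc_form x v) + H' (x $ 1) (mc_form x u) (br4 n v)) / 2
     + (H (x $ 1) (br4 m u) (br4 n v) + H (x $ 1) (br4 n u) (br4 m v)) / (4::real)"

lemma linear_mc_form: "linear (mc_form x)"
  by (auto simp: linear_iff mc_form_def vec_eq_iff forall_3 algebra_simps diff_divide_distrib add_divide_distrib)

lemma linear_br4: "linear (br4 u)" "linear (\<lambda>u. br4 u v)"
  by (auto simp: linear_iff br4_def vec_eq_iff forall_3 algebra_simps)

lemma mc_form_line: "mc_form (x + s *\<^sub>R m) u = mc_form x u + s *\<^sub>R ((- 1 / 2) *\<^sub>R br4 m u)"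
  by (simp add: mc_form_def br4_def vec_eq_iff forall_3 field_simps)

lemma mc_form_simps [simp]:
  "mc_form x (axis 1 1) = 0" "mc_form x (inv_lift x w) = w"
  "br4 (axis 1 1) u = 0" "br4 u (axis 1 1) = 0"
  "br4 (inv_lift x v) (inv_lift x w) = heis_br v w"
  "inv_lift x w $ 1 = 0"
  by (simp_all add: mc_form_def inv_lift_def br4_def heis_br_def vec_eq_iff forall_3 axis_def)

lemma linear_vec_nth: "linear (\<lambda>v :: real ^ 'n. v $ i)"
  by (simp add: linear_iff)

lemma linear_bil:
  assumes "bilinear (h :: real ^ 3 \<Rightarrow> real ^ 3 \<Rightarrow> real)"
  shows "linear (\<lambda>z. h (mc_form x z) a)" "linear (\<lambda>z. h a (mc_form x z))"
    "linear (\<lambda>z. h (br4 u z) a)" "linear (\<lambda>z. h a (br4 u z))"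
    "linear (\<lambda>z. h (br4 z u) a)" "linear (\<lambda>z. h a (br4 z u))"
  using assms linear_mc_form[of x] linear_br4[of u]
  by (auto simp: bilinear_def linear_iff)

lemma bilinear_expand3:
  fixes h :: "real ^ 3 \<Rightarrow> real ^ 3 \<Rightarrow> real"
  assumes "bilinear h"
  shows "h u v = (\<Sum>a\<in>UNIV. \<Sum>b\<in>UNIV. u $ a * v $ b * h (axis a 1) (axis b 1))"
proof -
  have l: "linear (\<lambda>u. h u v)" "linear (h u)" for u v
    using assms by (auto simp: bilinear_def)
  have "h u v = (\<Sum>a\<in>UNIV. u $ a * (\<Sum>b\<in>UNIV. v $ b * h (axis a 1) (axis b 1)))"
    by (simp only: linear_sum_axis[OF l(1)] linear_sum_axis[OF l(2)])
  then show ?thesis by (simp add: sum_distrib_left mult.assoc)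
qed

text \<open>Bilinearity expands the form into a polynomial in \<open>s\<close> whose coefficients
  depend on time alone. The expansion holds only while the time stays in \<open>J\<close>, which is
  a neighbourhood of \<open>s = 0\<close>.\<close>

lemma bilinear_line_deriv:
  fixes H H' :: "real \<Rightarrow> 'a::real_vector \<Rightarrow> 'a \<Rightarrow> real"
  assumes "open J" "t \<in> J" "\<And>t. t \<in> J \<Longrightarrow> bilinear (H t)"
    "\<And>a b. ((\<lambda>t. H t a b) has_real_derivative H' t a b) (at t)"
  shows "((\<lambda>s. H (t + s * k) (A + s *\<^sub>R a) (B + s *\<^sub>R b)) has_real_derivative
     k * H' t A B + H t a B + H t A b) (at 0)"
proof -
  have d: "((\<lambda>s. H (t + s * k) u v) has_real_derivative H' t u v * k) (at 0)" for u v
  proof -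
    have "((\<lambda>s. t + s * k) has_real_derivative k) (at 0)" by (auto intro!: derivative_eq_intros)
    from DERIV_chain2[where f = "\<lambda>t. H t u v" and g = "\<lambda>s. t + s * k", OF _ this] assms(4)
    show ?thesis by simp
  qed
  have "((\<lambda>s. H (t + s * k) A B + s * H (t + s * k) a B + s * H (t + s * k) A b + s * s * H (t + s * k) a b)
     has_real_derivative k * H' t A B + H t a B + H t A b) (at 0)"
    by (auto intro!: derivative_eq_intros d)
  moreover have "open ((\<lambda>s. t + s * k) -` J)"
    by (intro open_vimage assms(1) continuous_intros)
  moreover have "H (t + s * k) A B + s * H (t + s * k) a B + s * H (t + s * k) A b + s * s * H (t + s * k) a b
      = H (t + s * k) (A + s *\<^sub>R a) (B + s *\<^sub>R b)" if "s \<in> (\<lambda>s. t + s * k) -` J" for s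
    using assms(3)[of "t + s * k"] that
    by (simp add: bilinear_ladd bilinear_radd bilinear_lmul bilinear_rmul algebra_simps)
  ultimately show ?thesis
    using assms(2) by (elim has_field_derivative_transform_within_open) auto
qed

lemma bilinear_deriv:
  fixes H H' :: "real \<Rightarrow> 'a::real_vector \<Rightarrow> 'a \<Rightarrow> real"
  assumes "open J" "t \<in> J" "\<And>t. t \<in> J \<Longrightarrow> bilinear (H t)"
    "\<And>a b. ((\<lambda>t. H t a b) has_real_derivative H' t a b) (at t)"
  shows "bilinear (H' t)"
proof -
  have tr: "H' t u v = d" if "\<And>t. t \<in> J \<Longrightarrow> \<phi> t = H t u v" "(\<phi> has_real_derivative d) (at t)" for u v \<phi> d
    using has_field_derivative_transform_within_open[OF that(2) assms(1,2) that(1)] assms(4) DERIV_unique by blast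
  show ?thesis
    unfolding bilinear_def linear_iff
  proof (intro allI conjI)
    fix u v w c
    show "H' t u (v + w) = H' t u v + H' t u w"
      by (rule tr[of "\<lambda>t. H t u v + H t u w"]) (auto intro!: DERIV_add assms(4) simp: bilinear_radd assms(3))
    show "H' t u (c *\<^sub>R v) = c *\<^sub>R H' t u v"
      by (rule tr[of "\<lambda>t. c * H t u v"]) (auto intro!: DERIV_cmult assms(4) simp: bilinear_rmul assms(3))
    show "H' t (v + w) u = H' t v u + H' t w u"
      by (rule tr[of "\<lambda>t. H t v u + H t w u"]) (auto intro!: DERIV_add assms(4) simp: bilinear_ladd assms(3))
    show "H' t (c *\<^sub>R v) u = c *\<^sub>R H' t v u"
      by (rule tr[of "\<lambda>t. c * H t v u"]) (auto intro!: DERIV_cmult assms(4) simp: bilinear_lmul assms(3))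
  qed
qed

lemma open_interval_times_heis: "open J \<Longrightarrow> open (interval_times_heis J)"
  using open_vimage_vec_nth[of J 1] by (simp add: interval_times_heis_def vimage_def)

locale heis_jet =
  fixes J :: "real set" and P P' :: "real \<Rightarrow> real"
    and H H' :: "real \<Rightarrow> real ^ 3 \<Rightarrow> real ^ 3 \<Rightarrow> real"
  assumes open_J: "open J"
    and bil: "\<And>t. t \<in> J \<Longrightarrow> bilinear (H t)"
    and symH: "\<And>t a b. t \<in> J \<Longrightarrow> H t a b = H t b a"
    and derP: "\<And>t. t \<in> J \<Longrightarrow> (P has_real_derivative P' t) (at t)"
    and derH: "\<And>t a b. t \<in> J \<Longrightarrow> ((\<lambda>t. H t a b) has_real_derivative H' t a b) (at t)"
    and P_nz: "\<And>t. t \<in> J \<Longrightarrow> P t \<noteq> 0"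
    and smoothP: "smooth_real_on P J"
    and smoothH: "\<And>a b. smooth_real_on (\<lambda>t. H t a b) J"
    and H_nondeg: "\<And>t a. t \<in> J \<Longrightarrow> (\<And>b. H t a b = 0) \<Longrightarrow> a = 0"
begin

lemma bil': "t \<in> J \<Longrightarrow> bilinear (H' t)"
  by (rule bilinear_deriv[OF open_J _ bil derH])

lemma symH': "t \<in> J \<Longrightarrow> H' t a b = H' t b a"
  by (rule DERIV_unique[OF derH])
    (auto intro: has_field_derivative_transform_within_open[OF derH open_J] symH)

lemma hmet_bilinear: "x $ 1 \<in> J \<Longrightarrow> bilinear (hmet P H x)"
  unfolding bilinear_def hmet_def
  by (intro conjI allI linear_compose_add linear_mult_right linear_mult_left linear_vec_nth linear_bil[OF bil])

lemma hmet_nondeg: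
  assumes "x $ 1 \<in> J" "\<And>v. hmet P H x u v = 0"
  shows "u = 0"
proof -
  have "hmet P H x u (axis 1 1) = P (x $ 1) * u $ 1"
    using bil[OF assms(1)] by (simp add: hmet_def bilinear_rzero)
  then have u1: "u $ 1 = 0" using assms P_nz[OF assms(1)] by simp
  have "H (x $ 1) (mc_form x u) b = 0" for b
    using assms(2)[of "inv_lift x b"] u1 by (simp add: hmet_def)
  then have "mc_form x u = 0" using H_nondeg[OF assms(1)] by blast
  then have "u $ 2 = 0" "u $ 3 = 0" "u $ 4 - (x $ 2 * u $ 3 - x $ 3 * u $ 2) / 2 = 0"
    by (auto simp: mc_form_def vec_eq_iff forall_3)
  with u1 show ?thesis by (auto simp: vec_eq_iff forall_4)
qed

lemma hmet_line_deriv: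
  assumes "x $ 1 \<in> J"
  shows "((\<lambda>s. hmet P H (x + s *\<^sub>R m) u v) has_real_derivative hmetD P' H H' x m u v) (at 0)"
proof -
  have P: "((\<lambda>s. P (x $ 1 + s * m $ 1)) has_real_derivative P' (x $ 1) * m $ 1) (at 0)"
  proof -
    have "((\<lambda>s. x $ 1 + s * m $ 1) has_real_derivative m $ 1) (at 0)" by (auto intro!: derivative_eq_intros)
    from DERIV_chain2[where f = P and g = "\<lambda>s. x $ 1 + s * m $ 1", OF _ this] derP[OF assms]
    show ?thesis by simp
  qed
  have "((\<lambda>s. P (x $ 1 + s * m $ 1) * (u $ 1 * v $ 1) +
      H (x $ 1 + s * m $ 1) (mc_form x u + s *\<^sub>R ((- 1 / 2) *\<^sub>R br4 m u)) (mc_form x v + s *\<^sub>R ((- 1 / 2) *\<^sub>R br4 m v)))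
    has_real_derivative P' (x $ 1) * m $ 1 * (u $ 1 * v $ 1) +
    (m $ 1 * H' (x $ 1) (mc_form x u) (mc_form x v) + H (x $ 1) ((- 1 / 2) *\<^sub>R br4 m u) (mc_form x v)
      + H (x $ 1) (mc_form x u) ((- 1 / 2) *\<^sub>R br4 m v))) (at 0)"
    by (intro DERIV_add DERIV_cmult_right P bilinear_line_deriv[where H = H and H' = H', OF open_J assms bil derH[OF assms]])
  then show ?thesis
    unfolding hmet_def hmetD_def mc_form_line
    by (simp add: bilinear_lmul bilinear_rmul bilinear_lneg bilinear_rneg bil[OF assms] algebra_simps add_divide_distrib)
qed

sublocale metric_jet "interval_times_heis J" "hmet P H" "hmetD P' H H'"
proof (rule metric_jet.intro)
  show "open (interval_times_heis J)" by (rule open_interval_times_heis[OF open_J])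
  then have o: "open {x :: real ^ 4. x $ 1 \<in> J}" by (simp add: interval_times_heis_def)
  have U: "x $ 1 \<in> J" if "x \<in> interval_times_heis J" for x
    using that by (simp add: interval_times_heis_def)
  fix x assume x: "x \<in> interval_times_heis J"
  show "bilinear (hmet P H x)" by (rule hmet_bilinear[OF U[OF x]])
  show "hmet P H x u v = hmet P H x v u" for u v
    using symH[OF U[OF x]] by (simp add: hmet_def)
  show "linear (\<lambda>w. hmetD P' H H' x w u v)" for u v
    unfolding hmetD_def
    by (intro linear_intros linear_vec_nth linear_bil[OF bil[OF U[OF x]]] linear_bil[OF bil'[OF U[OF x]]])
  show "linear (\<lambda>w. hmetD P' H H' x u w v)" for u v
    unfolding hmetD_def
    by (intro linear_intros linear_vec_nth linear_bil[OF bil[OF U[OF x]]] linear_bil[OF bil'[OF U[OF x]]])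
  show "linear (\<lambda>w. hmetD P' H H' x u v w)" for u v
    unfolding hmetD_def
    by (intro linear_intros linear_vec_nth linear_bil[OF bil[OF U[OF x]]] linear_bil[OF bil'[OF U[OF x]]])
  show "hmetD P' H H' x w u v = hmetD P' H H' x w v u" for u v w
    using symH[OF U[OF x]] symH'[OF U[OF x]] unfolding hmetD_def by (simp add: add.commute mult_ac)
  show "partial_deriv i (metric_component (hmet P H) j k) x = hmetD P' H H' x (axis i 1) (axis j 1) (axis k 1)" for i j k
    unfolding metric_component_def by (rule partial_deriv_eqI[OF hmet_line_deriv[OF U[OF x]]])
  show "det (metric_matrix (hmet P H) x) \<noteq> 0"
  proof -
    have "v = 0" if v: "metric_matrix (hmet P H) x *v v = 0" for v
    proof (rule hmet_nondeg[OF U[OF x]])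
      fix w
      have l: "linear (\<lambda>w. hmet P H x w v)" "linear (\<lambda>w. hmet P H x v w)" for v
        using hmet_bilinear[OF U[OF x]] by (auto simp: bilinear_def)
      have "hmet P H x (axis i 1) v = (metric_matrix (hmet P H) x *v v) $ i" for i
        using linear_sum_axis[OF l(2)[of "axis i 1"], of v]
        by (simp add: matrix_vector_mult_def metric_matrix_def metric_component_def mult.commute)
      then have "hmet P H x (axis i 1) v = 0" for i using v by simp
      then have "hmet P H x w v = 0" using linear_sum_axis[OF l(1), of w v] by simp
      then show "hmet P H x v w = 0" using symH[OF U[OF x]] by (simp add: hmet_def mult_ac)
    qed
    then show ?thesis
      by (metis invertible_det_nz invertible_left_inverse matrix_left_invertible_ker)
  qed
next
  have o: "open {x :: real ^ 4. x $ 1 \<in> J}"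
    using open_interval_times_heis[OF open_J] by (simp add: interval_times_heis_def)
  fix i j
  have lin: "smooth_fun_on (\<lambda>x. mc_form x u $ a) {x. x $ 1 \<in> J}" for u a
  proof -
    have "smooth_fun_on (\<lambda>x. u $ 4 - (x $ 2 * u $ 3 - x $ 3 * u $ 2) / 2) {x :: real ^ 4. x $ 1 \<in> J}"
      by (intro smooth_fun_on_diff smooth_fun_on_divide smooth_fun_on_mult smooth_fun_on_const
          smooth_fun_on_nth o) auto
    then show ?thesis using exhaust_3[of a] by (auto simp: mc_form_def smooth_fun_on_const)
  qed
  have "smooth_fun_on (\<lambda>x. P (x $ 1) * axis i 1 $ 1 * axis j 1 $ 1 +
     (\<Sum>a\<in>UNIV. \<Sum>b\<in>UNIV. mc_form x (axis i 1) $ a * mc_form x (axis j 1) $ b * H (x $ 1) (axis a 1) (axis b 1)))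
     {x :: real ^ 4. x $ 1 \<in> J}"
    by (intro smooth_fun_on_add smooth_fun_on_sum smooth_fun_on_mult smooth_fun_on_const o lin
       smooth_fun_on_real_comp_nth[OF open_J smoothP]
       smooth_fun_on_real_comp_nth[OF open_J smoothH[of "axis a 1" "axis b 1" for a b]])
  then show "smooth_fun_on (metric_component (hmet P H) i j) (interval_times_heis J)"
    unfolding interval_times_heis_def
    by (subst smooth_fun_on_cong[OF o]) (auto simp: metric_component_def hmet_def bilinear_expand3[OF bil])
qed

end

lemma br_zero: "heis_br 0 a = 0" "heis_br a 0 = 0" "heis_br a a = 0"
  by (simp_all add: heis_br_def vec_eq_iff forall_3)

text \<open>Index 1 is the interval direction, so the group vector \<open>e $ i\<close> carries
  index \<open>i + 1\<close>: the center has index 2 and the plane indices 3 and 4.\<close>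

definition hframe :: "real ^ 4 \<Rightarrow> real ^ 3 ^ 3 \<Rightarrow> 4 \<Rightarrow> real ^ 4" where
  "hframe x e a = vector [axis 1 1, inv_lift x (e $ 1), inv_lift x (e $ 2), inv_lift x (e $ 3)] $ a"

definition heta :: "real \<Rightarrow> 4 \<Rightarrow> real" where
  "heta \<epsilon> a = vector [\<epsilon>, \<epsilon>, 1, 1] $ a"

lemma hframe_simps [simp]:
  "hframe x e 1 = axis 1 1" "hframe x e 2 = inv_lift x (e $ 1)"
  "hframe x e 3 = inv_lift x (e $ 2)" "hframe x e 4 = inv_lift x (e $ 3)"
  "heta \<epsilon> 1 = \<epsilon>" "heta \<epsilon> 2 = \<epsilon>" "heta \<epsilon> 3 = 1" "heta \<epsilon> 4 = 1"
  by (simp_all add: hframe_def heta_def)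

text \<open>The interval coordinate is arc length, hence the constant \<epsilon>. The frame
  \<open>e\<close> is orthonormal for the metric at the time of \<open>x\<close> only, and \<kappa>
  is its structure constant.\<close>

locale heis_frame_jet = heis_jet J "\<lambda>_. \<epsilon>" "\<lambda>_. 0" H H'
  for J \<epsilon> H H' +
  fixes H'' :: "real \<Rightarrow> real ^ 3 \<Rightarrow> real ^ 3 \<Rightarrow> real" and x :: "real ^ 4" and e :: "real ^ 3 ^ 3" and \<kappa> :: real
  assumes eps: "\<epsilon> = 1 \<or> \<epsilon> = -1"
    and xJ: "x $ 1 \<in> J"
    and derH': "\<And>t a b. t \<in> J \<Longrightarrow> ((\<lambda>t. H' t a b) has_real_derivative H'' t a b) (at t)"
    and orth: "orthonormal_basis (H (x $ 1)) (vector [\<epsilon>, 1, 1]) e"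
    and bracket: "heis_br (e $ 2) (e $ 3) = (- 2 * \<kappa>) *\<^sub>R e $ 1" "heis_br (e $ 1) v = 0"
begin

lemma bil'': "t \<in> J \<Longrightarrow> bilinear (H'' t)"
  by (rule bilinear_deriv[OF open_J _ bil' derH'])

lemma symH'': "t \<in> J \<Longrightarrow> H'' t a b = H'' t b a"
  by (rule DERIV_unique[OF derH'])
    (auto intro: has_field_derivative_transform_within_open[OF derH' open_J] symH')

lemma orth_simps [simp]:
  "H (x $ 1) (e $ 1) (e $ 1) = \<epsilon>" "H (x $ 1) (e $ 2) (e $ 2) = 1" "H (x $ 1) (e $ 3) (e $ 3) = 1"
  "H (x $ 1) (e $ 1) (e $ 2) = 0" "H (x $ 1) (e $ 1) (e $ 3) = 0" "H (x $ 1) (e $ 2) (e $ 3) = 0"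
  "H (x $ 1) (e $ 2) (e $ 1) = 0" "H (x $ 1) (e $ 3) (e $ 1) = 0" "H (x $ 1) (e $ 3) (e $ 2) = 0"
  using orth by (simp_all add: orthonormal_basis_def)

lemma br_anti: "heis_br v w = - heis_br w v"
  by (simp add: heis_br_def vec_eq_iff forall_3)

lemma br_simps [simp]:
  "heis_br (e $ 2) (e $ 3) = (- 2 * \<kappa>) *\<^sub>R e $ 1" "heis_br (e $ 3) (e $ 2) = (2 * \<kappa>) *\<^sub>R e $ 1"
  "heis_br (e $ 1) v = 0" "heis_br v (e $ 1) = 0"
  using bracket br_anti[of "e $ 3" "e $ 2"] br_anti[of v "e $ 1"] by simp_all

lemmas bil_simps = bilinear_lzero bilinear_rzero bilinear_lmul bilinear_rmul bilinear_lneg bilinear_rneg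

lemmas bil_x [simp] = bil_simps[OF bil[OF xJ]] bil_simps[OF bil'[OF xJ]] bil_simps[OF bil''[OF xJ]]

sublocale metric_frame "interval_times_heis J" "hmet (\<lambda>_. \<epsilon>) H" "hmetD (\<lambda>_. 0) H H'" x
  "hframe x e" "heta \<epsilon>" "hmetDD H H' H'' x"
proof (rule metric_frame.intro, rule metric_jet_axioms, rule metric_frame_axioms.intro)
  show "x \<in> interval_times_heis J" using xJ by (simp add: interval_times_heis_def)
  show "hmet (\<lambda>_. \<epsilon>) H x (hframe x e a) (hframe x e b) = (if a = b then heta \<epsilon> a else 0)" for a b
    using exhaust_4[of a] exhaust_4[of b] by (elim disjE) (simp_all add: hmet_def)
  show "heta \<epsilon> a \<noteq> 0" for a using exhaust_4[of a] eps by (elim disjE) simp_all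
  show "linear (\<lambda>z. hmetDD H H' H'' x z u v w)" for u v w
    unfolding hmetDD_def
    by (intro linear_intros linear_vec_nth linear_bil[OF bil[OF xJ]] linear_bil[OF bil'[OF xJ]]
        linear_bil[OF bil''[OF xJ]])
  show "linear (\<lambda>z. hmetDD H H' H'' x u z v w)" for u v w
    unfolding hmetDD_def
    by (intro linear_intros linear_vec_nth linear_bil[OF bil[OF xJ]] linear_bil[OF bil'[OF xJ]]
        linear_bil[OF bil''[OF xJ]])
  show "linear (\<lambda>z. hmetDD H H' H'' x u v z w)" for u v w
    unfolding hmetDD_def
    by (intro linear_intros linear_vec_nth linear_bil[OF bil[OF xJ]] linear_bil[OF bil'[OF xJ]]
        linear_bil[OF bil''[OF xJ]])
  show "linear (\<lambda>z. hmetDD H H' H'' x u v w z)" for u v w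
    unfolding hmetDD_def
    by (intro linear_intros linear_vec_nth linear_bil[OF bil[OF xJ]] linear_bil[OF bil'[OF xJ]]
        linear_bil[OF bil''[OF xJ]])
  show "((\<lambda>s. hmetD (\<lambda>_. 0) H H' (x + s *\<^sub>R axis i 1) (axis m 1) (axis j 1) (axis k 1))
       has_real_derivative hmetDD H H' H'' x (axis i 1) (axis m 1) (axis j 1) (axis k 1)) (at 0)" for i m j k
  proof -
    define n :: "real ^ 4" where "n = axis i 1"
    define b where "b = br4 (axis m 1)"
    let ?u = "axis j 1 :: real ^ 4" and ?v = "axis k 1 :: real ^ 4" and ?m = "axis m 1 :: real ^ 4"
    note d = bilinear_line_deriv[where H = H and H' = H', OF open_J xJ bil derH[OF xJ], of "n $ 1"]
    note d' = bilinear_line_deriv[where H = H' and H' = H'', OF open_J xJ bil' derH'[OF xJ], of "n $ 1"]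
    let ?c = "\<lambda>u. (- 1 / 2) *\<^sub>R br4 n u"
    have "((\<lambda>s. ?m $ 1 * H' (x $ 1 + s * n $ 1) (mc_form x ?u + s *\<^sub>R ?c ?u) (mc_form x ?v + s *\<^sub>R ?c ?v)
       - (H (x $ 1 + s * n $ 1) (b ?u + s *\<^sub>R 0) (mc_form x ?v + s *\<^sub>R ?c ?v)
         + H (x $ 1 + s * n $ 1) (mc_form x ?u + s *\<^sub>R ?c ?u) (b ?v + s *\<^sub>R 0)) / 2) has_real_derivative
       ?m $ 1 * (n $ 1 * H'' (x $ 1) (mc_form x ?u) (mc_form x ?v) + H' (x $ 1) (?c ?u) (mc_form x ?v)
         + H' (x $ 1) (mc_form x ?u) (?c ?v))
       - ((n $ 1 * H' (x $ 1) (b ?u) (mc_form x ?v) + H (x $ 1) 0 (mc_form x ?v) + H (x $ 1) (b ?u) (?c ?v))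
         + (n $ 1 * H' (x $ 1) (mc_form x ?u) (b ?v) + H (x $ 1) (?c ?u) (b ?v) + H (x $ 1) (mc_form x ?u) 0)) / 2) (at 0)"
      by (intro DERIV_diff DERIV_cdivide DERIV_add DERIV_cmult d d')
    then show ?thesis
      unfolding hmetD_def hmetDD_def mc_form_line n_def[symmetric] b_def[symmetric]
      by (simp add: algebra_simps add_divide_distrib diff_divide_distrib)
  qed
qed

text \<open>The second fundamental form of the orbit in the frame, as half the time derivative of
  the metric.\<close>

definition K :: "3 \<Rightarrow> 3 \<Rightarrow> real" where "K i j = H' (x $ 1) (e $ i) (e $ j) / 2"

lemma K_H': "H' (x $ 1) (e $ i) (e $ j) = 2 * K i j" by (simp add: K_def)

lemma K_sym: "K 2 1 = K 1 2" "K 3 1 = K 1 3" "K 3 2 = K 2 3"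
  using symH'[OF xJ] by (simp_all add: K_def)

abbreviation fr where "fr a \<equiv> hframe x e a"
abbreviation CF where "CF a b c \<equiv> christoffel_first (hmetD (\<lambda>_. 0) H H' x) (fr a) (fr b) (fr c)"

text \<open>The frame vectors are extended with constant coordinates, so the symbols are symmetric
  in the last two slots. The bracket enters through the derivative of the Maurer-Cartan form, in the
  four entries with \<open>\<kappa> * \<epsilon>\<close>; the other nonzero entries come from
  \<open>K\<close>.\<close>

lemma cf_table:
    "CF 1 1 1 = 0"
    "CF 1 1 2 = 0"
    "CF 1 1 3 = 0"
    "CF 1 1 4 = 0"
    "CF 1 2 1 = 0"
    "CF 1 2 2 = - K 1 1"
    "CF 1 2 3 = - K 1 2"
    "CF 1 2 4 = - K 1 3"
    "CF 1 3 1 = 0"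
    "CF 1 3 2 = - K 1 2"
    "CF 1 3 3 = - K 2 2"
    "CF 1 3 4 = - K 2 3"
    "CF 1 4 1 = 0"
    "CF 1 4 2 = - K 1 3"
    "CF 1 4 3 = - K 2 3"
    "CF 1 4 4 = - K 3 3"
    "CF 2 1 1 = 0"
    "CF 2 1 2 = K 1 1"
    "CF 2 1 3 = K 1 2"
    "CF 2 1 4 = K 1 3"
    "CF 2 2 1 = K 1 1"
    "CF 2 2 2 = 0"
    "CF 2 2 3 = 0"
    "CF 2 2 4 = 0"
    "CF 2 3 1 = K 1 2"
    "CF 2 3 2 = 0"
    "CF 2 3 3 = 0"
    "CF 2 3 4 = 0"
    "CF 2 4 1 = K 1 3"
    "CF 2 4 2 = 0"
    "CF 2 4 3 = 0"
    "CF 2 4 4 = 0"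
    "CF 3 1 1 = 0"
    "CF 3 1 2 = K 1 2"
    "CF 3 1 3 = K 2 2"
    "CF 3 1 4 = K 2 3"
    "CF 3 2 1 = K 1 2"
    "CF 3 2 2 = 0"
    "CF 3 2 3 = 0"
    "CF 3 2 4 = - (\<kappa> * \<epsilon>)"
    "CF 3 3 1 = K 2 2"
    "CF 3 3 2 = 0"
    "CF 3 3 3 = 0"
    "CF 3 3 4 = 0"
    "CF 3 4 1 = K 2 3"
    "CF 3 4 2 = - (\<kappa> * \<epsilon>)"
    "CF 3 4 3 = 0"
    "CF 3 4 4 = 0"
    "CF 4 1 1 = 0"
    "CF 4 1 2 = K 1 3"
    "CF 4 1 3 = K 2 3"
    "CF 4 1 4 = K 3 3"
    "CF 4 2 1 = K 1 3"
    "CF 4 2 2 = 0"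
    "CF 4 2 3 = \<kappa> * \<epsilon>"
    "CF 4 2 4 = 0"
    "CF 4 3 1 = K 2 3"
    "CF 4 3 2 = \<kappa> * \<epsilon>"
    "CF 4 3 3 = 0"
    "CF 4 3 4 = 0"
    "CF 4 4 1 = K 3 3"
    "CF 4 4 2 = 0"
    "CF 4 4 3 = 0"
    "CF 4 4 4 = 0"
  by (simp_all add: christoffel_first_def hmetD_def K_H' K_sym br_zero)

text \<open>Antisymmetry in the first pair rests on the symmetry of the second derivatives of the
  metric; antisymmetry in the second pair is visible in the definition.\<close>

lemma curvature_antisym: "\<Phi> k l u v = - \<Phi> l k u v"
proof -
  have "hmetDD H H' H'' x a b c d = hmetDD H H' H'' x b a c d" for a b c d
    unfolding hmetDD_def by (simp add: algebra_simps)
  from this[of v u k l] this[of v u l k]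
  have "christoffel_first_deriv (hmetDD H H' H'' x) u k v l - christoffel_first_deriv (hmetDD H H' H'' x) v k u l
     = - (christoffel_first_deriv (hmetDD H H' H'' x) u l v k - christoffel_first_deriv (hmetDD H H' H'' x) v l u k)"
    unfolding christoffel_first_deriv_def by (simp add: field_simps)
  moreover have "(\<Sum>a\<in>UNIV. (c a u k * c a v l - c a v k * c a u l) / heta \<epsilon> a)
     = - (\<Sum>a\<in>UNIV. (c a u l * c a v k - c a v l * c a u k) / heta \<epsilon> a)" for c :: "4 \<Rightarrow> real ^ 4 \<Rightarrow> real ^ 4 \<Rightarrow> real"
    unfolding sum_negf[symmetric] minus_divide_left by (simp add: algebra_simps)
  note this[of "\<lambda>a. christoffel_first (hmetD (\<lambda>_. 0) H H' x) (hframe x e a)"]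
  ultimately show ?thesis
    unfolding curvature_form_def by simp
qed

end

subsection \<open>Einstein and half-flat metrics in an adapted frame\<close>

lemma levi_civita_swap:
  "levi_civita j i k l = - levi_civita i j k l" "levi_civita i j l k = - levi_civita i j k l"
  "levi_civita i k j l = - levi_civita i j k l"
  unfolding levi_civita_def by (simp_all add: det_4)

lemma levi_civita_same: "levi_civita i i k l = 0" "levi_civita i j k k = 0" "levi_civita i j j l = 0"
  unfolding levi_civita_def by (simp_all add: det_4)

lemma levi_civita_values:
  "levi_civita 1 2 3 4 = 1" "levi_civita 1 3 4 2 = 1" "levi_civita 1 4 2 3 = 1"
  "levi_civita 3 4 1 2 = 1" "levi_civita 4 2 1 3 = 1" "levi_civita 2 3 1 4 = 1"
  unfolding levi_civita_def by (simp_all add: det_4 axis_def)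

text \<open>The Hodge star on the pair of indices of \<open>T\<close>, for a positively oriented
  frame; the signs of the metric are left to be absorbed into \<open>T\<close>.\<close>

definition dual_pair_sum :: "(4 \<Rightarrow> 4 \<Rightarrow> real) \<Rightarrow> 4 \<Rightarrow> 4 \<Rightarrow> real" where
  "dual_pair_sum T p q = (\<Sum>s\<in>UNIV. \<Sum>r\<in>UNIV. levi_civita p q r s * T r s) / 2"

lemma levi_civita_zero: "levi_civita i j i l = 0" "levi_civita i j k i = 0" "levi_civita i j k j = 0"
  unfolding levi_civita_def by (simp_all add: det_4 algebra_simps)

lemma dual_pair_sum_swap: "dual_pair_sum T q p = - dual_pair_sum T p q"
  unfolding dual_pair_sum_def levi_civita_swap(1)[of q p] by (simp add: sum_negf)

lemma dual_pair_sum_same: "dual_pair_sum T p p = 0"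
  by (simp add: dual_pair_sum_def levi_civita_same)

text \<open>The order 42 instead of 24 makes all six signs positive, so the pairs 12, 13, 14 and 34,
  42, 23 are exchanged without signs. All later tables use these six pairs.\<close>

lemma dual_pair_sum_values:
  assumes "\<And>r s. T r s = - T s r"
  shows "dual_pair_sum T 1 2 = T 3 4" "dual_pair_sum T 1 3 = T 4 2" "dual_pair_sum T 1 4 = T 2 3"
    "dual_pair_sum T 3 4 = T 1 2" "dual_pair_sum T 4 2 = T 1 3" "dual_pair_sum T 2 3 = T 1 4"
proof -
  have l: "levi_civita 1 2 4 3 = - 1" "levi_civita 1 3 2 4 = - 1" "levi_civita 1 4 3 2 = - 1"
    "levi_civita 3 4 2 1 = - 1" "levi_civita 4 2 3 1 = - 1" "levi_civita 2 3 4 1 = - 1"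
    using levi_civita_swap(2)[of 1 2 4 3] levi_civita_swap(2)[of 1 3 2 4] levi_civita_swap(2)[of 1 4 3 2]
      levi_civita_swap(2)[of 3 4 2 1] levi_civita_swap(2)[of 4 2 3 1] levi_civita_swap(2)[of 2 3 4 1]
    by (simp_all add: levi_civita_values)
  show "dual_pair_sum T 1 2 = T 3 4" "dual_pair_sum T 1 3 = T 4 2" "dual_pair_sum T 1 4 = T 2 3"
    "dual_pair_sum T 3 4 = T 1 2" "dual_pair_sum T 4 2 = T 1 3" "dual_pair_sum T 2 3 = T 1 4"
    using assms[of 3 4] assms[of 4 2] assms[of 2 3] assms[of 1 2] assms[of 1 3] assms[of 1 4]
    by (simp_all add: dual_pair_sum_def sum_4 levi_civita_same levi_civita_zero levi_civita_values l)
qed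

text \<open>\<open>inv_lift\<close> differs from the inclusion of the Lie algebra by a shear, so the
  orientation of the frame does not depend on the point.\<close>

lemma det_hframe: "det (\<chi> a. hframe x e a) = det e"
  by (simp add: det_4 det_3 inv_lift_def axis_def field_simps)

context heis_frame_jet
begin

abbreviation Riem where "Riem a b c d \<equiv> \<Phi> (fr a) (fr b) (fr c) (fr d)"

definition M where "M i j = H'' (x $ 1) (e $ i) (e $ j)"

lemma M_H'': "H'' (x $ 1) (e $ i) (e $ j) = M i j" by (simp add: M_def)

lemma M_sym: "M 2 1 = M 1 2" "M 3 1 = M 1 3" "M 3 2 = M 2 3"
  using symH''[OF xJ] by (simp_all add: M_def)

lemma curvature_antisym2: "\<Phi> u v l k = - \<Phi> u v k l"
proof -
  have "(\<Sum>a\<in>UNIV. (c a l u * c a k v - c a k u * c a l v) / heta \<epsilon> a)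
     = - (\<Sum>a\<in>UNIV. (c a k u * c a l v - c a l u * c a k v) / heta \<epsilon> a)" for c :: "4 \<Rightarrow> real ^ 4 \<Rightarrow> real ^ 4 \<Rightarrow> real"
    unfolding sum_negf[symmetric] minus_divide_left by (simp add: algebra_simps)
  note this[of "\<lambda>a. christoffel_first (hmetD (\<lambda>_. 0) H H' x) (fr a)"]
  then show ?thesis unfolding curvature_form_def by simp
qed

lemma curvature_diag: "\<Phi> u u v w = 0" "\<Phi> v w u u = 0"
  using curvature_antisym[of u u v w] curvature_antisym2[of v w u u] by simp_all

text \<open>Indices in the group only: the Gauss equation, with intrinsic curvature terms in the
  square of \<kappa>. One index 1: the Codazzi equation, linear in \<open>K\<close>. An index 1 in
  both pairs: the radial equation, together with the components that the symmetry of the two pairs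
  yields from Codazzi. \<open>M\<close> occurs only in the components
  \<open>Riem 1 i 1 j\<close>.\<close>

lemma curvature_table:
    "Riem 1 2 3 4 = \<epsilon> * \<kappa> * (K 2 2 + K 3 3) - 2 * \<kappa> * K 1 1"
    "Riem 3 4 1 2 = \<epsilon> * \<kappa> * (K 2 2 + K 3 3) - 2 * \<kappa> * K 1 1"
    "Riem 1 2 4 2 = - \<epsilon> * \<kappa> * K 1 2"
    "Riem 4 2 1 2 = - \<epsilon> * \<kappa> * K 1 2"
    "Riem 1 2 2 3 = - \<epsilon> * \<kappa> * K 1 3"
    "Riem 2 3 1 2 = - \<epsilon> * \<kappa> * K 1 3"
    "Riem 1 3 3 4 = - 3 * \<kappa> * K 1 2"
    "Riem 3 4 1 3 = - 3 * \<kappa> * K 1 2"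
    "Riem 1 4 3 4 = - 3 * \<kappa> * K 1 3"
    "Riem 3 4 1 4 = - 3 * \<kappa> * K 1 3"
    "Riem 1 3 4 2 = \<kappa> * K 1 1 - \<epsilon> * \<kappa> * K 3 3"
    "Riem 4 2 1 3 = \<kappa> * K 1 1 - \<epsilon> * \<kappa> * K 3 3"
    "Riem 1 4 2 3 = \<kappa> * K 1 1 - \<epsilon> * \<kappa> * K 2 2"
    "Riem 2 3 1 4 = \<kappa> * K 1 1 - \<epsilon> * \<kappa> * K 2 2"
    "Riem 1 3 2 3 = \<epsilon> * \<kappa> * K 2 3"
    "Riem 2 3 1 3 = \<epsilon> * \<kappa> * K 2 3"
    "Riem 1 4 4 2 = \<epsilon> * \<kappa> * K 2 3"
    "Riem 4 2 1 4 = \<epsilon> * \<kappa> * K 2 3"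
    "Riem 3 4 3 4 = - 3 * \<epsilon> * \<kappa> * \<kappa> - \<epsilon> * (K 2 2 * K 3 3 - K 2 3 * K 2 3)"
    "Riem 4 2 4 2 = \<kappa> * \<kappa> - \<epsilon> * (K 1 1 * K 3 3 - K 1 3 * K 1 3)"
    "Riem 2 3 2 3 = \<kappa> * \<kappa> - \<epsilon> * (K 1 1 * K 2 2 - K 1 2 * K 1 2)"
    "Riem 3 4 4 2 = - \<epsilon> * (K 1 3 * K 2 3 - K 1 2 * K 3 3)"
    "Riem 4 2 3 4 = - \<epsilon> * (K 1 3 * K 2 3 - K 1 2 * K 3 3)"
    "Riem 3 4 2 3 = - \<epsilon> * (K 1 2 * K 2 3 - K 1 3 * K 2 2)"
    "Riem 2 3 3 4 = - \<epsilon> * (K 1 2 * K 2 3 - K 1 3 * K 2 2)"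
    "Riem 4 2 2 3 = - \<epsilon> * (K 1 2 * K 1 3 - K 1 1 * K 2 3)"
    "Riem 2 3 4 2 = - \<epsilon> * (K 1 2 * K 1 3 - K 1 1 * K 2 3)"
    "Riem 1 2 1 2 = \<epsilon> * K 1 1 * K 1 1 + K 1 2 * K 1 2 + K 1 3 * K 1 3 - M 1 1 / 2"
    "Riem 1 2 1 3 = \<epsilon> * K 1 1 * K 1 2 + K 1 2 * K 2 2 + K 1 3 * K 2 3 - M 1 2 / 2"
    "Riem 1 2 1 4 = \<epsilon> * K 1 1 * K 1 3 + K 1 2 * K 2 3 + K 1 3 * K 3 3 - M 1 3 / 2"
    "Riem 1 3 1 2 = \<epsilon> * K 1 2 * K 1 1 + K 2 2 * K 1 2 + K 2 3 * K 1 3 - M 1 2 / 2"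
    "Riem 1 3 1 3 = \<epsilon> * K 1 2 * K 1 2 + K 2 2 * K 2 2 + K 2 3 * K 2 3 - M 2 2 / 2"
    "Riem 1 3 1 4 = \<epsilon> * K 1 2 * K 1 3 + K 2 2 * K 2 3 + K 2 3 * K 3 3 - M 2 3 / 2"
    "Riem 1 4 1 2 = \<epsilon> * K 1 3 * K 1 1 + K 2 3 * K 1 2 + K 3 3 * K 1 3 - M 1 3 / 2"
    "Riem 1 4 1 3 = \<epsilon> * K 1 3 * K 1 2 + K 2 3 * K 2 2 + K 3 3 * K 2 3 - M 2 3 / 2"
    "Riem 1 4 1 4 = \<epsilon> * K 1 3 * K 1 3 + K 2 3 * K 2 3 + K 3 3 * K 3 3 - M 3 3 / 2"
  \<comment> \<open>Fixing the sign \<epsilon> turns the divisions by \<open>heta\<close> into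
    changes of sign.\<close>
  by (simp_all only: curvature_form_def sum_4 cf_table christoffel_first_deriv_def)
    (use eps in \<open>elim disjE; simp add: hmetDD_def K_H' M_H'' K_sym M_sym br_zero algebra_simps\<close>)+

lemma curvature_flip:
    "\<Phi> (fr 1) (fr 1) u v = 0"
    "\<Phi> u v (fr 1) (fr 1) = 0"
    "\<Phi> (fr 2) (fr 1) u v = - \<Phi> (fr 1) (fr 2) u v"
    "\<Phi> u v (fr 2) (fr 1) = - \<Phi> u v (fr 1) (fr 2)"
    "\<Phi> (fr 2) (fr 2) u v = 0"
    "\<Phi> u v (fr 2) (fr 2) = 0"
    "\<Phi> (fr 2) (fr 4) u v = - \<Phi> (fr 4) (fr 2) u v"
    "\<Phi> u v (fr 2) (fr 4) = - \<Phi> u v (fr 4) (fr 2)"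
    "\<Phi> (fr 3) (fr 1) u v = - \<Phi> (fr 1) (fr 3) u v"
    "\<Phi> u v (fr 3) (fr 1) = - \<Phi> u v (fr 1) (fr 3)"
    "\<Phi> (fr 3) (fr 2) u v = - \<Phi> (fr 2) (fr 3) u v"
    "\<Phi> u v (fr 3) (fr 2) = - \<Phi> u v (fr 2) (fr 3)"
    "\<Phi> (fr 3) (fr 3) u v = 0"
    "\<Phi> u v (fr 3) (fr 3) = 0"
    "\<Phi> (fr 4) (fr 1) u v = - \<Phi> (fr 1) (fr 4) u v"
    "\<Phi> u v (fr 4) (fr 1) = - \<Phi> u v (fr 1) (fr 4)"
    "\<Phi> (fr 4) (fr 3) u v = - \<Phi> (fr 3) (fr 4) u v"
    "\<Phi> u v (fr 4) (fr 3) = - \<Phi> u v (fr 3) (fr 4)"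
    "\<Phi> (fr 4) (fr 4) u v = 0"
    "\<Phi> u v (fr 4) (fr 4) = 0"
  by (rule curvature_diag curvature_antisym curvature_antisym2)+

lemmas curvature_simps = curvature_table curvature_flip

end

locale heis_einstein_frame = heis_frame_jet J \<epsilon> H H' H'' x e \<kappa>
  for J \<epsilon> H H' H'' x e \<kappa> +
  fixes \<Lambda> :: real
  assumes einstein_x: "\<And>i j. ricci (hmet (\<lambda>_. \<epsilon>) H) i j x = \<Lambda> * metric_component (hmet (\<lambda>_. \<epsilon>) H) i j x"
begin

sublocale metric_frame4 "interval_times_heis J" "hmet (\<lambda>_. \<epsilon>) H" "hmetD (\<lambda>_. 0) H H'" x
  "hframe x e" "heta \<epsilon>" "hmetDD H H' H'' x" \<Lambda>
  by (rule metric_frame4.intro, rule metric_frame_axioms, rule metric_frame4_axioms.intro, rule einstein_x)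

lemma orientation_factor_sgn: "orientation_factor = sgn (det e)" "det e \<noteq> 0"
proof -
  have sq: "orientation_factor\<^sup>2 = 1" using orientation_factor_sq eps by auto
  have eq: "orientation_factor = sqrt \<bar>det (metric_matrix (hmet (\<lambda>_. \<epsilon>) H) x)\<bar> * det e"
    by (simp add: orientation_factor_def det_hframe)
  from sq eq show "det e \<noteq> 0" by auto
  from eq have "sgn orientation_factor = sgn (sqrt \<bar>det (metric_matrix (hmet (\<lambda>_. \<epsilon>) H) x)\<bar>) * sgn (det e)"
    by (simp add: sgn_mult)
  moreover have "sqrt \<bar>det (metric_matrix (hmet (\<lambda>_. \<epsilon>) H) x)\<bar> > 0"
    using sq eq by (cases "det (metric_matrix (hmet (\<lambda>_. \<epsilon>) H) x) = 0") auto
  ultimately have "sgn orientation_factor = sgn (det e)" by simp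
  moreover have "sgn orientation_factor = orientation_factor" using sq by (auto simp: power2_eq_1_iff)
  ultimately show "orientation_factor = sgn (det e)" by simp
qed

abbreviation Weyl where "Weyl a b c d \<equiv> W (fr a) (fr b) (fr c) (fr d)"

lemma W_antisym: "W v u w z = - W u v w z" "W u v z w = - W u v w z"
  unfolding W_def using curvature_antisym[of v u w z] curvature_antisym2[of u v z w]
  by (simp_all add: algebra_simps)

lemma half_flat_iff:
  "(\<forall>i j k l. hodge_weyl (hmet (\<lambda>_. \<epsilon>) H) i j k l x = \<sigma> * weyl (hmet (\<lambda>_. \<epsilon>) H) i j k l x) \<longleftrightarrow>
   (\<forall>p q k l. sgn (det e) * dual_pair_sum (\<lambda>r s. Weyl r s k l
        / (heta \<epsilon> r * heta \<epsilon> s)) p q = \<sigma> * Weyl p q k l)"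
  unfolding half_flat_iff_frame orientation_factor_sgn dual_pair_sum_def by simp

lemma frame_inner: "hmet (\<lambda>_. \<epsilon>) H x (fr a) (fr b) = (if a = b then heta \<epsilon> a else 0)"
  by (rule frame)

text \<open>The sign of the duality and the orientation of the frame enter only through their
  product \<open>s\<close>. The factor \<epsilon> in two of the relations stems from raising the
  index 2 of the center.\<close>

lemma half_flat_pairs:
  assumes \<sigma>: "\<sigma> = 1 \<or> \<sigma> = -1"
    and hf: "\<And>i j k l. hodge_weyl (hmet (\<lambda>_. \<epsilon>) H) i j k l x = \<sigma> * weyl (hmet (\<lambda>_. \<epsilon>) H) i j k l x"
    and s: "s = \<sigma> * sgn (det e)"
  shows "Weyl 1 2 k l
      = s * Weyl 3 4 k l"
    "Weyl 1 3 k l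
      = s * \<epsilon> * Weyl 4 2 k l"
    "Weyl 1 4 k l
      = s * \<epsilon> * Weyl 2 3 k l"
proof -
  let ?T = "\<lambda>r s. Weyl r s k l / (heta \<epsilon> r * heta \<epsilon> s)"
  have anti: "?T r s = - ?T s r" for r s
    using W_antisym(1)[of "fr r" "fr s"] by (simp add: mult.commute)
  have *: "sgn (det e) * dual_pair_sum ?T p q = \<sigma> * Weyl p q k l" for p q
    using hf half_flat_iff[of \<sigma>] by blast
  have "sgn (det e) = 1 \<or> sgn (det e) = -1" using orientation_factor_sgn(2) by (auto simp: sgn_if)
  with \<sigma> eps s show
    "Weyl 1 2 k l
      = s * Weyl 3 4 k l"
    "Weyl 1 3 k l
      = s * \<epsilon> * Weyl 4 2 k l"
    "Weyl 1 4 k l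
      = s * \<epsilon> * Weyl 2 3 k l"
    using *[of 1 2] *[of 1 3] *[of 1 4] unfolding dual_pair_sum_values[of ?T, OF anti] by auto
qed

text \<open>The mixed entries \<open>K 1 2\<close> and \<open>K 1 3\<close> vanish by comparing two
  relations each. The relations for the pairs 42 and 23 then factor with a common factor, nonzero
  because the product is \<open>\<epsilon> * \<Lambda> / 3\<close>; cancelling it yields equality of
  the plane entries, and it also kills \<open>K 2 3\<close>. The last equation is the only one that
  involves the second derivative of the metric.\<close>

lemma half_flat_structure:
  assumes \<sigma>: "\<sigma> = 1 \<or> \<sigma> = -1" and "\<Lambda> \<noteq> 0" "\<kappa> \<noteq> 0"
    and hf: "\<And>i j k l. hodge_weyl (hmet (\<lambda>_. \<epsilon>) H) i j k l x = \<sigma> * weyl (hmet (\<lambda>_. \<epsilon>) H) i j k l x"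
    and s: "s = \<sigma> * sgn (det e)"
  shows "K 1 2 = 0" "K 1 3 = 0" "K 2 3 = 0" "K 3 3 = K 2 2"
    "(\<kappa> - s * \<epsilon> * K 1 1) * (\<kappa> + s * K 2 2) = \<epsilon> * \<Lambda> / 3"
    "(\<kappa> + s * K 2 2)\<^sup>2 + 2 * \<kappa> * (\<kappa> - s * \<epsilon> * K 1 1) = - (\<epsilon> * \<Lambda> / 3)"
    "M 1 1 = 2 * \<epsilon> * (K 1 1)\<^sup>2 - 2 * \<Lambda> / 3 - 4 * s * \<kappa> * (\<epsilon> * K 2 2 - K 1 1)"
proof -
  note P = half_flat_pairs[OF \<sigma> hf s]
  note WS = W_def curvature_simps frame_inner
  have s1: "s = 1 \<or> s = -1" using \<sigma> s orientation_factor_sgn(2) by (auto simp: sgn_if)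
  have ee: "\<epsilon> * \<epsilon> = 1" "s * s = 1" using eps s1 by auto
  have nz: "s * \<epsilon> \<noteq> 0" "\<epsilon> \<noteq> 0" "s \<noteq> 0" using eps s1 by auto
  \<comment> \<open>Nine of the eighteen duality relations are written out, in terms of
    \<open>K\<close> and \<open>M\<close>.\<close>
  have e1: "\<epsilon> * \<kappa> * (K 2 2 + K 3 3) - 2 * \<kappa> * K 1 1
      = s * (- 3 * \<epsilon> * \<kappa> * \<kappa> - \<epsilon> * (K 2 2 * K 3 3 - K 2 3 * K 2 3) - \<Lambda> / 3)"
    using P(1)[of 3 4] by (simp add: WS del: hframe_simps(1-4))
  have e2: "- \<epsilon> * \<kappa> * K 1 2 = s * (- \<epsilon> * (K 1 3 * K 2 3 - K 1 2 * K 3 3))"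
    using P(1)[of 4 2] by (simp add: WS del: hframe_simps(1-4))
  have e3: "- \<epsilon> * \<kappa> * K 1 3 = s * (- \<epsilon> * (K 1 2 * K 2 3 - K 1 3 * K 2 2))"
    using P(1)[of 2 3] by (simp add: WS del: hframe_simps(1-4))
  have e4: "- 3 * \<kappa> * K 1 2 = s * \<epsilon> * (- \<epsilon> * (K 1 3 * K 2 3 - K 1 2 * K 3 3))"
    using P(2)[of 3 4] by (simp add: WS del: hframe_simps(1-4))
  have e5: "- 3 * \<kappa> * K 1 3 = s * \<epsilon> * (- \<epsilon> * (K 1 2 * K 2 3 - K 1 3 * K 2 2))"
    using P(3)[of 3 4] by (simp add: WS del: hframe_simps(1-4))
  have e6: "\<epsilon> * \<kappa> * K 2 3 = s * \<epsilon> * (- \<epsilon> * (K 1 2 * K 1 3 - K 1 1 * K 2 3))"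
    using P(2)[of 2 3] by (simp add: WS del: hframe_simps(1-4))
  have e7: "\<kappa> * K 1 1 - \<epsilon> * \<kappa> * K 3 3 = s * \<epsilon> * (\<kappa> * \<kappa> - \<epsilon> * (K 1 1 * K 3 3 - K 1 3 * K 1 3) - \<epsilon> * \<Lambda> / 3)"
    using P(2)[of 4 2] by (simp add: WS del: hframe_simps(1-4))
  have e8: "\<kappa> * K 1 1 - \<epsilon> * \<kappa> * K 2 2 = s * \<epsilon> * (\<kappa> * \<kappa> - \<epsilon> * (K 1 1 * K 2 2 - K 1 2 * K 1 2) - \<epsilon> * \<Lambda> / 3)"
    using P(3)[of 2 3] by (simp add: WS del: hframe_simps(1-4))
  have e9: "\<epsilon> * K 1 1 * K 1 1 + K 1 2 * K 1 2 + K 1 3 * K 1 3 - M 1 1 / 2 - \<Lambda> / 3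
      = s * (\<epsilon> * \<kappa> * (K 2 2 + K 3 3) - 2 * \<kappa> * K 1 1)"
    using P(1)[of 1 2] ee by (simp add: WS del: hframe_simps(1-4))
  \<comment> \<open>Up to signs the two relations have the same quadratic side, but coefficients 1
    and 3 in front of the mixed entry.\<close>
  have k2: "2 * (\<kappa> * K 1 2) = 0" using e2 e4 ee by algebra
  have k3: "2 * (\<kappa> * K 1 3) = 0" using e3 e5 ee by algebra
  show K12: "K 1 2 = 0" and K13: "K 1 3 = 0" using k2 k3 \<open>\<kappa> \<noteq> 0\<close> by auto
  define q where "q = \<Lambda> / 3"
  have Lq: "\<Lambda> = 3 * q" by (simp add: q_def)
  have A: "(\<kappa> - s * \<epsilon> * K 1 1) * (\<kappa> + s * K 3 3) = \<epsilon> * \<Lambda> / 3"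
      "(\<kappa> - s * \<epsilon> * K 1 1) * (\<kappa> + s * K 2 2) = \<epsilon> * \<Lambda> / 3"
    using e7 e8 ee unfolding Lq K12 K13 by (simp, algebra)+
  then have nz: "\<kappa> - s * \<epsilon> * K 1 1 \<noteq> 0" using \<open>\<Lambda> \<noteq> 0\<close> eps by auto
  from A have "\<kappa> + s * K 3 3 = \<kappa> + s * K 2 2" using nz by (metis mult_left_cancel)
  then show K33: "K 3 3 = K 2 2" using s1 by auto
  have "K 2 3 * (\<kappa> - s * \<epsilon> * K 1 1) = 0"
    using e6 ee unfolding K12 K13 by algebra
  then show K23: "K 2 3 = 0" using nz by simp
  show "(\<kappa> - s * \<epsilon> * K 1 1) * (\<kappa> + s * K 2 2) = \<epsilon> * \<Lambda> / 3" by (rule A(2))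
  show "(\<kappa> + s * K 2 2)\<^sup>2 + 2 * \<kappa> * (\<kappa> - s * \<epsilon> * K 1 1) = - (\<epsilon> * \<Lambda> / 3)"
    using e1 ee unfolding Lq K23 K33 by (simp, algebra)
  show "M 1 1 = 2 * \<epsilon> * (K 1 1)\<^sup>2 - 2 * \<Lambda> / 3 - 4 * s * \<kappa> * (\<epsilon> * K 2 2 - K 1 1)"
    using e9 by (simp add: K12 K13 K33 power2_eq_square algebra_simps)
qed

end

section \<open>Converse: diagonal solutions of the equations are Einstein and half-flat\<close>

context heis_frame_jet
begin

text \<open>Here \<open>l1\<close>, \<open>l2\<close> play the role of half the logarithmic
  derivatives of the two coefficients and \<open>m1\<close>, \<open>m2\<close> of their derivatives;
  twice differentiating an F with \<open>F' = 2 l F\<close> gives \<open>2 (m + 2 l l) F\<close>,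
  the shape of \<open>M_diag\<close>. The whole Weyl tensor is expressed through the single number
  \<open>r\<close>.\<close>

context
  fixes l1 l2 m1 m2 s \<Lambda> q r :: real
  assumes K_off: "K 1 2 = 0" "K 1 3 = 0" "K 2 3 = 0" and M_off: "M 1 2 = 0" "M 1 3 = 0" "M 2 3 = 0"
    and K_diag: "K 1 1 = \<epsilon> * l1" "K 2 2 = l2" "K 3 3 = l2"
    and M_diag: "M 1 1 = 2 * \<epsilon> * (m1 + 2 * l1\<^sup>2)" "M 2 2 = 2 * (m2 + 2 * l2\<^sup>2)" "M 3 3 = 2 * (m2 + 2 * l2\<^sup>2)"
    and s: "s = 1 \<or> s = -1"
    and eqA: "(\<kappa> - s * l1) * (\<kappa> + s * l2) = \<epsilon> * q"
    and eqB: "(\<kappa> + s * l2)\<^sup>2 + 2 * \<kappa> * (\<kappa> - s * l1) = - (\<epsilon> * q)"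
    and eqC1: "m1 = - l1\<^sup>2 - \<epsilon> * q - 2 * s * \<kappa> * (l2 - l1)"
    and eqC2: "m2 = - l2\<^sup>2 - \<epsilon> * q - s * \<kappa> * (l1 - l2)"
    and q: "\<Lambda> = 3 * q" and r: "r = \<epsilon> * \<kappa> * (l1 - l2)"
begin

lemma curvature_zero:
    "Riem 1 2 1 3 = 0"
    "Riem 1 2 1 4 = 0"
    "Riem 1 2 4 2 = 0"
    "Riem 1 2 2 3 = 0"
    "Riem 1 3 1 2 = 0"
    "Riem 1 3 1 4 = 0"
    "Riem 1 3 3 4 = 0"
    "Riem 1 3 2 3 = 0"
    "Riem 1 4 1 2 = 0"
    "Riem 1 4 1 3 = 0"
    "Riem 1 4 3 4 = 0"
    "Riem 1 4 4 2 = 0"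
    "Riem 3 4 1 3 = 0"
    "Riem 3 4 1 4 = 0"
    "Riem 3 4 4 2 = 0"
    "Riem 3 4 2 3 = 0"
    "Riem 4 2 1 2 = 0"
    "Riem 4 2 1 4 = 0"
    "Riem 4 2 3 4 = 0"
    "Riem 4 2 2 3 = 0"
    "Riem 2 3 1 2 = 0"
    "Riem 2 3 1 3 = 0"
    "Riem 2 3 3 4 = 0"
    "Riem 2 3 4 2 = 0"
  by (simp_all add: curvature_table K_off M_off del: hframe_simps(1-4))

lemma sign_simps:
  "y / \<epsilon> = y * \<epsilon>" "\<epsilon> * \<epsilon> = 1" "\<epsilon> * (\<epsilon> * y) = y" "s * s = 1" "s * (s * y) = y"
  using eps s by auto

text \<open>Up to signs the Weyl tensor acts with eigenvalues proportional to \<open>-2\<close>,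
  \<open>1\<close>, \<open>1\<close> on the pairs of one duality class; the trace zero is what the
  Einstein equation sees.\<close>

lemma curvature_values:
    "Riem 1 2 1 2 = q - 2 * s * r"
    "Riem 1 2 3 4 = - 2 * r"
    "Riem 1 3 1 3 = \<epsilon> * q + s * \<epsilon> * r"
    "Riem 1 3 4 2 = r"
    "Riem 1 4 1 4 = \<epsilon> * q + s * \<epsilon> * r"
    "Riem 1 4 2 3 = r"
    "Riem 3 4 1 2 = - 2 * r"
    "Riem 3 4 3 4 = q - 2 * s * r"
    "Riem 4 2 1 3 = r"
    "Riem 4 2 4 2 = \<epsilon> * q + s * \<epsilon> * r"
    "Riem 2 3 1 4 = r"
    "Riem 2 3 2 3 = \<epsilon> * q + s * \<epsilon> * r"
  unfolding curvature_table K_off K_diag M_diag eqC1 eqC2 r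
  by (insert sign_simps(2,4) eqA eqB) (((simp add: power2_eq_square, algebra) | algebra | simp add: algebra_simps)[1])+

lemmas curvature_all = curvature_zero curvature_values curvature_flip

lemma einstein_at: "ricci (hmet (\<lambda>_. \<epsilon>) H) k j x = \<Lambda> * metric_component (hmet (\<lambda>_. \<epsilon>) H) k j x"
proof (rule einstein_at_frame)
  fix b d :: 4
  show "(\<Sum>a\<in>UNIV. Riem a b a d / heta \<epsilon> a)
     = (if b = d then \<Lambda> * heta \<epsilon> b else 0)"
    unfolding sum_4 using exhaust_4[of b] exhaust_4[of d]
    by (elim disjE; hypsubst; simp add: curvature_all q sign_simps algebra_simps del: hframe_simps(1-4))
qed

lemma half_flat_at:
  "hodge_weyl (hmet (\<lambda>_. \<epsilon>) H) i j k l x = (s * sgn (det e)) * weyl (hmet (\<lambda>_. \<epsilon>) H) i j k l x"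
proof -
  interpret F: heis_einstein_frame J \<epsilon> H H' H'' x e \<kappa> \<Lambda>
    by unfold_locales (rule einstein_at)
  have o: "sgn (det e) = 1 \<or> sgn (det e) = -1" using F.orientation_factor_sgn(2) by (auto simp: sgn_if)
  have main: "sgn (det e) * dual_pair_sum (\<lambda>r s. F.Weyl r s k l
        / (heta \<epsilon> r * heta \<epsilon> s)) p q = s * sgn (det e) * F.Weyl p q k l"
     (is "_ * dual_pair_sum ?T p q = ?R p q") for p q k l
  proof -
    have anti: "?T r s = - ?T s r" for r s
      using F.W_antisym(1)[of "fr r" "fr s"] by (simp add: mult.commute)
    note V = dual_pair_sum_values[of ?T, OF anti]
    note WS = curvature_all F.frame_inner
    have W1: "F.Weyl 1 2 k l
        = s * F.Weyl 3 4 k l"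
      unfolding F.W_def using exhaust_4[of k] exhaust_4[of l]
      by (elim disjE; hypsubst; simp add: WS q sign_simps algebra_simps del: hframe_simps(1-4))
    have W2: "F.Weyl 1 3 k l
        = s * \<epsilon> * F.Weyl 4 2 k l"
      unfolding F.W_def using exhaust_4[of k] exhaust_4[of l]
      by (elim disjE; hypsubst; simp add: WS q sign_simps algebra_simps del: hframe_simps(1-4))
    have W3: "F.Weyl 1 4 k l
        = s * \<epsilon> * F.Weyl 2 3 k l"
      unfolding F.W_def using exhaust_4[of k] exhaust_4[of l]
      by (elim disjE; hypsubst; simp add: WS q sign_simps algebra_simps del: hframe_simps(1-4))
    \<comment> \<open>The three relations settle the other three pairs as well, because duality
      exchanges the pairs and the signs \<open>s\<close> and \<epsilon> square to 1.\<close>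
    have pos: "sgn (det e) * dual_pair_sum ?T 1 2 = ?R 1 2" "sgn (det e) * dual_pair_sum ?T 1 3 = ?R 1 3"
      "sgn (det e) * dual_pair_sum ?T 1 4 = ?R 1 4" "sgn (det e) * dual_pair_sum ?T 3 4 = ?R 3 4"
      "sgn (det e) * dual_pair_sum ?T 4 2 = ?R 4 2" "sgn (det e) * dual_pair_sum ?T 2 3 = ?R 2 3"
      unfolding V W1 W2 W3 by (simp_all add: sign_simps algebra_simps del: hframe_simps(1-4))
    have neg: "sgn (det e) * dual_pair_sum ?T q p = ?R q p" if "sgn (det e) * dual_pair_sum ?T p q = ?R p q" for p q
      using that F.W_antisym(1)[of "fr q" "fr p"] dual_pair_sum_swap[of ?T p q] by simp
    have same: "sgn (det e) * dual_pair_sum ?T p p = ?R p p" for p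
      using F.W_antisym(1)[of "fr p" "fr p"] by (simp add: dual_pair_sum_same)
    have "\<forall>p q. sgn (det e) * dual_pair_sum ?T p q = ?R p q"
      unfolding forall_4 by (intro conjI) (rule pos pos[THEN neg] same)+
    then show ?thesis by blast
  qed
  then show ?thesis using F.half_flat_iff[of "s * sgn (det e)"] by blast
qed

end

end

subsection \<open>Conserved quantities and incompleteness\<close>

text \<open>\<open>heis_metric\<close> and \<open>hmet\<close> agree only over the interval, where
  the group metrics are invariant; all curvature quantities are local, so agreement on an open set
  is enough.\<close>

lemma metric_cong:
  fixes g h :: "'n::finite form_field"
  assumes "open U" "\<And>x u v. x \<in> U \<Longrightarrow> g x u v = h x u v" and x: "x \<in> U"
  shows "metric_component g i j x = metric_component h i j x"
    and "metric_matrix g x = metric_matrix h x"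
    and "inverse_metric g i j x = inverse_metric h i j x"
    and "christoffel g k i j x = christoffel h k i j x"
    and "riemann g l k i j x = riemann h l k i j x"
    and "ricci g i j x = ricci h i j x"
    and "scalar_curvature g x = scalar_curvature h x"
proof -
  have c: "metric_component g i j y = metric_component h i j y" if "y \<in> U" for i j y
    using assms(2)[OF that] by (simp add: metric_component_def)
  have m: "metric_matrix g y = metric_matrix h y" if "y \<in> U" for y
    using c[OF that] by (simp add: metric_matrix_def)
  have i: "inverse_metric g i j y = inverse_metric h i j y" if "y \<in> U" for i j y
    using m[OF that] by (simp add: inverse_metric_def)
  have ch: "christoffel g k i j y = christoffel h k i j y" if "y \<in> U" for k i j y
    using i[OF that] partial_deriv_cong_open[OF assms(1) that c] by (simp add: christoffel_def)
  have r: "riemann g l k i j y = riemann h l k i j y" if "y \<in> U" for l k i j y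
    using ch[OF that] partial_deriv_cong_open[OF assms(1) that ch] by (simp add: riemann_def)
  have ri: "ricci g i j y = ricci h i j y" if "y \<in> U" for i j y
    using r[OF that] by (simp add: ricci_def)
  show "metric_component g i j x = metric_component h i j x" "metric_matrix g x = metric_matrix h x"
    "inverse_metric g i j x = inverse_metric h i j x" "christoffel g k i j x = christoffel h k i j x"
    "riemann g l k i j x = riemann h l k i j x" "ricci g i j x = ricci h i j x"
    "scalar_curvature g x = scalar_curvature h x"
    using c[OF x] m[OF x] i[OF x] ch[OF x] r[OF x] ri[OF x] by (simp_all add: scalar_curvature_def)
qed

lemma weyl_cong:
  assumes "open U" "\<And>x u v. x \<in> U \<Longrightarrow> g x u v = h x u v" and x: "x \<in> U"
  shows "weyl g l k i j x = weyl h l k i j x" "hodge_weyl g l k i j x = hodge_weyl h l k i j x"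
proof -
  note c = metric_cong[OF assms]
  show w: "weyl g l k i j x = weyl h l k i j x" for l k i j
    by (simp add: weyl_def c)
  show "hodge_weyl g l k i j x = hodge_weyl h l k i j x"
    by (simp add: hodge_weyl_def volume_form_def c w)
qed

lemma geodesically_complete_cong:
  assumes "open U" "\<And>x u v. x \<in> U \<Longrightarrow> g x u v = h x u v"
  shows "geodesically_complete U g \<longleftrightarrow> geodesically_complete U h"
proof -
  have "geodesic_with_velocity U g c v \<longleftrightarrow> geodesic_with_velocity U h c v" for c v
    unfolding geodesic_with_velocity_def by (simp add: metric_cong(4)[OF assms] cong: conj_cong)
  then show ?thesis by (simp add: geodesically_complete_def)
qed

lemma has_vector_derivative_nth:
  fixes c :: "real \<Rightarrow> real ^ 'n::finite"
  shows "(c has_vector_derivative c') F \<Longrightarrow> ((\<lambda>s. c s $ i) has_vector_derivative c' $ i) F"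
  by (rule bounded_linear.has_vector_derivative[OF bounded_linear_vec_nth])

lemma has_vector_derivative_nth_real:
  fixes c :: "real \<Rightarrow> real ^ 'n::finite"
  shows "(c has_vector_derivative c') (at s within S) \<Longrightarrow> ((\<lambda>s. c s $ i) has_real_derivative c' $ i) (at s within S)"
  using has_vector_derivative_nth by (simp add: has_real_derivative_iff_has_vector_derivative)

text \<open>The derivative is taken within \<open>S\<close>, because the geodesics of the
  completeness argument are first followed on intervals that have 0 as an endpoint.\<close>

lemma bilinear_curve_deriv:
  fixes H H' :: "real \<Rightarrow> real ^ 3 \<Rightarrow> real ^ 3 \<Rightarrow> real"
  assumes "open J" "\<tau> s \<in> J" and bil: "\<And>t. t \<in> J \<Longrightarrow> bilinear (H t)"
    and H': "\<And>t a b. t \<in> J \<Longrightarrow> ((\<lambda>t. H t a b) has_real_derivative H' t a b) (at t)"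
    and \<tau>: "(\<tau> has_real_derivative k) (at s within S)" "\<And>s. s \<in> S \<Longrightarrow> \<tau> s \<in> J" "s \<in> S"
    and A: "\<And>i. ((\<lambda>s. A s $ i) has_real_derivative A' $ i) (at s within S)"
    and B: "\<And>i. ((\<lambda>s. B s $ i) has_real_derivative B' $ i) (at s within S)"
  shows "((\<lambda>s. H (\<tau> s) (A s) (B s)) has_real_derivative
     k * H' (\<tau> s) (A s) (B s) + H (\<tau> s) A' (B s) + H (\<tau> s) (A s) B') (at s within S)"
proof -
  have d: "((\<lambda>s. H (\<tau> s) u v) has_real_derivative H' (\<tau> s) u v * k) (at s within S)" for u v
    by (rule DERIV_chain2[OF H'[OF assms(2)] \<tau>(1)])
  have "((\<lambda>s. \<Sum>a\<in>UNIV. \<Sum>b\<in>UNIV. A s $ a * B s $ b * H (\<tau> s) (axis a 1) (axis b 1)) has_real_derivative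
     (\<Sum>a\<in>UNIV. \<Sum>b\<in>UNIV. (A' $ a * B s $ b + B' $ b * A s $ a) * H (\<tau> s) (axis a 1) (axis b 1)
        + H' (\<tau> s) (axis a 1) (axis b 1) * k * (A s $ a * B s $ b))) (at s within S)"
    by (intro DERIV_sum DERIV_mult A B d)
  moreover have "(\<Sum>a\<in>UNIV. \<Sum>b\<in>UNIV. (A' $ a * B s $ b + B' $ b * A s $ a) * H (\<tau> s) (axis a 1) (axis b 1)
        + H' (\<tau> s) (axis a 1) (axis b 1) * k * (A s $ a * B s $ b)) =
     k * H' (\<tau> s) (A s) (B s) + H (\<tau> s) A' (B s) + H (\<tau> s) (A s) B'"
  proof -
    have "bilinear (H' (\<tau> s))"
      by (rule bilinear_deriv[where H = H and H' = H', OF assms(1,2) bil H'[OF assms(2)]])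
    note e = bilinear_expand3[OF this, of "A s" "B s"]
      bilinear_expand3[OF bil[OF assms(2)], of A' "B s"] bilinear_expand3[OF bil[OF assms(2)], of "A s" B']
    show ?thesis
      unfolding e sum_distrib_left sum.distrib[symmetric]
      by (intro sum.cong refl) (simp add: algebra_simps)
  qed
  ultimately have "((\<lambda>s. \<Sum>a\<in>UNIV. \<Sum>b\<in>UNIV. A s $ a * B s $ b * H (\<tau> s) (axis a 1) (axis b 1)) has_real_derivative
     k * H' (\<tau> s) (A s) (B s) + H (\<tau> s) A' (B s) + H (\<tau> s) (A s) B') (at s within S)" by simp
  then show ?thesis
    by (rule has_field_derivative_transform_within[OF _ zero_less_one \<tau>(3)])
      (simp add: bilinear_expand3[OF bil[OF \<tau>(2)], symmetric])
qed

context heis_jet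
begin

lemma hmet_curve_deriv:
  assumes S: "\<And>s. s \<in> S \<Longrightarrow> c s $ 1 \<in> J" "s \<in> S"
    and c: "(c has_vector_derivative v) (at s within S)"
    and a: "(a has_vector_derivative a') (at s within S)"
    and b: "(b has_vector_derivative b') (at s within S)"
  shows "((\<lambda>s. hmet P H (c s) (a s) (b s)) has_real_derivative
     hmetD P' H H' (c s) v (a s) (b s) + hmet P H (c s) a' (b s) + hmet P H (c s) (a s) b') (at s within S)"
proof -
  note n = has_vector_derivative_nth_real
  have mc: "((\<lambda>s. mc_form (c s) (u s) $ i) has_real_derivative (mc_form (c s) u' - (1/2) *\<^sub>R br4 v (u s)) $ i) (at s within S)"
    if u: "(u has_vector_derivative u') (at s within S)" for u u' i
  proof -
    have "((\<lambda>s. u s $ 4 - (c s $ 2 * u s $ 3 - c s $ 3 * u s $ 2) / 2) has_real_derivative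
       u' $ 4 - ((v $ 2 * u s $ 3 + u' $ 3 * c s $ 2) - (v $ 3 * u s $ 2 + u' $ 2 * c s $ 3)) / 2) (at s within S)"
      by (intro DERIV_diff DERIV_cdivide DERIV_mult n u c)
    then show ?thesis
      using exhaust_3[of i] n[OF u] by (elim disjE) (simp_all add: mc_form_def br4_def algebra_simps add_divide_distrib diff_divide_distrib)
  qed
  have J: "c s $ 1 \<in> J" using S by blast
  have "((\<lambda>s. P (c s $ 1) * (a s $ 1) * (b s $ 1) + H (c s $ 1) (mc_form (c s) (a s)) (mc_form (c s) (b s))) has_real_derivative
    ((P' (c s $ 1) * v $ 1 * a s $ 1 + a' $ 1 * P (c s $ 1)) * b s $ 1 + b' $ 1 * (P (c s $ 1) * a s $ 1)) +
    (v $ 1 * H' (c s $ 1) (mc_form (c s) (a s)) (mc_form (c s) (b s))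
     + H (c s $ 1) (mc_form (c s) a' - (1/2) *\<^sub>R br4 v (a s)) (mc_form (c s) (b s))
     + H (c s $ 1) (mc_form (c s) (a s)) (mc_form (c s) b' - (1/2) *\<^sub>R br4 v (b s)))) (at s within S)"
    by (intro DERIV_add DERIV_mult n a b DERIV_chain2[where f = P and g = "\<lambda>s. c s $ 1", OF derP[OF J]] c
        bilinear_curve_deriv[OF open_J _ bil derH _ _ S(2) mc[OF a] mc[OF b], where \<tau> = "\<lambda>s. c s $ 1"] S)
  then show ?thesis
    unfolding hmet_def hmetD_def
    by (simp add: bilinear_lsub bilinear_rsub bilinear_lmul bilinear_rmul bil[OF J] algebra_simps add_divide_distrib)
qed

text \<open>The common source of the conservation laws: the geodesic equation removes the
  acceleration and leaves half the derivative of the metric along \<open>X\<close>. With the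
  velocity as \<open>X\<close> this gives the energy, with a Killing field the momentum.\<close>

lemma geodesic_energy_deriv:
  assumes S: "\<And>s. s \<in> S \<Longrightarrow> c s $ 1 \<in> J" "s \<in> S"
    and c: "(c has_vector_derivative v s) (at s within S)"
    and v: "(v has_vector_derivative
       (\<chi> k. - (\<Sum>i\<in>UNIV. \<Sum>j\<in>UNIV. christoffel (hmet P H) k i j (c s) * v s $ i * v s $ j))) (at s within S)"
    and X: "(X has_vector_derivative X') (at s within S)"
  shows "((\<lambda>s. hmet P H (c s) (v s) (X s)) has_real_derivative
     hmetD P' H H' (c s) (X s) (v s) (v s) / 2 + hmet P H (c s) (v s) X') (at s within S)"
proof -
  let ?a = "\<chi> k. - (\<Sum>i\<in>UNIV. \<Sum>j\<in>UNIV. christoffel (hmet P H) k i j (c s) * v s $ i * v s $ j)"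
  have U: "c s \<in> interval_times_heis J" using S by (simp add: interval_times_heis_def)
  have "?a = - (\<chi> k. (\<Sum>i\<in>UNIV. \<Sum>j\<in>UNIV. christoffel (hmet P H) k i j (c s) * v s $ i * v s $ j))"
    by (simp add: vec_eq_iff)
  then have "hmet P H (c s) ?a (X s) = - christoffel_first (hmetD P' H H' (c s)) (X s) (v s) (v s)"
    using metric_christoffel[OF U] bilinear_lneg[OF bilin[OF U]] by simp
  moreover have "hmetD P' H H' (c s) (v s) (v s) (X s) - christoffel_first (hmetD P' H H' (c s)) (X s) (v s) (v s)
     = hmetD P' H H' (c s) (X s) (v s) (v s) / 2"
    using Dg_sym[OF U, of "v s" "v s" "X s"] by (simp add: christoffel_first_def diff_divide_distrib)
  ultimately show ?thesis
    by (intro DERIV_cong[OF hmet_curve_deriv[OF S c v X]]) simp_all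
qed

lemma geodesic_energy:
  assumes "geodesic_with_velocity (interval_times_heis J) (hmet P H) c v"
  shows "hmet P H (c s) (v s) (v s) = hmet P H (c 0) (v 0) (v 0)"
proof -
  have "((\<lambda>s. hmet P H (c s) (v s) (v s)) has_real_derivative 0) (at s)" for s
  proof -
    let ?a = "\<chi> k. - (\<Sum>i\<in>UNIV. \<Sum>j\<in>UNIV. christoffel (hmet P H) k i j (c s) * v s $ i * v s $ j)"
    have U: "c s \<in> interval_times_heis J" for s using assms by (simp add: geodesic_with_velocity_def)
    have d: "(c has_vector_derivative v s) (at s)" "(v has_vector_derivative ?a) (at s)"
      using assms by (simp_all add: geodesic_with_velocity_def)
    have "?a = - (\<chi> k. (\<Sum>i\<in>UNIV. \<Sum>j\<in>UNIV. christoffel (hmet P H) k i j (c s) * v s $ i * v s $ j))"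
      by (simp add: vec_eq_iff)
    then have "hmet P H (c s) (v s) ?a = - christoffel_first (hmetD P' H H' (c s)) (v s) (v s) (v s)"
      using metric_christoffel[OF U, of s] bilinear_lneg[OF bilin[OF U]] sym[OF U] by simp
    then have "hmet P H (c s) (v s) ?a = - hmetD P' H H' (c s) (v s) (v s) (v s) / 2"
      by (simp add: christoffel_first_def)
    then show ?thesis
      using geodesic_energy_deriv[of UNIV c s v v ?a, OF _ _ d d(2)] U by (simp add: interval_times_heis_def)
  qed
  then show ?thesis using DERIV_isconst_all[of "\<lambda>s. hmet P H (c s) (v s) (v s)"] by blast
qed

definition killing_field :: "real ^ 3 \<Rightarrow> real ^ 4 \<Rightarrow> real ^ 4" where
  \<comment> \<open>the right-invariant fields, which generate the left translations\<close>
  "killing_field w x = vector [0, w $ 1, w $ 2, w $ 3 - (x $ 2 * w $ 2 - x $ 3 * w $ 1) / 2]"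

lemma geodesic_momentum:
  assumes "geodesic_with_velocity (interval_times_heis J) (hmet P H) c v"
  shows "hmet P H (c s) (v s) (killing_field w (c s)) = hmet P H (c 0) (v 0) (killing_field w (c 0))"
proof -
  have "((\<lambda>s. hmet P H (c s) (v s) (killing_field w (c s))) has_real_derivative 0) (at s)" for s
  proof -
    let ?a = "\<chi> k. - (\<Sum>i\<in>UNIV. \<Sum>j\<in>UNIV. christoffel (hmet P H) k i j (c s) * v s $ i * v s $ j)"
    have U: "c s \<in> interval_times_heis J" for s using assms by (simp add: geodesic_with_velocity_def)
    then have J: "c s $ 1 \<in> J" for s by (simp add: interval_times_heis_def)
    have d: "(c has_vector_derivative v s) (at s)" "(v has_vector_derivative ?a) (at s)"
      using assms by (simp_all add: geodesic_with_velocity_def)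
    define X' :: "real ^ 4" where "X' = vector [0, 0, 0, - (v s $ 2 * w $ 2 - v s $ 3 * w $ 1) / 2]"
    have X: "((\<lambda>s. killing_field w (c s)) has_vector_derivative X') (at s)"
    proof -
      define L :: "real ^ 4 \<Rightarrow> real ^ 4" where "L x = vector [0, 0, 0, - (x $ 2 * w $ 2 - x $ 3 * w $ 1) / 2]" for x
      have "linear L" by (auto simp: linear_iff L_def vec_eq_iff forall_4 field_simps)
      then have "bounded_linear L" by (rule linear_conv_bounded_linear[THEN iffD1])
      then have "((\<lambda>s. L (c s)) has_vector_derivative L (v s)) (at s)"
        using d(1) by (rule bounded_linear.has_vector_derivative)
      then have "((\<lambda>s. L (c s) + vector [0, w $ 1, w $ 2, w $ 3]) has_vector_derivative L (v s)) (at s)"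
        by (auto intro!: derivative_eq_intros)
      moreover have "(\<lambda>s. L (c s) + vector [0, w $ 1, w $ 2, w $ 3]) = (\<lambda>s. killing_field w (c s))"
        by (simp add: fun_eq_iff L_def killing_field_def vec_eq_iff forall_4 field_simps)
      ultimately show ?thesis by (simp add: L_def X'_def)
    qed
    \<comment> \<open>The Killing equation in this setting: the derivative of the metric along the
      right-invariant field cancels against the change of the field along the curve.\<close>
    have "br4 (killing_field w (c s)) (v s) = (2::real) *\<^sub>R mc_form (c s) X'"
      by (simp add: br4_def killing_field_def mc_form_def X'_def vec_eq_iff forall_3 field_simps)
    moreover have "killing_field w (c s) $ 1 = 0" "X' $ 1 = 0" by (simp_all add: killing_field_def X'_def)
    ultimately have "hmetD P' H H' (c s) (killing_field w (c s)) (v s) (v s) / 2 + hmet P H (c s) (v s) X' = 0"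
      using symH[OF J[of s], of "mc_form (c s) (v s)"]
      by (simp add: hmetD_def hmet_def bilinear_lmul bilinear_rmul bil[OF J])
    then show ?thesis
      using geodesic_energy_deriv[of UNIV c s v "\<lambda>s. killing_field w (c s)" X', OF _ _ d X] J by simp
  qed
  then show ?thesis using DERIV_isconst_all[of "\<lambda>s. hmet P H (c s) (v s) (killing_field w (c s))"] by blast
qed

text \<open>A geodesic leaving an orbit orthogonally has zero momentum, so it stays a coordinate line, which
  runs through the interval in finite time when the arc length T is bounded on one side.\<close>

theorem not_geodesically_complete:
  assumes T: "\<And>t. t \<in> J \<Longrightarrow> (T has_real_derivative sqrt \<bar>P t\<bar>) (at t)"
    and bdd: "(\<forall>t\<in>J. b \<le> T t) \<or> (\<forall>t\<in>J. T t \<le> b)" and "J \<noteq> {}"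
  shows "\<not> geodesically_complete (interval_times_heis J) (hmet P H)"
proof
  assume complete: "geodesically_complete (interval_times_heis J) (hmet P H)"
  obtain t0 where t0: "t0 \<in> J" using \<open>J \<noteq> {}\<close> by blast
  have "t0 *\<^sub>R axis 1 1 \<in> interval_times_heis J" using t0 by (simp add: interval_times_heis_def)
  with complete obtain c v where geo: "geodesic_with_velocity (interval_times_heis J) (hmet P H) c v"
    and c0: "c 0 = t0 *\<^sub>R axis 1 1" and v0: "v 0 = axis 1 1"
    unfolding geodesically_complete_def by blast
  have J: "c s $ 1 \<in> J" for s using geo by (simp add: geodesic_with_velocity_def interval_times_heis_def)
  have c': "(c has_vector_derivative v s) (at s)" for s using geo by (simp add: geodesic_with_velocity_def)
  have v': "continuous_on UNIV v"
    using geo by (auto simp: geodesic_with_velocity_def intro!: continuous_at_imp_continuous_on has_vector_derivative_continuous)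
  have mc0: "mc_form (c s) (v s) = 0" for s
  proof (rule H_nondeg[OF J[of s]])
    fix b :: "real ^ 3"
    \<comment> \<open>Chosen so that the Killing field of \<open>w\<close> has Maurer-Cartan value
      \<open>b\<close> at the point \<open>c s\<close>. The correction has no factor 1/2, since the
      Killing field and \<open>mc_form\<close> each contribute one half.\<close>
    define w :: "real ^ 3" where "w = vector [b $ 1, b $ 2, b $ 3 + (c s $ 2 * b $ 2 - c s $ 3 * b $ 1)]"
    have "mc_form (c s) (killing_field w (c s)) = b"
      by (simp add: mc_form_def killing_field_def w_def vec_eq_iff forall_3)
    moreover have "killing_field w x $ 1 = 0" for x by (simp add: killing_field_def)
    ultimately have "H (c s $ 1) (mc_form (c s) (v s)) b = hmet P H (c 0) (v 0) (killing_field w (c 0))"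
      using geodesic_momentum[OF geo, of s w] by (simp add: hmet_def)
    then show "H (c s $ 1) (mc_form (c s) (v s)) b = 0"
      using bil[OF J[of 0]] by (simp add: v0 hmet_def killing_field_def bilinear_lzero)
  qed
  define u where "u s = sqrt \<bar>P (c s $ 1)\<bar> * v s $ 1" for s
  have "P (c s $ 1) * (v s $ 1)\<^sup>2 = P t0" for s
    using geodesic_energy[OF geo, of s] mc0 bilinear_lzero[OF bil[OF t0]] bil[OF J] by (simp add: hmet_def bilinear_lzero c0 v0 power2_eq_square mult.assoc)
  note energy = this
  have u2: "(u s)\<^sup>2 = \<bar>P t0\<bar>" for s
    unfolding energy[of s, symmetric] by (simp add: u_def power_mult_distrib abs_mult)
  have contP: "continuous_on J P" using derP by (auto intro!: continuous_at_imp_continuous_on DERIV_isCont)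
  have "continuous_on UNIV c"
    using c' by (auto intro!: continuous_at_imp_continuous_on has_vector_derivative_continuous)
  then have contu: "continuous_on UNIV u"
    unfolding u_def using J by (auto intro!: continuous_intros v' continuous_on_compose2[OF contP])
  define q where "q = sqrt \<bar>P t0\<bar>"
  have q: "q > 0" "u 0 = q" using P_nz[OF t0] by (simp_all add: q_def u_def c0 v0)
  \<comment> \<open>The speed is continuous and never zero, so it keeps its initial sign.\<close>
  have uq: "u s = q" for s
  proof (rule ccontr)
    assume ne: "u s \<noteq> q"
    have "(u s)\<^sup>2 = q\<^sup>2" using u2[of s] by (simp add: q_def)
    with ne have neg: "u s = - q" by (simp add: power2_eq_iff)
    have "connected (u ` UNIV)" by (rule connected_continuous_image[OF contu connected_UNIV])
    then have "0 \<in> u ` UNIV"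
      using connectedD_interval[of "u ` UNIV" "- q" q 0] q neg by (metis less_imp_le neg_le_0_iff_le rangeI)
    then obtain z where "u z = 0" by auto
    then show False using u2[of z] P_nz[OF t0] by simp
  qed
  have "((\<lambda>s. T (c s $ 1) - q * s) has_real_derivative 0) (at s)" for s
  proof -
    have "((\<lambda>s. T (c s $ 1)) has_real_derivative sqrt \<bar>P (c s $ 1)\<bar> * v s $ 1) (at s)"
      by (rule DERIV_chain2[OF T[OF J] has_vector_derivative_nth_real[OF c']])
    then show ?thesis using uq[of s] by (auto intro!: derivative_eq_intros simp: u_def)
  qed
  then have "T (c s $ 1) - q * s = T (c 0 $ 1) - q * 0" for s
    using DERIV_isconst_all[of "\<lambda>s. T (c s $ 1) - q * s"] by blast
  then have lin: "T (c s $ 1) = T t0 + q * s" for s by (simp add: c0 algebra_simps)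
  \<comment> \<open>The arc length is affine along the geodesic, so it takes values one unit beyond
    the bound on either side.\<close>
  have "T (c ((b - T t0 - 1) / q) $ 1) = b - 1" "T (c ((b - T t0 + 1) / q) $ 1) = b + 1"
    using q(1) by (simp_all add: lin)
  note ends = this
  from bdd show False
  proof
    assume "\<forall>t\<in>J. b \<le> T t"
    then have "b \<le> T (c ((b - T t0 - 1) / q) $ 1)" using J by blast
    with ends(1) show False by simp
  next
    assume "\<forall>t\<in>J. T t \<le> b"
    then have "T (c ((b - T t0 + 1) / q) $ 1) \<le> b" using J by blast
    with ends(2) show False by simp
  qed
qed

end

subsection \<open>Global solutions of ordinary differential equations\<close>

text \<open>Picard iteration with an exponentially weighted supremum norm: the fixed point is sought
  for \<open>exp (- 2 M s)\<close> times the displacement from \<open>y0\<close>, among bounded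
  continuous functions. The weight makes the operator a contraction with factor 1/2 on the half-line
  at once, so no local solutions have to be continued.\<close>

lemma picard_global:
  fixes f :: "'a::banach \<Rightarrow> 'a"
  assumes lip: "L-lipschitz_on UNIV f" and bnd: "\<And>x. norm (f x) \<le> B"
  obtains y where "y 0 = y0" "\<And>s. s \<ge> 0 \<Longrightarrow> (y has_vector_derivative f (y s)) (at s within {0..})"
proof -
  \<comment> \<open>Adding 1 keeps the weight strictly increasing even if the Lipschitz constant is
    0.\<close>
  define M where "M = L + 1"
  have L0: "L \<ge> 0" using lip by (rule lipschitz_on_nonneg)
  then have M: "M > 0" by (simp add: M_def)
  have fl: "norm (f x - f z) \<le> M * norm (x - z)" for x z
  proof -
    have "norm (f x - f z) \<le> L * norm (x - z)"
      using lipschitz_onD[OF lip, of x z] by (simp add: dist_norm)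
    also have "\<dots> \<le> M * norm (x - z)" by (simp add: M_def distrib_right)
    finally show ?thesis .
  qed
  have fc: "continuous_on UNIV f" by (rule lipschitz_on_continuous_on[OF lip])
  have B: "B \<ge> 0" using bnd[of undefined] norm_ge_zero order_trans by blast
  define G where "G u r = f (y0 + exp (2 * M * r) *\<^sub>R apply_bcontfun u r)" for u :: "real \<Rightarrow>\<^sub>C 'a" and r
  have Gc: "continuous_on S (G u)" for S u
    unfolding G_def by (intro continuous_on_compose2[OF fc] continuous_intros) auto
  have Gi: "G u integrable_on {a..b}" for u a b
    by (rule integrable_continuous_real[OF Gc])
  \<comment> \<open>Bounded continuous functions live on the whole line, so negative times are sent
    to 0.\<close>
  define I where "I u s = integral {0..max 0 s} (G u)" for u and s :: real
  define \<Phi> where "\<Phi> u s = exp (- (2 * M * max 0 s)) *\<^sub>R I u s" for u s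
  have Ic: "continuous_on UNIV (I u)" for u
  proof -
    have "isCont (I u) s" for s
    proof -
      define b where "b = max 0 s + 1"
      have "continuous_on {..<b} (I u)"
        unfolding I_def
        by (intro continuous_on_compose2[OF indefinite_integral_continuous_1[OF Gi, of 0 b]] continuous_intros)
          (auto simp: b_def)
      then show ?thesis by (simp add: continuous_on_eq_continuous_at b_def)
    qed
    then show ?thesis by (simp add: continuous_at_imp_continuous_on)
  qed
  have \<Phi>c: "continuous_on UNIV (\<Phi> u)" for u
    unfolding \<Phi>_def by (intro continuous_intros Ic)
  have In: "norm (I u s) \<le> B * max 0 s" for u s
  proof -
    have "norm (I u s) \<le> integral {0..max 0 s} (\<lambda>_. B)"
      unfolding I_def by (rule integral_norm_bound_integral[OF Gi integrable_const_ivl]) (simp add: G_def bnd)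
    then show ?thesis by (simp add: mult.commute)
  qed
  \<comment> \<open>The bound on \<open>f\<close> lets the integral grow at most linearly, which the
    exponential weight absorbs; hence the operator stays within the bounded functions.\<close>
  have \<Phi>b: "norm (\<Phi> u s) \<le> B / (2 * M)" for u s
  proof -
    let ?S = "max 0 s"
    have "2 * M * ?S \<le> exp (2 * M * ?S)" using exp_ge_add_one_self[of "2 * M * ?S"] by linarith
    then have "exp (- (2 * M * ?S)) * (2 * M * ?S) \<le> 1" by (simp add: exp_minus field_simps)
    then have 1: "exp (- (2 * M * ?S)) * ?S \<le> 1 / (2 * M)" using M by (simp add: field_simps)
    have "norm (\<Phi> u s) \<le> exp (- (2 * M * ?S)) * (B * ?S)"
      unfolding \<Phi>_def by (simp add: In)
    also have "\<dots> = B * (exp (- (2 * M * ?S)) * ?S)" by simp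
    also have "\<dots> \<le> B * (1 / (2 * M))" by (rule mult_left_mono[OF 1 B])
    finally show ?thesis by simp
  qed
  have \<Phi>in: "\<Phi> u \<in> bcontfun" for u by (rule bcontfun_normI[OF \<Phi>c \<Phi>b])
  define T where "T u = Bcontfun (\<Phi> u)" for u
  have T: "apply_bcontfun (T u) = \<Phi> u" for u by (simp add: T_def Bcontfun_inverse \<Phi>in)
  have contr: "dist (T u) (T w) \<le> 1/2 * dist u w" for u w
  proof (rule dist_bound)
    fix s :: real
    let ?S = "max 0 s" and ?d = "dist u w"
    have hi: "((\<lambda>r. M * exp (2 * M * r) * ?d) has_integral (exp (2 * M * ?S) * ?d / 2 - exp (2 * M * 0) * ?d / 2)) {0..?S}"
      by (rule fundamental_theorem_of_calculus)
        (auto intro!: derivative_eq_intros simp flip: has_real_derivative_iff_has_vector_derivative)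
    have "norm (I u s - I w s) = norm (integral {0..?S} (\<lambda>r. G u r - G w r))"
      by (simp add: I_def Henstock_Kurzweil_Integration.integral_diff[OF Gi Gi])
    also have "\<dots> \<le> integral {0..?S} (\<lambda>r. M * exp (2 * M * r) * ?d)"
    proof (rule integral_norm_bound_integral)
      fix r
      have "norm (G u r - G w r) \<le> M * norm (exp (2 * M * r) *\<^sub>R apply_bcontfun u r - exp (2 * M * r) *\<^sub>R apply_bcontfun w r)"
        unfolding G_def using fl[of "y0 + exp (2 * M * r) *\<^sub>R apply_bcontfun u r" "y0 + exp (2 * M * r) *\<^sub>R apply_bcontfun w r"] by simp
      also have "\<dots> = M * (exp (2 * M * r) * dist (apply_bcontfun u r) (apply_bcontfun w r))"
        by (simp add: dist_norm flip: scaleR_diff_right)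
      also have "\<dots> \<le> M * (exp (2 * M * r) * ?d)"
        using M dist_bounded[of u r w] by (intro mult_left_mono) auto
      finally show "norm (G u r - G w r) \<le> M * exp (2 * M * r) * ?d" by simp
    qed (use hi in \<open>auto intro: integrable_diff Gi\<close>)
    also have "\<dots> = exp (2 * M * ?S) * ?d / 2 - ?d / 2" using integral_unique[OF hi] by simp
    also have "\<dots> \<le> exp (2 * M * ?S) * (?d / 2)" by simp
    finally have le: "norm (I u s - I w s) \<le> exp (2 * M * ?S) * (?d / 2)" .
    have "dist (\<Phi> u s) (\<Phi> w s) = exp (- (2 * M * ?S)) * norm (I u s - I w s)"
      by (simp add: \<Phi>_def dist_norm flip: scaleR_diff_right)
    also have "\<dots> \<le> exp (- (2 * M * ?S)) * (exp (2 * M * ?S) * (?d / 2))"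
      by (rule mult_left_mono[OF le]) simp
    also have "\<dots> = 1/2 * ?d" by (simp add: exp_minus)
    finally show "dist (apply_bcontfun (T u) s) (apply_bcontfun (T w) s) \<le> 1/2 * ?d" by (simp add: T)
  qed
  have "\<exists>!u. T u = u" by (rule banach_fix_type[of "1/2"]) (use contr in auto)
  then obtain u where u: "T u = u" by blast
  define y where "y s = y0 + exp (2 * M * s) *\<^sub>R apply_bcontfun u s" for s
  have yI: "y s = y0 + integral {0..s} (\<lambda>r. f (y r))" if "s \<ge> 0" for s
  proof -
    have "apply_bcontfun u s = \<Phi> u s" using u T by metis
    then have "y s = y0 + I u s" using that by (simp add: y_def \<Phi>_def exp_minus)
    moreover have "G u = (\<lambda>r. f (y r))" by (simp add: G_def y_def fun_eq_iff)
    ultimately show ?thesis using that by (simp add: I_def)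
  qed
  show thesis
  proof (rule that)
    show "y 0 = y0" using yI[of 0] by simp
    fix s :: real assume s: "s \<ge> 0"
    have c: "continuous_on {0..s + 1} (\<lambda>r. f (y r))"
      using Gc[of _ u] by (simp add: G_def y_def)
    have "((\<lambda>s. y0 + integral {0..s} (\<lambda>r. f (y r))) has_vector_derivative f (y s)) (at s within {0..s+1})"
      using integral_has_vector_derivative[OF c, of s] s by (auto intro!: derivative_eq_intros)
    then have "(y has_vector_derivative f (y s)) (at s within {0..s+1})"
      by (rule has_vector_derivative_transform[rotated 2]) (use s yI in auto)
    moreover have "at s within {0..s+1} = at s within {0..}"
      by (rule at_within_nhd[of _ "{..<s+1}"]) auto
    ultimately show "(y has_vector_derivative f (y s)) (at s within {0..})" by simp
  qed
qed

text \<open>The squared distance of two solutions, multiplied by \<open>exp (- 2 L s)\<close>, has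
  nonpositive derivative and vanishes at 0.\<close>

lemma ode_unique:
  fixes f :: "'a::real_inner \<Rightarrow> 'a"
  assumes lip: "L-lipschitz_on K f" and "y 0 = z 0"
    and y: "\<And>s. s \<in> {0..S} \<Longrightarrow> (y has_vector_derivative f (y s)) (at s within {0..}) \<and> y s \<in> K"
    and z: "\<And>s. s \<in> {0..S} \<Longrightarrow> (z has_vector_derivative f (z s)) (at s within {0..}) \<and> z s \<in> K"
    and s: "s \<in> {0..S}"
  shows "y s = z s"
proof -
  let ?\<phi> = "\<lambda>s. exp (- (2 * L * s)) * ((y s - z s) \<bullet> (y s - z s))"
  have d: "(?\<phi> has_real_derivative exp (- (2 * L * r)) * (2 * ((y r - z r) \<bullet> (f (y r) - f (z r))) - 2 * L * ((y r - z r) \<bullet> (y r - z r))))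
      (at r within {0..})" if "r \<in> {0..S}" for r
  proof -
    have "((\<lambda>s. y s - z s) has_vector_derivative (f (y r) - f (z r))) (at r within {0..})"
      using y[OF that] z[OF that] by (intro has_vector_derivative_diff) auto
    then have "((\<lambda>s. (y s - z s) \<bullet> (y s - z s)) has_real_derivative 2 * ((y r - z r) \<bullet> (f (y r) - f (z r)))) (at r within {0..})"
      unfolding has_real_derivative_iff_has_vector_derivative
      using bounded_bilinear.has_vector_derivative[OF bounded_bilinear_inner] by (fastforce simp: inner_commute)
    note dN = this
    have dE: "((\<lambda>s. exp (- (2 * L * s))) has_real_derivative exp (- (2 * L * r)) * (- (2 * L))) (at r within {0..})"
      by (auto intro!: derivative_eq_intros)
    show ?thesis
      by (rule DERIV_cong[OF DERIV_mult[OF dE dN]]) (simp add: right_diff_distrib mult_ac)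
  qed
  have "?\<phi> s \<le> ?\<phi> 0"
  proof (rule DERIV_nonpos_imp_decreasing_open[of 0 s ?\<phi>])
    show "0 \<le> s" using s by simp
    show "continuous_on {0..s} ?\<phi>"
      unfolding continuous_on_eq_continuous_within
    proof
      fix r assume r: "r \<in> {0..s}"
      with s have "continuous (at r within {0..}) ?\<phi>" by (intro DERIV_continuous[OF d]) auto
      then show "continuous (at r within {0..s}) ?\<phi>" by (rule continuous_within_subset) auto
    qed
    fix r assume r: "0 < r" "r < s"
    let ?D = "exp (- (2 * L * r)) * (2 * ((y r - z r) \<bullet> (f (y r) - f (z r))) - 2 * L * ((y r - z r) \<bullet> (y r - z r)))"
    have "at r within {0..} = at r" using r by (intro at_within_interior) (simp add: interior_Ici)
    then have "(?\<phi> has_real_derivative ?D) (at r)" using d[of r] r s by simp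
    moreover have "?D \<le> 0"
    proof -
      have "y r \<in> K" "z r \<in> K" using y[of r] z[of r] r s by auto
      then have "norm (f (y r) - f (z r)) \<le> L * norm (y r - z r)"
        using lipschitz_onD[OF lip] by (simp add: dist_norm)
      then have "(y r - z r) \<bullet> (f (y r) - f (z r)) \<le> norm (y r - z r) * (L * norm (y r - z r))"
        by (intro order_trans[OF norm_cauchy_schwarz] mult_left_mono) auto
      also have "\<dots> = L * ((y r - z r) \<bullet> (y r - z r))" by (simp add: dot_square_norm power2_eq_square)
      finally show ?thesis by (simp add: mult_le_0_iff)
    qed
    ultimately show "\<exists>D. (?\<phi> has_real_derivative D) (at r) \<and> D \<le> 0" by blast
  qed
  then have "exp (- (2 * L * s)) * ((y s - z s) \<bullet> (y s - z s)) \<le> 0" using assms(2) by simp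
  then have "(y s - z s) \<bullet> (y s - z s) \<le> 0" by (simp add: mult_le_0_iff)
  then show ?thesis using inner_ge_zero[of "y s - z s"] by simp
qed

text \<open>A continuity argument at the infimum of the exit times: the curve is still in
  \<open>K\<close> there because \<open>K\<close> is closed, hence in its interior by the a priori
  hypothesis, and it stays in \<open>K\<close> for a little longer.\<close>

lemma stays_in_compact:
  fixes y :: "real \<Rightarrow> 'a::euclidean_space"
  assumes "compact K" "y 0 \<in> K" "S \<ge> 0" and cont: "continuous_on {0..} y"
    and apriori: "\<And>\<tau>. \<tau> \<in> {0..S} \<Longrightarrow> (\<And>s. s \<in> {0..\<tau>} \<Longrightarrow> y s \<in> K) \<Longrightarrow> y \<tau> \<in> interior K"
    and s: "s \<in> {0..S}"
  shows "y s \<in> K"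
proof (rule ccontr)
  assume "y s \<notin> K"
  define B where "B = {r \<in> {0..S}. y r \<notin> K}"
  have B: "B \<noteq> {}" "bdd_below B" using \<open>y s \<notin> K\<close> s by (auto simp: B_def intro!: bdd_belowI[of _ 0])
  define \<sigma> where "\<sigma> = Inf B"
  have "\<sigma> \<le> s" unfolding \<sigma>_def using s \<open>y s \<notin> K\<close> by (intro cInf_lower B) (auto simp: B_def)
  moreover have "0 \<le> \<sigma>" unfolding \<sigma>_def by (intro cInf_greatest B) (auto simp: B_def)
  ultimately have \<sigma>: "\<sigma> \<in> {0..S}" using s by auto
  have below: "y r \<in> K" if "0 \<le> r" "r < \<sigma>" for r
  proof (rule ccontr)
    assume "y r \<notin> K"
    with that \<sigma> have "r \<in> B" by (auto simp: B_def)
    then show False using cInf_lower[OF _ B(2)] that by (force simp: \<sigma>_def)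
  qed
  have "y \<sigma> \<in> K"
  proof (cases "\<sigma> = 0")
    case False
    then have "\<sigma> > 0" using \<sigma> by simp
    have "continuous_on {0..\<sigma>} y" using cont by (rule continuous_on_subset) auto
    then have "closed ({0..\<sigma>} \<inter> y -` K)"
      using \<open>compact K\<close> by (intro continuous_closed_preimage compact_imp_closed) auto
    moreover have "{0..<\<sigma>} \<subseteq> {0..\<sigma>} \<inter> y -` K" using below by auto
    ultimately have "closure {0..<\<sigma>} \<subseteq> {0..\<sigma>} \<inter> y -` K" by (intro closure_minimal)
    moreover have "\<sigma> \<in> closure {0..<\<sigma>}" using \<open>\<sigma> > 0\<close> by simp
    ultimately show ?thesis by blast
  qed (use assms in simp)
  then have "y r \<in> K" if "r \<in> {0..\<sigma>}" for r using below that by (cases "r = \<sigma>") auto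
  then have "y \<sigma> \<in> interior K" by (rule apriori[OF \<sigma>])
  moreover have "continuous (at \<sigma> within {0..}) y" using cont \<sigma> by (auto simp: continuous_on_eq_continuous_within)
  ultimately have "\<forall>\<^sub>F r in at \<sigma> within {0..}. y r \<in> interior K"
    by (auto simp: continuous_within intro: topological_tendstoD)
  then obtain e where e: "e > 0" "\<And>r. r \<ge> 0 \<Longrightarrow> r \<noteq> \<sigma> \<Longrightarrow> dist r \<sigma> < e \<Longrightarrow> y r \<in> interior K"
    unfolding eventually_at by auto
  have "\<sigma> + e \<le> r" if "r \<in> B" for r
  proof (rule ccontr)
    assume "\<not> \<sigma> + e \<le> r"
    moreover have "\<sigma> \<le> r" unfolding \<sigma>_def by (rule cInf_lower[OF that B(2)])
    moreover have "r \<noteq> \<sigma>" using that \<open>y \<sigma> \<in> K\<close> by (auto simp: B_def)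
    ultimately have "y r \<in> interior K" using e(2)[of r] \<sigma> by (auto simp: dist_real_def)
    then show False using that interior_subset by (auto simp: B_def)
  qed
  then have "\<sigma> + e \<le> \<sigma>" unfolding \<sigma>_def by (intro cInf_greatest B)
  then show False using e(1) by simp
qed

text \<open>For each horizon \<open>S\<close> the field is composed with the nearest-point
  projection onto \<open>K S\<close>, which makes it bounded and globally Lipschitz. The a priori
  hypothesis shows that the solution never leaves \<open>K S\<close>, so the projection has no
  effect on it. The compact sets may grow with \<open>S\<close>; the solutions are glued by
  uniqueness.\<close>

theorem ode_global_solution:
  fixes f :: "'a::euclidean_space \<Rightarrow> 'a"
  assumes K: "\<And>S. compact (K S) \<and> convex (K S) \<and> y0 \<in> K S \<and> K S \<subseteq> \<Omega>"
    and lip: "\<And>S. \<exists>L. L-lipschitz_on (K S) f"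
    and apriori: "\<And>S \<tau> y. \<tau> \<in> {0..S} \<Longrightarrow> y 0 = y0 \<Longrightarrow>
       (\<And>s. s \<in> {0..\<tau>} \<Longrightarrow> y s \<in> K S \<and> (y has_vector_derivative f (y s)) (at s within {0..})) \<Longrightarrow> y \<tau> \<in> interior (K S)"
  obtains y where "y 0 = y0" "\<And>s. s \<ge> 0 \<Longrightarrow> y s \<in> \<Omega> \<and> (y has_vector_derivative f (y s)) (at s within {0..})"
proof -
  have ex: "\<exists>y. y 0 = y0 \<and> continuous_on {0..} y \<and>
     (\<forall>s\<in>{0..S}. y s \<in> K S \<and> (y has_vector_derivative f (y s)) (at s within {0..}))" if "S \<ge> 0" for S
  proof -
    note KS = K[of S]
    have cl: "closed (K S)" "K S \<noteq> {}" using KS by (auto simp: compact_imp_closed)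
    obtain L where L: "L-lipschitz_on (K S) f" using lip by blast
    \<comment> \<open>Convexity of \<open>K S\<close> makes the projection Lipschitz with constant
      1.\<close>
    define F where "F x = f (closest_point (K S) x)" for x
    have cp: "closest_point (K S) x \<in> K S" for x using cl by (rule closest_point_in_set)
    have lipF: "L-lipschitz_on UNIV F"
    proof (rule lipschitz_onI)
      fix x z
      have "dist (F x) (F z) \<le> L * dist (closest_point (K S) x) (closest_point (K S) z)"
        unfolding F_def by (rule lipschitz_onD[OF L cp cp])
      also have "\<dots> \<le> L * dist x z"
        using KS cl lipschitz_on_nonneg[OF L] by (intro mult_left_mono closest_point_lipschitz) auto
      finally show "dist (F x) (F z) \<le> L * dist x z" .
    qed (rule lipschitz_on_nonneg[OF L])
    have "bounded (f ` K S)"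
      using KS lipschitz_on_continuous_on[OF L] by (intro compact_imp_bounded compact_continuous_image) auto
    then obtain B where bndF: "\<And>x. norm (F x) \<le> B" using cp unfolding F_def bounded_iff by blast
    obtain y where y: "y 0 = y0" "\<And>s. s \<ge> 0 \<Longrightarrow> (y has_vector_derivative F (y s)) (at s within {0..})"
      using picard_global[OF lipF bndF, of y0] by blast
    have c: "continuous_on {0..} y"
      using y(2) has_vector_derivative_continuous by (fastforce simp: continuous_on_eq_continuous_within)
    have F: "F x = f x" if "x \<in> K S" for x using that by (simp add: F_def closest_point_self)
    have "y s \<in> K S" if "s \<in> {0..S}" for s
    proof (rule stays_in_compact[OF _ _ \<open>S \<ge> 0\<close> c _ that])
      show "compact (K S)" "y 0 \<in> K S" using KS y(1) by auto
      show "y \<tau> \<in> interior (K S)" if "\<tau> \<in> {0..S}" "\<And>s. s \<in> {0..\<tau>} \<Longrightarrow> y s \<in> K S" for \<tau>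
      proof (rule apriori[where y = y, OF that(1) y(1)])
        fix s assume s: "s \<in> {0..\<tau>}"
        then show "y s \<in> K S \<and> (y has_vector_derivative f (y s)) (at s within {0..})"
          using that(2)[OF s] y(2)[of s] F by auto
      qed
    qed
    note inK = this
    show ?thesis
    proof (intro exI[of _ y] conjI ballI)
      fix s assume s: "s \<in> {0..S}"
      show "y s \<in> K S" by (rule inK[OF s])
      show "(y has_vector_derivative f (y s)) (at s within {0..})"
        using y(2)[of s] F[OF inK[OF s]] s by simp
    qed (use y c in auto)
  qed
  define Y where "Y n = (SOME y. y 0 = y0 \<and> continuous_on {0..} y \<and>
     (\<forall>s\<in>{0..real n}. y s \<in> K (real n) \<and> (y has_vector_derivative f (y s)) (at s within {0..})))" for n :: nat
  have Y: "Y n 0 = y0" "continuous_on {0..} (Y n)"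
     "\<And>s. s \<in> {0..real n} \<Longrightarrow> Y n s \<in> K (real n) \<and> (Y n has_vector_derivative f (Y n s)) (at s within {0..})" for n
    using someI_ex[OF ex[of "real n"]] by (auto simp: Y_def)
  \<comment> \<open>The solution for the longer horizon also stays in the smaller compact set up to
    time \<open>n\<close>, since the a priori hypothesis holds for every solution. Both are then
    compared on one set with one Lipschitz constant.\<close>
  have eq: "Y m s = Y n s" if "n \<le> m" "s \<in> {0..real n}" for n m s
  proof -
    obtain L where L: "L-lipschitz_on (K (real n)) f" using lip by blast
    have in_K: "Y m r \<in> K (real n)" if r: "r \<in> {0..real n}" for r
    proof (rule stays_in_compact[OF _ _ _ Y(2) _ r])
      show "compact (K (real n))" "Y m 0 \<in> K (real n)" using K Y(1) by auto
      show "Y m \<tau> \<in> interior (K (real n))" if t: "\<tau> \<in> {0..real n}" "\<And>s. s \<in> {0..\<tau>} \<Longrightarrow> Y m s \<in> K (real n)" for \<tau>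
      proof (rule apriori[where y = "Y m", OF t(1) Y(1)])
        fix s assume s: "s \<in> {0..\<tau>}"
        then have "s \<in> {0..real m}" using t(1) \<open>n \<le> m\<close> by auto
        then show "Y m s \<in> K (real n) \<and> (Y m has_vector_derivative f (Y m s)) (at s within {0..})"
          using t(2)[OF s] Y(3) by blast
      qed
    qed simp
    show ?thesis
    proof (rule ode_unique[OF L _ _ _ that(2)])
      show "Y m 0 = Y n 0" by (simp add: Y(1))
      fix r assume r: "r \<in> {0..real n}"
      then have "r \<in> {0..real m}" using \<open>n \<le> m\<close> by auto
      then show "(Y m has_vector_derivative f (Y m r)) (at r within {0..}) \<and> Y m r \<in> K (real n)"
        using in_K[OF r] Y(3) by blast
      show "(Y n has_vector_derivative f (Y n r)) (at r within {0..}) \<and> Y n r \<in> K (real n)"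
        using Y(3)[OF r] by blast
    qed
  qed
  define y where "y s = Y (nat \<lceil>s\<rceil>) s" for s
  have yY: "y s = Y n s" if "0 \<le> s" "s \<le> real n" for s n
    unfolding y_def using that by (intro eq[symmetric]) (auto simp: ceiling_le_iff nat_le_iff real_nat_ceiling_ge)
  show thesis
  proof (rule that)
    show "y 0 = y0" using yY[of 0 0] Y(1) by simp
    fix s :: real assume s: "s \<ge> 0"
    \<comment> \<open>The extra unit of time leaves a neighbourhood of \<open>s\<close> on which
      \<open>y\<close> is the single solution \<open>Y n\<close>.\<close>
    define n where "n = nat \<lceil>s\<rceil> + 1"
    have n: "s + 1 \<le> real n" unfolding n_def by (simp add: real_nat_ceiling_ge)
    have Yn: "Y n s \<in> K (real n) \<and> (Y n has_vector_derivative f (Y n s)) (at s within {0..})"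
      using Y(3)[of s n] s n by simp
    have ys: "y s = Y n s" using yY[of s n] s n by simp
    have "(y has_vector_derivative f (y s)) (at s within {0..})"
      unfolding ys
    proof (rule has_vector_derivative_transform_within[OF _ zero_less_one])
      show "(Y n has_vector_derivative f (Y n s)) (at s within {0..})" using Yn by blast
      fix r :: real assume "r \<in> {0..}" "dist r s < 1"
      then show "Y n r = y r" using n by (intro yY[symmetric]) (auto simp: dist_real_def)
    qed (use s in simp)
    moreover have "y s \<in> \<Omega>" using ys Yn K by auto
    ultimately show "y s \<in> \<Omega> \<and> (y has_vector_derivative f (y s)) (at s within {0..})" by blast
  qed
qed

subsection \<open>Completeness\<close>

lemma has_vector_derivative_within_Un:
  "(f has_vector_derivative d) (at x within A) \<Longrightarrow> (f has_vector_derivative d) (at x within B) \<Longrightarrow>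
   (f has_vector_derivative d) (at x within A \<union> B)"
  unfolding has_vector_derivative_def has_derivative_within by (simp add: Lim_within_Un)

lemma lipschitz_on_mult_real:
  fixes g h :: "'a::metric_space \<Rightarrow> real"
  assumes "compact K" "L-lipschitz_on K g" "M-lipschitz_on K h"
  shows "\<exists>N. N-lipschitz_on K (\<lambda>x. g x * h x)"
proof -
  have "bounded (g ` K)" "bounded (h ` K)"
    using assms by (auto intro!: compact_imp_bounded compact_continuous_image lipschitz_on_continuous_on)
  then obtain A B where AB: "\<And>x. x \<in> K \<Longrightarrow> \<bar>g x\<bar> \<le> A" "\<And>x. x \<in> K \<Longrightarrow> \<bar>h x\<bar> \<le> B"
    by (auto simp: bounded_iff)
  note nn = lipschitz_on_nonneg[OF assms(2)] lipschitz_on_nonneg[OF assms(3)]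
  have "(\<bar>A\<bar> * M + \<bar>B\<bar> * L)-lipschitz_on K (\<lambda>x. g x * h x)"
  proof (rule lipschitz_onI)
    fix x y assume xy: "x \<in> K" "y \<in> K"
    have "g x * h x - g y * h y = g x * (h x - h y) + h y * (g x - g y)" by (simp add: algebra_simps)
    then have "\<bar>g x * h x - g y * h y\<bar> \<le> \<bar>g x\<bar> * \<bar>h x - h y\<bar> + \<bar>h y\<bar> * \<bar>g x - g y\<bar>"
      by (metis abs_mult abs_triangle_ineq)
    also have "\<dots> \<le> \<bar>A\<bar> * (M * dist x y) + \<bar>B\<bar> * (L * dist x y)"
      using AB xy lipschitz_onD[OF assms(2) xy] lipschitz_onD[OF assms(3) xy]
      by (intro add_mono mult_mono) (auto simp: dist_real_def intro: order_trans[OF _ abs_ge_self])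
    finally show "dist (g x * h x) (g y * h y) \<le> (\<bar>A\<bar> * M + \<bar>B\<bar> * L) * dist x y"
      by (simp add: dist_real_def algebra_simps)
  qed (use nn in auto)
  then show ?thesis by blast
qed

lemma lipschitz_on_sum_real:
  fixes g :: "'b \<Rightarrow> 'a::metric_space \<Rightarrow> real"
  assumes "\<And>i. i \<in> I \<Longrightarrow> \<exists>L. L-lipschitz_on K (g i)"
  shows "\<exists>L. L-lipschitz_on K (\<lambda>x. \<Sum>i\<in>I. g i x)"
  using assms
proof (induction I rule: infinite_finite_induct)
  case (insert i I)
  obtain L where L: "L-lipschitz_on K (g i)" using insert.prems by blast
  obtain M where "M-lipschitz_on K (\<lambda>x. \<Sum>i\<in>I. g i x)" using insert.IH insert.prems by blast
  from lipschitz_on_add[OF L this] show ?case using insert.hyps by auto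
qed (auto intro: lipschitz_on_constant)

lemma lipschitz_on_vec:
  fixes F :: "'a::metric_space \<Rightarrow> real ^ 'n::finite"
  assumes "\<And>k. \<exists>L. L-lipschitz_on K (\<lambda>x. F x $ k)"
  shows "\<exists>L. L-lipschitz_on K F"
proof -
  obtain L where L: "\<And>k. (L k)-lipschitz_on K (\<lambda>x. F x $ k)" using assms by metis
  have "(\<Sum>k\<in>UNIV. L k)-lipschitz_on K F"
  proof (rule lipschitz_onI)
    fix x y assume xy: "x \<in> K" "y \<in> K"
    have "dist (F x) (F y) \<le> (\<Sum>k\<in>UNIV. \<bar>(F x - F y) $ k\<bar>)"
      unfolding dist_norm by (rule norm_le_l1_cart)
    also have "\<dots> \<le> (\<Sum>k\<in>UNIV. L k * dist x y)"
      using lipschitz_onD[OF L xy] by (intro sum_mono) (simp add: dist_real_def)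
    finally show "dist (F x) (F y) \<le> (\<Sum>k\<in>UNIV. L k) * dist x y" by (simp add: sum_distrib_right)
  qed (auto intro: sum_nonneg lipschitz_on_nonneg[OF L])
  then show ?thesis by blast
qed

text \<open>Mean value inequality, with the sum of the absolute partial derivatives as a bound on
  the derivative over the compact set.\<close>

lemma smooth_fun_on_lipschitz:
  fixes f :: "real ^ 'n::finite \<Rightarrow> real"
  assumes "smooth_fun_on f U" "open U" "compact C" "convex C" "C \<subseteq> U"
  shows "\<exists>L. L-lipschitz_on C f"
proof -
  have "continuous_on C (\<lambda>x. \<Sum>i\<in>UNIV. \<bar>partial_deriv i f x\<bar>)"
    by (intro continuous_intros continuous_on_subset[OF smooth_fun_on_continuous[OF smooth_fun_on_partial_deriv[OF assms(1)]] assms(5)])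
  then have "bounded ((\<lambda>x. \<Sum>i\<in>UNIV. \<bar>partial_deriv i f x\<bar>) ` C)"
    using assms(3) by (intro compact_imp_bounded compact_continuous_image)
  then obtain B where B: "\<And>x. x \<in> C \<Longrightarrow> \<bar>\<Sum>i\<in>UNIV. \<bar>partial_deriv i f x\<bar>\<bar> \<le> B"
    by (auto simp: bounded_iff)
  have "\<bar>B\<bar>-lipschitz_on C f"
  proof (rule lipschitz_onI)
    fix x y assume xy: "x \<in> C" "y \<in> C"
    have "norm (f x - f y) \<le> \<bar>B\<bar> * norm (x - y)"
    proof (rule differentiable_bound[OF assms(4) _ _ xy])
      fix z assume z: "z \<in> C"
      show "(f has_derivative (\<lambda>v. \<Sum>i\<in>UNIV. v $ i * partial_deriv i f z)) (at z within C)"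
        using has_derivative_partial_deriv[OF smooth_fun_on_differentiable[OF assms(1)]] z assms(5)
        by (blast intro: has_derivative_at_withinI)
      show "onorm (\<lambda>v. \<Sum>i\<in>UNIV. v $ i * partial_deriv i f z) \<le> \<bar>B\<bar>"
      proof (rule onorm_bound)
        fix v :: "real ^ 'n"
        have "norm (\<Sum>i\<in>UNIV. v $ i * partial_deriv i f z) \<le> (\<Sum>i\<in>UNIV. norm v * \<bar>partial_deriv i f z\<bar>)"
          by (intro sum_norm_le) (simp add: abs_mult component_le_norm_cart mult_right_mono)
        also have "\<dots> = (\<Sum>i\<in>UNIV. \<bar>partial_deriv i f z\<bar>) * norm v" by (simp add: sum_distrib_left mult.commute)
        also have "\<dots> \<le> \<bar>B\<bar> * norm v" using B[OF z] by (intro mult_right_mono) auto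
        finally show "norm (\<Sum>i\<in>UNIV. v $ i * partial_deriv i f z) \<le> \<bar>B\<bar> * norm v" .
      qed simp
    qed
    then show "dist (f x) (f y) \<le> \<bar>B\<bar> * dist x y" by (simp add: dist_norm)
  qed simp
  then show ?thesis by blast
qed

lemma abs_le_of_sq_bound:
  fixes z E m :: real
  assumes "m > 0" "m * z\<^sup>2 \<le> E"
  shows "\<bar>z\<bar> < sqrt (E / m) + 1"
proof -
  have "z\<^sup>2 \<le> E / m" using assms by (simp add: field_simps)
  then have "\<bar>z\<bar> \<le> sqrt (E / m)" by (simp add: real_le_rsqrt)
  then show ?thesis by simp
qed

context heis_jet
begin

definition accel :: "real ^ 4 \<Rightarrow> real ^ 4 \<Rightarrow> real ^ 4" where
  "accel x v = (\<chi> k. - (\<Sum>i\<in>UNIV. \<Sum>j\<in>UNIV. christoffel (hmet P H) k i j x * v $ i * v $ j))"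

lemma energy_constant_within:
  assumes "convex S" "0 \<in> S" "\<And>s. s \<in> S \<Longrightarrow> c s $ 1 \<in> J"
    and c: "\<And>s. s \<in> S \<Longrightarrow> (c has_vector_derivative v s) (at s within S)"
    and v: "\<And>s. s \<in> S \<Longrightarrow> (v has_vector_derivative accel (c s) (v s)) (at s within S)"
    and s: "s \<in> S"
  shows "hmet P H (c s) (v s) (v s) = hmet P H (c 0) (v 0) (v 0)"
proof -
  have "((\<lambda>s. hmet P H (c s) (v s) (v s)) has_real_derivative 0) (at s within S)" if "s \<in> S" for s
  proof -
    have U: "c s \<in> interval_times_heis J" using assms(3)[OF that] by (simp add: interval_times_heis_def)
    have "accel (c s) (v s) = - (\<chi> k. (\<Sum>i\<in>UNIV. \<Sum>j\<in>UNIV. christoffel (hmet P H) k i j (c s) * v s $ i * v s $ j))"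
      by (simp add: vec_eq_iff accel_def)
    then have "hmet P H (c s) (v s) (accel (c s) (v s)) = - christoffel_first (hmetD P' H H' (c s)) (v s) (v s) (v s)"
      using metric_christoffel[OF U] bilinear_lneg[OF bilin[OF U]] sym[OF U] by simp
    then have "hmet P H (c s) (v s) (accel (c s) (v s)) = - hmetD P' H H' (c s) (v s) (v s) (v s) / 2"
      by (simp add: christoffel_first_def)
    then show ?thesis
      using geodesic_energy_deriv[OF assms(3) that c[OF that] v[OF that, unfolded accel_def] v[OF that]] by simp
  qed
  then obtain k where "\<And>s. s \<in> S \<Longrightarrow> hmet P H (c s) (v s) (v s) = k"
    using has_field_derivative_zero_constant[OF assms(1), of "\<lambda>s. hmet P H (c s) (v s) (v s)"] by blast
  then show ?thesis using s assms(2) by simp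
qed

lemma geodesic_field_lipschitz:
  assumes "cbox a b \<subseteq> interval_times_heis J"
  shows "\<exists>L. L-lipschitz_on (cbox (a, p) (b, q)) (\<lambda>(x, v). (v, accel x v))"
proof -
  let ?K = "cbox (a, p) (b, q) :: ((real ^ 4) \<times> (real ^ 4)) set"
  have K: "compact ?K" by (rule compact_cbox)
  have v: "\<exists>L. L-lipschitz_on ?K (\<lambda>z. snd z $ i)" for i
  proof -
    have "1-lipschitz_on ?K (\<lambda>z. snd z $ i)"
    proof (rule lipschitz_onI)
      fix y z :: "(real ^ 4) \<times> (real ^ 4)"
      have "dist (snd y $ i) (snd z $ i) \<le> dist (snd y) (snd z)" by (rule dist_vec_nth_le)
      also have "\<dots> \<le> dist y z" by (rule dist_snd_le)
      finally show "dist (snd y $ i) (snd z $ i) \<le> 1 * dist y z" by simp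
    qed simp
    then show ?thesis by blast
  qed
  have G: "\<exists>L. L-lipschitz_on ?K (\<lambda>z. christoffel (hmet P H) k i j (fst z))" for k i j
  proof -
    obtain L where L: "L-lipschitz_on (cbox a b) (christoffel (hmet P H) k i j)"
      using smooth_fun_on_lipschitz[OF christoffel_smooth open_U compact_cbox convex_box(1) assms] by blast
    have "L-lipschitz_on ?K (\<lambda>z. christoffel (hmet P H) k i j (fst z))"
    proof (rule lipschitz_onI)
      fix y z assume "y \<in> ?K" "z \<in> ?K"
      then have "fst y \<in> cbox a b" "fst z \<in> cbox a b" by (auto simp: cbox_Pair_eq)
      then have "dist (christoffel (hmet P H) k i j (fst y)) (christoffel (hmet P H) k i j (fst z)) \<le> L * dist (fst y) (fst z)"
        by (rule lipschitz_onD[OF L])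
      also have "\<dots> \<le> L * dist y z" using lipschitz_on_nonneg[OF L] by (intro mult_left_mono dist_fst_le)
      finally show "dist (christoffel (hmet P H) k i j (fst y)) (christoffel (hmet P H) k i j (fst z)) \<le> L * dist y z" .
    qed (rule lipschitz_on_nonneg[OF L])
    then show ?thesis by blast
  qed
  have m: "\<exists>L. L-lipschitz_on ?K (\<lambda>z. g z * h z)"
    if "\<exists>L. L-lipschitz_on ?K g" "\<exists>L. L-lipschitz_on ?K h" for g h :: "_ \<Rightarrow> real"
    using that lipschitz_on_mult_real[OF K] by blast
  have "\<exists>L. L-lipschitz_on ?K (\<lambda>z. accel (fst z) (snd z))"
  proof (rule lipschitz_on_vec)
    fix k
    obtain L where "L-lipschitz_on ?K (\<lambda>z. \<Sum>i\<in>UNIV. \<Sum>j\<in>UNIV. christoffel (hmet P H) k i j (fst z) * snd z $ i * snd z $ j)"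
    proof -
      have "\<exists>L. L-lipschitz_on ?K (\<lambda>z. \<Sum>i\<in>UNIV. \<Sum>j\<in>UNIV. christoffel (hmet P H) k i j (fst z) * snd z $ i * snd z $ j)"
        by (intro lipschitz_on_sum_real m G v)
      then show thesis using that by blast
    qed
    then have "L-lipschitz_on ?K (\<lambda>z. accel (fst z) (snd z) $ k)"
      unfolding accel_def vec_lambda_beta by (simp only: lipschitz_on_minus_iff)
    then show "\<exists>L. L-lipschitz_on ?K (\<lambda>z. accel (fst z) (snd z) $ k)" by blast
  qed
  moreover have "\<exists>L. L-lipschitz_on ?K (\<lambda>z. snd z :: real ^ 4)" by (rule lipschitz_on_vec[OF v])
  ultimately show ?thesis unfolding case_prod_unfold using lipschitz_on_Pair by blast
qed

text \<open>Energy bounds the speed in arc length, so \<open>T\<close> changes by at most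
  \<open>sqrt E * \<bar>S\<bar>\<close> up to time \<open>S\<close>; as \<open>T\<close> is onto,
  the interval coordinate is confined to a compact interval. There the metric is uniformly positive,
  which bounds the remaining velocities and then the positions.\<close>

theorem geodesically_complete_riemannian:
  assumes J: "is_interval J" and P_pos: "\<And>t. t \<in> J \<Longrightarrow> P t > 0"
    and H_pos: "\<And>t a. t \<in> J \<Longrightarrow> a \<noteq> 0 \<Longrightarrow> H t a a > 0"
    and T: "\<And>t. t \<in> J \<Longrightarrow> (T has_real_derivative sqrt (P t)) (at t)"
    and T_surj: "\<And>r. \<exists>t\<in>J. T t = r"
  shows "geodesically_complete (interval_times_heis J) (hmet P H)"
proof -
  have T_mono: "T s < T t" if "s \<in> J" "t \<in> J" "s < t" for s t
  proof (rule DERIV_pos_imp_increasing[OF that(3)])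
    fix r assume "s \<le> r" "r \<le> t"
    then have "r \<in> J" using J that unfolding is_interval_1 by blast
    then show "\<exists>y. (T has_real_derivative y) (at r) \<and> 0 < y" using T P_pos by fastforce
  qed
  have half: "\<exists>c v. c 0 = p \<and> v 0 = w \<and> (\<forall>s\<ge>0. c s \<in> interval_times_heis J \<and>
      (c has_vector_derivative v s) (at s within {0..}) \<and> (v has_vector_derivative accel (c s) (v s)) (at s within {0..}))"
    if p: "p \<in> interval_times_heis J" for p w
  proof -
    have p1: "p $ 1 \<in> J" using p by (simp add: interval_times_heis_def)
    define E where "E = hmet P H p w w"
    have H_nonneg: "0 \<le> H t a a" if "t \<in> J" for t a
      using H_pos[OF that, of a] bilinear_lzero[OF bil[OF that]] by (cases "a = 0") auto
    have E0: "E \<ge> 0"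
      using P_pos[OF p1] H_nonneg[OF p1] by (simp add: E_def hmet_def mult.assoc)
    \<comment> \<open>The margin 1 in the values of \<open>T\<close> puts the curve into the
      interior of the box, as \<open>ode_global_solution\<close> demands.\<close>
    have bounds: "\<exists>lo hi m. lo \<in> J \<and> hi \<in> J \<and> T lo = T (p $ 1) - (sqrt E * \<bar>S\<bar> + 1) \<and>
        T hi = T (p $ 1) + (sqrt E * \<bar>S\<bar> + 1) \<and> m > 0 \<and>
        (\<forall>t\<in>{lo..hi}. m \<le> P t \<and> (\<forall>a. m * (a \<bullet> a) \<le> H t a a))" for S
    proof -
      obtain lo hi where lh: "lo \<in> J" "hi \<in> J" "T lo = T (p $ 1) - (sqrt E * \<bar>S\<bar> + 1)"
          "T hi = T (p $ 1) + (sqrt E * \<bar>S\<bar> + 1)"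
        using T_surj by metis
      have sub: "{lo..hi} \<subseteq> J" using lh J unfolding is_interval_1 by (meson atLeastAtMost_iff subsetI)
      have r: "sqrt E * \<bar>S\<bar> + 1 > 0" using E0 by (simp add: add_nonneg_pos)
      then have "lo \<le> p $ 1" "p $ 1 \<le> hi"
        using T_mono[OF p1 lh(1)] T_mono[OF lh(2) p1] lh(3,4) by (smt (verit, best))+
      then have ne: "{lo..hi} \<noteq> {}" by auto
      have "continuous_on {lo..hi} P"
        using derP sub by (auto intro!: continuous_at_imp_continuous_on DERIV_isCont)
      then obtain t1 where t1: "t1 \<in> {lo..hi}" "\<And>t. t \<in> {lo..hi} \<Longrightarrow> P t1 \<le> P t"
        using continuous_attains_inf[OF compact_Icc ne] by blast
      have Hc: "continuous_on {lo..hi} (\<lambda>t. H t a b)" for a b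
        using derH sub by (auto intro!: continuous_at_imp_continuous_on DERIV_isCont)
      \<comment> \<open>The uniform lower bound for the forms is their minimum over the times in
        question and the unit sphere.\<close>
      have "continuous_on ({lo..hi} \<times> sphere 0 1)
          (\<lambda>z. \<Sum>a\<in>UNIV. \<Sum>b\<in>UNIV. snd z $ a * snd z $ b * H (fst z) (axis a 1) (axis b 1))"
        by (intro continuous_intros continuous_on_compose2[OF Hc continuous_on_fst[OF continuous_on_id]]) auto
      moreover have "(\<Sum>a\<in>UNIV. \<Sum>b\<in>UNIV. snd z $ a * snd z $ b * H (fst z) (axis a 1) (axis b 1))
          = H (fst z) (snd z) (snd z)" if "z \<in> {lo..hi} \<times> sphere 0 1" for z
        using bilinear_expand3[OF bil, of "fst z" "snd z" "snd z"] sub that by auto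
      ultimately have "continuous_on ({lo..hi} \<times> sphere 0 1) (\<lambda>z. H (fst z) (snd z) (snd z))"
        by (simp cong: continuous_on_cong)
      moreover have "compact ({lo..hi} \<times> sphere (0::real ^ 3) 1)" by (intro compact_Times compact_Icc compact_sphere)
      moreover have "{lo..hi} \<times> sphere (0::real ^ 3) 1 \<noteq> {}" using ne by simp
      ultimately obtain z where z: "z \<in> {lo..hi} \<times> sphere 0 1"
          "\<And>y. y \<in> {lo..hi} \<times> sphere 0 1 \<Longrightarrow> H (fst z) (snd z) (snd z) \<le> H (fst y) (snd y) (snd y)"
        using continuous_attains_inf[of "{lo..hi} \<times> sphere (0::real ^ 3) 1" "\<lambda>z. H (fst z) (snd z) (snd z)"] by blast
      define m where "m = min (P t1) (H (fst z) (snd z) (snd z))"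
      have "snd z \<noteq> 0" "fst z \<in> J" using z(1) sub by auto
      then have m: "m > 0" using H_pos P_pos t1(1) sub by (auto simp: m_def)
      have mP: "m \<le> P t" if "t \<in> {lo..hi}" for t using t1(2)[OF that] by (simp add: m_def)
      have mH: "m * (a \<bullet> a) \<le> H t a a" if t: "t \<in> {lo..hi}" for t a
      proof (cases "a = 0")
        case True
        then show ?thesis using H_nonneg t sub by auto
      next
        case False
        define u where "u = (1 / norm a) *\<^sub>R a"
        have "norm u = 1" using False by (simp add: u_def)
        then have "m \<le> H t u u" using z(2)[of "(t, u)"] t by (simp add: m_def)
        moreover have "H t a a = (norm a * norm a) * H t u u"
        proof -
          have "a = norm a *\<^sub>R u" using False by (simp add: u_def)
          then have "H t a a = H t (norm a *\<^sub>R u) (norm a *\<^sub>R u)" by simp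
          then show ?thesis using bil[of t] t sub by (simp add: bilinear_lmul bilinear_rmul subset_iff)
        qed
        ultimately show ?thesis
          using mult_right_mono[of m "H t u u" "norm a * norm a"]
          by (simp add: dot_square_norm power2_eq_square mult.commute)
      qed
      show ?thesis using lh m mP mH by blast
    qed
    then obtain lo hi m where lo: "\<And>S. lo S \<in> J" and hi: "\<And>S. hi S \<in> J"
      and Tlo: "\<And>S. T (lo S) = T (p $ 1) - (sqrt E * \<bar>S\<bar> + 1)"
      and Thi: "\<And>S. T (hi S) = T (p $ 1) + (sqrt E * \<bar>S\<bar> + 1)"
      and m: "\<And>S. m S > 0" and mP: "\<And>S t. t \<in> {lo S..hi S} \<Longrightarrow> m S \<le> P t"
      and mH: "\<And>S t a. t \<in> {lo S..hi S} \<Longrightarrow> m S * (a \<bullet> a) \<le> H t a a"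
      by metis
    \<comment> \<open>The constants are ordered by dependence: \<open>V\<close> bounds the velocity
      in the interval direction and in the invariant frame, \<open>X\<close> the two planar
      positions, \<open>V4\<close> the last velocity, which contains products of planar positions
      and velocities, and \<open>Z\<close> the last position.\<close>
    define V where "V S = sqrt (E / m S) + 1" for S
    define X where "X S = \<bar>p $ 2\<bar> + \<bar>p $ 3\<bar> + V S * \<bar>S\<bar> + 1" for S
    define V4 where "V4 S = V S + V S * X S" for S
    define Z where "Z S = \<bar>p $ 4\<bar> + V4 S * \<bar>S\<bar> + 1" for S
    have V: "V S \<ge> 1" "X S \<ge> 1" "V4 S \<ge> V S" "V4 S \<ge> 1" "Z S \<ge> 1" for S
    proof -
      show v: "V S \<ge> 1" using E0 m[of S] by (simp add: V_def)
      then show x: "X S \<ge> 1" by (simp add: X_def)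
      show "V4 S \<ge> V S" "V4 S \<ge> 1" using v x by (simp_all add: V4_def add_increasing2)
      then show "Z S \<ge> 1" by (simp add: Z_def)
    qed
    define a :: "real \<Rightarrow> real ^ 4" where "a S = vector [lo S, - X S, - X S, - Z S]" for S
    define b :: "real \<Rightarrow> real ^ 4" where "b S = vector [hi S, X S, X S, Z S]" for S
    \<comment> \<open>The absolute values of \<open>w\<close> place the initial velocity in the box
      as well.\<close>
    define q :: "real \<Rightarrow> real ^ 4" where "q S = vector [V S + 1, V S + 1, V S + 1, V4 S + 1]
      + vector [\<bar>w $ 1\<bar>, \<bar>w $ 2\<bar>, \<bar>w $ 3\<bar>, \<bar>w $ 4\<bar>]" for S
    define K where "K S = cbox (a S, - q S) (b S, q S)" for S
    have ab: "cbox (a S) (b S) \<subseteq> interval_times_heis J" for S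
    proof
      fix x assume "x \<in> cbox (a S) (b S)"
      then have "lo S \<le> x $ 1" "x $ 1 \<le> hi S" by (simp_all add: mem_box_cart a_def b_def forall_4)
      then have "x $ 1 \<in> J" using J lo[of S] hi[of S] unfolding is_interval_1 by blast
      then show "x \<in> interval_times_heis J" by (simp add: interval_times_heis_def)
    qed
    have strict: "lo S < t \<and> t < hi S" if "t \<in> J" "\<bar>T t - T (p $ 1)\<bar> < sqrt E * \<bar>S\<bar> + 1" for S t
    proof -
      have "T (lo S) < T t" "T t < T (hi S)" using that(2) Tlo Thi by auto
      then show ?thesis
        using T_mono[OF that(1) lo[of S]] T_mono[OF hi[of S] that(1)] by (metis less_asym linorder_less_linear order_less_irrefl)
    qed
    have r: "sqrt E * \<bar>S\<bar> + 1 > 0" for S using E0 by (simp add: add_nonneg_pos)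
    obtain y where y0: "y 0 = (p, w)" and y: "\<And>s. s \<ge> 0 \<Longrightarrow> y s \<in> interval_times_heis J \<times> UNIV \<and>
        (y has_vector_derivative (case y s of (x, v) \<Rightarrow> (v, accel x v))) (at s within {0..})"
    proof (rule ode_global_solution[of K "(p, w)" "interval_times_heis J \<times> UNIV" "\<lambda>(x, v). (v, accel x v)"])
      fix S
      have "lo S < p $ 1 \<and> p $ 1 < hi S" using strict[OF p1, of S] r[of S] by simp
      moreover have "\<bar>p $ 2\<bar> \<le> X S" "\<bar>p $ 3\<bar> \<le> X S" "\<bar>p $ 4\<bar> \<le> Z S"
        using V(1)[of S] V(4)[of S] by (simp_all add: X_def Z_def add_increasing2)
      ultimately have "p \<in> cbox (a S) (b S)"
        by (auto simp: mem_box_cart a_def b_def forall_4)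
      moreover have "w \<in> cbox (- q S) (q S)"
        using V(1)[of S] V(4)[of S] by (auto simp: mem_box_cart q_def forall_4)
      ultimately show "compact (K S) \<and> convex (K S) \<and> (p, w) \<in> K S \<and> K S \<subseteq> interval_times_heis J \<times> UNIV"
        using ab[of S] unfolding K_def by (auto simp: cbox_Pair_eq compact_cbox intro!: convex_Times compact_Times)
      show "\<exists>L. L-lipschitz_on (K S) (\<lambda>(x, v). (v, accel x v))"
        unfolding K_def by (rule geodesic_field_lipschitz[OF ab])
    next
      fix S \<tau> y
      assume \<tau>: "\<tau> \<in> {0..S}" and y0: "y 0 = (p, w)"
        and y: "\<And>s. s \<in> {0..\<tau>} \<Longrightarrow> y s \<in> K S \<and>
          (y has_vector_derivative (case y s of (x, v) \<Rightarrow> (v, accel x v))) (at s within {0..})"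
      define c where "c s = fst (y s)" for s
      define v where "v s = snd (y s)" for s
      have S: "\<bar>S\<bar> = S" "\<tau> \<le> S" "0 \<le> \<tau>" using \<tau> by auto
      have c': "(c has_vector_derivative v s) (at s within {0..\<tau>})"
        and v': "(v has_vector_derivative accel (c s) (v s)) (at s within {0..\<tau>})" if "s \<in> {0..\<tau>}" for s
      proof -
        have d: "(y has_vector_derivative (v s, accel (c s) (v s))) (at s within {0..\<tau>})"
          using y[OF that] by (auto simp: c_def v_def case_prod_unfold intro: has_vector_derivative_within_subset)
        show "(c has_vector_derivative v s) (at s within {0..\<tau>})" "(v has_vector_derivative accel (c s) (v s)) (at s within {0..\<tau>})"
          using bounded_linear.has_vector_derivative[OF bounded_linear_fst d]
            bounded_linear.has_vector_derivative[OF bounded_linear_snd d] by (simp_all add: c_def[abs_def] v_def[abs_def])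
      qed
      have box: "c s \<in> cbox (a S) (b S)" if "s \<in> {0..\<tau>}" for s
        using y[OF that] by (auto simp: K_def c_def cbox_Pair_eq mem_Times_iff)
      then have cJ: "c s $ 1 \<in> J" if "s \<in> {0..\<tau>}" for s
        using ab that by (force simp: interval_times_heis_def)
      have c1: "c s $ 1 \<in> {lo S..hi S}" if "s \<in> {0..\<tau>}" for s
        using box[OF that] by (simp add: mem_box_cart a_def b_def forall_4)
      have energy: "hmet P H (c s) (v s) (v s) = E" if "s \<in> {0..\<tau>}" for s
        using energy_constant_within[OF _ _ cJ c' v' that] S y0 by (simp add: E_def c_def v_def)
      have Pv: "P (c s $ 1) * (v s $ 1)\<^sup>2 \<le> E" and Hv: "H (c s $ 1) (mc_form (c s) (v s)) (mc_form (c s) (v s)) \<le> E"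
        if "s \<in> {0..\<tau>}" for s
      proof -
        have "hmet P H (c s) (v s) (v s) = P (c s $ 1) * (v s $ 1)\<^sup>2 + H (c s $ 1) (mc_form (c s) (v s)) (mc_form (c s) (v s))"
          by (simp add: hmet_def power2_eq_square mult.assoc)
        moreover have "0 \<le> P (c s $ 1) * (v s $ 1)\<^sup>2" using P_pos[OF cJ[OF that]] by simp
        moreover note H_nonneg[OF cJ[OF that], of "mc_form (c s) (v s)"]
        ultimately show "P (c s $ 1) * (v s $ 1)\<^sup>2 \<le> E" "H (c s $ 1) (mc_form (c s) (v s)) (mc_form (c s) (v s)) \<le> E"
          using energy[OF that] by linarith+
      qed
      have v1: "\<bar>v s $ 1\<bar> < V S" if "s \<in> {0..\<tau>}" for s
        unfolding V_def
        by (rule abs_le_of_sq_bound[OF m order_trans[OF mult_right_mono[OF mP[OF c1[OF that]]] Pv[OF that]]]) simp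
      have mc: "\<bar>mc_form (c s) (v s) $ i\<bar> < V S" if "s \<in> {0..\<tau>}" for s i
        unfolding V_def
      proof (rule abs_le_of_sq_bound[OF m order_trans[OF _ order_trans[OF mH[OF c1[OF that]] Hv[OF that]]]])
        have "(mc_form (c s) (v s) $ i)\<^sup>2 \<le> mc_form (c s) (v s) \<bullet> mc_form (c s) (v s)"
          using component_le_norm_cart[of "mc_form (c s) (v s)" i]
          by (metis abs_le_square_iff abs_norm_cancel dot_square_norm)
        then show "m S * (mc_form (c s) (v s) $ i)\<^sup>2 \<le> m S * (mc_form (c s) (v s) \<bullet> mc_form (c s) (v s))"
          using m[of S] by simp
      qed
      have v23: "\<bar>v s $ 2\<bar> < V S" "\<bar>v s $ 3\<bar> < V S" if "s \<in> {0..\<tau>}" for s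
        using mc[OF that, of 1] mc[OF that, of 2] by (simp_all add: mc_form_def)
      have x23: "\<bar>c s $ 2\<bar> \<le> X S" "\<bar>c s $ 3\<bar> \<le> X S" if "s \<in> {0..\<tau>}" for s
        using box[OF that] by (auto simp: mem_box_cart a_def b_def forall_4 abs_le_iff)
      have v4: "\<bar>v s $ 4\<bar> < V4 S" if "s \<in> {0..\<tau>}" for s
      proof -
        have "\<bar>c s $ 2 * v s $ 3\<bar> \<le> X S * V S" "\<bar>c s $ 3 * v s $ 2\<bar> \<le> X S * V S"
          unfolding abs_mult using x23[OF that] v23[OF that] by (auto intro!: mult_mono)
        then have "\<bar>(c s $ 2 * v s $ 3 - c s $ 3 * v s $ 2) / 2\<bar> \<le> V S * X S" by (simp add: mult.commute)
        moreover have "\<bar>v s $ 4 - (c s $ 2 * v s $ 3 - c s $ 3 * v s $ 2) / 2\<bar> < V S"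
          using mc[OF that, of 3] by (simp add: mc_form_def)
        ultimately show ?thesis unfolding V4_def by linarith
      qed
      have move: "\<bar>c \<tau> $ i - p $ i\<bar> \<le> B * \<tau>" if "\<And>s. s \<in> {0..\<tau>} \<Longrightarrow> \<bar>v s $ i\<bar> \<le> B" for i B
        using field_differentiable_bound[of "{0..\<tau>}" "\<lambda>s. c s $ i" "\<lambda>s. v s $ i" B \<tau> 0]
          has_vector_derivative_nth_real[OF c'] that S y0 by (simp add: c_def)
      have t\<tau>: "\<tau> \<in> {0..\<tau>}" using S by simp
      \<comment> \<open>Along the curve the arc length is Lipschitz with constant the root of the
        energy.\<close>
      have "\<bar>T (c \<tau> $ 1) - T (c 0 $ 1)\<bar> \<le> sqrt E * \<bar>\<tau> - 0\<bar>"
      proof (rule field_differentiable_bound[of "{0..\<tau>}" "\<lambda>s. T (c s $ 1)" "\<lambda>s. sqrt (P (c s $ 1)) * v s $ 1", unfolded real_norm_def])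
        fix s assume s: "s \<in> {0..\<tau>}"
        show "((\<lambda>s. T (c s $ 1)) has_real_derivative sqrt (P (c s $ 1)) * v s $ 1) (at s within {0..\<tau>})"
          by (rule DERIV_chain2[where f = T and g = "\<lambda>s. c s $ 1", OF T[OF cJ[OF s]] has_vector_derivative_nth_real[OF c'[OF s]]])
        have "\<bar>sqrt (P (c s $ 1)) * v s $ 1\<bar> = sqrt (P (c s $ 1) * (v s $ 1)\<^sup>2)"
          using P_pos[OF cJ[OF s]] by (simp add: abs_mult real_sqrt_mult)
        also have "\<dots> \<le> sqrt E" using Pv[OF s] by simp
        finally show "\<bar>sqrt (P (c s $ 1)) * v s $ 1\<bar> \<le> sqrt E" .
      qed (use S in auto)
      also have "sqrt E * \<bar>\<tau> - 0\<bar> \<le> sqrt E * \<bar>S\<bar>" using S E0 by (intro mult_left_mono) auto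
      finally have "\<bar>T (c \<tau> $ 1) - T (p $ 1)\<bar> < sqrt E * \<bar>S\<bar> + 1" using y0 by (simp add: c_def)
      then have t1: "lo S < c \<tau> $ 1" "c \<tau> $ 1 < hi S" using strict[OF cJ[OF t\<tau>]] by auto
      have "V S * \<tau> \<le> V S * \<bar>S\<bar>" "V4 S * \<tau> \<le> V4 S * \<bar>S\<bar>" using S V[of S] by (auto intro!: mult_left_mono)
      moreover have "\<bar>c \<tau> $ 2 - p $ 2\<bar> \<le> V S * \<tau>" "\<bar>c \<tau> $ 3 - p $ 3\<bar> \<le> V S * \<tau>" "\<bar>c \<tau> $ 4 - p $ 4\<bar> \<le> V4 S * \<tau>"
        by (rule move, rule less_imp_le, erule v23 v4)+
      ultimately have t2: "\<bar>c \<tau> $ 2\<bar> < X S" "\<bar>c \<tau> $ 3\<bar> < X S" "\<bar>c \<tau> $ 4\<bar> < Z S"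
        unfolding X_def Z_def by linarith+
      have "c \<tau> \<in> box (a S) (b S)" using t1 t2 by (auto simp: mem_box_cart a_def b_def forall_4 abs_less_iff)
      moreover have "v \<tau> \<in> box (- q S) (q S)"
        using v1[OF t\<tau>] v23[OF t\<tau>] v4[OF t\<tau>] by (auto simp: mem_box_cart q_def forall_4 abs_less_iff)
      ultimately show "y \<tau> \<in> interior (K S)"
        by (simp add: K_def cbox_Pair_eq interior_Times mem_Times_iff c_def v_def)
    qed (use that in auto)
    define c where "c s = fst (y s)" for s
    define v where "v s = snd (y s)" for s
    have "c s \<in> interval_times_heis J \<and>
      (c has_vector_derivative v s) (at s within {0..}) \<and> (v has_vector_derivative accel (c s) (v s)) (at s within {0..})"
      if "s \<ge> 0" for s
    proof -
      have d: "(y has_vector_derivative (v s, accel (c s) (v s))) (at s within {0..})"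
        using y[OF that] by (auto simp: c_def v_def case_prod_unfold)
      show ?thesis
        using bounded_linear.has_vector_derivative[OF bounded_linear_fst d]
          bounded_linear.has_vector_derivative[OF bounded_linear_snd d] y[OF that]
        by (simp add: c_def[abs_def] v_def[abs_def] mem_Times_iff)
    qed
    moreover have "c 0 = p" "v 0 = w" by (simp_all add: c_def v_def y0)
    ultimately show ?thesis by blast
  qed
  show ?thesis
    unfolding geodesically_complete_def
  proof (intro ballI allI)
    fix p w assume p: "p \<in> interval_times_heis J"
    obtain c v where cv: "c 0 = p" "v 0 = w" "\<And>s. s \<ge> 0 \<Longrightarrow> c s \<in> interval_times_heis J \<and>
      (c has_vector_derivative v s) (at s within {0..}) \<and> (v has_vector_derivative accel (c s) (v s)) (at s within {0..})"
      using half[OF p, of w] by blast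
    obtain c1 v1 where cv1: "c1 0 = p" "v1 0 = - w" "\<And>s. s \<ge> 0 \<Longrightarrow> c1 s \<in> interval_times_heis J \<and>
      (c1 has_vector_derivative v1 s) (at s within {0..}) \<and> (v1 has_vector_derivative accel (c1 s) (v1 s)) (at s within {0..})"
      using half[OF p, of "- w"] by blast
    define C where "C s = (if s \<ge> 0 then c s else c1 (- s))" for s
    define Q where "Q s = (if s \<ge> 0 then v s else - v1 (- s))" for s
    \<comment> \<open>The acceleration is quadratic in the velocity, so a forward solution with
      reversed initial velocity, run backwards, is the past of the geodesic.\<close>
    have even: "accel x (- u) = accel x u" for x u by (simp add: accel_def)
    have neg: "((\<lambda>s. g (- s)) has_vector_derivative - g') (at s within {..0})"
      if "(g has_vector_derivative g') (at (- s) within {0..})" for g :: "real \<Rightarrow> real ^ 4" and g' s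
    proof -
      have "(uminus has_vector_derivative - 1) (at s within {..0})" by (auto intro!: derivative_eq_intros)
      moreover have "uminus ` {..0::real} = {0..}" by auto
      ultimately show ?thesis
        using vector_diff_chain_within[of uminus "- 1" s "{..0}" g g'] that by (simp add: o_def)
    qed
    have right: "(C has_vector_derivative Q s) (at s within {0..}) \<and> (Q has_vector_derivative accel (C s) (Q s)) (at s within {0..})"
      if "s \<ge> 0" for s
      using cv(3)[OF that] that
      by (auto simp: C_def Q_def intro: has_vector_derivative_transform[rotated 2])
    have left: "(C has_vector_derivative Q s) (at s within {..0}) \<and> (Q has_vector_derivative accel (C s) (Q s)) (at s within {..0})"
      if "s \<le> 0" for s
    proof -
      have Cm: "C r = c1 (- r)" "Q r = - v1 (- r)" if "r \<le> 0" for r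
        using that cv cv1 by (cases "r = 0"; simp add: C_def Q_def)+
      have d: "((\<lambda>r. c1 (- r)) has_vector_derivative - v1 (- s)) (at s within {..0})"
        "((\<lambda>r. v1 (- r)) has_vector_derivative - accel (c1 (- s)) (v1 (- s))) (at s within {..0})"
        using cv1(3)[of "- s"] that by (auto intro: neg)
      have "((\<lambda>r. - v1 (- r)) has_vector_derivative accel (C s) (Q s)) (at s within {..0})"
        using has_vector_derivative_minus[OF d(2)] Cm[OF that] by (simp add: even)
      then have "(Q has_vector_derivative accel (C s) (Q s)) (at s within {..0})"
        by (rule has_vector_derivative_transform[rotated 2]) (use Cm that in auto)
      moreover have "(C has_vector_derivative Q s) (at s within {..0})"
        unfolding Cm(2)[OF that]
        by (rule has_vector_derivative_transform[OF _ _ d(1)]) (use Cm that in auto)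
      ultimately show ?thesis by blast
    qed
    have both: "(g has_vector_derivative g') (at s)"
      if "s \<ge> 0 \<Longrightarrow> (g has_vector_derivative g') (at s within {0..})"
        "s \<le> 0 \<Longrightarrow> (g has_vector_derivative g') (at s within {..0})" for g :: "real \<Rightarrow> real ^ 4" and g' s
    proof -
      consider "s > 0" | "s < 0" | "s = 0" by linarith
      then show ?thesis
      proof cases
        case 1
        then have "at s within {0..} = at s" by (intro at_within_interior) (simp add: interior_Ici)
        then show ?thesis using that(1) 1 by simp
      next
        case 2
        then have "at s within {..0} = at s" by (intro at_within_interior) (simp add: interior_Iic)
        then show ?thesis using that(2) 2 by simp
      next
        case 3
        have "{0..} \<union> {..0::real} = UNIV" by auto
        then show ?thesis using has_vector_derivative_within_Un[of g g' s "{0..}" "{..0}"] that 3 by simp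
      qed
    qed
    have "C s \<in> interval_times_heis J \<and> (C has_vector_derivative Q s) (at s) \<and>
       (Q has_vector_derivative accel (C s) (Q s)) (at s)" for s
    proof (intro conjI)
      show "C s \<in> interval_times_heis J" using cv(3)[of s] cv1(3)[of "- s"] by (simp add: C_def)
      show "(C has_vector_derivative Q s) (at s)" by (rule both) (use left right in auto)
      show "(Q has_vector_derivative accel (C s) (Q s)) (at s)" by (rule both) (use left right in auto)
    qed
    moreover have "C 0 = p" "Q 0 = w" by (simp_all add: C_def Q_def cv)
    ultimately show "\<exists>c v. geodesic_with_velocity (interval_times_heis J) (hmet P H) c v \<and> c 0 = p \<and> v 0 = w"
      unfolding geodesic_with_velocity_def accel_def by blast
  qed
qed

end

subsection \<open>Left-invariant forms on the Heisenberg group\<close>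

text \<open>The derivative of the left translation by \<open>a\<close>; the multiplication is affine
  in its second argument, so no base point occurs.\<close>

definition left_trans :: "real ^ 3 \<Rightarrow> real ^ 3 \<Rightarrow> real ^ 3" where
  "left_trans a v = vector [v $ 1, v $ 2, v $ 3 + (a $ 1 * v $ 2 - a $ 2 * v $ 1) / 2]"

definition left_trans_inv :: "real ^ 3 \<Rightarrow> real ^ 3 \<Rightarrow> real ^ 3" where
  "left_trans_inv a v = vector [v $ 1, v $ 2, v $ 3 - (a $ 1 * v $ 2 - a $ 2 * v $ 1) / 2]"

lemma linear_left_trans: "linear (left_trans a)" "linear (left_trans_inv a)"
  by (auto simp: linear_iff left_trans_def left_trans_inv_def vec_eq_iff forall_3 field_simps)

lemma left_trans_inverse [simp]:
  "left_trans_inv a (left_trans a v) = v" "left_trans a (left_trans_inv a v) = v" "left_trans 0 v = v"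
  by (simp_all add: left_trans_def left_trans_inv_def vec_eq_iff forall_3)

lemma left_translation_deriv_eq: "left_translation_deriv a p = left_trans a"
proof -
  have eq: "heis_mult a = (\<lambda>p. a + left_trans a p)"
    by (simp add: fun_eq_iff heis_mult_def left_trans_def vec_eq_iff forall_3)
  have "(heis_mult a has_derivative (\<lambda>v. 0 + left_trans a v)) (at p)"
    unfolding eq by (intro has_derivative_add has_derivative_const linear_imp_has_derivative linear_left_trans)
  then show ?thesis unfolding left_translation_deriv_def by (simp add: frechet_derivative_at[symmetric])
qed

lemma left_invariant_field_eq: "left_invariant_field v p = left_trans p v"
  by (simp add: left_invariant_field_def left_translation_deriv_eq)

lemma heis_bracket_eq: "heis_bracket v w = heis_br v w"
proof -
  have d: "frechet_derivative (left_invariant_field v) (at p) u = vector [0, 0, (u $ 1 * v $ 2 - u $ 2 * v $ 1) / 2]" for v p u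
  proof -
    define L :: "real ^ 3 \<Rightarrow> real ^ 3" where "L u = vector [0, 0, (u $ 1 * v $ 2 - u $ 2 * v $ 1) / 2]" for u
    have eq: "left_invariant_field v = (\<lambda>p. v + L p)"
      by (simp add: fun_eq_iff left_invariant_field_eq left_trans_def L_def vec_eq_iff forall_3)
    have "linear L" by (auto simp: linear_iff L_def vec_eq_iff forall_3 field_simps)
    then have "(left_invariant_field v has_derivative (\<lambda>u. 0 + L u)) (at p)"
      unfolding eq by (intro has_derivative_add has_derivative_const linear_imp_has_derivative)
    from frechet_derivative_at[OF this, symmetric] show ?thesis by (simp add: L_def)
  qed
  show ?thesis
    unfolding heis_bracket_def vector_field_bracket_def d
    by (simp add: left_invariant_field_eq heis_br_def vec_eq_iff forall_3 field_simps)
qed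

lemma heis_center_eq: "heis_center = {v. v $ 1 = 0 \<and> v $ 2 = 0}"
proof -
  have "v $ 1 = 0 \<and> v $ 2 = 0" if "\<forall>w. heis_br v w = 0" for v
    using that[rule_format, of "axis 1 1"] that[rule_format, of "axis 2 1"]
    by (auto simp: heis_br_def vec_eq_iff forall_3 axis_def)
  then show ?thesis
    unfolding heis_center_def heis_bracket_eq by (auto simp: heis_br_def vec_eq_iff forall_3)
qed

lemma heis_frame_iff:
  "heis_frame k e \<longleftrightarrow> invertible e \<and> e $ 1 $ 1 = 0 \<and> e $ 1 $ 2 = 0 \<and> e $ 1 $ 3 \<noteq> 0 \<and>
     heis_br (e $ 2) (e $ 3) = (- 2 * k) *\<^sub>R e $ 1"
proof -
  have "span {e $ 1} = heis_center \<longleftrightarrow> e $ 1 $ 1 = 0 \<and> e $ 1 $ 2 = 0 \<and> e $ 1 $ 3 \<noteq> 0"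
  proof
    assume eq: "span {e $ 1} = heis_center"
    have "e $ 1 \<in> heis_center" unfolding eq[symmetric] by (simp add: span_base)
    moreover have "axis 3 1 \<in> span {e $ 1}" unfolding eq by (simp add: heis_center_eq axis_def)
    then obtain c where "axis 3 1 = c *\<^sub>R e $ 1" by (auto simp: span_singleton)
    then have "1 = c * e $ 1 $ 3" by (metis axis_nth real_scaleR_def vector_scaleR_component)
    ultimately show "e $ 1 $ 1 = 0 \<and> e $ 1 $ 2 = 0 \<and> e $ 1 $ 3 \<noteq> 0" by (auto simp: heis_center_eq)
  next
    assume e: "e $ 1 $ 1 = 0 \<and> e $ 1 $ 2 = 0 \<and> e $ 1 $ 3 \<noteq> 0"
    show "span {e $ 1} = heis_center"
    proof (intro equalityI subsetI)
      fix v assume "v \<in> heis_center"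
      then have "v = (v $ 3 / e $ 1 $ 3) *\<^sub>R e $ 1"
        using e by (auto simp: heis_center_eq vec_eq_iff forall_3)
      then show "v \<in> span {e $ 1}" by (metis insertI1 span_base span_scale)
    qed (use e in \<open>auto simp: span_singleton heis_center_eq\<close>)
  qed
  moreover have "heis_br (e $ 1) v = 0" if "e $ 1 $ 1 = 0" "e $ 1 $ 2 = 0" for v
    using that by (simp add: heis_br_def vec_eq_iff forall_3)
  ultimately show ?thesis unfolding heis_frame_def heis_bracket_eq by auto
qed

lemma heis_frame_center: "heis_frame k e \<Longrightarrow> heis_br (e $ 1) v = 0"
  by (simp add: heis_frame_iff heis_br_def vec_eq_iff forall_3)

lemma mc_form_group_part: "mc_form x u = left_trans_inv (group_part x) (group_part u)"
  by (simp add: mc_form_def left_trans_inv_def group_part_def)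

lemma left_invariant_eq:
  assumes "left_invariant q"
  shows "q p u v = q 0 (left_trans_inv p u) (left_trans_inv p v)"
proof -
  have "q (heis_mult p 0) (left_trans p (left_trans_inv p u)) (left_trans p (left_trans_inv p v))
      = q 0 (left_trans_inv p u) (left_trans_inv p v)"
    using assms unfolding left_invariant_def left_translation_deriv_eq by blast
  moreover have "heis_mult p 0 = p" by (simp add: heis_mult_def vec_eq_iff forall_3)
  ultimately show ?thesis by simp
qed

lemma left_invariant_extend:
  "left_invariant (\<lambda>p u v. q (left_trans_inv p u) (left_trans_inv p v))"
proof -
  have "left_trans_inv (heis_mult a p) (left_trans a u) = left_trans_inv p u" for a p u
    by (simp add: left_trans_inv_def left_trans_def heis_mult_def vec_eq_iff forall_3 field_simps)
  then show ?thesis by (simp add: left_invariant_def left_translation_deriv_eq)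
qed

lemma heis_metric_eq_hmet:
  assumes "left_invariant (h (x $ 1))"
  shows "heis_metric \<epsilon> h x u v = hmet (\<lambda>_. \<epsilon>) (\<lambda>t. h t 0) x u v"
  unfolding heis_metric_def hmet_def mc_form_group_part
  using left_invariant_eq[OF assms, of "group_part x"] by simp

section \<open>Coordinates in a left-invariant frame and diagonal forms\<close>

definition frame_coords :: "real ^ 3 ^ 3 \<Rightarrow> real ^ 3 \<Rightarrow> real ^ 3" where
  "frame_coords e w = matrix_inv (transpose e) *v w"

lemma linear_frame_coords: "linear (frame_coords e)"
  by (simp add: frame_coords_def[abs_def])

lemma frame_coords_expand:
  assumes "invertible e"
  shows "w = (\<Sum>j\<in>UNIV. frame_coords e w $ j *\<^sub>R e $ j)" "frame_coords e (e $ i) = axis i 1"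
proof -
  have t: "invertible (transpose e)" using assms by (simp add: transpose_invertible)
  have "transpose e *v frame_coords e w = w"
    by (simp add: frame_coords_def matrix_vector_mul_assoc matrix_inv_works[OF t])
  moreover have "transpose e *v z = (\<Sum>j\<in>UNIV. z $ j *\<^sub>R e $ j)" for z
    by (simp add: matrix_vector_mult_def transpose_def vec_eq_iff mult.commute)
  ultimately show "w = (\<Sum>j\<in>UNIV. frame_coords e w $ j *\<^sub>R e $ j)" by simp
  have "e $ i = transpose e *v axis i 1"
    by (simp add: matrix_vector_mult_def transpose_def vec_eq_iff axis_def if_distrib[of "\<lambda>x. _ * x"] cong: if_cong)
  then show "frame_coords e (e $ i) = axis i 1"
    by (simp add: frame_coords_def matrix_vector_mul_assoc matrix_inv_works[OF t] del: transpose_matrix_vector)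
qed

lemma bilinear_frame_expand:
  fixes q :: "real ^ 3 \<Rightarrow> real ^ 3 \<Rightarrow> real"
  assumes "invertible e" "bilinear q"
  shows "q u w = (\<Sum>i\<in>UNIV. \<Sum>j\<in>UNIV. frame_coords e u $ i * (frame_coords e w $ j * q (e $ i) (e $ j)))"
proof -
  have "q u w = q (\<Sum>j\<in>UNIV. frame_coords e u $ j *\<^sub>R e $ j) (\<Sum>j\<in>UNIV. frame_coords e w $ j *\<^sub>R e $ j)"
    using frame_coords_expand(1)[OF assms(1), of u] frame_coords_expand(1)[OF assms(1), of w] by simp
  then show ?thesis
    by (simp add: sum_3 bilinear_ladd[OF assms(2)] bilinear_radd[OF assms(2)] bilinear_lmul[OF assms(2)]
        bilinear_rmul[OF assms(2)] algebra_simps)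
qed

text \<open>The matrix of left-invariant fields is a left translation times the transpose of
  \<open>e\<close>, so its inverse first applies the Maurer-Cartan form and then takes coordinates
  in the frame.\<close>

lemma left_invariant_coframe_eq:
  assumes "invertible e"
  shows "left_invariant_coframe e i (group_part x) (group_part u) = frame_coords e (mc_form x u) $ i"
proof -
  let ?p = "group_part x"
  let ?M = "transpose (\<chi> j. left_invariant_field (e $ j) ?p)"
  let ?N = "matrix (left_trans_inv ?p)"
  have t: "invertible (transpose e)" using assms by (simp add: transpose_invertible)
  have N: "?N *v v = left_trans_inv ?p v" for v
    by (rule matrix_works) (simp add: linear_matrix_vector_mul_eq linear_left_trans)
  have "?N ** ?M = transpose e"
  proof -
    have "(?N ** ?M) $ i $ j = (?N *v (left_trans ?p (e $ j))) $ i" for i j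
      by (simp add: matrix_matrix_mult_def matrix_vector_mult_def transpose_def left_invariant_field_eq)
    then show ?thesis by (simp add: N vec_eq_iff transpose_def)
  qed
  then have "(matrix_inv (transpose e) ** ?N) ** ?M = mat 1"
    by (simp add: matrix_inv_works[OF t] flip: matrix_mul_assoc)
  then have "matrix_inv ?M = matrix_inv (transpose e) ** ?N" by (rule matrix_inv_unique)
  then show ?thesis
    by (simp add: left_invariant_coframe_def frame_coords_def mc_form_group_part N flip: matrix_vector_mul_assoc)
qed

definition dform :: "real ^ 3 ^ 3 \<Rightarrow> real \<Rightarrow> real \<Rightarrow> real ^ 3 \<Rightarrow> real ^ 3 \<Rightarrow> real" where
  "dform e A B u w = A * (frame_coords e u $ 1 * frame_coords e w $ 1)
     + B * (frame_coords e u $ 2 * frame_coords e w $ 2 + frame_coords e u $ 3 * frame_coords e w $ 3)"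

lemma bilinear_dform: "bilinear (dform e A B)"
  using linear_frame_coords[of e]
  by (auto simp: bilinear_def linear_iff dform_def algebra_simps)

lemma dform_sym: "dform e A B u w = dform e A B w u"
  by (simp add: dform_def mult.commute)

lemma dform_frame:
  assumes "invertible e"
  shows "dform e A B (e $ i) (e $ j) = (if i = j then if i = 1 then A else B else 0)"
  using exhaust_3[of i] exhaust_3[of j]
  by (elim disjE) (simp_all add: dform_def frame_coords_expand[OF assms] axis_def)

lemma dform_nondeg:
  assumes "invertible e" "A \<noteq> 0" "B \<noteq> 0" "\<And>w. dform e A B u w = 0"
  shows "u = 0"
proof -
  have "frame_coords e u $ j = 0" for j
    using assms(4)[of "e $ j"] exhaust_3[of j] assms(2,3)
    by (elim disjE) (simp_all add: dform_def frame_coords_expand[OF assms(1)] axis_def)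
  then show ?thesis using frame_coords_expand(1)[OF assms(1), of u] by simp
qed

lemma dform_pos:
  assumes "invertible e" "A > 0" "B > 0" "u \<noteq> 0"
  shows "dform e A B u u > 0"
proof -
  have nn: "0 \<le> A * (frame_coords e u $ 1 * frame_coords e u $ 1)" "0 \<le> B * (frame_coords e u $ 2 * frame_coords e u $ 2)"
    "0 \<le> B * (frame_coords e u $ 3 * frame_coords e u $ 3)"
    using assms by simp_all
  have "dform e A B u u \<noteq> 0"
  proof
    assume "dform e A B u u = 0"
    then have "A * (frame_coords e u $ 1 * frame_coords e u $ 1) = 0" "B * (frame_coords e u $ 2 * frame_coords e u $ 2) = 0"
      "B * (frame_coords e u $ 3 * frame_coords e u $ 3) = 0"
      using nn by (simp_all only: dform_def distrib_left)
    then have "frame_coords e u $ j = 0" for j using exhaust_3[of j] assms by auto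
    then show False using frame_coords_expand(1)[OF assms(1), of u] assms(4) by simp
  qed
  then show ?thesis using nn by (simp add: dform_def distrib_left)
qed

lemma bilinear_eq_dform:
  assumes "invertible e" "bilinear q" "\<And>i j. q (e $ i) (e $ j) = (if i = j then if i = 1 then A else B else 0)"
  shows "q u w = dform e A B u w"
proof -
  note bilinear_frame_expand[OF assms(1,2), of u w]
  then show ?thesis by (simp add: assms(3) sum_3 dform_def algebra_simps)
qed

lemma model_metric_eq_hmet:
  assumes "invertible e"
  shows "model_metric \<epsilon> \<Lambda> k \<gamma> e = hmet
     (\<lambda>\<rho>. \<epsilon> * (- (3 / (2 * \<epsilon> * \<Lambda> * \<rho>\<^sup>2)) * ((\<rho> + 2 * \<gamma>) / (\<rho> + \<gamma>))))
     (\<lambda>\<rho>. dform e (\<epsilon> * (- (3 / (2 * \<epsilon> * \<Lambda> * \<rho>\<^sup>2)) * ((\<rho> + 2 * \<gamma>) / (\<rho> + \<gamma>)) / k\<^sup>2 * ((\<rho> + \<gamma>) / (\<rho> + 2 * \<gamma>))\<^sup>2))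
        (- (3 / (2 * \<epsilon> * \<Lambda> * \<rho>\<^sup>2)) * ((\<rho> + 2 * \<gamma>) / (\<rho> + \<gamma>)) * 2 * (\<rho> + \<gamma>)))"
proof (intro ext)
  fix x u v :: "real ^ 4"
  define c where "c = - (3 / (2 * \<epsilon> * \<Lambda> * (x $ 1)\<^sup>2)) * ((x $ 1 + 2 * \<gamma>) / (x $ 1 + \<gamma>))"
  define d where "d = ((x $ 1 + \<gamma>) / (x $ 1 + 2 * \<gamma>))\<^sup>2"
  show "model_metric \<epsilon> \<Lambda> k \<gamma> e x u v = hmet
     (\<lambda>\<rho>. \<epsilon> * (- (3 / (2 * \<epsilon> * \<Lambda> * \<rho>\<^sup>2)) * ((\<rho> + 2 * \<gamma>) / (\<rho> + \<gamma>))))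
     (\<lambda>\<rho>. dform e (\<epsilon> * (- (3 / (2 * \<epsilon> * \<Lambda> * \<rho>\<^sup>2)) * ((\<rho> + 2 * \<gamma>) / (\<rho> + \<gamma>)) / k\<^sup>2 * ((\<rho> + \<gamma>) / (\<rho> + 2 * \<gamma>))\<^sup>2))
        (- (3 / (2 * \<epsilon> * \<Lambda> * \<rho>\<^sup>2)) * ((\<rho> + 2 * \<gamma>) / (\<rho> + \<gamma>)) * 2 * (\<rho> + \<gamma>))) x u v"
    unfolding model_metric_def Let_def hmet_def left_invariant_coframe_eq[OF assms] dform_def c_def[symmetric] d_def[symmetric]
    by (simp add: algebra_simps)
qed

subsection \<open>Adapted frames\<close>

lemma orthonormal_basis_expand:
  fixes q :: "real ^ 3 \<Rightarrow> real ^ 3 \<Rightarrow> real"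
  assumes "bilinear q" "orthonormal_basis q (vector [d1, d2, d3]) b" "d1 \<noteq> 0" "d2 \<noteq> 0" "d3 \<noteq> 0"
  shows "invertible b"
    and "q u v = d1 * (frame_coords b u $ 1 * frame_coords b v $ 1) + d2 * (frame_coords b u $ 2 * frame_coords b v $ 2)
      + d3 * (frame_coords b u $ 3 * frame_coords b v $ 3)"
proof -
  have q: "q (b $ i) (b $ j) = (if i = j then vector [d1, d2, d3] $ i else 0)" for i j
    using assms(2) by (simp add: orthonormal_basis_def)
  have "z = 0" if "transpose b *v z = 0" for z
  proof -
    have "transpose b *v z = (\<Sum>j\<in>UNIV. z $ j *\<^sub>R b $ j)"
      by (simp add: matrix_vector_mult_def transpose_def vec_eq_iff mult.commute)
    then have s: "z $ 1 *\<^sub>R b $ 1 + z $ 2 *\<^sub>R b $ 2 + z $ 3 *\<^sub>R b $ 3 = 0" using that by (simp add: sum_3)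
    have "q (z $ 1 *\<^sub>R b $ 1 + z $ 2 *\<^sub>R b $ 2 + z $ 3 *\<^sub>R b $ 3) (b $ i) = 0" for i
      unfolding s by (rule bilinear_lzero[OF assms(1)])
    then have m: "z $ 1 * q (b $ 1) (b $ i) + z $ 2 * q (b $ 2) (b $ i) + z $ 3 * q (b $ 3) (b $ i) = 0" for i
      by (simp add: bilinear_ladd[OF assms(1)] bilinear_lmul[OF assms(1)])
    from m[of 1] m[of 2] m[of 3] show "z = 0" using assms(3-5) by (simp add: q vec_eq_iff forall_3)
  qed
  then have "invertible (transpose b)"
    by (metis invertible_left_inverse matrix_left_invertible_ker)
  then show b: "invertible b" using transpose_invertible by fastforce
  note bilinear_frame_expand[OF b assms(1), of u v]
  then show "q u v = d1 * (frame_coords b u $ 1 * frame_coords b v $ 1) + d2 * (frame_coords b u $ 2 * frame_coords b v $ 2)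
      + d3 * (frame_coords b u $ 3 * frame_coords b v $ 3)"
    by (simp add: q sum_3)
qed

text \<open>Everything is computed in the coordinates of an orthonormal basis. The last part is the
  reversed Cauchy-Schwarz inequality, obtained from Lagrange's identity for the two spacelike
  coordinates: a vector orthogonal to a timelike one is spacelike.\<close>

lemma has_signature_3:
  fixes q :: "real ^ 3 \<Rightarrow> real ^ 3 \<Rightarrow> real"
  assumes "has_signature q (vector [\<epsilon>, 1, 1])" "\<epsilon> = 1 \<or> \<epsilon> = (-1::real)"
  shows "bilinear q" "q u v = q v u" "(\<And>w. q u w = 0) \<Longrightarrow> u = 0"
    "\<epsilon> = 1 \<Longrightarrow> u \<noteq> 0 \<Longrightarrow> q u u > 0"
    "\<epsilon> = -1 \<Longrightarrow> q z z < 0 \<Longrightarrow> q z u = 0 \<Longrightarrow> u \<noteq> 0 \<Longrightarrow> q u u > 0"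
proof -
  obtain b where "bilinear q" and b: "orthonormal_basis q (vector [\<epsilon>, 1, 1]) b"
    using assms(1) by (auto simp: has_signature_def)
  show "bilinear q" by fact
  note ex = orthonormal_basis_expand[OF \<open>bilinear q\<close> b]
  have inv: "invertible b" and q: "q u v = \<epsilon> * (frame_coords b u $ 1 * frame_coords b v $ 1) + (frame_coords b u $ 2 * frame_coords b v $ 2)
      + (frame_coords b u $ 3 * frame_coords b v $ 3)" for u v
    using ex assms(2) by auto
  show "q u v = q v u" by (simp add: q mult.commute)
  have z: "u = 0" if "frame_coords b u $ 1 = 0" "frame_coords b u $ 2 = 0" "frame_coords b u $ 3 = 0" for u
    using frame_coords_expand(1)[OF inv, of u] that by (simp add: sum_3)
  show "u = 0" if "\<And>w. q u w = 0"
    using that[of "b $ 1"] that[of "b $ 2"] that[of "b $ 3"] assms(2)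
    by (intro z) (auto simp: q frame_coords_expand[OF inv] axis_def)
  show "q u u > 0" if "\<epsilon> = 1" "u \<noteq> 0"
  proof -
    let ?c = "frame_coords b u"
    have "?c $ 1 \<noteq> 0 \<or> ?c $ 2 \<noteq> 0 \<or> ?c $ 3 \<noteq> 0" using z that(2) by blast
    then have "(?c $ 1)\<^sup>2 + (?c $ 2)\<^sup>2 + (?c $ 3)\<^sup>2 > 0"
      by (smt (verit) zero_le_power2 zero_less_power2)
    then show ?thesis using that(1) by (simp add: q power2_eq_square)
  qed
  show "q u u > 0" if "\<epsilon> = -1" "q z z < 0" "q z u = 0" "u \<noteq> 0" for z u
  proof (rule ccontr)
    let ?z = "\<lambda>i. frame_coords b z $ i" and ?u = "\<lambda>i. frame_coords b u $ i"
    assume "\<not> q u u > 0"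
    then have u: "(?u 2)\<^sup>2 + (?u 3)\<^sup>2 \<le> (?u 1)\<^sup>2" using that(1) by (simp add: q power2_eq_square)
    have zz: "(?z 2)\<^sup>2 + (?z 3)\<^sup>2 < (?z 1)\<^sup>2" using that(1,2) by (simp add: q power2_eq_square)
    have zu: "?z 1 * ?u 1 = ?z 2 * ?u 2 + ?z 3 * ?u 3" using that(1,3) by (simp add: q)
    have "(?z 1)\<^sup>2 * (?u 1)\<^sup>2 = (?z 2 * ?u 2 + ?z 3 * ?u 3)\<^sup>2" by (simp add: zu[symmetric] power_mult_distrib)
    also have "\<dots> = ((?z 2)\<^sup>2 + (?z 3)\<^sup>2) * ((?u 2)\<^sup>2 + (?u 3)\<^sup>2) - (?z 2 * ?u 3 - ?z 3 * ?u 2)\<^sup>2"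
      by (simp add: power2_eq_square algebra_simps)
    also have "\<dots> \<le> ((?z 2)\<^sup>2 + (?z 3)\<^sup>2) * ((?u 2)\<^sup>2 + (?u 3)\<^sup>2)" by simp
    also have "\<dots> \<le> ((?z 2)\<^sup>2 + (?z 3)\<^sup>2) * (?u 1)\<^sup>2" by (rule mult_left_mono[OF u]) simp
    finally have "(?u 1)\<^sup>2 * ((?z 1)\<^sup>2 - ((?z 2)\<^sup>2 + (?z 3)\<^sup>2)) \<le> 0" by (simp add: algebra_simps)
    then have "(?u 1)\<^sup>2 \<le> 0" using zz by (simp add: mult_le_0_iff)
    then have "?u 1 = 0" by simp
    moreover from this u have "?u 2 = 0 \<and> ?u 3 = 0" by (simp add: sum_power2_le_zero_iff)
    ultimately show False using z that(4) by blast
  qed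
qed

text \<open>Gram-Schmidt started at the center. After that step the form is positive on the
  orthogonal complement, in either signature.\<close>

lemma adapted_frame_exists:
  fixes h :: "3 form_field"
  assumes sig: "has_signature (h 0) (vector [\<epsilon>, 1, 1])" and \<epsilon>: "\<epsilon> = 1 \<or> \<epsilon> = -1"
    and tl: "\<epsilon> = -1 \<Longrightarrow> h 0 (axis 3 1) (axis 3 1) < 0"
  shows "\<exists>k e. adapted_frame \<epsilon> h k e"
proof -
  define q where "q = h 0"
  note S = has_signature_3[OF sig \<epsilon>, folded q_def]
  define Z :: "real ^ 3" where "Z = axis 3 1"
  have "Z \<noteq> 0" by (simp add: Z_def axis_eq_0_iff)
  have bl: "bilinear q" by (rule S(1))
  note bs = bilinear_ladd[OF bl] bilinear_radd[OF bl] bilinear_lmul[OF bl] bilinear_rmul[OF bl]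
    bilinear_lsub[OF bl] bilinear_rsub[OF bl] bilinear_lneg[OF bl] bilinear_rneg[OF bl]
  have Zpos: "\<epsilon> * q Z Z > 0" using \<epsilon> tl S(4)[OF _ \<open>Z \<noteq> 0\<close>] by (auto simp: q_def Z_def)
  then have Z0: "q Z Z \<noteq> 0" by auto
  have perp: "q u u > 0" if "q Z u = 0" "u \<noteq> 0" for u
    using \<epsilon> S(4)[OF _ that(2)] S(5)[of Z u] that tl by (auto simp: q_def Z_def)
  define n where "n = sqrt (\<epsilon> * q Z Z)"
  have n: "n > 0" "n * n = \<epsilon> * q Z Z" using Zpos by (simp_all add: n_def)
  define X where "X = axis 1 1 - (q (axis 1 1) Z / q Z Z) *\<^sub>R Z"
  have X: "q Z X = 0" "X $ 1 = 1" "X $ 2 = 0"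
    using Z0 S(2)[of Z "axis 1 1"] by (simp_all add: X_def bs Z_def axis_def)
  then have "X \<noteq> 0" by auto
  define x where "x = sqrt (q X X)"
  have x: "x > 0" "x * x = q X X" using perp[OF X(1) \<open>X \<noteq> 0\<close>] by (simp_all add: x_def)
  define Y where "Y = axis 2 1 - (q (axis 2 1) Z / q Z Z) *\<^sub>R Z - (q (axis 2 1) X / q X X) *\<^sub>R X"
  have "q X X \<noteq> 0" using x by auto
  then have Y: "q Z Y = 0" "q X Y = 0" "Y $ 2 = 1"
    using Z0 X S(2)[of Z "axis 2 1"] S(2)[of X "axis 2 1"] S(2)[of X Z]
    by (simp_all add: Y_def bs Z_def axis_def)
  then have "Y \<noteq> 0" by auto
  define y where "y = sqrt (q Y Y)"
  have y: "y > 0" "y * y = q Y Y" using perp[OF Y(1) \<open>Y \<noteq> 0\<close>] by (simp_all add: y_def)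
  \<comment> \<open>The bracket of \<open>X\<close> and \<open>Y\<close> is \<open>Z\<close>, so the
    minus sign in the first vector is what makes \<open>k\<close> positive.\<close>
  define e :: "real ^ 3 ^ 3" where "e = vector [(- 1 / n) *\<^sub>R Z, (1 / x) *\<^sub>R X, (1 / y) *\<^sub>R Y]"
  define k where "k = n / (2 * x * y)"
  have k: "k > 0" using n x y by (simp add: k_def)
  have eps2: "\<epsilon> * \<epsilon> = 1" using \<epsilon> by auto
  have qZ: "q Z Z = \<epsilon> * (n * n)" using n(2) eps2 by (simp flip: mult.assoc)
  have orth: "orthonormal_basis q (vector [\<epsilon>, 1, 1]) e"
    unfolding orthonormal_basis_def forall_3 e_def
    using n(1) x(1) y(1) x(2)[symmetric] y(2)[symmetric] X Y S(2)[of X Z] S(2)[of Y Z] S(2)[of Y X] qZ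
    by (simp add: bs)
  have "invertible e" using orthonormal_basis_expand(1)[OF bl orth] \<epsilon> by auto
  moreover have "e $ 1 $ 1 = 0" "e $ 1 $ 2 = 0" "e $ 1 $ 3 \<noteq> 0" using n(1) by (simp_all add: e_def Z_def axis_def)
  moreover have "heis_br (e $ 2) (e $ 3) = (- 2 * k) *\<^sub>R e $ 1"
    using n(1) x(1) y(1) X Y by (simp add: heis_br_def e_def k_def Z_def axis_def vec_eq_iff forall_3 field_simps)
  ultimately have "heis_frame k e" by (simp add: heis_frame_iff)
  then show ?thesis using k orth by (auto simp: adapted_frame_def q_def)
qed

subsection \<open>The cubic equation\<close>

lemma cube_root_cube: "cube_root z ^ 3 = z"
proof (cases "z = 0")
  case False
  have "cube_root z ^ 3 = complex_of_real (root 3 (cmod z) ^ 3) * exp (of_nat 3 * (\<i> * complex_of_real (Arg z) / 3))"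
    unfolding cube_root_def power_mult_distrib exp_of_nat_mult[symmetric] of_real_power by simp
  also have "\<dots> = complex_of_real (cmod z) * exp (\<i> * complex_of_real (Arg z))" by simp
  also have "\<dots> = z" using Arg_eq[OF False] by simp
  finally show ?thesis .
qed (simp add: cube_root_def)

lemma cube_root_pos: "a > 0 \<Longrightarrow> cube_root (complex_of_real a) = complex_of_real (root 3 a)"
  by (simp add: cube_root_def)

lemma cube_root_neg: "a < 0 \<Longrightarrow> cube_root (complex_of_real a) = complex_of_real (root 3 \<bar>a\<bar>) * exp (\<i> * complex_of_real pi / 3)"
  by (simp add: cube_root_def)

lemma norm_cube_root: "cmod (cube_root z) = root 3 (cmod z)"
proof -
  have "exp (\<i> * complex_of_real (Arg z) / 3) = exp (\<i> * complex_of_real (Arg z / 3))" by simp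
  then show ?thesis unfolding cube_root_def norm_mult by (simp only: norm_exp_i_times) simp
qed

lemma Re_cube_root_pos:
  assumes "z \<noteq> 0"
  shows "Re (cube_root z) > 0"
proof -
  have e: "exp (\<i> * complex_of_real (Arg z) / 3) = cis (Arg z / 3)"
    by (simp add: cis_conv_exp)
  have "- pi < Arg z" "Arg z \<le> pi" using Arg_bounded[of z] by auto
  then have "cos (Arg z / 3) > 0" using pi_gt_zero by (intro cos_gt_zero_pi) linarith+
  then show ?thesis using assms by (simp add: cube_root_def e)
qed

text \<open>In this context \<open>q\<close> is \<open>\<epsilon> * \<Lambda>\<close>, three times
  the number called \<open>q\<close> in the geometric parts; \<open>cubic_third\<close> converts
  between the two forms of the cubic.\<close>

context
  fixes \<epsilon> \<Lambda> k q :: real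
  assumes eps: "\<epsilon> = 1 \<or> \<epsilon> = -1" and k: "k > 0" and q: "q = \<epsilon> * \<Lambda>" and q0: "q \<noteq> 0"
begin

text \<open>Cardano's formula: \<open>rho_w\<close> is a primitive third root of unity, and
  \<open>rho_u\<close>, \<open>rho_v\<close> are the two cube roots whose combinations with powers
  of \<open>rho_w\<close> are the three roots.\<close>

definition "rho_w = exp (2 * \<i> * complex_of_real pi / 3)"
definition "rho_A = cube_root (complex_of_real (9 * k) + csqrt (complex_of_real (81 * k\<^sup>2 + q)))"
definition "rho_B = cube_root (complex_of_real q)"
definition "rho_u = rho_A / (complex_of_real (2 * k) * rho_B\<^sup>2)"
definition "rho_v = - 1 / (complex_of_real (2 * k) * rho_B * rho_A)"

lemma rho_w3: "rho_w ^ 3 = 1" "rho_w\<^sup>2 + rho_w + 1 = 0"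
proof -
  have "rho_w ^ 3 = exp (of_nat 3 * (2 * \<i> * complex_of_real pi / 3))"
    unfolding rho_w_def exp_of_nat_mult ..
  also have "\<dots> = exp (2 * complex_of_real pi * \<i>)" by (simp add: mult_ac)
  finally show w3: "rho_w ^ 3 = 1" by simp
  have "rho_w = cis (2 * pi / 3)" by (simp add: rho_w_def cis_conv_exp mult_ac)
  then have "Re rho_w = cos (2 * pi / 3)" by (metis cis.sel(1))
  then have "Re rho_w = - 1 / 2" using cos_120 by simp
  then have "rho_w \<noteq> 1" by auto
  moreover have "(rho_w - 1) * (rho_w\<^sup>2 + rho_w + 1) = 0" using w3 by (simp add: algebra_simps power2_eq_square power3_eq_cube)
  ultimately show "rho_w\<^sup>2 + rho_w + 1 = 0" by simp
qed

lemma rho_w_inverse: "exp (- (2 * \<i> * complex_of_real pi / 3)) = rho_w\<^sup>2"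
proof -
  have "exp (- (2 * \<i> * complex_of_real pi / 3)) * rho_w = 1" by (simp add: rho_w_def exp_minus)
  moreover have "rho_w\<^sup>2 * rho_w = 1" using rho_w3(1) by (simp add: power2_eq_square power3_eq_cube)
  ultimately show ?thesis by (metis mult_cancel_right zero_neq_one mult_zero_right)
qed

lemma rho_roots:
  "rho_root \<epsilon> \<Lambda> k 1 = rho_w * rho_u + rho_w\<^sup>2 * rho_v"
  "rho_root \<epsilon> \<Lambda> k 2 = rho_u + rho_v"
  "rho_root \<epsilon> \<Lambda> k 3 = rho_w\<^sup>2 * rho_u + rho_w * rho_v"
  unfolding rho_root_def Let_def q[symmetric] rho_A_def[symmetric] rho_B_def[symmetric]
  by (simp_all add: rho_u_def rho_v_def rho_w_inverse[symmetric] mult.assoc) (simp_all add: rho_w_def mult_ac)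

lemma rho_A3: "rho_A ^ 3 = complex_of_real (9 * k) + csqrt (complex_of_real (81 * k\<^sup>2 + q))"
  by (simp only: rho_A_def cube_root_cube)

lemma rho_B3: "rho_B ^ 3 = complex_of_real q"
  by (simp only: rho_B_def cube_root_cube)

text \<open>The resolvent: the cube of \<open>rho_A\<close> solves a quadratic equation whichever
  square root is taken.\<close>

lemma rho_A3_quadratic: "rho_A ^ 3 * (rho_A ^ 3 - complex_of_real (18 * k)) = complex_of_real q"
proof -
  define c where "c = csqrt (complex_of_real (81 * k\<^sup>2 + q))"
  have c: "c * c = 81 * (complex_of_real k * complex_of_real k) + complex_of_real q"
    using power2_csqrt[of "complex_of_real (81 * k\<^sup>2 + q)"] by (simp add: c_def power2_eq_square)
  show ?thesis unfolding rho_A3 c_def[symmetric] using c by (simp add: algebra_simps)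
qed

lemma rho_nonzero: "rho_A \<noteq> 0" "rho_B \<noteq> 0"
  using rho_A3_quadratic rho_B3 q0 by auto

lemma rho_uv: "rho_u * rho_v = - 1 / complex_of_real (4 * k\<^sup>2 * q)"
  unfolding rho_u_def rho_v_def of_real_mult rho_B3[symmetric]
  using rho_nonzero k by (simp add: field_simps power2_eq_square power3_eq_cube)

lemma rho_u3v3: "rho_u ^ 3 + rho_v ^ 3 = complex_of_real (9 / (4 * k\<^sup>2 * q\<^sup>2))"
proof -
  have u: "rho_u ^ 3 = rho_A ^ 3 / (complex_of_real (8 * k ^ 3) * (complex_of_real q)\<^sup>2)"
    unfolding rho_B3[symmetric] by (simp add: rho_u_def power_divide power_mult_distrib flip: power_mult)
  have v: "rho_v ^ 3 = - 1 / (complex_of_real (8 * k ^ 3) * complex_of_real q * rho_A ^ 3)"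
    unfolding rho_B3[symmetric] by (simp add: rho_v_def power_divide power_mult_distrib)
  define Y where "Y = rho_A ^ 3"
  have Y: "Y \<noteq> 0" using rho_nonzero by (simp add: Y_def)
  have quad: "Y * (Y - complex_of_real (18 * k)) = complex_of_real q" using rho_A3_quadratic by (simp add: Y_def)
  have "rho_u ^ 3 + rho_v ^ 3 = (Y\<^sup>2 - complex_of_real q) / (complex_of_real (8 * k ^ 3) * (complex_of_real q)\<^sup>2 * Y)"
    unfolding u v Y_def[symmetric] using Y q0 k by (simp add: field_simps power2_eq_square)
  also have "Y\<^sup>2 - complex_of_real q = complex_of_real (18 * k) * Y"
    unfolding quad[symmetric] by (simp add: algebra_simps power2_eq_square)
  finally show ?thesis using Y q0 k by (simp add: field_simps power2_eq_square power3_eq_cube)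
qed

lemma q_sq: "q\<^sup>2 = \<Lambda>\<^sup>2"
  using eps by (auto simp: q)

text \<open>Only \<open>rho_u * rho_v\<close> and the sum of the cubes enter the product, so the
  choice of branches affects the numbering of the roots but not their set.\<close>

lemma rho_product:
  "(z - rho_root \<epsilon> \<Lambda> k 1) * (z - rho_root \<epsilon> \<Lambda> k 2) * (z - rho_root \<epsilon> \<Lambda> k 3)
     = z ^ 3 + complex_of_real (3 / (4 * k\<^sup>2 * q)) * z - complex_of_real (9 / (4 * k\<^sup>2 * q\<^sup>2))"
proof -
  have "(z - (rho_w * rho_u + rho_w\<^sup>2 * rho_v)) * (z - (rho_u + rho_v)) * (z - (rho_w\<^sup>2 * rho_u + rho_w * rho_v))
     = z ^ 3 - 3 * (rho_u * rho_v) * z - (rho_u ^ 3 + rho_v ^ 3)"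
    using rho_w3(2) by algebra
  then show ?thesis unfolding rho_roots rho_uv rho_u3v3 by simp
qed

lemma real_root_iff:
  "(\<exists>l\<in>{1, 2, 3}. rho_root \<epsilon> \<Lambda> k l = complex_of_real x) \<longleftrightarrow> 4 * k\<^sup>2 * q\<^sup>2 * x ^ 3 + 3 * q * x - 9 = 0"
proof -
  have "(\<exists>l\<in>{1, 2, 3}. rho_root \<epsilon> \<Lambda> k l = complex_of_real x) \<longleftrightarrow>
     (complex_of_real x - rho_root \<epsilon> \<Lambda> k 1) * (complex_of_real x - rho_root \<epsilon> \<Lambda> k 2) * (complex_of_real x - rho_root \<epsilon> \<Lambda> k 3) = 0"
    by auto
  also have "\<dots> \<longleftrightarrow> complex_of_real (x ^ 3 + 3 / (4 * k\<^sup>2 * q) * x - 9 / (4 * k\<^sup>2 * q\<^sup>2)) = 0"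
    unfolding rho_product by (simp only: of_real_add of_real_diff of_real_mult of_real_power)
  also have "\<dots> \<longleftrightarrow> x ^ 3 + 3 / (4 * k\<^sup>2 * q) * x - 9 / (4 * k\<^sup>2 * q\<^sup>2) = 0" by (simp only: of_real_eq_0_iff)
  also have "\<dots> \<longleftrightarrow> 4 * k\<^sup>2 * q\<^sup>2 * x ^ 3 + 3 * q * x - 9 = 0"
  proof -
    have "4 * k\<^sup>2 * q\<^sup>2 * x ^ 3 + 3 * q * x - 9
       = (4 * k\<^sup>2 * q\<^sup>2) * (x ^ 3 + 3 / (4 * k\<^sup>2 * q) * x - 9 / (4 * k\<^sup>2 * q\<^sup>2))"
      using k q0 by (simp add: field_simps power2_eq_square)
    then show ?thesis using k q0 by simp
  qed
  finally show ?thesis .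
qed

text \<open>By the convention for roots \<open>rho_B\<close> has argument \<open>pi / 3\<close> for
  negative \<open>q\<close>. Its square is \<open>rho_w\<close> times a positive number and its
  phase cubed is -1, so all phases except that of \<open>rho_A\<close> cancel in this root.\<close>

lemma rho_root_1:
  assumes neg: "q < 0"
  shows "rho_root \<epsilon> \<Lambda> k 1 = rho_A / complex_of_real (2 * k * (root 3 \<bar>q\<bar>)\<^sup>2) + 1 / (complex_of_real (2 * k * root 3 \<bar>q\<bar>) * rho_A)"
proof -
  define b where "b = root 3 \<bar>q\<bar>"
  have b: "b > 0" using neg by (simp add: b_def)
  define h where "h = exp (\<i> * complex_of_real pi / 3)"
  have B: "rho_B = complex_of_real b * h" unfolding rho_B_def b_def h_def by (rule cube_root_neg[OF neg])
  have hh: "h\<^sup>2 = rho_w" unfolding h_def rho_w_def by (simp add: mult_ac flip: exp_of_nat_mult exp_double)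
  have h3: "h ^ 3 = - 1"
  proof -
    have "h ^ 3 = exp (of_nat 3 * (\<i> * complex_of_real pi / 3))" unfolding h_def exp_of_nat_mult ..
    also have "\<dots> = exp (complex_of_real pi * \<i>)" by (simp add: mult.commute)
    finally show ?thesis by simp
  qed
  have h0: "h \<noteq> 0" by (simp add: h_def)
  have "rho_root \<epsilon> \<Lambda> k 1 = h\<^sup>2 * (rho_A / (complex_of_real (2 * k) * (complex_of_real b * h)\<^sup>2))
      - h ^ 4 / (complex_of_real (2 * k) * (complex_of_real b * h) * rho_A)"
    unfolding rho_roots rho_u_def rho_v_def B hh[symmetric] by (simp flip: power_mult)
  also have "h ^ 4 = - h" using h3 by (simp add: eval_nat_numeral)
  finally show ?thesis
    unfolding b_def[symmetric] using b h0 k rho_nonzero(1) by (simp add: field_simps power2_eq_square)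
qed

text \<open>Beyond the threshold the square root is imaginary, and the squared modulus of the
  radicand is \<open>81 k k - (81 k k + q) = - q\<close>.\<close>

lemma rho_A_conj:
  assumes "q \<le> - 81 * k\<^sup>2"
  shows "rho_A * cnj rho_A = complex_of_real (root 3 \<bar>q\<bar>)"
proof -
  have q_neg: "q < 0" using assms k by (smt (verit) zero_less_power2)
  define z where "z = complex_of_real (9 * k) + csqrt (complex_of_real (81 * k\<^sup>2 + q))"
  have "csqrt (complex_of_real (81 * k\<^sup>2 + q)) = \<i> * complex_of_real (sqrt \<bar>81 * k\<^sup>2 + q\<bar>)"
    using assms by (simp add: csqrt_of_real_nonpos)
  then have "Re z = 9 * k" "Im z = sqrt \<bar>81 * k\<^sup>2 + q\<bar>" by (simp_all add: z_def)
  then have "(cmod z)\<^sup>2 = \<bar>q\<bar>" using assms q_neg by (simp add: cmod_power2 power_mult_distrib)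
  then have "(root 3 (cmod z))\<^sup>2 = root 3 \<bar>q\<bar>"
    by (metis real_root_power zero_less_numeral)
  then have "(cmod rho_A)\<^sup>2 = root 3 \<bar>q\<bar>" by (simp add: rho_A_def z_def norm_cube_root)
  then show ?thesis by (simp add: complex_norm_square[symmetric] flip: of_real_power)
qed

text \<open>Below the threshold \<open>rho_A\<close> is positive and the root is a sum of positive
  terms. Beyond it the two terms are conjugate, and \<open>rho_A\<close> lies in the right
  half-plane, because a third of an argument is at most \<open>pi / 3\<close> in absolute
  value.\<close>

lemma rho_root_1_pos:
  assumes neg: "q < 0"
  shows "\<exists>x>0. rho_root \<epsilon> \<Lambda> k 1 = complex_of_real x"
proof (cases "81 * k\<^sup>2 + q \<ge> 0")
  case True
  define a where "a = 9 * k + sqrt (81 * k\<^sup>2 + q)"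
  have a: "a > 0" using k True by (simp add: a_def add_pos_nonneg)
  have "rho_A = complex_of_real (root 3 a)"
    unfolding rho_A_def using cube_root_pos[OF a] True by (simp add: a_def csqrt_of_real_nonneg flip: of_real_add of_real_mult of_real_power)
  then have "rho_root \<epsilon> \<Lambda> k 1 = complex_of_real (root 3 a / (2 * k * (root 3 \<bar>q\<bar>)\<^sup>2) + 1 / (2 * k * root 3 \<bar>q\<bar> * root 3 a))"
    unfolding rho_root_1[OF neg] by simp
  moreover have "root 3 a / (2 * k * (root 3 \<bar>q\<bar>)\<^sup>2) + 1 / (2 * k * root 3 \<bar>q\<bar> * root 3 a) > 0"
    using a k q0 by (intro add_pos_pos divide_pos_pos mult_pos_pos) auto
  ultimately show ?thesis by blast
next
  case False
  define b where "b = root 3 \<bar>q\<bar>"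
  have b: "b > 0" using neg by (simp add: b_def)
  have conj: "rho_A * cnj rho_A = complex_of_real b" unfolding b_def by (rule rho_A_conj) (use False in simp)
  then have "1 / (complex_of_real (2 * k * b) * rho_A) = cnj rho_A / complex_of_real (2 * k * b\<^sup>2)"
    using rho_nonzero(1) b k by (simp add: field_simps power2_eq_square)
  then have "rho_root \<epsilon> \<Lambda> k 1 = (rho_A + cnj rho_A) / complex_of_real (2 * k * b\<^sup>2)"
    unfolding rho_root_1[OF neg] b_def[symmetric] by (simp add: add_divide_distrib)
  then have "rho_root \<epsilon> \<Lambda> k 1 = complex_of_real (2 * Re rho_A / (2 * k * b\<^sup>2))"
    by (simp add: complex_add_cnj)
  moreover have "Re rho_A > 0"
    unfolding rho_A_def using rho_nonzero(1) by (intro Re_cube_root_pos) (auto simp: rho_A_def cube_root_def)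
  ultimately show ?thesis using b k by (intro exI[of _ "2 * Re rho_A / (2 * k * b\<^sup>2)"]) auto
qed

lemma rho_sums:
  "rho_root \<epsilon> \<Lambda> k 1 + rho_root \<epsilon> \<Lambda> k 2 + rho_root \<epsilon> \<Lambda> k 3 = 0"
  "rho_root \<epsilon> \<Lambda> k 1 * rho_root \<epsilon> \<Lambda> k 2 * rho_root \<epsilon> \<Lambda> k 3 = complex_of_real (9 / (4 * k\<^sup>2 * q\<^sup>2))"
proof -
  show "rho_root \<epsilon> \<Lambda> k 1 + rho_root \<epsilon> \<Lambda> k 2 + rho_root \<epsilon> \<Lambda> k 3 = 0"
    unfolding rho_roots using rho_w3(2) by algebra
  show "rho_root \<epsilon> \<Lambda> k 1 * rho_root \<epsilon> \<Lambda> k 2 * rho_root \<epsilon> \<Lambda> k 3 = complex_of_real (9 / (4 * k\<^sup>2 * q\<^sup>2))"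
    using rho_product[of 0] by simp
qed

text \<open>The sum of the roots is 0, so a second real root makes the third real. The product is
  positive, so the remaining two have equal sign, and the sum makes it negative. The bound on
  \<open>q\<close> says that the discriminant, now a square, is nonnegative.\<close>

lemma other_roots:
  assumes neg: "q < 0" and l: "l \<in> {2, 3}" and x: "rho_root \<epsilon> \<Lambda> k l = complex_of_real x"
  shows "x < 0" "q \<le> - 81 * k\<^sup>2"
proof -
  obtain r1 where r1: "r1 > 0" "rho_root \<epsilon> \<Lambda> k 1 = complex_of_real r1" using rho_root_1_pos[OF neg] by blast
  define y where "y = - r1 - x"
  have s: "r1 * x * y = 9 / (4 * k\<^sup>2 * q\<^sup>2)"
    and roots: "\<And>z. (z - r1) * (z - x) * (z - y) = z ^ 3 + 3 / (4 * k\<^sup>2 * q) * z - 9 / (4 * k\<^sup>2 * q\<^sup>2)"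
  proof -
    define m where "m = (if l = 2 then 3 else 2::nat)"
    have "rho_root \<epsilon> \<Lambda> k m = - rho_root \<epsilon> \<Lambda> k 1 - rho_root \<epsilon> \<Lambda> k l"
      using rho_sums(1) l by (auto simp: m_def algebra_simps eq_neg_iff_add_eq_0)
    then have y: "rho_root \<epsilon> \<Lambda> k m = complex_of_real y" by (simp add: r1 x y_def del: One_nat_def)
    have pr: "(z - rho_root \<epsilon> \<Lambda> k 1) * (z - rho_root \<epsilon> \<Lambda> k l) * (z - rho_root \<epsilon> \<Lambda> k m)
       = z ^ 3 + complex_of_real (3 / (4 * k\<^sup>2 * q)) * z - complex_of_real (9 / (4 * k\<^sup>2 * q\<^sup>2))" for z
      using rho_product[of z] l by (auto simp: m_def mult_ac)
    show roots: "(z - r1) * (z - x) * (z - y) = z ^ 3 + 3 / (4 * k\<^sup>2 * q) * z - 9 / (4 * k\<^sup>2 * q\<^sup>2)" for z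
    proof -
      have "complex_of_real ((z - r1) * (z - x) * (z - y)) = complex_of_real (z ^ 3 + 3 / (4 * k\<^sup>2 * q) * z - 9 / (4 * k\<^sup>2 * q\<^sup>2))"
        using pr[of "complex_of_real z"] unfolding r1 x y
        by (simp only: of_real_add of_real_diff of_real_mult of_real_power)
      then show ?thesis by (simp only: of_real_eq_iff)
    qed
    show "r1 * x * y = 9 / (4 * k\<^sup>2 * q\<^sup>2)" using roots[of 0] by simp
  qed
  have "r1 * x * y > 0" unfolding s using k q0 by simp
  then have "x * y > 0" using r1(1) by (simp add: mult.assoc zero_less_mult_iff)
  moreover have "x + y < 0" using r1 by (simp add: y_def)
  ultimately show "x < 0" by (auto simp: zero_less_mult_iff)
  have p: "r1 * x + r1 * y + x * y = 3 / (4 * k\<^sup>2 * q)"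
    using roots[of 1] roots[of "-1"] s by (simp add: algebra_simps)
  define P where "P = 3 / (4 * k\<^sup>2 * q)"
  define M where "M = 9 / (4 * k\<^sup>2 * q\<^sup>2)"
  \<comment> \<open>The discriminant of a cubic without quadratic term, with linear coefficient
    \<open>P\<close> and constant term \<open>- M\<close>.\<close>
  have "((r1 - x) * (x - y) * (r1 - y))\<^sup>2 = - 4 * P ^ 3 - 27 * M\<^sup>2"
  proof -
    have P: "P = r1 * x + r1 * y + x * y" and M: "M = r1 * x * y" using p s by (simp_all add: P_def M_def)
    show ?thesis unfolding P M y_def by algebra
  qed
  then have "- 4 * P ^ 3 - 27 * M\<^sup>2 \<ge> 0" by (metis zero_le_power2)
  moreover have "- 4 * P ^ 3 - 27 * M\<^sup>2 = (27 / (16 * k ^ 6 * q ^ 4)) * (- q - 81 * k\<^sup>2)"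
    unfolding P_def M_def using k q0 by (simp add: field_simps eval_nat_numeral)
  moreover have "27 / (16 * k ^ 6 * q ^ 4) > 0" using k q0 by simp
  ultimately have "\<not> - q - 81 * k\<^sup>2 < 0" using mult_pos_neg by (metis not_less)
  then show "q \<le> - 81 * k\<^sup>2" by simp
qed

text \<open>In this range \<open>rho_u\<close> and \<open>rho_v\<close> are complex conjugates, and
  conjugation squares \<open>rho_w\<close>; hence each root is fixed by conjugation.\<close>

lemma other_roots_real:
  assumes le: "q \<le> - 81 * k\<^sup>2" and l: "l \<in> {2, 3}"
  shows "rho_root \<epsilon> \<Lambda> k l \<in> \<real>"
proof -
  have neg: "q < 0" using le k by (smt (verit) zero_less_power2)
  define b where "b = root 3 \<bar>q\<bar>"
  have b: "b > 0" using neg by (simp add: b_def)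
  define h where "h = exp (\<i> * complex_of_real pi / 3)"
  have B: "rho_B = complex_of_real b * h" unfolding rho_B_def b_def h_def by (rule cube_root_neg[OF neg])
  have h3: "h ^ 3 = - 1"
  proof -
    have "h ^ 3 = exp (of_nat 3 * (\<i> * complex_of_real pi / 3))" unfolding h_def exp_of_nat_mult ..
    also have "\<dots> = exp (complex_of_real pi * \<i>)" by (simp add: mult.commute)
    finally show ?thesis by simp
  qed
  have hc: "h * cnj h = 1"
  proof -
    have "h = cis (pi / 3)" by (simp add: h_def cis_conv_exp)
    then show ?thesis by (simp add: cis_cnj cis_mult)
  qed
  have A: "rho_A * cnj rho_A = complex_of_real b" unfolding b_def by (rule rho_A_conj[OF le])
  have uv: "cnj rho_u = rho_v"
  proof -
    have nz: "h \<noteq> 0" using hc by auto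
    have h2: "(cnj h)\<^sup>2 = - h"
    proof -
      have "h * (h * cnj h) * (h * cnj h) = (h ^ 3) * (cnj h)\<^sup>2" by (simp add: power2_eq_square power3_eq_cube)
      then have "h = - (cnj h)\<^sup>2" by (simp add: hc h3)
      from arg_cong[OF this, of uminus] show ?thesis by simp
    qed
    have cA: "cnj rho_A = complex_of_real b / rho_A" using A rho_nonzero(1) by (simp add: field_simps)
    have "cnj rho_u = (complex_of_real b / rho_A) / (complex_of_real (2 * k) * ((complex_of_real b)\<^sup>2 * - h))"
      by (simp add: rho_u_def B power_mult_distrib h2 cA)
    then show ?thesis
      unfolding rho_v_def B using nz b k rho_nonzero(1) by (simp add: power2_eq_square)
  qed
  have wc: "cnj rho_w = rho_w\<^sup>2"
  proof -
    have "rho_w = cis (2 * pi / 3)" by (simp add: rho_w_def cis_conv_exp mult_ac)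
    then have "rho_w * cnj rho_w = cis (2 * pi / 3) * cnj (cis (2 * pi / 3))" by (rule arg_cong)
    also have "\<dots> = 1" unfolding cis_cnj cis_mult by simp
    finally have "rho_w * cnj rho_w = 1" .
    moreover have "rho_w * rho_w\<^sup>2 = 1" using rho_w3(1) by (simp add: power2_eq_square power3_eq_cube mult.assoc)
    ultimately show ?thesis by (metis mult_cancel_left mult_zero_left zero_neq_one)
  qed
  have vu: "cnj rho_v = rho_u" using uv by (metis complex_cnj_cnj)
  have w4: "rho_w ^ 4 = rho_w" using rho_w3(1) by (simp add: power4_eq_xxxx power3_eq_cube mult.assoc)
  have "cnj (rho_root \<epsilon> \<Lambda> k l) = rho_root \<epsilon> \<Lambda> k l"
    using l by (auto simp: rho_roots uv vu wc w4 add.commute)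
  then show ?thesis by (simp add: Reals_cnj_iff)
qed

text \<open>For positive \<open>q\<close> the radicands are positive, and Cardano's formula can be
  carried out in the reals.\<close>

lemma rho_root4_real:
  assumes pos: "q > 0"
  shows "\<exists>x. rho_root4 \<epsilon> \<Lambda> k = complex_of_real x \<and> 4 * k\<^sup>2 * q\<^sup>2 * x ^ 3 + 3 * q * x - 9 = 0"
proof -
  define S where "S = sqrt (81 * k\<^sup>2 + q)"
  have S: "S * S = 81 * k\<^sup>2 + q" "S > 9 * k"
  proof -
    show "S * S = 81 * k\<^sup>2 + q" using pos by (simp add: S_def)
    have "(9 * k)\<^sup>2 < 81 * k\<^sup>2 + q" using pos by (simp add: power_mult_distrib)
    then show "S > 9 * k" unfolding S_def by (rule real_less_rsqrt)
  qed
  have L0: "\<Lambda> \<noteq> 0" using q q0 by auto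
  have "sqrt (\<Lambda> ^ 8 * (81 * k\<^sup>2 + q)) = \<Lambda> ^ 4 * S"
  proof -
    have "sqrt (\<Lambda> ^ 8) = \<Lambda> ^ 4" by (rule real_sqrt_unique) (simp_all flip: power_mult)
    then show ?thesis by (simp add: real_sqrt_mult S_def)
  qed
  moreover have nn: "\<Lambda> ^ 8 * (81 * k\<^sup>2 + q) \<ge> 0" using pos by simp
  ultimately have cs: "csqrt (complex_of_real (\<Lambda> ^ 8 * (81 * k\<^sup>2 + q))) = complex_of_real (\<Lambda> ^ 4 * S)"
    using csqrt_of_real_nonneg[of "complex_of_real (\<Lambda> ^ 8 * (81 * k\<^sup>2 + q))"]
    by (simp only: Im_complex_of_real Re_complex_of_real)
  define D where "D = \<Lambda> ^ 4 * (S - 9 * k)"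
  have D: "D > 0" using S L0 by (simp add: D_def)
  define a where "a = root 3 D"
  have a: "a > 0" "a ^ 3 = D" using D by (simp_all add: a_def)
  have "complex_of_real (- 9 * k * \<Lambda> ^ 4) + csqrt (complex_of_real (\<Lambda> ^ 8 * (81 * k\<^sup>2 + q))) = complex_of_real D"
    unfolding cs by (simp add: D_def algebra_simps)
  then have A: "cube_root (complex_of_real (- 9 * k * \<Lambda> ^ 4) + csqrt (complex_of_real (\<Lambda> ^ 8 * (81 * k\<^sup>2 + q)))) = complex_of_real a"
    using cube_root_pos[OF D] by (simp only: a_def)
  define u where "u = q / (2 * k * a)"
  define v where "v = - a / (2 * k * \<Lambda>\<^sup>2)"
  have r: "rho_root4 \<epsilon> \<Lambda> k = complex_of_real (u + v)"
    unfolding rho_root4_def Let_def q[symmetric] A u_def v_def by simp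
  have uv: "u * v * (4 * k\<^sup>2 * q) = - 1"
    unfolding u_def v_def q_sq[symmetric] using a(1) k q0 by (simp add: field_simps power2_eq_square)
  have u3: "u ^ 3 * (8 * k ^ 3 * D) = q ^ 3" unfolding u_def a(2)[symmetric] using a(1) k by (simp add: field_simps)
  have v3: "v ^ 3 * (8 * k ^ 3 * \<Lambda> ^ 6) = - D" unfolding v_def a(2)[symmetric] using L0 k by (simp add: field_simps eval_nat_numeral)
  have L4: "\<Lambda> ^ 4 = q ^ 4" "\<Lambda> ^ 6 = q ^ 6"
    using arg_cong[OF q_sq, of "\<lambda>x. x ^ 2"] arg_cong[OF q_sq, of "\<lambda>x. x ^ 3"] by (simp_all flip: power_mult)
  \<comment> \<open>Up to the factor \<open>q * q\<close> this is the conjugate radical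
    \<open>S - 9 k\<close>. As \<open>(S - 9 k) * (S + 9 k) = q\<close>, it serves to rewrite the
    cube of \<open>u\<close> without a denominator.\<close>
  define N where "N = q\<^sup>2 * (S - 9 * k)"
  have N: "N \<noteq> 0" "(S + 9 * k) * N = q ^ 3" "D = q\<^sup>2 * N"
  proof -
    show "N \<noteq> 0" using S(2) q0 by (simp add: N_def)
    show "(S + 9 * k) * N = q ^ 3" using S(1) unfolding N_def by algebra
    show "D = q\<^sup>2 * N" unfolding D_def N_def L4(1) by (simp add: eval_nat_numeral)
  qed
  have "(u ^ 3 * (8 * k ^ 3 * q\<^sup>2)) * N = (S + 9 * k) * N"
    using u3 N(2,3) by (simp add: mult_ac)
  then have u3': "u ^ 3 * (8 * k ^ 3 * q\<^sup>2) = S + 9 * k" using N(1) by simp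
  have "(v ^ 3 * (8 * k ^ 3 * q\<^sup>2)) * q ^ 4 = - (S - 9 * k) * q ^ 4"
    using v3 unfolding D_def L4 by (simp add: algebra_simps eval_nat_numeral)
  then have v3': "v ^ 3 * (8 * k ^ 3 * q\<^sup>2) = - (S - 9 * k)" using q0 by simp
  have "(2 * k) * ((u ^ 3 + v ^ 3) * (4 * k\<^sup>2 * q\<^sup>2)) = (2 * k) * 9"
    using u3' v3' by (simp add: algebra_simps eval_nat_numeral)
  then have uv3: "(u ^ 3 + v ^ 3) * (4 * k\<^sup>2 * q\<^sup>2) = 9" using k by (simp add: mult_ac)
  have "4 * k\<^sup>2 * q\<^sup>2 * (u + v) ^ 3 + 3 * q * (u + v) - 9 = 0"
    using uv uv3 by algebra
  with r show ?thesis by blast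
qed

text \<open>For positive \<open>q\<close> the cubic is strictly increasing: the difference quotient
  is a positive semidefinite form plus a positive number.\<close>

lemma cubic_unique:
  assumes "q > 0" "4 * k\<^sup>2 * q\<^sup>2 * x ^ 3 + 3 * q * x - 9 = 0" "4 * k\<^sup>2 * q\<^sup>2 * y ^ 3 + 3 * q * y - 9 = 0"
  shows "x = y"
proof -
  have "(x - y) * (4 * k\<^sup>2 * q\<^sup>2 * (x\<^sup>2 + x * y + y\<^sup>2) + 3 * q) = 0"
    using assms(2,3) by algebra
  moreover have "x\<^sup>2 + x * y + y\<^sup>2 \<ge> 0"
  proof -
    have "x\<^sup>2 + x * y + y\<^sup>2 = (x + y / 2)\<^sup>2 + 3 / 4 * y\<^sup>2" by (simp add: power2_eq_square field_simps)
    then show ?thesis by simp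
  qed
  then have "4 * k\<^sup>2 * q\<^sup>2 * (x\<^sup>2 + x * y + y\<^sup>2) + 3 * q > 0"
    using assms(1) by (intro add_nonneg_pos mult_nonneg_nonneg) auto
  ultimately show ?thesis by simp
qed

end

subsection \<open>Changes of the interval coordinate\<close>

text \<open>A nowhere vanishing derivative gives injectivity by the mean value theorem; on an
  interval this makes the image open and the inverse continuous, and smoothness of the inverse
  follows by bootstrapping.\<close>

lemma diffeo_1d:
  fixes f f' :: "real \<Rightarrow> real"
  assumes "open I" "is_interval I" "smooth_real_on f I"
    and f': "\<And>t. t \<in> I \<Longrightarrow> (f has_real_derivative f' t) (at t)" "\<And>t. t \<in> I \<Longrightarrow> f' t \<noteq> 0"
  obtains g where "open (f ` I)" "is_interval (f ` I)" "smooth_real_on g (f ` I)"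
    "\<And>t. t \<in> I \<Longrightarrow> g (f t) = t" "\<And>y. y \<in> f ` I \<Longrightarrow> f (g y) = y" "\<And>y. y \<in> f ` I \<Longrightarrow> g y \<in> I"
    "\<And>y. y \<in> f ` I \<Longrightarrow> (g has_real_derivative inverse (f' (g y))) (at y)"
proof -
  have cont: "continuous_on I f" using f'(1) by (auto intro!: continuous_at_imp_continuous_on DERIV_isCont)
  have ne: "f a \<noteq> f b" if ab: "a \<in> I" "b \<in> I" "a < b" for a b
  proof
    assume eq: "f a = f b"
    have sub: "x \<in> I" if "a \<le> x" "x \<le> b" for x using assms(2) ab that unfolding is_interval_1 by blast
    obtain z where "a < z" "z < b" "f b - f a = (b - a) * f' z"
      using MVT2[OF ab(3), of f f'] sub f'(1) by blast
    then show False using eq ab f'(2)[of z] sub[of z] by auto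
  qed
  then have inj: "inj_on f I" by (metis inj_onI linorder_neqE_linordered_idom)
  have pc: "path_connected I" using assms(2) by (simp add: is_interval_path_connected)
  obtain g where g: "homeomorphism I (f ` I) f g"
    using homeomorphism_into_1d[OF pc cont refl inj] by blast
  then have gg: "\<And>t. t \<in> I \<Longrightarrow> g (f t) = t" "\<And>y. y \<in> f ` I \<Longrightarrow> f (g y) = y" "continuous_on (f ` I) g" "g ` f ` I = I"
    by (auto simp: homeomorphism_def)
  have op: "open (f ` I)"
    using injective_eq_1d_open_map_UNIV[OF cont assms(2)] inj assms(1) by blast
  have iv: "is_interval (f ` I)"
    using connected_continuous_image[OF cont is_interval_connected[OF assms(2)]] by (simp add: is_interval_connected_1)
  have gI: "g y \<in> I" if "y \<in> f ` I" for y using gg(4) that by blast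
  show thesis
  proof (rule that[OF op iv _ gg(1,2) gI])
    show "smooth_real_on g (f ` I)"
      by (rule smooth_real_on_inverse_function[OF assms(1) op assms(3) gg(3) _ gg(2) f']) (use gg(4) in auto)
    show "(g has_real_derivative inverse (f' (g y))) (at y)" if "y \<in> f ` I" for y
      by (rule inverse_function_derivative[OF op that gg(3,2) f'(1)[OF gI[OF that]] f'(2)[OF gI[OF that]]])
  qed auto
qed

lemma antiderivative_on_interval:
  fixes f :: "real \<Rightarrow> real"
  assumes "open I" "is_interval I" "continuous_on I f" "c \<in> I"
  obtains T where "T c = 0" "\<And>x. x \<in> I \<Longrightarrow> (T has_real_derivative f x) (at x)"
proof (rule that[of "\<lambda>u. LBINT y=ereal c..ereal u. f y"])
  let ?T = "\<lambda>u. LBINT y=ereal c..ereal u. f y"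
  show "?T c = 0" by simp
  fix x assume x: "x \<in> I"
  have "min c x \<in> I" "max c x \<in> I" using assms(4) x by (auto simp: min_def max_def)
  then obtain e1 e2 where e: "e1 > 0" "ball (min c x) e1 \<subseteq> I" "e2 > 0" "ball (max c x) e2 \<subseteq> I"
    using assms(1) openE by metis
  define a where "a = min c x - e1 / 2"
  define b where "b = max c x + e2 / 2"
  have "a \<in> I" "b \<in> I" using e by (auto simp: a_def b_def subset_iff dist_real_def)
  then have sub: "{a..b} \<subseteq> I" using assms(2) unfolding is_interval_1 by (meson atLeastAtMost_iff subsetI)
  have ab: "a < c" "c < b" "a < x" "x < b" using e by (auto simp: a_def b_def)
  have "(?T has_vector_derivative f x) (at x within {a..b})"
    by (rule interval_integral_FTC2) (use ab sub assms(3) continuous_on_subset in auto)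
  moreover have "at x within {a..b} = at x" using ab by (simp add: at_within_Icc_at)
  ultimately show "(?T has_real_derivative f x) (at x)"
    by (simp add: has_real_derivative_iff_has_vector_derivative)
qed

text \<open>The group coordinates are kept, so the Maurer-Cartan form is unchanged and only the
  coefficient of the interval direction picks up the square of \<open>r'\<close>.\<close>

lemma change_coordinate_isometry:
  assumes J: "open J" and I: "open I" and r: "smooth_real_on r J" "r ` J = I"
    and r': "\<And>t. t \<in> J \<Longrightarrow> (r has_real_derivative r' t) (at t)"
    and g: "smooth_real_on g I" "\<And>t. t \<in> J \<Longrightarrow> g (r t) = t" "\<And>\<rho>. \<rho> \<in> I \<Longrightarrow> r (g \<rho>) = \<rho>" "\<And>\<rho>. \<rho> \<in> I \<Longrightarrow> g \<rho> \<in> J"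
    and P: "\<And>t. t \<in> J \<Longrightarrow> P (r t) * (r' t)\<^sup>2 = Q t"
    and H: "\<And>t u v. t \<in> J \<Longrightarrow> H (r t) u v = K t u v"
    and gJ: "\<And>x u v. x $ 1 \<in> J \<Longrightarrow> g1 x u v = hmet Q K x u v"
    and gI: "\<And>x u v. x $ 1 \<in> I \<Longrightarrow> g2 x u v = hmet P H x u v"
  shows "isometry_between (interval_times_heis J) g1 (interval_times_heis I) g2
    (\<lambda>x. vector [r (x $ 1), x $ 2, x $ 3, x $ 4])"
proof -
  define \<phi> where "\<phi> s x = (vector [s (x $ 1), x $ 2, x $ 3, x $ 4] :: real ^ 4)" for s :: "real \<Rightarrow> real" and x :: "real ^ 4"
  have sm: "smooth_map_on (\<phi> s) (interval_times_heis S)" if "open S" "smooth_real_on s S" for s S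
    unfolding smooth_map_on_def forall_4 \<phi>_def
    using smooth_fun_on_real_comp_nth[OF that] by (simp add: interval_times_heis_def smooth_fun_on_nth)
  have \<phi>1: "\<phi> g (\<phi> r x) = x" "\<phi> r x \<in> interval_times_heis I" if "x \<in> interval_times_heis J" for x
    using that g(2) r(2) by (auto simp: \<phi>_def interval_times_heis_def vec_eq_iff forall_4)
  have \<phi>2: "\<phi> r (\<phi> g y) = y" "\<phi> g y \<in> interval_times_heis J" if "y \<in> interval_times_heis I" for y
    using that g(3,4) by (auto simp: \<phi>_def interval_times_heis_def vec_eq_iff forall_4)
  have bij: "bij_betw (\<phi> r) (interval_times_heis J) (interval_times_heis I)"
    by (rule bij_betw_byWitness[where f' = "\<phi> g"]) (use \<phi>1 \<phi>2 in auto)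
  have inv: "inv_into (interval_times_heis J) (\<phi> r) y = \<phi> g y" if "y \<in> interval_times_heis I" for y
    using \<phi>2[OF that] bij by (metis bij_betw_inv_into_left)
  have "smooth_map_on (inv_into (interval_times_heis J) (\<phi> r)) (interval_times_heis I)"
    using sm[OF I g(1)] smooth_fun_on_cong[OF open_interval_times_heis[OF I], of "\<lambda>y. inv_into (interval_times_heis J) (\<phi> r) y $ i" "\<lambda>y. \<phi> g y $ i" for i]
    by (simp add: smooth_map_on_def inv)
  then have diff: "diffeomorphism_between (interval_times_heis J) (interval_times_heis I) (\<phi> r)"
    using bij sm[OF J r(1)] by (simp add: diffeomorphism_between_def)
  have "g1 x u v = g2 (\<phi> r x) (frechet_derivative (\<phi> r) (at x) u) (frechet_derivative (\<phi> r) (at x) v)"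
    if x: "x \<in> interval_times_heis J" for x u v
  proof -
    have xJ: "x $ 1 \<in> J" using x by (simp add: interval_times_heis_def)
    define D :: "real ^ 4 \<Rightarrow> real ^ 4" where "D u = u + (r' (x $ 1) * u $ 1 - u $ 1) *\<^sub>R axis 1 1" for u
    have "((\<lambda>x. r (x $ 1)) has_derivative (\<lambda>u. r' (x $ 1) * u $ 1)) (at x)"
      using has_derivative_compose[OF bounded_linear_imp_has_derivative[OF bounded_linear_vec_nth]
          r'[OF xJ, unfolded has_field_derivative_def]] .
    then have "((\<lambda>x. x + (r (x $ 1) - x $ 1) *\<^sub>R axis 1 1) has_derivative D) (at x)"
      unfolding D_def
      by (intro has_derivative_add has_derivative_ident has_derivative_scaleR_left has_derivative_diff
          bounded_linear_imp_has_derivative bounded_linear_vec_nth)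
    moreover have "(\<lambda>x. x + (r (x $ 1) - x $ 1) *\<^sub>R axis 1 1) = \<phi> r"
      by (simp add: \<phi>_def fun_eq_iff vec_eq_iff forall_4 axis_def)
    ultimately have D: "frechet_derivative (\<phi> r) (at x) = D" using frechet_derivative_at by metis
    have d1: "D u $ 1 = r' (x $ 1) * u $ 1" and mc: "mc_form (\<phi> r x) (D u) = mc_form x u" for u
      by (simp_all add: D_def mc_form_def \<phi>_def axis_def)
    have x1: "\<phi> r x $ 1 = r (x $ 1)" by (simp add: \<phi>_def)
    have "r (x $ 1) \<in> I" using r(2) xJ by blast
    then have "g2 (\<phi> r x) (D u) (D v) = P (r (x $ 1)) * (r' (x $ 1))\<^sup>2 * u $ 1 * v $ 1 + H (r (x $ 1)) (mc_form x u) (mc_form x v)"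
      by (simp add: gI x1 hmet_def d1 mc power2_eq_square mult_ac)
    then show ?thesis by (simp add: D gJ[OF xJ] hmet_def P[OF xJ] H[OF xJ])
  qed
  then have "isometry_between (interval_times_heis J) g1 (interval_times_heis I) g2 (\<phi> r)"
    using diff by (simp add: isometry_between_def)
  then show ?thesis by (simp add: \<phi>_def[abs_def])
qed

subsection \<open>The model metrics\<close>

text \<open>With \<open>q = \<epsilon> * \<Lambda> / 3\<close> the prefactor of the model metric is
  \<open>- 1 / (2 q)\<close> over the square of \<rho>. The sign \<epsilon> of the interval and
  center coefficients is split off, so that all three functions are positive on the
  interval.\<close>

definition model_P :: "real \<Rightarrow> real \<Rightarrow> real \<Rightarrow> real" where
  "model_P q \<gamma> \<rho> = - (1 / (2 * q * \<rho>\<^sup>2)) * ((\<rho> + 2 * \<gamma>) / (\<rho> + \<gamma>))"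

definition model_center :: "real \<Rightarrow> real \<Rightarrow> real \<Rightarrow> real \<Rightarrow> real" where
  "model_center q \<gamma> k \<rho> = - (1 / (2 * q * k\<^sup>2)) * ((\<rho> + \<gamma>) / (\<rho>\<^sup>2 * (\<rho> + 2 * \<gamma>)))"

definition model_plane :: "real \<Rightarrow> real \<Rightarrow> real \<Rightarrow> real" where
  "model_plane q \<gamma> \<rho> = - (1 / q) * ((\<rho> + 2 * \<gamma>) / \<rho>\<^sup>2)"

text \<open>\<open>I_sign\<close> unites the two families of intervals: the sign of
  \<open>\<rho> + 2 * \<gamma>\<close> is opposite to that of \<open>q\<close>, see
  \<open>rho_interval_eq\<close>.\<close>

locale model_interval =
  fixes \<epsilon> q k \<gamma> :: real and e :: "real ^ 3 ^ 3" and I :: "real set"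
  assumes eps: "\<epsilon> = 1 \<or> \<epsilon> = -1" and q0: "q \<noteq> 0" and k: "k > 0" and frame_e: "heis_frame k e"
    and I_open: "open I" and I_interval: "is_interval I"
    and I_nz: "\<And>\<rho>. \<rho> \<in> I \<Longrightarrow> \<rho> \<noteq> 0" and I_pos: "\<And>\<rho>. \<rho> \<in> I \<Longrightarrow> \<rho> + \<gamma> > 0"
    and I_sign: "\<And>\<rho>. \<rho> \<in> I \<Longrightarrow> q * (\<rho> + 2 * \<gamma>) < 0"
begin

lemma I_nz2: "\<rho> \<in> I \<Longrightarrow> \<rho> + 2 * \<gamma> \<noteq> 0"
  using I_sign by fastforce

lemma inv_e: "invertible e" using frame_e by (simp add: heis_frame_iff)

lemma model_pos:
  assumes "\<rho> \<in> I"
  shows "model_P q \<gamma> \<rho> > 0" "model_center q \<gamma> k \<rho> > 0" "model_plane q \<gamma> \<rho> > 0"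
proof -
  note n = I_nz[OF assms] I_pos[OF assms] I_sign[OF assms] I_nz2[OF assms]
  have 1: "- (\<rho> + 2 * \<gamma>) / q > 0" using n(3) q0 by (auto simp: zero_less_divide_iff mult_less_0_iff)
  define a where "a = \<rho> + 2 * \<gamma>"
  define b where "b = \<rho> + \<gamma>"
  have ab: "a \<noteq> 0" "b > 0" "- a / q > 0" using n 1 by (simp_all add: a_def b_def)
  have "model_P q \<gamma> \<rho> = (- a / q) * (1 / (2 * \<rho>\<^sup>2 * b))"
    using q0 n ab unfolding model_P_def a_def[symmetric] b_def[symmetric] by (simp add: field_simps)
  moreover have "\<dots> > 0" by (rule mult_pos_pos[OF ab(3)]) (use n ab in simp)
  ultimately show "model_P q \<gamma> \<rho> > 0" by simp
  have "model_center q \<gamma> k \<rho> = (- a / q) * (b / (2 * k\<^sup>2 * \<rho>\<^sup>2 * a\<^sup>2))"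
    using q0 n k ab unfolding model_center_def a_def[symmetric] b_def[symmetric] by (simp add: field_simps power2_eq_square)
  moreover have "\<dots> > 0" by (rule mult_pos_pos[OF ab(3)]) (use n ab k in simp)
  ultimately show "model_center q \<gamma> k \<rho> > 0" by simp
  have "model_plane q \<gamma> \<rho> = (- a / q) * (1 / \<rho>\<^sup>2)" unfolding model_plane_def a_def[symmetric] by simp
  moreover have "\<dots> > 0" by (rule mult_pos_pos[OF ab(3)]) (use n in simp)
  ultimately show "model_plane q \<gamma> \<rho> > 0" by simp
qed

lemma model_smooth:
  "smooth_real_on (model_P q \<gamma>) I" "smooth_real_on (model_center q \<gamma> k) I" "smooth_real_on (model_plane q \<gamma>) I"
proof -
  have a: "smooth_real_on (\<lambda>\<rho>. \<rho> + c) I" for c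
    by (intro smooth_real_on_add smooth_real_on_ident smooth_real_on_const)
  have s: "smooth_real_on (\<lambda>\<rho>. \<rho>\<^sup>2) I" by (intro smooth_real_on_power smooth_real_on_ident)
  note n = I_nz I_nz2 I_pos[THEN less_imp_neq, symmetric]
  show "smooth_real_on (model_P q \<gamma>) I"
    unfolding model_P_def[abs_def] using n q0
    by (intro smooth_real_on_mult smooth_real_on_uminus smooth_real_on_divide smooth_real_on_const a s) auto
  show "smooth_real_on (model_center q \<gamma> k) I"
    unfolding model_center_def[abs_def] using n q0
    by (intro smooth_real_on_mult smooth_real_on_uminus smooth_real_on_divide smooth_real_on_const a s) auto
  show "smooth_real_on (model_plane q \<gamma>) I"
    unfolding model_plane_def[abs_def] using n q0
    by (intro smooth_real_on_mult smooth_real_on_uminus smooth_real_on_divide smooth_real_on_const a s) auto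
qed

text \<open>Logarithmic derivatives in partial fractions. In this form they become linear
  expressions in the three reciprocals used in \<open>model_realization\<close>.\<close>

lemma model_deriv:
  assumes "\<rho> \<in> I"
  shows "(model_center q \<gamma> k has_real_derivative
      2 * (- 1 / \<rho> + 1 / (2 * (\<rho> + \<gamma>)) - 1 / (2 * (\<rho> + 2 * \<gamma>))) * model_center q \<gamma> k \<rho>) (at \<rho>)"
    and "(model_plane q \<gamma> has_real_derivative
      2 * (- 1 / \<rho> + 1 / (2 * (\<rho> + 2 * \<gamma>))) * model_plane q \<gamma> \<rho>) (at \<rho>)"
    and "(model_P q \<gamma> has_real_derivative
      (- 2 / \<rho> + 1 / (\<rho> + 2 * \<gamma>) - 1 / (\<rho> + \<gamma>)) * model_P q \<gamma> \<rho>) (at \<rho>)"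
proof -
  note n = I_nz[OF assms] I_pos[OF assms] I_nz2[OF assms] q0 k
  have n': "\<rho> + \<gamma> \<noteq> 0" using n by simp
  show "(model_center q \<gamma> k has_real_derivative
      2 * (- 1 / \<rho> + 1 / (2 * (\<rho> + \<gamma>)) - 1 / (2 * (\<rho> + 2 * \<gamma>))) * model_center q \<gamma> k \<rho>) (at \<rho>)"
    unfolding model_center_def[abs_def] using n n'
    by (auto intro!: derivative_eq_intros simp: divide_simps) (simp add: algebra_simps power2_eq_square)?
  show "(model_plane q \<gamma> has_real_derivative
      2 * (- 1 / \<rho> + 1 / (2 * (\<rho> + 2 * \<gamma>))) * model_plane q \<gamma> \<rho>) (at \<rho>)"
    unfolding model_plane_def[abs_def] using n n'
    by (auto intro!: derivative_eq_intros simp: divide_simps) (simp add: algebra_simps power2_eq_square)?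
  show "(model_P q \<gamma> has_real_derivative
      (- 2 / \<rho> + 1 / (\<rho> + 2 * \<gamma>) - 1 / (\<rho> + \<gamma>)) * model_P q \<gamma> \<rho>) (at \<rho>)"
    unfolding model_P_def[abs_def] using n n'
    by (auto intro!: derivative_eq_intros simp: divide_simps) (simp add: algebra_simps power2_eq_square)?
qed

lemma dform_smooth:
  "smooth_real_on A S \<Longrightarrow> smooth_real_on B S \<Longrightarrow> smooth_real_on (\<lambda>t. dform e (A t) (B t) u w) S"
  unfolding dform_def by (intro smooth_real_on_add smooth_real_on_mult smooth_real_on_const)

lemma dform_deriv:
  "(A has_real_derivative A') (at t) \<Longrightarrow> (B has_real_derivative B') (at t) \<Longrightarrow>
   ((\<lambda>t. dform e (A t) (B t) u w) has_real_derivative dform e A' B' u w) (at t)"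
  unfolding dform_def by (intro DERIV_add DERIV_cmult_right)

lemma model_jet:
  "heis_jet I (\<lambda>\<rho>. \<epsilon> * model_P q \<gamma> \<rho>)
     (\<lambda>\<rho>. \<epsilon> * ((- 2 / \<rho> + 1 / (\<rho> + 2 * \<gamma>) - 1 / (\<rho> + \<gamma>)) * model_P q \<gamma> \<rho>))
     (\<lambda>\<rho>. dform e (\<epsilon> * model_center q \<gamma> k \<rho>) (model_plane q \<gamma> \<rho>))
     (\<lambda>\<rho>. dform e (\<epsilon> * (2 * (- 1 / \<rho> + 1 / (2 * (\<rho> + \<gamma>)) - 1 / (2 * (\<rho> + 2 * \<gamma>))) * model_center q \<gamma> k \<rho>))
        (2 * (- 1 / \<rho> + 1 / (2 * (\<rho> + 2 * \<gamma>))) * model_plane q \<gamma> \<rho>))"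
proof (rule heis_jet.intro)
  have e0: "\<epsilon> \<noteq> 0" using eps by auto
  show "open I" by (rule I_open)
  show "smooth_real_on (\<lambda>\<rho>. \<epsilon> * model_P q \<gamma> \<rho>) I"
    by (intro smooth_real_on_mult smooth_real_on_const model_smooth)
  show "smooth_real_on (\<lambda>\<rho>. dform e (\<epsilon> * model_center q \<gamma> k \<rho>) (model_plane q \<gamma> \<rho>) a b) I" for a b
    by (intro dform_smooth smooth_real_on_mult smooth_real_on_const model_smooth)
  fix t assume t: "t \<in> I"
  show "bilinear (dform e (\<epsilon> * model_center q \<gamma> k t) (model_plane q \<gamma> t))" by (rule bilinear_dform)
  show "dform e (\<epsilon> * model_center q \<gamma> k t) (model_plane q \<gamma> t) a b = dform e (\<epsilon> * model_center q \<gamma> k t) (model_plane q \<gamma> t) b a" for a b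
    by (rule dform_sym)
  show "((\<lambda>\<rho>. \<epsilon> * model_P q \<gamma> \<rho>) has_real_derivative \<epsilon> * ((- 2 / t + 1 / (t + 2 * \<gamma>) - 1 / (t + \<gamma>)) * model_P q \<gamma> t)) (at t)"
    by (intro DERIV_cmult model_deriv t)
  show "((\<lambda>\<rho>. dform e (\<epsilon> * model_center q \<gamma> k \<rho>) (model_plane q \<gamma> \<rho>) a b) has_real_derivative
     dform e (\<epsilon> * (2 * (- 1 / t + 1 / (2 * (t + \<gamma>)) - 1 / (2 * (t + 2 * \<gamma>))) * model_center q \<gamma> k t))
        (2 * (- 1 / t + 1 / (2 * (t + 2 * \<gamma>))) * model_plane q \<gamma> t) a b) (at t)" for a b
    by (intro dform_deriv DERIV_cmult model_deriv t)
  show "\<epsilon> * model_P q \<gamma> t \<noteq> 0" using e0 model_pos[OF t] by simp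
  show "a = 0" if "\<And>b. dform e (\<epsilon> * model_center q \<gamma> k t) (model_plane q \<gamma> t) a b = 0" for a
    by (rule dform_nondeg[OF inv_e _ _ that]) (use e0 model_pos[OF t] in auto)
qed

lemma model_metric_eq:
  assumes "x $ 1 \<in> I" "q = \<epsilon> * \<Lambda> / 3"
  shows "model_metric \<epsilon> \<Lambda> k \<gamma> e x u v = hmet (\<lambda>\<rho>. \<epsilon> * model_P q \<gamma> \<rho>)
     (\<lambda>\<rho>. dform e (\<epsilon> * model_center q \<gamma> k \<rho>) (model_plane q \<gamma> \<rho>)) x u v"
proof -
  note n = I_nz[OF assms(1)] I_pos[OF assms(1)] I_nz2[OF assms(1)] q0 k
  have n': "x $ 1 + \<gamma> \<noteq> 0" "\<epsilon> \<noteq> 0" "\<Lambda> \<noteq> 0" using n assms(2) by auto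
  have P: "- (3 / (2 * \<epsilon> * \<Lambda> * (x $ 1)\<^sup>2)) * ((x $ 1 + 2 * \<gamma>) / (x $ 1 + \<gamma>)) = model_P q \<gamma> (x $ 1)"
    using n' by (simp add: model_P_def assms(2))
  define a where "a = x $ 1 + 2 * \<gamma>"
  define b where "b = x $ 1 + \<gamma>"
  have ab: "a \<noteq> 0" "b \<noteq> 0" using n n' by (simp_all add: a_def b_def)
  have C: "model_P q \<gamma> (x $ 1) / k\<^sup>2 * ((x $ 1 + \<gamma>) / (x $ 1 + 2 * \<gamma>))\<^sup>2 = model_center q \<gamma> k (x $ 1)"
    unfolding model_P_def model_center_def a_def[symmetric] b_def[symmetric]
    using n ab by (simp add: field_simps power2_eq_square)
  have L: "model_P q \<gamma> (x $ 1) * 2 * (x $ 1 + \<gamma>) = model_plane q \<gamma> (x $ 1)"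
    unfolding model_P_def model_plane_def a_def[symmetric] b_def[symmetric]
    using n ab by (simp add: field_simps)
  show ?thesis
    unfolding model_metric_eq_hmet[OF inv_e] hmet_def P C L ..
qed

end

subsection \<open>Realization of the model metrics\<close>

definition scaled_frame :: "real ^ 3 ^ 3 \<Rightarrow> real \<Rightarrow> real \<Rightarrow> real ^ 3 ^ 3" where
  "scaled_frame e c d = vector [(1 / c) *\<^sub>R e $ 1, (1 / d) *\<^sub>R e $ 2, (1 / d) *\<^sub>R e $ 3]"

lemma dform_scaled_frame:
  assumes "invertible e"
  shows "dform e A B (scaled_frame e c d $ i) (scaled_frame e c d $ j)
    = (if i = j then if i = 1 then A / c\<^sup>2 else B / d\<^sup>2 else 0)"
  using exhaust_3[of i] exhaust_3[of j]
  by (elim disjE) (simp_all add: scaled_frame_def bilinear_lmul[OF bilinear_dform] bilinear_rmul[OF bilinear_dform]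
    dform_frame[OF assms] power2_eq_square)

lemma det_scaled_frame: "det (scaled_frame e c d) = det e / (c * d\<^sup>2)"
  by (simp add: det_3 scaled_frame_def diff_divide_distrib add_divide_distrib power2_eq_square mult_ac)

text \<open>Scaling the center by \<open>1 / c\<close> and the plane by \<open>1 / d\<close>
  multiplies the structure constant by \<open>c\<close> over the square of \<open>d\<close>; with
  the roots of the metric coefficients this is the time-dependent \<kappa>.\<close>

lemma bracket_scaled_frame:
  assumes "heis_frame k e" "c \<noteq> 0" "d \<noteq> 0"
  shows "heis_br (scaled_frame e c d $ 2) (scaled_frame e c d $ 3) = (- 2 * (k * c / d\<^sup>2)) *\<^sub>R scaled_frame e c d $ 1"
    and "heis_br (scaled_frame e c d $ 1) v = 0"
proof -
  have "heis_br (scaled_frame e c d $ 2) (scaled_frame e c d $ 3) = (1 / d\<^sup>2) *\<^sub>R heis_br (e $ 2) (e $ 3)"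
    using assms(3) by (simp add: scaled_frame_def heis_br_def vec_eq_iff forall_3 field_simps power2_eq_square)
  also have "\<dots> = (- 2 * (k * c / d\<^sup>2)) *\<^sub>R scaled_frame e c d $ 1"
    using assms by (simp add: heis_frame_iff scaled_frame_def)
  finally show "heis_br (scaled_frame e c d $ 2) (scaled_frame e c d $ 3) = (- 2 * (k * c / d\<^sup>2)) *\<^sub>R scaled_frame e c d $ 1" .
  show "heis_br (scaled_frame e c d $ 1) v = 0"
    using assms(1) by (simp add: heis_frame_iff scaled_frame_def heis_br_def vec_eq_iff forall_3)
qed

text \<open>The two normalizations say that the given frame \<open>e\<close> is orthonormal at the
  parameter value \<open>\<rho>\<^sub>0\<close>.\<close>

locale model_solution = model_interval +
  fixes \<rho>\<^sub>0 \<Lambda> :: real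
  assumes \<rho>0: "\<rho>\<^sub>0 \<in> I" and \<rho>0_center: "model_center q \<gamma> k \<rho>\<^sub>0 = 1" and \<rho>0_plane: "model_plane q \<gamma> \<rho>\<^sub>0 = 1"
    and q_eq: "q = \<epsilon> * \<Lambda> / 3"
begin

text \<open>Arc length \<open>T\<close> becomes the time, and the metric coefficients are pulled
  back along its inverse \<open>r\<close>. The curvature conditions then reduce to identities
  between three reciprocals and the speed \<open>w\<close> of \<open>r\<close>.\<close>

theorem model_realization:
  "\<exists>J h t\<^sub>0. quaternionic_heisenberg \<epsilon> \<Lambda> J h \<and> t\<^sub>0 \<in> J \<and> adapted_frame \<epsilon> (h t\<^sub>0) k e \<and>
     takes_model_form \<epsilon> \<Lambda> k e \<gamma> J h t\<^sub>0 I \<rho>\<^sub>0"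
proof -
  let ?P = "model_P q \<gamma>" and ?C = "model_center q \<gamma> k" and ?L = "model_plane q \<gamma>"
  have e0: "\<epsilon> \<noteq> 0" "\<epsilon> * \<epsilon> = 1" using eps by auto
  have L0: "\<Lambda> \<noteq> 0" using q0 q_eq by auto
  have sqP: "smooth_real_on (\<lambda>\<rho>. sqrt (?P \<rho>)) I"
    by (rule smooth_real_on_sqrt[OF model_smooth(1) model_pos(1)])
  have "continuous_on I (\<lambda>\<rho>. sqrt (?P \<rho>))"
  proof -
    have "Ck_on 0 (\<lambda>\<rho>. sqrt (?P \<rho>)) I" using sqP unfolding smooth_real_on_def by blast
    then show ?thesis by simp
  qed
  then obtain T where T: "T \<rho>\<^sub>0 = 0" "\<And>\<rho>. \<rho> \<in> I \<Longrightarrow> (T has_real_derivative sqrt (?P \<rho>)) (at \<rho>)"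
    using antiderivative_on_interval[OF I_open I_interval _ \<rho>0] by blast
  have Tsm: "smooth_real_on T I" by (rule smooth_real_on_antiderivative[OF T(2) sqP])
  define J where "J = T ` I"
  have sqP0: "sqrt (?P \<rho>) \<noteq> 0" if "\<rho> \<in> I" for \<rho> using model_pos(1)[OF that] by simp
  obtain r where J: "open J" "is_interval J" and r_sm: "smooth_real_on r J"
    and rT: "\<And>\<rho>. \<rho> \<in> I \<Longrightarrow> r (T \<rho>) = \<rho>" and Tr: "\<And>t. t \<in> J \<Longrightarrow> T (r t) = t" and rI: "\<And>t. t \<in> J \<Longrightarrow> r t \<in> I"
    and r': "\<And>t. t \<in> J \<Longrightarrow> (r has_real_derivative inverse (sqrt (?P (r t)))) (at t)"
    using diffeo_1d[OF I_open I_interval Tsm T(2) sqP0] unfolding J_def by blast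
  have rJ: "r ` J = I"
    using rI rT by (auto simp: J_def image_iff)
  define w where "w t = inverse (sqrt (?P (r t)))" for t
  define X where "X t = 1 / r t" for t
  define Y where "Y t = 1 / (r t + \<gamma>)" for t
  define Z where "Z t = 1 / (r t + 2 * \<gamma>)" for t
  define l1 where "l1 t = w t * (- X t + Y t / 2 - Z t / 2)" for t
  define l2 where "l2 t = w t * (- X t + Z t / 2)" for t
  define N where "N t = X t + Y t / 2 - Z t / 2" for t
  define m1 where "m1 t = (w t)\<^sup>2 * (N t * (- X t + Y t / 2 - Z t / 2) + ((X t)\<^sup>2 - (Y t)\<^sup>2 / 2 + (Z t)\<^sup>2 / 2))" for t
  define m2 where "m2 t = (w t)\<^sup>2 * (N t * (- X t + Z t / 2) + ((X t)\<^sup>2 - (Z t)\<^sup>2 / 2))" for t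
  define F1 where "F1 t = ?C (r t)" for t
  define F2 where "F2 t = ?L (r t)" for t
  have Fpos: "F1 t > 0" "F2 t > 0" "w t > 0" if "t \<in> J" for t
    using model_pos[OF rI[OF that]] by (simp_all add: F1_def F2_def w_def)
  note r'w = r'[folded w_def]
  have X': "(X has_real_derivative w t * - (X t)\<^sup>2) (at t)" if "t \<in> J" for t
    unfolding X_def[abs_def] using I_nz[OF rI[OF that]]
    by (auto intro!: derivative_eq_intros r'w[OF that] simp: power2_eq_square)
  have Y': "(Y has_real_derivative w t * - (Y t)\<^sup>2) (at t)" if "t \<in> J" for t
    unfolding Y_def[abs_def] using I_pos[OF rI[OF that]]
    by (auto intro!: derivative_eq_intros r'w[OF that] simp: power2_eq_square)
  have Z': "(Z has_real_derivative w t * - (Z t)\<^sup>2) (at t)" if "t \<in> J" for t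
    unfolding Z_def[abs_def] using I_nz2[OF rI[OF that]]
    by (auto intro!: derivative_eq_intros r'w[OF that] simp: power2_eq_square)
  have Pw: "?P (r t) = 1 / (w t)\<^sup>2" "w t * sqrt (?P (r t)) = 1" if "t \<in> J" for t
    using model_pos(1)[OF rI[OF that]] by (simp_all add: w_def power_inverse divide_inverse)
  \<comment> \<open>Differentiating the relation between \<open>w\<close> and the coefficient
    \<open>model_P\<close> expresses the derivative of \<open>w\<close> through the same
    reciprocals.\<close>
  have w': "(w has_real_derivative w t * (w t * N t)) (at t)" if t: "t \<in> J" for t
  proof -
    have "((\<lambda>t. ?P (r t)) has_real_derivative (- 2 * X t + Z t - Y t) * ?P (r t) * w t) (at t)"
      using DERIV_chain2[where f = ?P and g = r, OF model_deriv(3)[OF rI[OF t]] r'w[OF t]]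
      by (simp add: X_def Y_def Z_def)
    note dP = this
    note dS = DERIV_chain2[where f = sqrt and g = "\<lambda>t. ?P (r t)", OF DERIV_real_sqrt[OF model_pos(1)[OF rI[OF t]]] dP]
    note dI = DERIV_inverse'[OF dS sqP0[OF rI[OF t]]]
    show ?thesis
      unfolding w_def[abs_def]
    proof (rule DERIV_cong[OF dI])
      show "- (inverse (sqrt (?P (r t))) * (inverse (sqrt (?P (r t))) / 2 * ((- 2 * X t + Z t - Y t) * ?P (r t) * w t))
         * inverse (sqrt (?P (r t)))) = inverse (sqrt (?P (r t))) * (inverse (sqrt (?P (r t))) * N t)"
        unfolding w_def[symmetric] unfolding Pw(1)[OF t] using Fpos(3)[OF t] by (simp add: N_def field_simps power2_eq_square)
    qed
  qed
  have l1': "(l1 has_real_derivative m1 t) (at t)" if "t \<in> J" for t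
    unfolding l1_def[abs_def]
    by (auto intro!: derivative_eq_intros w'[OF that] X'[OF that] Y'[OF that] Z'[OF that]
        simp: m1_def field_simps power2_eq_square)
  have l2': "(l2 has_real_derivative m2 t) (at t)" if "t \<in> J" for t
    unfolding l2_def[abs_def]
    by (auto intro!: derivative_eq_intros w'[OF that] X'[OF that] Z'[OF that]
        simp: m2_def field_simps power2_eq_square)
  have F1': "(F1 has_real_derivative 2 * l1 t * F1 t) (at t)" if "t \<in> J" for t
    using DERIV_chain2[where f = ?C and g = r, OF model_deriv(1)[OF rI[OF that]] r'w[OF that]]
    by (simp add: F1_def[abs_def] l1_def X_def Y_def Z_def mult_ac)
  have F2': "(F2 has_real_derivative 2 * l2 t * F2 t) (at t)" if "t \<in> J" for t
    using DERIV_chain2[where f = ?L and g = r, OF model_deriv(2)[OF rI[OF that]] r'w[OF that]]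
    by (simp add: F2_def[abs_def] l2_def X_def Z_def mult_ac)
  define H where "H t = dform e (\<epsilon> * F1 t) (F2 t)" for t
  define H' where "H' t = dform e (\<epsilon> * (2 * l1 t * F1 t)) (2 * l2 t * F2 t)" for t
  define H'' where "H'' t = dform e (\<epsilon> * (2 * (m1 t + 2 * (l1 t)\<^sup>2) * F1 t)) (2 * (m2 t + 2 * (l2 t)\<^sup>2) * F2 t)" for t
  have H_jet: "heis_jet J (\<lambda>_. \<epsilon>) (\<lambda>_. 0) H H'"
  proof (rule heis_jet.intro)
    show "open J" by (rule J)
    show "smooth_real_on (\<lambda>_. \<epsilon>) J" by (rule smooth_real_on_const)
    show "smooth_real_on (\<lambda>t. H t a b) J" for a b
      unfolding H_def F1_def F2_def
      by (intro dform_smooth smooth_real_on_mult smooth_real_on_const smooth_real_on_compose[OF model_smooth(2) r_sm]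
          smooth_real_on_compose[OF model_smooth(3) r_sm]) (use rI in auto)
    fix t assume t: "t \<in> J"
    show "bilinear (H t)" unfolding H_def by (rule bilinear_dform)
    show "H t a b = H t b a" for a b unfolding H_def by (rule dform_sym)
    show "((\<lambda>_. \<epsilon>) has_real_derivative 0) (at t)" by simp
    show "((\<lambda>t. H t a b) has_real_derivative H' t a b) (at t)" for a b
      unfolding H_def H'_def by (intro dform_deriv DERIV_cmult F1' F2' t)
    show "\<epsilon> \<noteq> 0" by (rule e0)
    show "a = 0" if "\<And>b. H t a b = 0" for a
      using dform_nondeg[OF inv_e _ _ that[unfolded H_def]] e0 Fpos[OF t] by simp
  qed
  have H'': "((\<lambda>t. H' t a b) has_real_derivative H'' t a b) (at t)" if t: "t \<in> J" for t a b
    unfolding H'_def H''_def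
  proof (intro dform_deriv DERIV_cmult)
    show "((\<lambda>t. 2 * l1 t * F1 t) has_real_derivative 2 * (m1 t + 2 * (l1 t)\<^sup>2) * F1 t) (at t)"
      by (rule DERIV_cong[OF DERIV_mult[OF DERIV_cmult[OF l1'[OF t]] F1'[OF t]]])
        (simp add: algebra_simps power2_eq_square)
    show "((\<lambda>t. 2 * l2 t * F2 t) has_real_derivative 2 * (m2 t + 2 * (l2 t)\<^sup>2) * F2 t) (at t)"
      by (rule DERIV_cong[OF DERIV_mult[OF DERIV_cmult[OF l2'[OF t]] F2'[OF t]]])
        (simp add: algebra_simps power2_eq_square)
  qed
  \<comment> \<open>The orientation for which the metric is half-flat depends on the sign of
    \<open>q\<close>, because that sign decides the sign of \<open>Z\<close>.\<close>
  define s where "s = (if q > 0 then 1 else - 1 :: real)"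
  have s: "s = 1 \<or> s = -1" "s * s = 1" by (auto simp: s_def)
  define \<kappa> where "\<kappa> t = k * sqrt (F1 t) / F2 t" for t
  \<comment> \<open>The denominators satisfy \<open>a = 2 * b - r t\<close>; the first identity is
    this relation divided by their product. The third one is proved for squares, where the radical
    in \<kappa> disappears, and its sign is fixed afterwards.\<close>
  have XYZ: "X t * Y t = 2 * X t * Z t - Y t * Z t" "q = - ((w t)\<^sup>2 * (2 * (X t)\<^sup>2 - X t * Y t) / 2)"
    "s * \<kappa> t = - (w t * Z t / 2)" if t: "t \<in> J" for t
  proof -
    define a where "a = r t + 2 * \<gamma>"
    define b where "b = r t + \<gamma>"
    note n = I_nz[OF rI[OF t]]
    have ab: "a \<noteq> 0" "b \<noteq> 0" "a = 2 * b - r t" "q * a < 0"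
      using I_nz2[OF rI[OF t]] I_pos[OF rI[OF t]] I_sign[OF rI[OF t]] by (simp_all add: a_def b_def)
    have XYZ: "X t = 1 / r t" "Y t = 1 / b" "Z t = 1 / a" by (simp_all add: X_def Y_def Z_def a_def b_def)
    have "1 / r t * (1 / b) = 2 * (1 / r t) * (1 / a) - 1 / b * (1 / a)"
    proof -
      have "1 / r t * (1 / b) = a / (r t * b * a)" using ab(1) by simp
      also have "\<dots> = (2 * b - r t) / (r t * b * a)" by (simp only: ab(3))
      also have "\<dots> = 2 * (1 / r t) * (1 / a) - 1 / b * (1 / a)"
        using n ab(1,2) by (simp add: diff_divide_distrib)
      finally show ?thesis .
    qed
    then show "X t * Y t = 2 * X t * Z t - Y t * Z t" by (simp only: XYZ)
    have P: "1 / (w t)\<^sup>2 = - (1 / (2 * q * (r t)\<^sup>2)) * (a / b)"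
      using Pw(1)[OF t] by (simp add: model_P_def a_def b_def)
    have w2: "(w t)\<^sup>2 = - (2 * q * (r t)\<^sup>2 * b / a)"
    proof -
      have "(w t)\<^sup>2 = 1 / (1 / (w t)\<^sup>2)" by simp
      also have "\<dots> = - (2 * q * (r t)\<^sup>2 * b / a)" unfolding P by simp
      finally show ?thesis .
    qed
    have "2 * (1 / r t)\<^sup>2 - 1 / r t * (1 / b) = a / ((r t)\<^sup>2 * b)"
      unfolding ab(3) using n ab(2) by (simp add: field_simps power2_eq_square)
    then show "q = - ((w t)\<^sup>2 * (2 * (X t)\<^sup>2 - X t * Y t) / 2)"
      unfolding XYZ w2 using n ab(1,2) by simp
    have "(\<kappa> t)\<^sup>2 = k\<^sup>2 * F1 t / (F2 t)\<^sup>2"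
      using Fpos[OF t] by (simp add: \<kappa>_def power_divide power_mult_distrib)
    also have "\<dots> = - (q * b * (r t)\<^sup>2 / (2 * a ^ 3))"
      unfolding F1_def F2_def model_center_def model_plane_def a_def[symmetric] b_def[symmetric]
      using n ab(1,2) q0 k by (simp add: field_simps power2_eq_square power3_eq_cube)
    also have "\<dots> = (w t * Z t / 2)\<^sup>2"
      unfolding power_mult_distrib power_divide w2 XYZ using ab(1)
      by (simp add: field_simps power2_eq_square power3_eq_cube)
    finally have "(\<kappa> t)\<^sup>2 = (w t * Z t / 2)\<^sup>2" .
    then have "\<kappa> t = w t * Z t / 2 \<or> \<kappa> t = - (w t * Z t / 2)" by (simp add: power2_eq_iff)
    moreover have "\<kappa> t > 0" using Fpos[OF t] k by (simp add: \<kappa>_def)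
    moreover have "s * (w t * Z t / 2) < 0"
    proof -
      have "s * a < 0" using ab(4) q0 by (auto simp: s_def mult_less_0_iff)
      then have "s * Z t < 0" by (auto simp: XYZ mult_less_0_iff zero_less_divide_iff divide_less_0_iff)
      have "(s * Z t) * (w t / 2) < 0" by (rule mult_neg_pos[OF \<open>s * Z t < 0\<close>]) (use Fpos(3)[OF t] in simp)
      then show ?thesis by (simp only: times_divide_eq_right mult_ac)
    qed
    ultimately show "s * \<kappa> t = - (w t * Z t / 2)" using s by auto
  qed
  \<comment> \<open>The form at the identity is spread over the group by left translations.\<close>
  define h where "h t p u v = H t (left_trans_inv p u) (left_trans_inv p v)" for t and p u v :: "real ^ 3"
  have h_li: "left_invariant (h t)" for t
    unfolding h_def[abs_def] by (rule left_invariant_extend)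
  have h0: "(\<lambda>t. h t 0) = H"
  proof -
    have "left_trans_inv 0 v = v" for v by (simp add: left_trans_inv_def vec_eq_iff forall_3)
    then show ?thesis by (simp add: h_def fun_eq_iff)
  qed
  have hm: "heis_metric \<epsilon> h = hmet (\<lambda>_. \<epsilon>) H"
    using heis_metric_eq_hmet[where h = h, OF h_li] by (simp add: fun_eq_iff h0)
  define et where "et t = scaled_frame e (sqrt (F1 t)) (sqrt (F2 t))" for t
  have et: "dform e A B (et t $ i) (et t $ j) = (if i = j then if i = 1 then A / F1 t else B / F2 t else 0)"
    if "t \<in> J" for t A B i j
    using Fpos[OF that] by (simp add: et_def dform_scaled_frame[OF inv_e])
  have orth: "orthonormal_basis (H t) (vector [\<epsilon>, 1, 1]) (et t)" if "t \<in> J" for t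
    unfolding orthonormal_basis_def forall_3 H_def using Fpos[OF that] by (simp add: et[OF that])
  have frame: "heis_frame_jet J \<epsilon> H H' H'' x (et (x $ 1)) (\<kappa> (x $ 1))" if x: "x $ 1 \<in> J" for x
  proof (rule heis_frame_jet.intro[OF H_jet], rule heis_frame_jet_axioms.intro)
    have nz: "sqrt (F1 (x $ 1)) \<noteq> 0" "sqrt (F2 (x $ 1)) \<noteq> 0" using Fpos[OF x] by auto
    show "heis_br (et (x $ 1) $ 2) (et (x $ 1) $ 3) = (- 2 * \<kappa> (x $ 1)) *\<^sub>R et (x $ 1) $ 1"
      using bracket_scaled_frame(1)[OF frame_e nz] Fpos(2)[OF x] by (simp add: et_def \<kappa>_def)
    show "heis_br (et (x $ 1) $ 1) v = 0" for v
      using bracket_scaled_frame(2)[OF frame_e nz] by (simp add: et_def)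
  qed (use eps x H'' orth[OF x] in auto)
  have curv: "(\<forall>i j. ricci (hmet (\<lambda>_. \<epsilon>) H) i j x = \<Lambda> * metric_component (hmet (\<lambda>_. \<epsilon>) H) i j x) \<and>
      (\<forall>i j k l. hodge_weyl (hmet (\<lambda>_. \<epsilon>) H) i j k l x = (s * sgn (det e)) * weyl (hmet (\<lambda>_. \<epsilon>) H) i j k l x) \<and>
      has_signature (hmet (\<lambda>_. \<epsilon>) H x) (vector [\<epsilon>, \<epsilon>, 1, 1])"
    if x: "x $ 1 \<in> J" for x
  proof -
    interpret X: heis_frame_jet J \<epsilon> H H' H'' x "et (x $ 1)" "\<kappa> (x $ 1)" by (rule frame[OF x])
    let ?t = "x $ 1"
    note Fp = Fpos[OF x]
    have K: "X.K 1 2 = 0" "X.K 1 3 = 0" "X.K 2 3 = 0" "X.K 1 1 = \<epsilon> * l1 ?t" "X.K 2 2 = l2 ?t" "X.K 3 3 = l2 ?t"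
      using Fp by (simp_all add: X.K_def H'_def et[OF x])
    have M: "X.M 1 2 = 0" "X.M 1 3 = 0" "X.M 2 3 = 0" "X.M 1 1 = 2 * \<epsilon> * (m1 ?t + 2 * (l1 ?t)\<^sup>2)"
      "X.M 2 2 = 2 * (m2 ?t + 2 * (l2 ?t)\<^sup>2)" "X.M 3 3 = 2 * (m2 ?t + 2 * (l2 ?t)\<^sup>2)"
      using Fp by (simp_all add: X.M_def H''_def et[OF x])
    have qe: "\<epsilon> * (\<Lambda> / 3) = q" by (simp add: q_eq)
    \<comment> \<open>The second first-order equation and the equation for \<open>m1\<close> hold
      only modulo this relation; the other two need only the formulas for \<open>q\<close> and
      \<kappa>.\<close>
    have R: "2 * X ?t * Z ?t - Y ?t * Z ?t - X ?t * Y ?t = 0" using XYZ(1)[OF x] by simp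
    have sk2: "s * (s * y) = y" for y using s(2) by (metis mult.assoc mult_1)
    have A: "(\<kappa> ?t - s * l1 ?t) * (\<kappa> ?t + s * l2 ?t) = \<epsilon> * (\<Lambda> / 3)"
    proof -
      have "(\<kappa> ?t - s * l1 ?t) * (\<kappa> ?t + s * l2 ?t) = (s * \<kappa> ?t - l1 ?t) * (s * \<kappa> ?t + l2 ?t)"
        by (simp add: algebra_simps sk2)
      also have "\<dots> = - ((w ?t)\<^sup>2 * (2 * (X ?t)\<^sup>2 - X ?t * Y ?t) / 2)"
        unfolding XYZ(3)[OF x] l1_def l2_def by (simp add: field_simps power2_eq_square)
      also have "\<dots> = q" using XYZ(2)[OF x] by simp
      finally show ?thesis by (simp only: qe)
    qed
    have B: "(\<kappa> ?t + s * l2 ?t)\<^sup>2 + 2 * \<kappa> ?t * (\<kappa> ?t - s * l1 ?t) = - (\<epsilon> * (\<Lambda> / 3))"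
    proof -
      have "(\<kappa> ?t + s * l2 ?t)\<^sup>2 + 2 * \<kappa> ?t * (\<kappa> ?t - s * l1 ?t)
          = (s * \<kappa> ?t + l2 ?t)\<^sup>2 + 2 * (s * \<kappa> ?t) * (s * \<kappa> ?t - l1 ?t)"
        by (simp add: algebra_simps power2_eq_square sk2)
      also have "\<dots> = (w ?t)\<^sup>2 * (2 * (X ?t)\<^sup>2 - X ?t * Y ?t) / 2
          - (w ?t)\<^sup>2 / 2 * (2 * X ?t * Z ?t - Y ?t * Z ?t - X ?t * Y ?t)"
        unfolding XYZ(3)[OF x] l1_def l2_def by (simp add: field_simps power2_eq_square)
      also have "\<dots> = - q" using R XYZ(2)[OF x] by simp
      finally show ?thesis by (simp only: qe)
    qed
    have C1: "m1 ?t = - (l1 ?t)\<^sup>2 - \<epsilon> * (\<Lambda> / 3) - 2 * s * \<kappa> ?t * (l2 ?t - l1 ?t)"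
    proof -
      have "m1 ?t - (- (l1 ?t)\<^sup>2 - - ((w ?t)\<^sup>2 * (2 * (X ?t)\<^sup>2 - X ?t * Y ?t) / 2) - 2 * (s * \<kappa> ?t) * (l2 ?t - l1 ?t))
          = (w ?t)\<^sup>2 / 2 * (2 * X ?t * Z ?t - Y ?t * Z ?t - X ?t * Y ?t)"
        unfolding XYZ(3)[OF x] l1_def l2_def m1_def N_def by (simp add: field_simps power2_eq_square)
      then have "m1 ?t = - (l1 ?t)\<^sup>2 - q - 2 * (s * \<kappa> ?t) * (l2 ?t - l1 ?t)"
        unfolding R XYZ(2)[OF x, symmetric] by simp
      then show ?thesis unfolding qe by (simp add: mult.assoc)
    qed
    have C2: "m2 ?t = - (l2 ?t)\<^sup>2 - \<epsilon> * (\<Lambda> / 3) - s * \<kappa> ?t * (l1 ?t - l2 ?t)"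
    proof -
      have "m2 ?t - (- (l2 ?t)\<^sup>2 - - ((w ?t)\<^sup>2 * (2 * (X ?t)\<^sup>2 - X ?t * Y ?t) / 2) - s * \<kappa> ?t * (l1 ?t - l2 ?t)) = 0"
        unfolding XYZ(3)[OF x] l1_def l2_def m2_def N_def by (simp add: field_simps power2_eq_square)
      then show ?thesis unfolding XYZ(2)[OF x, symmetric] qe by simp
    qed
    note args = K(1-3) M(1-3) K(4-6) M(4-6) s(1) A B C1 C2
    have L3: "\<Lambda> = 3 * (\<Lambda> / 3)" by simp
    have ein: "ricci (hmet (\<lambda>_. \<epsilon>) H) i j x = \<Lambda> * metric_component (hmet (\<lambda>_. \<epsilon>) H) i j x" for i j
      by (rule X.einstein_at[OF args L3 refl])
    have hf: "hodge_weyl (hmet (\<lambda>_. \<epsilon>) H) i j k l x = (s * sgn (det (et ?t))) * weyl (hmet (\<lambda>_. \<epsilon>) H) i j k l x" for i j k l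
      by (rule X.half_flat_at[OF args L3 refl])
    \<comment> \<open>Positive scaling keeps the orientation, so one sign of the duality serves all
      points.\<close>
    have "sgn (det (et ?t)) = sgn (det e)"
      using Fp by (simp add: et_def det_scaled_frame sgn_divide sgn_mult)
    moreover have "has_signature (hmet (\<lambda>_. \<epsilon>) H x) (vector [\<epsilon>, \<epsilon>, 1, 1])"
      unfolding has_signature_def orthonormal_basis_def
      using X.hmet_bilinear[OF x] X.frame by (intro conjI exI[of _ "\<chi> a. hframe x (et ?t) a"]) (simp_all add: heta_def)
    ultimately show ?thesis using ein hf by simp
  qed
  have oJ: "open (interval_times_heis J)" by (rule open_interval_times_heis[OF J(1)])
  have smooth: "smooth_fun_on (metric_component (hmet (\<lambda>_. \<epsilon>) H) i j) (interval_times_heis J)" for i j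
  proof -
    interpret X: heis_jet J "\<lambda>_. \<epsilon>" "\<lambda>_. 0" H H' by (rule H_jet)
    show ?thesis by (rule X.smooth)
  qed
  have sig3: "has_signature (h t p) (vector [\<epsilon>, 1, 1])" if t: "t \<in> J" for t p
    unfolding has_signature_def
  proof (intro conjI exI)
    have "bilinear (H t)" unfolding H_def by (rule bilinear_dform)
    then show "bilinear (h t p)"
      using linear_left_trans(2)[of p] unfolding h_def[abs_def] by (auto simp: bilinear_def linear_iff)
    show "orthonormal_basis (h t p) (vector [\<epsilon>, 1, 1]) (\<chi> i. left_trans p (et t $ i))"
      using orth[OF t] by (simp add: orthonormal_basis_def h_def)
  qed
  have four: "heisenberg_four_manifold \<epsilon> J h"
    unfolding heisenberg_four_manifold_def hm using eps J h_li sig3 smooth \<rho>0 by (auto simp: J_def)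
  have tl: "timelike_center J h" if "\<epsilon> = -1"
    unfolding timelike_center_def
  proof (intro ballI allI)
    fix t p z assume t: "t \<in> J" and z: "z \<in> heis_center - {0}"
    obtain c where c: "z = c *\<^sub>R e $ 1" "c \<noteq> 0"
    proof -
      have "z = (z $ 3 / e $ 1 $ 3) *\<^sub>R e $ 1" "z $ 3 \<noteq> 0"
        using z frame_e by (auto simp: heis_center_eq heis_frame_iff vec_eq_iff forall_3)
      moreover have "e $ 1 $ 3 \<noteq> 0" using frame_e by (simp add: heis_frame_iff)
      ultimately show thesis using that by simp
    qed
    have "h t p (left_invariant_field z p) (left_invariant_field z p) = c * c * (\<epsilon> * F1 t)"
      by (simp add: h_def left_invariant_field_eq H_def c(1) bilinear_lmul[OF bilinear_dform] bilinear_rmul[OF bilinear_dform]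
          dform_frame[OF inv_e])
    moreover have "c * c > 0" using c(2) by (auto simp: zero_less_mult_iff)
    ultimately show "h t p (left_invariant_field z p) (left_invariant_field z p) < 0"
      using Fpos(1)[OF t] that by (simp add: mult_less_0_iff)
  qed
  have "sgn (det e) = 1 \<or> sgn (det e) = -1" using inv_e by (auto simp: invertible_det_nz sgn_if)
  then have \<sigma>: "s * sgn (det e) \<in> {1, -1}" using s(1) by auto
  have U: "x $ 1 \<in> J" if "x \<in> interval_times_heis J" for x using that by (simp add: interval_times_heis_def)
  have ein: "einstein (interval_times_heis J) (hmet (\<lambda>_. \<epsilon>) H) \<Lambda>"
    unfolding einstein_def using curv U by blast
  have hcf: "half_conformally_flat (interval_times_heis J) (hmet (\<lambda>_. \<epsilon>) H)"
    unfolding half_conformally_flat_def using curv U \<sigma> by blast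
  have pr: "pseudo_riemannian_metric (interval_times_heis J) (vector [\<epsilon>, \<epsilon>, 1, 1]) (hmet (\<lambda>_. \<epsilon>) H)"
    unfolding pseudo_riemannian_metric_def using oJ smooth curv U by blast
  have "quaternionic_heisenberg \<epsilon> \<Lambda> J h"
    unfolding quaternionic_heisenberg_def quaternionic_kaehler_def quaternionic_parakaehler_def hm
    using four eps tl ein hcf pr L0 by auto
  moreover have z: "0 \<in> J" "r 0 = \<rho>\<^sub>0" using T(1) \<rho>0 rT[OF \<rho>0] by (force simp: J_def image_iff)+
  moreover have "adapted_frame \<epsilon> (h 0) k e"
  proof -
    have "F1 0 = 1" "F2 0 = 1" using \<rho>0_center \<rho>0_plane by (simp_all add: F1_def F2_def z(2))
    moreover have "h 0 0 = H 0" using h0 by (metis)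
    ultimately show ?thesis
      unfolding adapted_frame_def orthonormal_basis_def forall_3 using k frame_e
      by (simp add: H_def dform_frame[OF inv_e])
  qed
  moreover have "takes_model_form \<epsilon> \<Lambda> k e \<gamma> J h 0 I \<rho>\<^sub>0"
    unfolding takes_model_form_def
  proof (intro exI[of _ r] conjI z)
    show "isometry_between (interval_times_heis J) (heis_metric \<epsilon> h) (interval_times_heis I) (model_metric \<epsilon> \<Lambda> k \<gamma> e)
       (\<lambda>x. vector [r (x $ 1), x $ 2, x $ 3, x $ 4])"
    proof (rule change_coordinate_isometry[OF J(1) I_open r_sm rJ r'w Tsm Tr rT _ _ _ _ model_metric_eq[OF _ q_eq]])
      show "T \<rho> \<in> J" if "\<rho> \<in> I" for \<rho> using that by (simp add: J_def)
      show "\<epsilon> * ?P (r t) * (w t)\<^sup>2 = \<epsilon>" if "t \<in> J" for t using Pw(1)[OF that] Fpos(3)[OF that] by simp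
      show "dform e (\<epsilon> * ?C (r t)) (?L (r t)) u v = H t u v" for t u v
        by (simp add: H_def F1_def F2_def)
      show "heis_metric \<epsilon> h x u v = hmet (\<lambda>_. \<epsilon>) H x u v" for x u v by (simp add: hm)
    qed
  qed
  ultimately show ?thesis by blast
qed

end

subsection \<open>Completeness of the model metrics\<close>

context model_solution
begin

text \<open>To the left of \<open>\<rho>\<^sub>0\<close> the coordinate stays away from 0, so the
  only possible singularity of the integrand is at a zero of \<open>\<rho> + \<gamma>\<close>, where
  it is of the integrable order -1/2. To the right the arc length increases.\<close>

lemma length_bounded_below:
  assumes "\<gamma> < 0 \<or> \<rho>\<^sub>0 < 0"
  obtains T b where "\<And>\<rho>. \<rho> \<in> I \<Longrightarrow> (T has_real_derivative sqrt (model_P q \<gamma> \<rho>)) (at \<rho>)" "\<And>\<rho>. \<rho> \<in> I \<Longrightarrow> b \<le> T \<rho>"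
proof -
  have "Ck_on 0 (\<lambda>\<rho>. sqrt (model_P q \<gamma> \<rho>)) I"
    using smooth_real_on_sqrt[OF model_smooth(1) model_pos(1)] unfolding smooth_real_on_def by blast
  then have "continuous_on I (\<lambda>\<rho>. sqrt (model_P q \<gamma> \<rho>))" by simp
  then obtain T where T: "T \<rho>\<^sub>0 = 0" "\<And>\<rho>. \<rho> \<in> I \<Longrightarrow> (T has_real_derivative sqrt (model_P q \<gamma> \<rho>)) (at \<rho>)"
    using antiderivative_on_interval[OF I_open I_interval _ \<rho>0] by blast
  \<comment> \<open>A lower bound for the absolute value of the coordinate: for negative \<gamma> it
    comes from \<open>\<rho> + \<gamma> > 0\<close>, otherwise from
    \<open>\<rho> \<le> \<rho>\<^sub>0 < 0\<close>.\<close>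
  define m where "m = (if \<gamma> < 0 then \<bar>\<gamma>\<bar> else \<bar>\<rho>\<^sub>0\<bar>)"
  have m: "m > 0" using assms by (auto simp: m_def)
  define C where "C = sqrt ((3 * \<bar>\<gamma>\<bar> + \<bar>\<rho>\<^sub>0\<bar>) / (\<bar>q\<bar> * m\<^sup>2) / 2)"
  have C: "C \<ge> 0" by (simp add: C_def)
  have bound: "sqrt (model_P q \<gamma> \<rho>) \<le> C / sqrt (\<rho> + \<gamma>)" if \<rho>: "\<rho> \<in> I" "\<rho> \<le> \<rho>\<^sub>0" for \<rho>
  proof -
    note n = I_nz[OF \<rho>(1)] I_pos[OF \<rho>(1)]
    have "m \<le> \<bar>\<rho>\<bar>" using n(2) assms \<rho>(2) by (auto simp: m_def)
    then have m2: "m\<^sup>2 \<le> \<rho>\<^sup>2" using m by (simp add: abs_le_square_iff[symmetric])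
    have "\<bar>\<rho> + 2 * \<gamma>\<bar> \<le> 3 * \<bar>\<gamma>\<bar> + \<bar>\<rho>\<^sub>0\<bar>" using n(2) \<rho>(2) by linarith
    then have "\<bar>\<rho> + 2 * \<gamma>\<bar> / (\<bar>q\<bar> * \<rho>\<^sup>2) \<le> (3 * \<bar>\<gamma>\<bar> + \<bar>\<rho>\<^sub>0\<bar>) / (\<bar>q\<bar> * m\<^sup>2)"
      using m m2 q0 by (intro frac_le mult_left_mono) auto
    moreover have "model_P q \<gamma> \<rho> = \<bar>model_P q \<gamma> \<rho>\<bar>" using model_pos(1)[OF \<rho>(1)] by simp
    moreover have "\<bar>model_P q \<gamma> \<rho>\<bar> = \<bar>\<rho> + 2 * \<gamma>\<bar> / (\<bar>q\<bar> * \<rho>\<^sup>2) / 2 / (\<rho> + \<gamma>)"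
      using n(2) by (simp add: model_P_def abs_mult abs_divide mult_ac)
    ultimately have "model_P q \<gamma> \<rho> \<le> (3 * \<bar>\<gamma>\<bar> + \<bar>\<rho>\<^sub>0\<bar>) / (\<bar>q\<bar> * m\<^sup>2) / 2 / (\<rho> + \<gamma>)"
      using n(2) by (simp only:) (intro divide_right_mono; simp)
    then have "sqrt (model_P q \<gamma> \<rho>) \<le> sqrt ((3 * \<bar>\<gamma>\<bar> + \<bar>\<rho>\<^sub>0\<bar>) / (\<bar>q\<bar> * m\<^sup>2) / 2 / (\<rho> + \<gamma>))" by simp
    then show ?thesis unfolding C_def by (simp only: real_sqrt_divide)
  qed
  have sub: "x \<in> I" if "a \<in> I" "b \<in> I" "a \<le> x" "x \<le> b" for a b x
    using I_interval that unfolding is_interval_1 by blast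
  have "- (2 * C * sqrt (\<rho>\<^sub>0 + \<gamma>)) \<le> T \<rho>" if \<rho>: "\<rho> \<in> I" for \<rho>
  proof (cases "\<rho> \<le> \<rho>\<^sub>0")
    case True
    \<comment> \<open>Comparison with the antiderivative of the bound, which remains finite as
      \<open>\<rho> + \<gamma>\<close> tends to 0.\<close>
    have "T \<rho>\<^sub>0 - 2 * C * sqrt (\<rho>\<^sub>0 + \<gamma>) \<le> T \<rho> - 2 * C * sqrt (\<rho> + \<gamma>)"
    proof (rule DERIV_nonpos_imp_nonincreasing[OF True])
      fix x assume x: "\<rho> \<le> x" "x \<le> \<rho>\<^sub>0"
      have xI: "x \<in> I" using sub[OF \<rho> \<rho>0] x by blast
      have s: "((\<lambda>x. sqrt (x + \<gamma>)) has_real_derivative inverse (sqrt (x + \<gamma>)) / 2) (at x)"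
        using DERIV_chain2[where f = sqrt and g = "\<lambda>x. x + \<gamma>", OF DERIV_real_sqrt[OF I_pos[OF xI]]] 
          DERIV_add[OF DERIV_ident DERIV_const, of \<gamma> x UNIV] by fastforce
      have "((\<lambda>x. T x - 2 * C * sqrt (x + \<gamma>)) has_real_derivative
          sqrt (model_P q \<gamma> x) - 2 * C * (inverse (sqrt (x + \<gamma>)) / 2)) (at x)"
        by (intro DERIV_diff T(2) xI DERIV_cmult s)
      moreover have "sqrt (model_P q \<gamma> x) - 2 * C * (inverse (sqrt (x + \<gamma>)) / 2) \<le> 0"
        using bound[OF xI x(2)] by (simp add: inverse_eq_divide)
      ultimately show "\<exists>y. ((\<lambda>x. T x - 2 * C * sqrt (x + \<gamma>)) has_real_derivative y) (at x) \<and> y \<le> 0" by blast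
    qed
    moreover have "C * sqrt (\<rho> + \<gamma>) \<ge> 0" using C I_pos[OF \<rho>] by simp
    ultimately show ?thesis using T(1) by simp
  next
    case False
    have "T \<rho>\<^sub>0 \<le> T \<rho>"
    proof (rule DERIV_nonneg_imp_nondecreasing[where f = T])
      fix x assume "\<rho>\<^sub>0 \<le> x" "x \<le> \<rho>"
      then have "x \<in> I" using sub[OF \<rho>0 \<rho>] by blast
      then show "\<exists>y. (T has_real_derivative y) (at x) \<and> 0 \<le> y"
        using T(2) model_pos(1) by (intro exI[of _ "sqrt (model_P q \<gamma> x)"]) (auto simp: less_imp_le)
    qed (use False in simp)
    moreover have "C * sqrt (\<rho>\<^sub>0 + \<gamma>) \<ge> 0" using C I_pos[OF \<rho>0] by simp
    ultimately show ?thesis using T(1) by simp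
  qed
  then show thesis using that T(2) by blast
qed

lemma model_complete_cong:
  "geodesically_complete (interval_times_heis I) (model_metric \<epsilon> \<Lambda> k \<gamma> e) \<longleftrightarrow>
   geodesically_complete (interval_times_heis I) (hmet (\<lambda>\<rho>. \<epsilon> * model_P q \<gamma> \<rho>)
     (\<lambda>\<rho>. dform e (\<epsilon> * model_center q \<gamma> k \<rho>) (model_plane q \<gamma> \<rho>)))"
  by (rule geodesically_complete_cong[OF open_interval_times_heis[OF I_open]])
    (simp add: interval_times_heis_def model_metric_eq[OF _ q_eq])

theorem model_incomplete:
  assumes "\<gamma> < 0 \<or> \<rho>\<^sub>0 < 0"
  shows "\<not> geodesically_complete (interval_times_heis I) (model_metric \<epsilon> \<Lambda> k \<gamma> e)"
proof -
  obtain T b where T: "\<And>\<rho>. \<rho> \<in> I \<Longrightarrow> (T has_real_derivative sqrt (model_P q \<gamma> \<rho>)) (at \<rho>)" "\<And>\<rho>. \<rho> \<in> I \<Longrightarrow> b \<le> T \<rho>"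
    using length_bounded_below[OF assms] by blast
  have "\<bar>\<epsilon> * model_P q \<gamma> \<rho>\<bar> = model_P q \<gamma> \<rho>" if "\<rho> \<in> I" for \<rho>
    using model_pos(1)[OF that] eps by auto
  then show ?thesis
    unfolding model_complete_cong
    using heis_jet.not_geodesically_complete[OF model_jet, of T b] T \<rho>0 by fastforce
qed

text \<open>For positive \<gamma> the quotient
  \<open>(\<rho> + 2 * \<gamma>) / (\<rho> + \<gamma>)\<close> is at least 1, so the integrand
  dominates a multiple of \<open>1 / \<rho>\<close> and the arc length is unbounded at both
  ends.\<close>

theorem model_complete:
  assumes "\<epsilon> = 1" "\<gamma> > 0" "I = {0<..}"
  shows "geodesically_complete (interval_times_heis I) (model_metric \<epsilon> \<Lambda> k \<gamma> e)"
proof -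
  have "Ck_on 0 (\<lambda>\<rho>. sqrt (model_P q \<gamma> \<rho>)) I"
    using smooth_real_on_sqrt[OF model_smooth(1) model_pos(1)] unfolding smooth_real_on_def by blast
  then have "continuous_on I (\<lambda>\<rho>. sqrt (model_P q \<gamma> \<rho>))" by simp
  then obtain T where T: "T \<rho>\<^sub>0 = 0" "\<And>\<rho>. \<rho> \<in> I \<Longrightarrow> (T has_real_derivative sqrt (model_P q \<gamma> \<rho>)) (at \<rho>)"
    using antiderivative_on_interval[OF I_open I_interval _ \<rho>0] by blast
  have r0: "\<rho>\<^sub>0 > 0" using \<rho>0 assms(3) by simp
  have q: "q < 0" using I_sign[OF \<rho>0] r0 assms(2) by (auto simp: mult_less_0_iff)
  define c where "c = sqrt (- 1 / (2 * q))"
  have c: "c > 0" using q by (simp add: c_def divide_neg_neg)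
  have bound: "c / \<rho> \<le> sqrt (model_P q \<gamma> \<rho>)" if "\<rho> > 0" for \<rho>
  proof -
    have "1 \<le> (\<rho> + 2 * \<gamma>) / (\<rho> + \<gamma>)" using that assms(2) by simp
    moreover have "0 \<le> - 1 / (2 * q) / \<rho>\<^sup>2" by (intro divide_nonneg_nonneg divide_nonpos_nonpos) (use q in auto)
    ultimately have "- 1 / (2 * q) / \<rho>\<^sup>2 * 1 \<le> - 1 / (2 * q) / \<rho>\<^sup>2 * ((\<rho> + 2 * \<gamma>) / (\<rho> + \<gamma>))"
      by (rule mult_left_mono)
    then have "- 1 / (2 * q) / \<rho>\<^sup>2 \<le> model_P q \<gamma> \<rho>" by (simp add: model_P_def)
    then have "sqrt (- 1 / (2 * q) / \<rho>\<^sup>2) \<le> sqrt (model_P q \<gamma> \<rho>)" by (rule real_sqrt_le_mono)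
    moreover have "sqrt (- 1 / (2 * q) / \<rho>\<^sup>2) = c / \<rho>" using that by (simp only: real_sqrt_divide[of _ "\<rho>\<^sup>2"] c_def real_sqrt_abs abs_of_pos)
    ultimately show ?thesis by (simp only:)
  qed
  have mono: "T x - c * ln x \<le> T y - c * ln y" if "0 < x" "x \<le> y" for x y
  proof (rule DERIV_nonneg_imp_nondecreasing[OF that(2)])
    fix z assume "x \<le> z" "z \<le> y"
    then have z: "z > 0" using that by simp
    have "((\<lambda>x. T x - c * ln x) has_real_derivative sqrt (model_P q \<gamma> z) - c * (1 / z)) (at z)"
      using z assms(3) by (intro DERIV_diff DERIV_cmult T(2) DERIV_ln_divide) auto
    then show "\<exists>d. ((\<lambda>x. T x - c * ln x) has_real_derivative d) (at z) \<and> 0 \<le> d"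
      using bound[OF z] by auto
  qed
  have surj: "\<exists>t\<in>I. T t = r" for r
  proof -
    \<comment> \<open>The points where the logarithmic comparison function has moved by the absolute
      value of \<open>r\<close> in either direction.\<close>
    define x where "x = exp (ln \<rho>\<^sub>0 - \<bar>r\<bar> / c)"
    define y where "y = exp (ln \<rho>\<^sub>0 + \<bar>r\<bar> / c)"
    have rc: "\<bar>r\<bar> / c \<ge> 0" using c by simp
    have e0: "\<rho>\<^sub>0 = exp (ln \<rho>\<^sub>0)" using r0 by simp
    have xy: "0 < x" "x \<le> \<rho>\<^sub>0" "\<rho>\<^sub>0 \<le> y"
      using rc by (simp add: x_def, subst e0, simp add: x_def, subst e0, simp add: y_def)
    have "T x \<le> - \<bar>r\<bar>" using mono[OF xy(1,2)] T(1) c by (simp add: x_def right_diff_distrib)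
    moreover have "\<bar>r\<bar> \<le> T y" using mono[OF r0 xy(3)] T(1) c by (simp add: y_def distrib_left)
    moreover have "continuous_on {x..y} T"
    proof (intro continuous_at_imp_continuous_on ballI)
      fix z assume "z \<in> {x..y}"
      then have "z \<in> I" using xy(1) assms(3) by auto
      then show "isCont T z" using T(2) DERIV_isCont by blast
    qed
    ultimately obtain t where "x \<le> t" "t \<le> y" "T t = r"
      using IVT'[of T x r y] xy by fastforce
    then show ?thesis using xy assms(3) by auto
  qed
  show ?thesis
    unfolding model_complete_cong
  proof (rule heis_jet.geodesically_complete_riemannian[OF model_jet I_interval _ _ _ surj])
    fix t assume t: "t \<in> I"
    show "0 < \<epsilon> * model_P q \<gamma> t" using model_pos(1)[OF t] assms(1) by simp
    show "0 < dform e (\<epsilon> * model_center q \<gamma> k t) (model_plane q \<gamma> t) a a" if "a \<noteq> 0" for a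
      using model_pos[OF t] assms(1) that by (intro dform_pos inv_e) auto
    show "(T has_real_derivative sqrt (\<epsilon> * model_P q \<gamma> t)) (at t)" using T(2)[OF t] assms(1) by simp
  qed
qed

end

subsection \<open>Classification\<close>

lemma constant_on_interval:
  fixes f :: "real \<Rightarrow> real"
  assumes "is_interval J" "\<And>t. t \<in> J \<Longrightarrow> (f has_real_derivative 0) (at t)" "s \<in> J" "t \<in> J"
  shows "f s = f t"
proof -
  have "convex J" using assms(1) by (simp add: is_interval_convex)
  then obtain c where "\<And>x. x \<in> J \<Longrightarrow> f x = c"
    using has_field_derivative_zero_constant[of J f] assms(2) has_field_derivative_at_within by blast
  then show ?thesis using assms(3,4) by simp
qed

lemma timelike_center_axis:
  assumes "timelike_center J h" "t \<in> J"
  shows "h t 0 (axis 3 1) (axis 3 1) < 0"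
proof -
  have "axis 3 1 \<in> heis_center - {0}" by (simp add: heis_center_eq axis_def[of 3] axis_eq_0_iff vec_eq_iff forall_3)
  then have "h t 0 (left_invariant_field (axis 3 1) 0) (left_invariant_field (axis 3 1) 0) < 0"
    using assms unfolding timelike_center_def by blast
  then show ?thesis by (simp add: left_invariant_field_eq)
qed

locale quaternionic_heis =
  fixes \<epsilon> \<Lambda> :: real and J :: "real set" and h :: "real \<Rightarrow> 3 form_field" and t\<^sub>0 k q :: real and e :: "real ^ 3 ^ 3"
  assumes qh: "quaternionic_heisenberg \<epsilon> \<Lambda> J h" and t0: "t\<^sub>0 \<in> J"
    and adapted: "adapted_frame \<epsilon> (h t\<^sub>0) k e" and q_def: "q = \<epsilon> * \<Lambda> / 3"
begin

abbreviation H where "H t \<equiv> h t 0"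
definition H' where "H' t a b = deriv (\<lambda>t. H t a b) t"
definition H'' where "H'' t a b = deriv (\<lambda>t. H' t a b) t"

lemma four: "heisenberg_four_manifold \<epsilon> J h" using qh by (simp add: quaternionic_heisenberg_def)

lemma eps: "\<epsilon> = 1 \<or> \<epsilon> = -1" and J_open: "open J" and J_interval: "is_interval J"
  and li: "t \<in> J \<Longrightarrow> left_invariant (h t)" and sig: "t \<in> J \<Longrightarrow> has_signature (h t p) (vector [\<epsilon>, 1, 1])"
  using four by (auto simp: heisenberg_four_manifold_def)

lemma L0: "\<Lambda> \<noteq> 0"
  using qh by (auto simp: quaternionic_heisenberg_def quaternionic_kaehler_def quaternionic_parakaehler_def)

lemma k: "k > 0" and frame_e: "heis_frame k e" and orth_e: "orthonormal_basis (H t\<^sub>0) (vector [\<epsilon>, 1, 1]) e"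
  using adapted by (auto simp: adapted_frame_def)

lemma inv_e: "invertible e" using frame_e by (simp add: heis_frame_iff)

lemma H_props: "t \<in> J \<Longrightarrow> bilinear (H t)" "t \<in> J \<Longrightarrow> H t u v = H t v u" "t \<in> J \<Longrightarrow> (\<And>w. H t u w = 0) \<Longrightarrow> u = 0"
  using has_signature_3[OF sig eps] by blast+

lemma center_neg: "\<epsilon> = -1 \<Longrightarrow> t \<in> J \<Longrightarrow> H t (axis 3 1) (axis 3 1) < 0"
  using qh by (auto simp: quaternionic_heisenberg_def intro: timelike_center_axis)

text \<open>The restriction of a metric component to the line over the identity of the group, where
  \<open>group_part\<close> is 0, is a coefficient of \<open>H\<close>.\<close>

lemma H_smooth: "smooth_real_on (\<lambda>t. H t a b) J"
proof -
  have gp: "group_part (t *\<^sub>R axis 1 1) = 0" "group_part (axis 2 1) = axis 1 1" "group_part (axis 3 1) = axis 2 1"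
     "group_part (axis 4 1) = axis 3 1" for t :: real
    by (simp_all add: group_part_def vec_eq_iff forall_3 axis_def)
  have ax: "axis (2::4) 1 $ 1 = (0::real)" "axis (3::4) 1 $ 1 = (0::real)" "axis (4::4) 1 $ 1 = (0::real)"
    by (simp_all add: axis_def)
  have sm: "smooth_real_on (\<lambda>t. metric_component (heis_metric \<epsilon> h) i j (t *\<^sub>R axis 1 1)) J" for i j
    by (rule smooth_real_on_line[where U = "interval_times_heis J"])
      (use four in \<open>auto simp: heisenberg_four_manifold_def interval_times_heis_def\<close>)
  \<comment> \<open>Group coordinate \<open>i\<close> is coordinate \<open>i + 1\<close> of the
    four-manifold.\<close>
  define n :: "3 \<Rightarrow> 4" where "n i = vector [2, 3, 4] $ i" for i
  have n: "group_part (axis (n i) 1) = axis i 1" "axis (n i) 1 $ 1 = (0::real)" for i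
    using exhaust_3[of i] by (auto simp: n_def gp ax)
  have ab: "smooth_real_on (\<lambda>t. H t (axis i 1) (axis j 1)) J" for i j
    using sm[of "n i" "n j"] by (simp add: metric_component_def heis_metric_def n gp)
  have "smooth_real_on (\<lambda>t. \<Sum>i\<in>UNIV. \<Sum>j\<in>UNIV. a $ i * b $ j * H t (axis i 1) (axis j 1)) J"
    unfolding sum_3 by (intro smooth_real_on_add smooth_real_on_mult smooth_real_on_const ab)
  then show ?thesis
    by (subst smooth_real_on_cong[OF J_open]) (simp_all add: bilinear_expand3[OF H_props(1)])
qed

lemma H_deriv: "t \<in> J \<Longrightarrow> ((\<lambda>t. H t a b) has_real_derivative H' t a b) (at t)"
  and H'_smooth: "smooth_real_on (\<lambda>t. H' t a b) J"
proof -
  obtain d where d: "\<And>t. t \<in> J \<Longrightarrow> ((\<lambda>t. H t a b) has_real_derivative d t) (at t)" "smooth_real_on d J"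
    using smooth_real_on_obtain_deriv[OF J_open H_smooth] by blast
  have eq: "H' t a b = d t" if "t \<in> J" for t unfolding H'_def by (rule DERIV_imp_deriv[OF d(1)[OF that]])
  show "t \<in> J \<Longrightarrow> ((\<lambda>t. H t a b) has_real_derivative H' t a b) (at t)" using d(1) eq by simp
  show "smooth_real_on (\<lambda>t. H' t a b) J" using d(2) eq by (subst smooth_real_on_cong[OF J_open]) auto
qed

lemma H'_deriv: "t \<in> J \<Longrightarrow> ((\<lambda>t. H' t a b) has_real_derivative H'' t a b) (at t)"
proof -
  assume t: "t \<in> J"
  obtain d where d: "\<And>t. t \<in> J \<Longrightarrow> ((\<lambda>t. H' t a b) has_real_derivative d t) (at t)"
    using smooth_real_on_obtain_deriv[OF J_open H'_smooth] by blast
  show ?thesis unfolding H''_def using DERIV_imp_deriv[OF d[OF t]] d[OF t] by simp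
qed

sublocale jet: heis_jet J "\<lambda>_. \<epsilon>" "\<lambda>_. 0" H H'
proof (rule heis_jet.intro)
  show "\<epsilon> \<noteq> 0" using eps by auto
qed (use J_open H_props H_deriv H_smooth in \<open>auto intro: smooth_real_on_const\<close>)

lemma metric_eq: "x \<in> interval_times_heis J \<Longrightarrow> heis_metric \<epsilon> h x u v = hmet (\<lambda>_. \<epsilon>) H x u v"
  using heis_metric_eq_hmet[OF li] by (simp add: interval_times_heis_def)

lemma curvature_conditions: "einstein (interval_times_heis J) (heis_metric \<epsilon> h) \<Lambda>" "half_conformally_flat (interval_times_heis J) (heis_metric \<epsilon> h)"
  using qh by (auto simp: quaternionic_heisenberg_def quaternionic_kaehler_def quaternionic_parakaehler_def)

lemma einstein_hmet:
  assumes x: "x \<in> interval_times_heis J"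
  shows "ricci (hmet (\<lambda>_. \<epsilon>) H) i j x = \<Lambda> * metric_component (hmet (\<lambda>_. \<epsilon>) H) i j x"
proof -
  have "ricci (heis_metric \<epsilon> h) i j x = \<Lambda> * metric_component (heis_metric \<epsilon> h) i j x"
    using curvature_conditions(1) x unfolding einstein_def by blast
  then show ?thesis by (simp only: metric_cong[OF open_interval_times_heis[OF J_open] metric_eq x])
qed

text \<open>One duality sign for the whole manifold, chosen once, so that the sign \<open>s\<close>
  below is independent of time.\<close>

definition \<sigma> where "\<sigma> = (SOME s. s \<in> {1, -1} \<and> (\<forall>x\<in>interval_times_heis J. \<forall>i j k l.
    hodge_weyl (heis_metric \<epsilon> h) i j k l x = s * weyl (heis_metric \<epsilon> h) i j k l x))"

lemma \<sigma>_props: "\<sigma> \<in> {1, -1} \<and> (\<forall>x\<in>interval_times_heis J. \<forall>i j k l.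
    hodge_weyl (heis_metric \<epsilon> h) i j k l x = \<sigma> * weyl (heis_metric \<epsilon> h) i j k l x)"
  unfolding \<sigma>_def by (rule someI_ex) (rule curvature_conditions(2)[unfolded half_conformally_flat_def Bex_def])

lemma \<sigma>: "\<sigma> = 1 \<or> \<sigma> = -1"
  "x \<in> interval_times_heis J \<Longrightarrow> hodge_weyl (hmet (\<lambda>_. \<epsilon>) H) i j k' l x = \<sigma> * weyl (hmet (\<lambda>_. \<epsilon>) H) i j k' l x"
proof -
  show "\<sigma> = 1 \<or> \<sigma> = -1" using \<sigma>_props by simp
  assume x: "x \<in> interval_times_heis J"
  show "hodge_weyl (hmet (\<lambda>_. \<epsilon>) H) i j k' l x = \<sigma> * weyl (hmet (\<lambda>_. \<epsilon>) H) i j k' l x"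
    using \<sigma>_props[THEN conjunct2, rule_format, OF x, of i j k' l]
    by (simp only: weyl_cong[OF open_interval_times_heis[OF J_open] metric_eq x])
qed

text \<open>The pointwise result is applied over the identity of the group, to an arbitrary frame
  adapted at the given time.\<close>

lemma frame_equations:
  assumes t: "t \<in> J" and c: "c > 0" and f: "heis_frame c f" and orth: "orthonormal_basis (H t) (vector [\<epsilon>, 1, 1]) f"
    and s: "s = \<sigma> * sgn (det f)"
  shows "H' t (f $ 1) (f $ 2) = 0" "H' t (f $ 1) (f $ 3) = 0" "H' t (f $ 2) (f $ 3) = 0"
    "H' t (f $ 3) (f $ 3) = H' t (f $ 2) (f $ 2)"
    "(c - s * \<epsilon> * (H' t (f $ 1) (f $ 1) / 2)) * (c + s * (H' t (f $ 2) (f $ 2) / 2)) = q"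
    "(c + s * (H' t (f $ 2) (f $ 2) / 2))\<^sup>2 + 2 * c * (c - s * \<epsilon> * (H' t (f $ 1) (f $ 1) / 2)) = - q"
    "H'' t (f $ 1) (f $ 1) = 2 * \<epsilon> * (H' t (f $ 1) (f $ 1) / 2)\<^sup>2 - 2 * \<Lambda> / 3
       - 4 * s * c * (\<epsilon> * (H' t (f $ 2) (f $ 2) / 2) - H' t (f $ 1) (f $ 1) / 2)"
proof -
  let ?x = "t *\<^sub>R axis 1 1 :: real ^ 4"
  have x1: "?x $ 1 = t" by simp
  have xU: "?x \<in> interval_times_heis J" using t by (simp add: interval_times_heis_def)
  interpret E: heis_einstein_frame J \<epsilon> H H' H'' ?x f c \<Lambda>
  proof (rule heis_einstein_frame.intro, rule heis_frame_jet.intro[OF jet.heis_jet_axioms],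
      rule heis_frame_jet_axioms.intro, goal_cases)
    case 5
    then show ?case using f by (simp add: heis_frame_iff)
  next
    case 7
    show ?case
      by (rule heis_einstein_frame_axioms.intro) (rule einstein_hmet[OF xU])
  qed (use eps t H'_deriv orth heis_frame_center[OF f] in auto)
  have hf: "hodge_weyl (hmet (\<lambda>_. \<epsilon>) H) i j k l ?x = \<sigma> * weyl (hmet (\<lambda>_. \<epsilon>) H) i j k l ?x" for i j k l
    by (rule \<sigma>(2)[OF xU])
  have c0: "c \<noteq> 0" using c by simp
  note S = E.half_flat_structure[OF \<sigma>(1) L0 c0 hf s]
  show "H' t (f $ 1) (f $ 2) = 0" "H' t (f $ 1) (f $ 3) = 0" "H' t (f $ 2) (f $ 3) = 0"
    "H' t (f $ 3) (f $ 3) = H' t (f $ 2) (f $ 2)"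
    "(c - s * \<epsilon> * (H' t (f $ 1) (f $ 1) / 2)) * (c + s * (H' t (f $ 2) (f $ 2) / 2)) = q"
    "(c + s * (H' t (f $ 2) (f $ 2) / 2))\<^sup>2 + 2 * c * (c - s * \<epsilon> * (H' t (f $ 1) (f $ 1) / 2)) = - q"
    "H'' t (f $ 1) (f $ 1) = 2 * \<epsilon> * (H' t (f $ 1) (f $ 1) / 2)\<^sup>2 - 2 * \<Lambda> / 3
       - 4 * s * c * (\<epsilon> * (H' t (f $ 2) (f $ 2) / 2) - H' t (f $ 1) (f $ 1) / 2)"
    using S by (simp_all add: E.K_def E.M_def q_def)
qed

text \<open>The frame equations are expressed in terms of the fixed frame here, so that the vanishing of the
  off-diagonal entries propagates in time.\<close>

lemma first_order:
  assumes t: "t \<in> J"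
  shows "H' t (e $ 1) v * H t (e $ 1) (e $ 1) = H' t (e $ 1) (e $ 1) * H t (e $ 1) v"
    and "\<exists>l. \<forall>u v. H t (e $ 1) u = 0 \<longrightarrow> H t (e $ 1) v = 0 \<longrightarrow> H' t u v = l * H t u v"
    and "\<epsilon> * H t (e $ 1) (e $ 1) > 0"
    and "H t (e $ 1) u = 0 \<Longrightarrow> u \<noteq> 0 \<Longrightarrow> H t u u > 0"
proof -
  \<comment> \<open>At each time a new adapted frame is taken, not assumed to be related to
    \<open>e\<close> except through the center.\<close>
  obtain c f where f: "adapted_frame \<epsilon> (h t) c f"
    using adapted_frame_exists[where h = "h t", OF sig[OF t] eps center_neg[OF _ t]] by blast
  then have c: "c > 0" and hf: "heis_frame c f" and orth: "orthonormal_basis (H t) (vector [\<epsilon>, 1, 1]) f"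
    by (auto simp: adapted_frame_def)
  have inv: "invertible f" using hf by (simp add: heis_frame_iff)
  note st = frame_equations[OF t c hf orth refl]
  have bl: "bilinear (H t)" "bilinear (H' t)" using H_props(1)[OF t] jet.bil'[OF t] by auto
  have sym': "H' t a b = H' t b a" for a b by (rule jet.symH'[OF t])
  note fo = orth[unfolded orthonormal_basis_def, rule_format]
  \<comment> \<open>Both first vectors span the center, so they are proportional; this transfers the
    equations to the fixed \<open>e $ 1\<close>.\<close>
  define d where "d = f $ 1 $ 3 / e $ 1 $ 3"
  have d: "f $ 1 = d *\<^sub>R e $ 1" "d \<noteq> 0"
    using hf frame_e by (auto simp: heis_frame_iff d_def vec_eq_iff forall_3)
  have Hf: "H t u v = \<epsilon> * (frame_coords f u $ 1 * frame_coords f v $ 1) + frame_coords f u $ 2 * frame_coords f v $ 2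
      + frame_coords f u $ 3 * frame_coords f v $ 3" for u v
    using orthonormal_basis_expand(2)[OF bl(1) orth, of u v] eps by auto
  have H'f: "H' t u v = H' t (f $ 1) (f $ 1) * (frame_coords f u $ 1 * frame_coords f v $ 1)
      + H' t (f $ 2) (f $ 2) * (frame_coords f u $ 2 * frame_coords f v $ 2 + frame_coords f u $ 3 * frame_coords f v $ 3)" for u v
    unfolding bilinear_frame_expand[OF inv bl(2), of u v] sum_3
    using st(1-4) sym'[of "f $ 2" "f $ 1"] sym'[of "f $ 3" "f $ 1"] sym'[of "f $ 3" "f $ 2"]
    by (simp add: algebra_simps)
  have f1: "H t (f $ 1) v = \<epsilon> * frame_coords f v $ 1" "H' t (f $ 1) v = H' t (f $ 1) (f $ 1) * frame_coords f v $ 1" for v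
    by (simp_all add: Hf H'f[of "f $ 1" v] frame_coords_expand(2)[OF inv] axis_def)
  have "H' t (f $ 1) v * H t (f $ 1) (f $ 1) = H' t (f $ 1) (f $ 1) * H t (f $ 1) v" for v
    unfolding f1(1) f1(2)[of v] by (simp add: frame_coords_expand(2)[OF inv])
  then show "H' t (e $ 1) v * H t (e $ 1) (e $ 1) = H' t (e $ 1) (e $ 1) * H t (e $ 1) v"
    using d(2) by (simp add: d(1) bilinear_lmul[OF bl(1)] bilinear_rmul[OF bl(1)] bilinear_lmul[OF bl(2)] bilinear_rmul[OF bl(2)])
  have perp: "frame_coords f u $ 1 = 0" if "H t (e $ 1) u = 0" for u
  proof -
    have "H t (f $ 1) u = 0" using that by (simp add: d(1) bilinear_lmul[OF bl(1)])
    then show ?thesis using f1(1) eps by auto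
  qed
  show "\<exists>l. \<forall>u v. H t (e $ 1) u = 0 \<longrightarrow> H t (e $ 1) v = 0 \<longrightarrow> H' t u v = l * H t u v"
  proof (intro exI[of _ "H' t (f $ 2) (f $ 2)"] allI impI)
    fix u v assume "H t (e $ 1) u = 0" "H t (e $ 1) v = 0"
    then show "H' t u v = H' t (f $ 2) (f $ 2) * H t u v"
      unfolding H'f[of u v] Hf[of u v] by (simp only: perp) simp
  qed
  have "H t (f $ 1) (f $ 1) = d * d * H t (e $ 1) (e $ 1)" by (simp add: d(1) bilinear_lmul[OF bl(1)] bilinear_rmul[OF bl(1)])
  then have "d * d * (\<epsilon> * H t (e $ 1) (e $ 1)) = \<epsilon> * \<epsilon>" using fo[of 1 1] by simp
  moreover have "\<epsilon> * \<epsilon> = 1" using eps by auto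
  moreover have "d * d > 0" using d(2) by (auto simp: zero_less_mult_iff)
  ultimately show "\<epsilon> * H t (e $ 1) (e $ 1) > 0" by (metis zero_less_mult_pos zero_less_one)
  show "H t u u > 0" if "H t (e $ 1) u = 0" "u \<noteq> 0"
  proof -
    have z: "frame_coords f u $ 1 = 0" by (rule perp[OF that(1)])
    have "frame_coords f u $ 2 \<noteq> 0 \<or> frame_coords f u $ 3 \<noteq> 0"
      using z frame_coords_expand(1)[OF inv, of u] that(2) by (auto simp: sum_3)
    then have "(frame_coords f u $ 2)\<^sup>2 + (frame_coords f u $ 3)\<^sup>2 > 0" by (simp add: sum_power2_gt_zero_iff)
    then show ?thesis by (simp add: Hf z power2_eq_square)
  qed
qed

end

section \<open>Integration of the equations and the coordinate \<rho>\<close>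

context quaternionic_heis
begin

lemma q0: "q \<noteq> 0" using eps L0 by (auto simp: q_def)

definition F1 where "F1 t = \<epsilon> * H t (e $ 1) (e $ 1)"
definition F2 where "F2 t = H t (e $ 2) (e $ 2)"
definition F1' where "F1' t = \<epsilon> * H' t (e $ 1) (e $ 1)"
definition F2' where "F2' t = H' t (e $ 2) (e $ 2)"

lemma ee: "\<epsilon> \<noteq> 0" "\<epsilon> * (\<epsilon> * y) = y" "\<epsilon> * \<epsilon> = 1" using eps by auto

lemma H_start: "H t\<^sub>0 (e $ i) (e $ j) = (if i = j then if i = 1 then \<epsilon> else 1 else 0)"
  using orth_e exhaust_3[of i] by (auto simp: orthonormal_basis_def)

lemma F_start: "F1 t\<^sub>0 = 1" "F2 t\<^sub>0 = 1"
  by (simp_all add: F1_def F2_def H_start ee)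

lemma F1_pos: "t \<in> J \<Longrightarrow> F1 t > 0"
  using first_order(3) by (simp add: F1_def)

text \<open>By \<open>first_order\<close> the quotient of \<open>H t (e $ 1) v\<close> and
  \<open>H t (e $ 1) (e $ 1)\<close> has derivative 0, so a vector orthogonal to the center once is
  orthogonal to it always.\<close>

lemma center_orthogonal:
  assumes t: "t \<in> J" and v: "H t\<^sub>0 (e $ 1) v = 0"
  shows "H t (e $ 1) v = 0"
proof -
  have nz: "H t (e $ 1) (e $ 1) \<noteq> 0" if "t \<in> J" for t using F1_pos[OF that] by (auto simp: F1_def)
  have "H t (e $ 1) v / H t (e $ 1) (e $ 1) = H t\<^sub>0 (e $ 1) v / H t\<^sub>0 (e $ 1) (e $ 1)"
  proof (rule constant_on_interval[OF J_interval _ t t0])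
    fix t assume t: "t \<in> J"
    show "((\<lambda>t. H t (e $ 1) v / H t (e $ 1) (e $ 1)) has_real_derivative 0) (at t)"
      by (rule DERIV_cong[OF DERIV_divide[OF H_deriv[OF t] H_deriv[OF t] nz[OF t]]])
        (simp add: first_order(1)[OF t] mult.commute)
  qed
  then show ?thesis using v nz[OF t] by simp
qed

lemma F2_pos: assumes "t \<in> J" shows "F2 t > 0"
proof -
  have "e $ 2 \<noteq> 0" using H_start[of 2 2] bilinear_lzero[OF H_props(1)[OF t0]] by force
  then show ?thesis unfolding F2_def
    by (intro first_order(4)[OF assms] center_orthogonal[OF assms]) (simp_all add: H_start)
qed

text \<open>On the orthogonal complement of the center, now known to be constant in time,
  \<open>H'\<close> is a multiple of \<open>H\<close> with one factor for all pairs of vectors;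
  hence quotients of entries are constant.\<close>

lemma plane_proportional:
  assumes t: "t \<in> J" and i: "i \<noteq> 1" "j \<noteq> 1"
  shows "H t (e $ i) (e $ j) = H t\<^sub>0 (e $ i) (e $ j) * F2 t"
proof -
  have "H t (e $ i) (e $ j) / F2 t = H t\<^sub>0 (e $ i) (e $ j) / F2 t\<^sub>0"
  proof (rule constant_on_interval[OF J_interval _ t t0])
    fix t assume t: "t \<in> J"
    obtain l where l: "\<And>u v. H t (e $ 1) u = 0 \<Longrightarrow> H t (e $ 1) v = 0 \<Longrightarrow> H' t u v = l * H t u v"
      using first_order(2)[OF t] by blast
    have p: "H t (e $ 1) (e $ a) = 0" if "a \<noteq> 1" for a
      by (rule center_orthogonal[OF t]) (use that in \<open>simp add: H_start\<close>)
    have two: "(2::3) \<noteq> 1" by simp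
    have nz: "H t (e $ 2) (e $ 2) \<noteq> 0" using F2_pos[OF t] by (simp add: F2_def)
    show "((\<lambda>t. H t (e $ i) (e $ j) / F2 t) has_real_derivative 0) (at t)"
      unfolding F2_def
      by (rule DERIV_cong[OF DERIV_divide[OF H_deriv[OF t] H_deriv[OF t] nz]])
        (simp add: l[OF p[OF i(1)] p[OF i(2)]] l[OF p[OF two] p[OF two]])
  qed
  then have "H t (e $ i) (e $ j) / F2 t = H t\<^sub>0 (e $ i) (e $ j)" by (simp add: F_start)
  then show ?thesis using F2_pos[OF t] by (simp add: field_simps)
qed

lemma H_frame:
  assumes t: "t \<in> J"
  shows "H t (e $ i) (e $ j) = (if i = j then if i = 1 then \<epsilon> * F1 t else F2 t else 0)"
proof (cases "i = 1 \<or> j = 1")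
  case True
  then show ?thesis
    using center_orthogonal[OF t, of "e $ i"] center_orthogonal[OF t, of "e $ j"] H_props(2)[OF t, of "e $ i" "e $ j"]
    by (auto simp: H_start F1_def ee)
next
  case False
  then show ?thesis using plane_proportional[OF t, of i j] by (auto simp: H_start)
qed

lemma H_dform: "t \<in> J \<Longrightarrow> H t u v = dform e (\<epsilon> * F1 t) (F2 t) u v"
  by (rule bilinear_eq_dform[OF inv_e H_props(1)]) (simp_all add: H_frame)

lemma F_deriv: "t \<in> J \<Longrightarrow> (F1 has_real_derivative F1' t) (at t)" "t \<in> J \<Longrightarrow> (F2 has_real_derivative F2' t) (at t)"
  unfolding F1_def[abs_def] F2_def[abs_def] F1'_def F2'_def by (intro DERIV_cmult H_deriv; assumption)+

definition s where "s = \<sigma> * sgn (det e)"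
text \<open>The structure constant of the rescaled frame. The numbers \<open>\<beta>1\<close> and
  \<open>\<beta>2\<close> below are the two factors in the first-order equation, with product
  \<open>q\<close>.\<close>

definition \<kappa> where "\<kappa> t = k * sqrt (F1 t) / F2 t"
definition l1 where "l1 t = F1' t / (2 * F1 t)"
definition l2 where "l2 t = F2' t / (2 * F2 t)"
definition \<beta>1 where "\<beta>1 t = \<kappa> t - s * l1 t"
definition \<beta>2 where "\<beta>2 t = \<kappa> t + s * l2 t"

lemma s: "s = 1 \<or> s = -1" "s * s = 1" "s * (s * y) = y"
proof -
  have "sgn (det e) = 1 \<or> sgn (det e) = -1" using inv_e by (auto simp: invertible_det_nz sgn_if)
  then have *: "s = 1 \<or> s = -1" using \<sigma>(1) by (auto simp: s_def)
  show "s = 1 \<or> s = -1" "s * s = 1" "s * (s * y) = y" using * by auto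
qed

lemma equations:
  assumes t: "t \<in> J"
  shows "\<beta>1 t * \<beta>2 t = q" "(\<beta>2 t)\<^sup>2 + 2 * \<kappa> t * \<beta>1 t = - q"
    "\<epsilon> * H'' t (e $ 1) (e $ 1) / F1 t = 2 * (l1 t)\<^sup>2 - 2 * q - 4 * s * \<kappa> t * (l2 t - l1 t)"
proof -
  define f where "f = scaled_frame e (sqrt (F1 t)) (sqrt (F2 t))"
  note P = F1_pos[OF t] F2_pos[OF t]
  have nz: "sqrt (F1 t) \<noteq> 0" "sqrt (F2 t) \<noteq> 0" using P by simp_all
  have c: "\<kappa> t > 0" using P k by (simp add: \<kappa>_def)
  have det: "det f = det e / (sqrt (F1 t) * F2 t)" using P by (simp add: f_def det_scaled_frame)
  \<comment> \<open>The scaling factors are positive, so the sign attached to the rescaled frame is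
    the constant \<open>s\<close>.\<close>
  then have sgn: "s = \<sigma> * sgn (det f)" using P by (simp add: s_def sgn_divide sgn_mult)
  have "det f \<noteq> 0" using inv_e P by (simp add: det invertible_det_nz)
  then have hf: "heis_frame (\<kappa> t) f"
    unfolding heis_frame_iff invertible_det_nz
    using bracket_scaled_frame(1)[OF frame_e nz] P frame_e
    by (simp add: f_def[symmetric] \<kappa>_def) (simp add: f_def scaled_frame_def heis_frame_iff)
  have orth: "orthonormal_basis (H t) (vector [\<epsilon>, 1, 1]) f"
    unfolding orthonormal_basis_def forall_3 H_dform[OF t] using P
    by (simp add: f_def dform_scaled_frame[OF inv_e])
  note E = frame_equations[OF t c hf orth sgn]
  have bl: "bilinear (H' t)" "bilinear (H'' t)"
    using jet.bil'[OF t] bilinear_deriv[where H = H' and H' = H'', OF J_open t jet.bil' H'_deriv[OF t]] by auto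
  have f1: "f $ 1 = (1 / sqrt (F1 t)) *\<^sub>R e $ 1" and f2: "f $ 2 = (1 / sqrt (F2 t)) *\<^sub>R e $ 2"
    by (simp_all add: f_def scaled_frame_def)
  have K1: "H' t (f $ 1) (f $ 1) / 2 = \<epsilon> * l1 t"
    using P by (simp add: f1 bilinear_lmul[OF bl(1)] bilinear_rmul[OF bl(1)] l1_def F1'_def ee)
  have K2: "H' t (f $ 2) (f $ 2) / 2 = l2 t"
    using P by (simp add: f2 bilinear_lmul[OF bl(1)] bilinear_rmul[OF bl(1)] l2_def F2'_def)
  have M: "H'' t (f $ 1) (f $ 1) = H'' t (e $ 1) (e $ 1) / F1 t"
    using P by (simp add: f1 bilinear_lmul[OF bl(2)] bilinear_rmul[OF bl(2)])
  have ss: "s * \<epsilon> * (\<epsilon> * y) = s * y" for y by (simp add: mult.assoc ee)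
  show "\<beta>1 t * \<beta>2 t = q" "(\<beta>2 t)\<^sup>2 + 2 * \<kappa> t * \<beta>1 t = - q"
    using E(5,6) unfolding K1 K2 ss \<beta>1_def \<beta>2_def by simp_all
  have "\<epsilon> * (H'' t (e $ 1) (e $ 1) / F1 t) = \<epsilon> * (2 * \<epsilon> * (\<epsilon> * l1 t)\<^sup>2 - 2 * \<Lambda> / 3
       - 4 * s * \<kappa> t * (\<epsilon> * l2 t - \<epsilon> * l1 t))"
    using E(7) unfolding K1 K2 M by simp
  also have "\<dots> = 2 * (\<epsilon> * \<epsilon>) * (\<epsilon> * \<epsilon>) * (l1 t)\<^sup>2 - 2 * q - 4 * s * \<kappa> t * (\<epsilon> * \<epsilon>) * (l2 t - l1 t)"
    by (simp add: q_def field_simps power2_eq_square)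
  finally show "\<epsilon> * H'' t (e $ 1) (e $ 1) / F1 t = 2 * (l1 t)\<^sup>2 - 2 * q - 4 * s * \<kappa> t * (l2 t - l1 t)"
    by (simp add: ee)
qed

lemma \<beta>_nz: "t \<in> J \<Longrightarrow> \<beta>1 t \<noteq> 0" "t \<in> J \<Longrightarrow> \<beta>2 t \<noteq> 0"
  using equations(1) q0 by force+

text \<open>By \<open>a_eq\<close> this is \<open>\<beta>1\<close> times the root of
  \<open>F1\<close>; it is written out so that smoothness can be read off. The factor in
  \<open>r\<close> achieves the value -1/2 in \<open>r_relations\<close>, on which the conservation
  of \<gamma> depends.\<close>

definition a where "a t = k * F1 t / F2 t - s * F1' t / (2 * sqrt (F1 t))"
definition r where "r t = - 1 / (2 * k * a t)"
definition r' where "r' t = s * q * sqrt (F1 t) / (2 * k * (a t)\<^sup>2)"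

lemma a_eq: "t \<in> J \<Longrightarrow> a t = \<beta>1 t * sqrt (F1 t)"
  using F1_pos[of t] F2_pos[of t] by (simp add: a_def \<beta>1_def \<kappa>_def l1_def field_simps)

lemma a_nz: "t \<in> J \<Longrightarrow> a t \<noteq> 0"
  using \<beta>_nz F1_pos[of t] by (simp add: a_eq)

text \<open>The third of the \<open>equations\<close> supplies the second derivative of
  \<open>F1\<close>.\<close>

lemma a_deriv:
  assumes t: "t \<in> J"
  shows "(a has_real_derivative s * q * sqrt (F1 t)) (at t)"
proof -
  define f where "f = sqrt (F1 t)"
  note P = F1_pos[OF t] F2_pos[OF t]
  have f: "f > 0" "F1 t = f\<^sup>2" using P by (simp_all add: f_def)
  have d1: "F1' t = 2 * l1 t * f\<^sup>2" and d2: "F2' t = 2 * l2 t * F2 t"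
    using P f by (simp_all add: l1_def l2_def)
  have dd: "\<epsilon> * H'' t (e $ 1) (e $ 1) = (2 * (l1 t)\<^sup>2 - 2 * q - 4 * s * \<kappa> t * (l2 t - l1 t)) * f\<^sup>2"
    using equations(3)[OF t] P f by (simp add: divide_eq_eq)
  have F1'': "(F1' has_real_derivative \<epsilon> * H'' t (e $ 1) (e $ 1)) (at t)"
    unfolding F1'_def[abs_def] by (intro DERIV_cmult H'_deriv t)
  have sq: "((\<lambda>t. sqrt (F1 t)) has_real_derivative l1 t * f) (at t)"
    by (rule DERIV_cong[OF DERIV_chain2[where f = sqrt and g = F1, OF DERIV_real_sqrt[OF P(1)] F_deriv(1)[OF t]]])
      (use f in \<open>simp add: f_def[symmetric] d1 field_simps power2_eq_square\<close>)
  have p1: "((\<lambda>t. k * F1 t / F2 t) has_real_derivative 2 * (l1 t - l2 t) * (k * f\<^sup>2 / F2 t)) (at t)"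
    by (rule DERIV_cong[OF DERIV_divide[OF DERIV_cmult[OF F_deriv(1)[OF t]] F_deriv(2)[OF t]]])
      (use P in \<open>simp_all add: d1 d2 f(2) field_simps power2_eq_square\<close>)
  have p2: "((\<lambda>t. s * F1' t / (2 * sqrt (F1 t))) has_real_derivative
      s * (- (l1 t)\<^sup>2 * f + ((l1 t)\<^sup>2 - q - 2 * s * \<kappa> t * (l2 t - l1 t)) * f)) (at t)"
    by (rule DERIV_cong[OF DERIV_divide[OF DERIV_cmult[OF F1''] DERIV_cmult[OF sq]]])
      (use f in \<open>simp_all add: f_def[symmetric] d1 dd field_simps power2_eq_square\<close>)
  have kf: "k * f\<^sup>2 / F2 t = \<kappa> t * f" by (simp add: \<kappa>_def f_def[symmetric] power2_eq_square)
  \<comment> \<open>All terms with \<open>l1 - l2\<close> carry the factor \<open>1 - s * s\<close>,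
    which is 0.\<close>
  have "2 * (l1 t - l2 t) * (\<kappa> t * f) - s * (- (l1 t)\<^sup>2 * f + ((l1 t)\<^sup>2 - q - 2 * s * \<kappa> t * (l2 t - l1 t)) * f)
      = s * q * f + 2 * (1 - s * s) * (l1 t - l2 t) * \<kappa> t * f"
    by (simp add: field_simps)
  then show ?thesis
    unfolding a_def[abs_def] f_def[symmetric]
    by (intro DERIV_cong[OF DERIV_diff[OF p1 p2]]) (simp only: kf, simp add: s(2))
qed

lemma r_nz: "t \<in> J \<Longrightarrow> r t \<noteq> 0"
  using a_nz k by (simp add: r_def)

lemma r_deriv: "t \<in> J \<Longrightarrow> (r has_real_derivative r' t) (at t)"
  unfolding r_def[abs_def] r'_def using a_nz k
  by (auto intro!: derivative_eq_intros a_deriv simp: field_simps power2_eq_square)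

lemma r_smooth: "smooth_real_on r J"
proof -
  have F: "smooth_real_on F1 J" "smooth_real_on F2 J" "smooth_real_on F1' J"
    unfolding F1_def[abs_def] F2_def[abs_def] F1'_def[abs_def]
    by (intro smooth_real_on_mult smooth_real_on_const H_smooth H'_smooth)+
  have "smooth_real_on a J"
    unfolding a_def[abs_def]
    by (intro smooth_real_on_diff smooth_real_on_divide smooth_real_on_mult smooth_real_on_const smooth_real_on_sqrt F)
      (use F1_pos F2_pos in fastforce)+
  then show ?thesis
    unfolding r_def[abs_def]
    by (intro smooth_real_on_divide smooth_real_on_mult smooth_real_on_const) (use a_nz k in auto)
qed

lemma r_relations:
  assumes t: "t \<in> J"
  shows "r t * \<kappa> t * F2 t * \<beta>1 t = - (1 / 2)" "r' t = - s * r t * \<beta>2 t" "4 * k\<^sup>2 * (r t)\<^sup>2 * (\<beta>1 t)\<^sup>2 * F1 t = 1"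
proof -
  note P = F1_pos[OF t] F2_pos[OF t] \<beta>_nz[OF t]
  define f where "f = sqrt (F1 t)"
  have f: "f > 0" "F1 t = f\<^sup>2" using P by (simp_all add: f_def)
  show "r t * \<kappa> t * F2 t * \<beta>1 t = - (1 / 2)" "4 * k\<^sup>2 * (r t)\<^sup>2 * (\<beta>1 t)\<^sup>2 * F1 t = 1"
    unfolding r_def a_eq[OF t] \<kappa>_def f_def[symmetric] using P f k
    by (simp_all add: field_simps power2_eq_square)
  show "r' t = - s * r t * \<beta>2 t"
  proof -
    have "r' t = s * (\<beta>1 t * \<beta>2 t) * f / (2 * k * (\<beta>1 t * f)\<^sup>2)"
      unfolding r'_def a_eq[OF t] f_def[symmetric] equations(1)[OF t] ..
    also have "\<dots> = - s * r t * \<beta>2 t"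
      unfolding r_def a_eq[OF t] f_def[symmetric] using P f k by (simp add: field_simps power2_eq_square)
    finally show ?thesis .
  qed
qed

definition \<gamma> where "\<gamma> = - (q * (r t\<^sub>0)\<^sup>2 + r t\<^sub>0) / 2"

lemma \<gamma>_eq: "\<gamma> = gamma_of \<epsilon> \<Lambda> (r t\<^sub>0)"
  unfolding \<gamma>_def by (simp add: gamma_of_def q_def field_simps power2_eq_square)

text \<open>The derivative of the first integral is a multiple of
  \<open>2 * q * r * \<kappa> * F2 + \<beta>2\<close>. Replacing \<open>q\<close> by
  \<open>\<beta>1 * \<beta>2\<close> and using the first of \<open>r_relations\<close> makes it
  vanish.\<close>

lemma \<gamma>:
  assumes t: "t \<in> J"
  shows "r t + 2 * \<gamma> = - (q * (r t)\<^sup>2 * F2 t)"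
proof -
  have "q * (r t)\<^sup>2 * F2 t + r t = q * (r t\<^sub>0)\<^sup>2 * F2 t\<^sub>0 + r t\<^sub>0"
  proof (rule constant_on_interval[OF J_interval _ t t0])
    fix t assume t: "t \<in> J"
    have d2: "F2' t = 2 * l2 t * F2 t" using F2_pos[OF t] by (simp add: l2_def)
    have l2: "l2 t = s * (\<beta>2 t - \<kappa> t)" by (simp add: \<beta>2_def s)
    have "(\<lambda>t. q * (r t)\<^sup>2 * F2 t + r t) = (\<lambda>t. q * (r t * r t) * F2 t + r t)" by (simp add: power2_eq_square)
    moreover have "((\<lambda>t. q * (r t * r t) * F2 t + r t) has_real_derivative
        q * (r' t * r t + r' t * r t) * F2 t + F2' t * (q * (r t * r t)) + r' t) (at t)"
      by (intro DERIV_add DERIV_mult DERIV_cmult r_deriv F_deriv t)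
    moreover have "q * (r' t * r t + r' t * r t) * F2 t + F2' t * (q * (r t * r t)) + r' t = 0"
    proof -
      have "q * (r' t * r t + r' t * r t) * F2 t + F2' t * (q * (r t * r t)) + r' t
          = - s * r t * (2 * q * (r t * \<kappa> t * F2 t) + \<beta>2 t)"
        unfolding d2 l2 r_relations(2)[OF t] by (simp add: algebra_simps)
      also have "2 * q * (r t * \<kappa> t * F2 t) + \<beta>2 t = 2 * (r t * \<kappa> t * F2 t * \<beta>1 t) * \<beta>2 t + \<beta>2 t"
        by (simp add: equations(1)[OF t, symmetric] mult_ac)
      also have "\<dots> = 0" unfolding r_relations(1)[OF t] by simp
      finally show ?thesis by simp
    qed
    ultimately show "((\<lambda>t. q * (r t)\<^sup>2 * F2 t + r t) has_real_derivative 0) (at t)" by simp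
  qed
  then have "q * (r t)\<^sup>2 * F2 t + r t = q * (r t\<^sub>0)\<^sup>2 + r t\<^sub>0" by (simp add: F_start)
  then show ?thesis by (simp add: \<gamma>_def field_simps)
qed

text \<open>The second first-order equation enters here. It makes \<open>r + \<gamma>\<close> a
  positive multiple of a square, which explains this condition on the interval.\<close>

lemma \<gamma>_half:
  assumes t: "t \<in> J"
  shows "r t + \<gamma> = F2 t * (r t)\<^sup>2 * (\<beta>2 t)\<^sup>2 / 2"
proof -
  have "r t = - (r t * (2 * (r t * \<kappa> t * F2 t * \<beta>1 t)))" unfolding r_relations(1)[OF t] by simp
  also have "\<dots> = F2 t * (r t)\<^sup>2 * ((\<beta>2 t)\<^sup>2 - ((\<beta>2 t)\<^sup>2 + 2 * \<kappa> t * \<beta>1 t))"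
    by (simp add: algebra_simps power2_eq_square)
  also have "\<dots> = F2 t * (r t)\<^sup>2 * (\<beta>2 t)\<^sup>2 + q * (r t)\<^sup>2 * F2 t"
    unfolding equations(2)[OF t] by (simp add: algebra_simps)
  finally show ?thesis using \<gamma>[OF t] by (simp add: field_simps)
qed

text \<open>\<open>\<gamma>\<close> and \<open>\<gamma>_half\<close> express the squares and
  products of \<open>\<beta>1\<close> and \<open>\<beta>2\<close> through \<open>r\<close>, and the
  coefficients become rational functions.\<close>

lemma model_values:
  assumes t: "t \<in> J"
  shows "r t + \<gamma> > 0" "q * (r t + 2 * \<gamma>) < 0" "model_plane q \<gamma> (r t) = F2 t" "model_center q \<gamma> k (r t) = F1 t"
    "model_P q \<gamma> (r t) * (r' t)\<^sup>2 = 1"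
proof -
  note P = F1_pos[OF t] F2_pos[OF t] \<beta>_nz[OF t] r_nz[OF t] q0 k
  show "r t + \<gamma> > 0" unfolding \<gamma>_half[OF t] using P by simp
  have "0 < (q * r t)\<^sup>2 * F2 t" using P by simp
  then show "q * (r t + 2 * \<gamma>) < 0" unfolding \<gamma>[OF t] by (simp add: power2_eq_square mult_ac)
  show "model_plane q \<gamma> (r t) = F2 t" unfolding model_plane_def \<gamma>[OF t] using P by simp
  have "F1 t = 1 / (4 * k\<^sup>2 * (r t)\<^sup>2 * (\<beta>1 t)\<^sup>2)" using r_relations(3)[OF t] P by (simp add: field_simps)
  also have "\<dots> = (\<beta>2 t)\<^sup>2 / (4 * (\<beta>1 t * \<beta>2 t)\<^sup>2 * k\<^sup>2 * (r t)\<^sup>2)"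
    using P by (simp add: field_simps power2_eq_square)
  also have "\<dots> = model_center q \<gamma> k (r t)"
    unfolding model_center_def \<gamma>[OF t] \<gamma>_half[OF t] equations(1)[OF t]
    using P by (simp add: field_simps power2_eq_square)
  finally show "model_center q \<gamma> k (r t) = F1 t" ..
  have r2: "(r' t)\<^sup>2 = (r t)\<^sup>2 * (\<beta>2 t)\<^sup>2"
    unfolding r_relations(2)[OF t] using s(2) by (simp add: power_mult_distrib power2_eq_square[of s])
  show "model_P q \<gamma> (r t) * (r' t)\<^sup>2 = 1"
    unfolding model_P_def \<gamma>[OF t] \<gamma>_half[OF t] r2 using P by (simp add: field_simps power2_eq_square)
qed

text \<open>The formulas for \<open>r + 2 * \<gamma>\<close> and \<open>r + \<gamma>\<close> at the
  initial time, where both coefficients are 1, eliminate \<gamma>; \<open>\<beta>1\<close> and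
  \<open>\<beta>2\<close> drop out through their product.\<close>

lemma r_cubic: "4 * k\<^sup>2 * q\<^sup>2 * (r t\<^sub>0) ^ 3 + q * r t\<^sub>0 - 1 = 0"
proof -
  have n: "r t\<^sub>0 \<noteq> 0" by (rule r_nz[OF t0])
  have "r t\<^sub>0 - q * (r t\<^sub>0)\<^sup>2 = (r t\<^sub>0)\<^sup>2 * (\<beta>2 t\<^sub>0)\<^sup>2"
    using \<gamma>[OF t0] \<gamma>_half[OF t0] by (simp add: F_start)
  also have "\<dots> = (r t\<^sub>0)\<^sup>2 * (\<beta>2 t\<^sub>0)\<^sup>2 * (4 * k\<^sup>2 * (r t\<^sub>0)\<^sup>2 * (\<beta>1 t\<^sub>0)\<^sup>2 * F1 t\<^sub>0)"
    unfolding r_relations(3)[OF t0] by simp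
  also have "\<dots> = 4 * k\<^sup>2 * (\<beta>1 t\<^sub>0 * \<beta>2 t\<^sub>0)\<^sup>2 * r t\<^sub>0 ^ 4"
    by (simp add: F_start power_mult_distrib power2_eq_square power4_eq_xxxx)
  finally have "r t\<^sub>0 * (4 * k\<^sup>2 * q\<^sup>2 * (r t\<^sub>0) ^ 3 + q * r t\<^sub>0 - 1) = 0"
    unfolding equations(1)[OF t0] by (simp add: algebra_simps power2_eq_square power3_eq_cube power4_eq_xxxx)
  then show ?thesis using n by simp
qed

lemma r'_nz: "t \<in> J \<Longrightarrow> r' t \<noteq> 0"
  using model_values(5) by force

theorem classification:
  obtains I where "model_solution \<epsilon> q k \<gamma> e I (r t\<^sub>0) \<Lambda>"
    "takes_model_form \<epsilon> \<Lambda> k e \<gamma> J h t\<^sub>0 I (r t\<^sub>0)" "I = r ` J"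
proof -
  obtain g where g: "open (r ` J)" "is_interval (r ` J)" "smooth_real_on g (r ` J)"
    "\<And>t. t \<in> J \<Longrightarrow> g (r t) = t" "\<And>y. y \<in> r ` J \<Longrightarrow> r (g y) = y" "\<And>y. y \<in> r ` J \<Longrightarrow> g y \<in> J"
    by (rule diffeo_1d[OF J_open J_interval r_smooth r_deriv r'_nz]) (assumption | rule that)+
  have "model_interval \<epsilon> q k \<gamma> e (r ` J)"
    by (rule model_interval.intro[OF eps q0 k frame_e g(1,2)]; erule imageE; simp add: r_nz model_values(1,2))
  then interpret S: model_solution \<epsilon> q k \<gamma> e "r ` J" "r t\<^sub>0" \<Lambda>
    by (rule model_solution.intro, unfold model_solution_axioms_def)
      (use t0 model_values(3,4)[OF t0] in \<open>simp add: F_start q_def\<close>)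
  have "takes_model_form \<epsilon> \<Lambda> k e \<gamma> J h t\<^sub>0 (r ` J) (r t\<^sub>0)"
    unfolding takes_model_form_def
  proof (intro exI[of _ r] conjI refl)
    show "isometry_between (interval_times_heis J) (heis_metric \<epsilon> h) (interval_times_heis (r ` J))
        (model_metric \<epsilon> \<Lambda> k \<gamma> e) (\<lambda>x. vector [r (x $ 1), x $ 2, x $ 3, x $ 4])"
    proof (rule change_coordinate_isometry[OF J_open g(1) r_smooth refl r_deriv g(3-6) _ _ _ S.model_metric_eq[OF _ q_def]])
      show "\<epsilon> * model_P q \<gamma> (r t) * (r' t)\<^sup>2 = \<epsilon>" if "t \<in> J" for t
        using model_values(5)[OF that] by simp
      show "dform e (\<epsilon> * model_center q \<gamma> k (r t)) (model_plane q \<gamma> (r t)) u v = H t u v" if "t \<in> J" for t u v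
        by (simp add: H_dform[OF that] model_values(3,4)[OF that])
      show "heis_metric \<epsilon> h x u v = hmet (\<lambda>_. \<epsilon>) H x u v" if "x $ 1 \<in> J" for x u v
        by (rule metric_eq) (use that in \<open>simp add: interval_times_heis_def\<close>)
    qed
  qed
  then show thesis using that S.model_solution_axioms by blast
qed

text \<open>The given time and the arc length of the model differ by a sign and a constant, so a
  one-sided bound passes from one to the other. The manifold may cover only part of the maximal
  interval.\<close>

theorem incomplete:
  assumes "\<gamma> < 0 \<or> r t\<^sub>0 < 0"
  shows "\<not> geodesically_complete (interval_times_heis J) (heis_metric \<epsilon> h)"
proof -
  obtain I where I: "model_solution \<epsilon> q k \<gamma> e I (r t\<^sub>0) \<Lambda>" "I = r ` J" using classification by blast
  interpret S: model_solution \<epsilon> q k \<gamma> e "r ` J" "r t\<^sub>0" \<Lambda> using I by simp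
  obtain T b where T: "\<And>\<rho>. \<rho> \<in> r ` J \<Longrightarrow> (T has_real_derivative sqrt (model_P q \<gamma> \<rho>)) (at \<rho>)"
    "\<And>\<rho>. \<rho> \<in> r ` J \<Longrightarrow> b \<le> T \<rho>"
    using S.length_bounded_below[OF assms] by blast
  define c where "c = s * sgn q"
  have c: "c = 1 \<or> c = -1" using s(1) q0 by (auto simp: c_def sgn_if)
  \<comment> \<open>The absolute value is 1 since \<open>r\<close> is an isometry in the interval
    direction, and the explicit formula for \<open>r'\<close> shows that the sign is the same at all
    times.\<close>
  have unit: "sqrt (model_P q \<gamma> (r t)) * r' t = c" if t: "t \<in> J" for t
  proof -
    have "(sqrt (model_P q \<gamma> (r t)) * r' t)\<^sup>2 = 1"
      using model_values(5)[OF t] S.model_pos(1)[of "r t"] t by (simp add: power_mult_distrib)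
    then have "\<bar>sqrt (model_P q \<gamma> (r t)) * r' t\<bar> = 1" by (simp add: abs_square_eq_1)
    moreover have "(sgn (a t))\<^sup>2 = 1" using a_nz[OF t] by (auto simp: sgn_if)
    then have "sgn (sqrt (model_P q \<gamma> (r t)) * r' t) = c"
      using S.model_pos(1)[of "r t"] t F1_pos[OF t] a_nz[OF t] k s(1)
      by (auto simp: c_def r'_def sgn_mult sgn_divide)
    ultimately show ?thesis by (metis mult.right_neutral sgn_mult_abs)
  qed
  have const: "T (r t) - c * t = T (r t\<^sub>0) - c * t\<^sub>0" if t: "t \<in> J" for t
  proof (rule constant_on_interval[OF J_interval _ t t0])
    fix t assume t: "t \<in> J"
    have "((\<lambda>t. T (r t)) has_real_derivative sqrt (model_P q \<gamma> (r t)) * r' t) (at t)"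
      by (rule DERIV_chain2[where f = T and g = r, OF T(1) r_deriv[OF t]]) (use t in blast)
    from DERIV_diff[OF this DERIV_cmult[OF DERIV_ident, of c]]
    show "((\<lambda>t. T (r t) - c * t) has_real_derivative 0) (at t)" by (simp add: unit[OF t])
  qed
  define B where "B = b - T (r t\<^sub>0) + c * t\<^sub>0"
  have B: "B \<le> c * t" if "t \<in> J" for t
    using const[OF that] T(2)[of "r t"] that by (simp add: B_def)
  have bdd: "(\<forall>t\<in>J. c * B \<le> t) \<or> (\<forall>t\<in>J. t \<le> c * B)"
    using c
  proof
    assume "c = 1" then show ?thesis using B by simp
  next
    assume "c = -1" then show ?thesis using B by fastforce
  qed
  have "sqrt \<bar>\<epsilon>\<bar> = 1" using eps by auto
  then have "\<not> geodesically_complete (interval_times_heis J) (hmet (\<lambda>_. \<epsilon>) H)"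
    using jet.not_geodesically_complete[of "\<lambda>t. t" "c * B"] bdd t0 by (auto intro: DERIV_ident)
  then show ?thesis
    using geodesically_complete_cong[where g = "heis_metric \<epsilon> h" and h = "hmet (\<lambda>_. \<epsilon>) H", OF open_interval_times_heis[OF J_open] metric_eq] by blast
qed

end

section \<open>Real roots of the cubic and maximal intervals\<close>

lemma cubic_values:
  fixes q k x :: real
  assumes "q \<noteq> 0" "k > 0" and x: "4 * k\<^sup>2 * q\<^sup>2 * x ^ 3 + q * x - 1 = 0" and \<gamma>: "2 * \<gamma> = - x * (1 + q * x)"
  shows "x \<noteq> 0" "x + 2 * \<gamma> = - (q * x\<^sup>2)" "x + \<gamma> = 2 * k\<^sup>2 * q\<^sup>2 * x ^ 4" "x + \<gamma> > 0" "q * (x + 2 * \<gamma>) < 0"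
    "model_center q \<gamma> k x = 1" "model_plane q \<gamma> x = 1"
proof -
  show n: "x \<noteq> 0" using x by auto
  show a: "x + 2 * \<gamma> = - (q * x\<^sup>2)" using \<gamma> by (simp add: algebra_simps power2_eq_square)
  have "2 * (x + \<gamma>) = x * (1 - q * x)" using \<gamma> by (simp add: algebra_simps)
  also have "1 - q * x = 4 * k\<^sup>2 * q\<^sup>2 * x ^ 3" using x by simp
  also have "x * \<dots> = 2 * (2 * k\<^sup>2 * q\<^sup>2 * x ^ 4)" by (simp add: power3_eq_cube power4_eq_xxxx)
  finally show b: "x + \<gamma> = 2 * k\<^sup>2 * q\<^sup>2 * x ^ 4" by simp
  show "x + \<gamma> > 0" unfolding b using assms(1,2) n by (intro mult_pos_pos) (auto simp: zero_less_power_eq)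
  have "(q * x)\<^sup>2 > 0" using assms(1) n by simp
  then show "q * (x + 2 * \<gamma>) < 0" unfolding a by (simp add: power2_eq_square mult_ac)
  show "model_center q \<gamma> k x = 1" "model_plane q \<gamma> x = 1"
    unfolding model_center_def model_plane_def a b using assms(1,2) n
    by (simp_all add: power2_eq_square power4_eq_xxxx)
qed

lemma rho_interval_eq:
  assumes "q = \<epsilon> * \<Lambda> / 3" "q \<noteq> 0" "j = (if q < 0 then 1 else 2)" "\<gamma> = gamma_of \<epsilon> \<Lambda> \<rho>\<^sub>0"
  shows "rho_interval \<epsilon> \<Lambda> j \<rho>\<^sub>0 =
    connected_component_set {\<rho>. \<rho> \<noteq> 0 \<and> \<rho> + \<gamma> > 0 \<and> q * (\<rho> + 2 * \<gamma>) < 0} \<rho>\<^sub>0"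
proof -
  have "(-1) ^ (j + 1) * (\<rho> + 2 * \<gamma>) > 0 \<longleftrightarrow> q * (\<rho> + 2 * \<gamma>) < 0" for \<rho>
    using assms(2,3) by (auto simp: mult_less_0_iff)
  then show ?thesis by (simp add: rho_interval_def assms(4) Let_def)
qed

lemma (in model_interval) subset_component:
  assumes "\<rho>\<^sub>0 \<in> I"
  shows "I \<subseteq> connected_component_set {\<rho>. \<rho> \<noteq> 0 \<and> \<rho> + \<gamma> > 0 \<and> q * (\<rho> + 2 * \<gamma>) < 0} \<rho>\<^sub>0"
  by (rule connected_component_maximal[OF assms is_interval_connected[OF I_interval]])
    (use I_nz I_pos I_sign in auto)

lemma maximal_model_solution:
  assumes eps: "\<epsilon> = 1 \<or> \<epsilon> = -1" and q: "q = \<epsilon> * \<Lambda> / 3" "q \<noteq> 0" and k: "k > 0" and e: "heis_frame k e"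
    and x: "4 * k\<^sup>2 * q\<^sup>2 * \<rho>\<^sub>0 ^ 3 + q * \<rho>\<^sub>0 - 1 = 0" and j: "j = (if q < 0 then 1 else 2)"
  shows "model_solution \<epsilon> q k (gamma_of \<epsilon> \<Lambda> \<rho>\<^sub>0) e (rho_interval \<epsilon> \<Lambda> j \<rho>\<^sub>0) \<rho>\<^sub>0 \<Lambda>"
proof -
  define \<gamma> where "\<gamma> = gamma_of \<epsilon> \<Lambda> \<rho>\<^sub>0"
  define D where "D = {\<rho>. \<rho> \<noteq> 0 \<and> \<rho> + \<gamma> > 0 \<and> q * (\<rho> + 2 * \<gamma>) < 0}"
  have "2 * \<gamma> = - \<rho>\<^sub>0 * (1 + q * \<rho>\<^sub>0)" by (simp add: \<gamma>_def gamma_of_def q)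
  note V = cubic_values[OF q(2) k x this]
  have I: "rho_interval \<epsilon> \<Lambda> j \<rho>\<^sub>0 = connected_component_set D \<rho>\<^sub>0"
    unfolding D_def by (rule rho_interval_eq[OF q j \<gamma>_def])
  have "open D" unfolding D_def
    by (intro open_Collect_conj open_Collect_neq open_Collect_less continuous_intros)
  then have "open (connected_component_set D \<rho>\<^sub>0)" by (rule open_connected_component)
  moreover have "is_interval (connected_component_set D \<rho>\<^sub>0)" by (simp add: is_interval_connected_1)
  moreover have "connected_component_set D \<rho>\<^sub>0 \<subseteq> D" by (rule connected_component_subset)
  ultimately have "model_interval \<epsilon> q k \<gamma> e (connected_component_set D \<rho>\<^sub>0)"
    using eps q(2) k e by (intro model_interval.intro) (auto simp: D_def)
  moreover have "\<rho>\<^sub>0 \<in> connected_component_set D \<rho>\<^sub>0"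
    using V(1,4,5) by (simp add: D_def connected_component_refl_eq)
  ultimately show ?thesis
    unfolding I \<gamma>_def[symmetric]
    using V(6,7) q(1) by (intro model_solution.intro model_solution_axioms.intro)
qed

lemma gamma_neg_pos:
  assumes "q = \<epsilon> * \<Lambda> / 3" "\<rho>\<^sub>0 > 0" "q > 0"
  shows "gamma_of \<epsilon> \<Lambda> \<rho>\<^sub>0 < 0"
  using assms(2,3) unfolding gamma_of_def assms(1)[symmetric] by (simp add: add_pos_pos)

text \<open>In terms of \<open>y = - q * x\<close> the cubic reads
  \<open>4 k k y y y = - q (y + 1)\<close>. At \<open>y = 1\<close> this gives
  \<open>- q = 2 k k\<close>, and comparing the cube of \<open>y\<close> with \<open>y\<close> and 1
  on either side of 1 decides the inequality.\<close>

lemma cubic_root_threshold: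
  fixes q k x :: real
  assumes "q < 0" "x > 0" "k > 0" and x: "4 * k\<^sup>2 * q\<^sup>2 * x ^ 3 + q * x - 1 = 0"
  shows "1 + q * x > 0 \<longleftrightarrow> q > - 2 * k\<^sup>2"
proof -
  define y where "y = - q * x"
  have y: "y > 0" using assms by (simp add: y_def mult_neg_pos)
  have "q * (4 * k\<^sup>2 * q\<^sup>2 * x ^ 3 + q * x - 1) = 0" using x by simp
  then have e: "4 * k\<^sup>2 * y ^ 3 = - q * (y + 1)"
    by (simp add: y_def algebra_simps power2_eq_square power3_eq_cube)
  have k2: "k\<^sup>2 > 0" using assms by simp
  show ?thesis
  proof
    assume "1 + q * x > 0"
    then have y1: "y < 1" by (simp add: y_def)
    have "y ^ 3 < y" using y y1 using power_strict_decreasing[of 1 3 y] by simp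
    moreover have "y * 2 < y + 1" using y1 by simp
    ultimately have "4 * k\<^sup>2 * y ^ 3 < 4 * k\<^sup>2 * y"  using k2 by simp
    then have "- q * (y + 1) < 2 * k\<^sup>2 * (2 * y)" using e by simp
    also have "\<dots> < 2 * k\<^sup>2 * (y + 1)" using k2 y1 by simp
    finally have "- q < 2 * k\<^sup>2" by (rule mult_right_less_imp_less) (use y in simp)
    then show "q > - 2 * k\<^sup>2" by simp
  next
    assume q: "q > - 2 * k\<^sup>2"
    have "- q * (y + 1) < 2 * k\<^sup>2 * (y + 1)" by (rule mult_strict_right_mono) (use q y in simp_all)
    moreover have "2 * k\<^sup>2 * (2 * y ^ 3) = 4 * k\<^sup>2 * y ^ 3" by simp
    ultimately have "2 * k\<^sup>2 * (2 * y ^ 3) < 2 * k\<^sup>2 * (y + 1)" unfolding e by (simp only:)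
    then have l: "2 * y ^ 3 < y + 1" by (rule mult_left_less_imp_less) simp
    have "y < 1"
    proof (rule ccontr)
      assume "\<not> y < 1"
      then have "1 \<le> y" by simp
      then have "y \<le> y ^ 3" "1 \<le> y ^ 3" by (simp_all add: power_increasing[of 1 3 y, simplified])
      then show False using l by linarith
    qed
    then show "1 + q * x > 0" by (simp add: y_def)
  qed
qed

lemma cubic_root_positive:
  fixes q k x :: real
  assumes "q > 0" "4 * k\<^sup>2 * q\<^sup>2 * x ^ 3 + q * x - 1 = 0"
  shows "x > 0"
proof (rule ccontr)
  assume "\<not> x > 0"
  then have "x ^ 3 \<le> 0" "q * x \<le> 0" using assms(1) by (simp_all add: power3_eq_cube mult_le_0_iff zero_le_mult_iff)
  then have "4 * k\<^sup>2 * q\<^sup>2 * x ^ 3 \<le> 0" by (simp add: mult_le_0_iff)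
  then show False using assms(2) \<open>q * x \<le> 0\<close> by linarith
qed

lemma cubic_third: "4 * k\<^sup>2 * p\<^sup>2 * x ^ 3 + 3 * p * x - 9 = 0 \<longleftrightarrow> 4 * k\<^sup>2 * (p / 3)\<^sup>2 * x ^ 3 + p / 3 * x - 1 = (0::real)"
proof -
  have "4 * k\<^sup>2 * p\<^sup>2 * x ^ 3 + 3 * p * x - 9 = 9 * (4 * k\<^sup>2 * (p / 3)\<^sup>2 * x ^ 3 + p / 3 * x - 1)"
    unfolding power_divide by (simp add: field_simps)
  then show ?thesis by (simp only: mult_eq_0_iff) simp
qed

lemma adapted_frame_exists_quaternionic:
  assumes "quaternionic_heisenberg \<epsilon> \<Lambda> J h" "t\<^sub>0 \<in> J"
  shows "\<exists>k e. adapted_frame \<epsilon> (h t\<^sub>0) k e"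
proof (rule adapted_frame_exists)
  have "heisenberg_four_manifold \<epsilon> J h" using assms(1) by (simp add: quaternionic_heisenberg_def)
  then show "has_signature (h t\<^sub>0 0) (vector [\<epsilon>, 1, 1])" "\<epsilon> = 1 \<or> \<epsilon> = -1"
    using assms(2) by (auto simp: heisenberg_four_manifold_def)
  show "h t\<^sub>0 0 (axis 3 1) (axis 3 1) < 0" if "\<epsilon> = -1"
    using assms that by (auto simp: quaternionic_heisenberg_def intro: timelike_center_axis)
qed

context quaternionic_heis
begin

text \<open>The image of \<open>r\<close> is connected, contains the initial value and satisfies the
  defining conditions, hence lies in the maximal interval.\<close>

lemma embeds_in_model:
  assumes j: "j = (if q < 0 then 1 else 2)"
  shows "\<exists>I. open I \<and> is_interval I \<and> I \<subseteq> rho_interval \<epsilon> \<Lambda> j (r t\<^sub>0) \<and>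
    takes_model_form \<epsilon> \<Lambda> k e (gamma_of \<epsilon> \<Lambda> (r t\<^sub>0)) J h t\<^sub>0 I (r t\<^sub>0)"
proof -
  obtain I where I: "model_solution \<epsilon> q k \<gamma> e I (r t\<^sub>0) \<Lambda>" "takes_model_form \<epsilon> \<Lambda> k e \<gamma> J h t\<^sub>0 I (r t\<^sub>0)"
    using classification by blast
  interpret S: model_solution \<epsilon> q k \<gamma> e I "r t\<^sub>0" \<Lambda> by (rule I(1))
  have "I \<subseteq> rho_interval \<epsilon> \<Lambda> j (r t\<^sub>0)"
    unfolding rho_interval_eq[OF q_def q0 j \<gamma>_eq] by (rule S.subset_component[OF S.\<rho>0])
  then show ?thesis using S.I_open S.I_interval I(2) unfolding \<gamma>_eq by blast
qed

lemma incomplete_positive: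
  assumes "q > 0"
  shows "\<not> geodesically_complete (interval_times_heis J) (heis_metric \<epsilon> h)"
proof (rule incomplete)
  have "r t\<^sub>0 > 0" by (rule cubic_root_positive[OF assms r_cubic])
  then show "\<gamma> < 0 \<or> r t\<^sub>0 < 0" unfolding \<gamma>_eq using gamma_neg_pos[OF q_def _ assms] by blast
qed

end

theorem theorem1p2:
  fixes \<epsilon> \<Lambda> :: real
  assumes "\<epsilon> = 1 \<or> \<epsilon> = -1" and "\<Lambda> \<noteq> 0"
  shows
    "(\<forall>J h t\<^sub>0. quaternionic_heisenberg \<epsilon> \<Lambda> J h \<and> t\<^sub>0 \<in> J \<longrightarrow>
        (\<exists>k e. adapted_frame \<epsilon> (h t\<^sub>0) k e) \<and>
        (\<forall>k e. adapted_frame \<epsilon> (h t\<^sub>0) k e \<longrightarrow>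
           (\<epsilon> * \<Lambda> < 0 \<longrightarrow>
              (\<exists>l\<in>{1, 2, 3}. \<exists>\<rho>\<^sub>0 I.
                 rho_root \<epsilon> \<Lambda> k l = complex_of_real \<rho>\<^sub>0 \<and>
                 open I \<and> is_interval I \<and> I \<subseteq> rho_interval \<epsilon> \<Lambda> 1 \<rho>\<^sub>0 \<and>
                 takes_model_form \<epsilon> \<Lambda> k e (gamma_of \<epsilon> \<Lambda> \<rho>\<^sub>0) J h t\<^sub>0 I \<rho>\<^sub>0)) \<and>
           (\<epsilon> * \<Lambda> > 0 \<longrightarrow>
              (\<exists>\<rho>\<^sub>0 I.
                 rho_root4 \<epsilon> \<Lambda> k = complex_of_real \<rho>\<^sub>0 \<and>
                 open I \<and> is_interval I \<and> I \<subseteq> rho_interval \<epsilon> \<Lambda> 2 \<rho>\<^sub>0 \<and>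
                 takes_model_form \<epsilon> \<Lambda> k e (gamma_of \<epsilon> \<Lambda> \<rho>\<^sub>0) J h t\<^sub>0 I \<rho>\<^sub>0))) \<and>
        (\<epsilon> * \<Lambda> > 0 \<longrightarrow>
           \<not> geodesically_complete (interval_times_heis J) (heis_metric \<epsilon> h)))
     \<and>
     (\<forall>k e. 0 < k \<and> heis_frame k e \<longrightarrow>
        (\<epsilon> * \<Lambda> < 0 \<longrightarrow>
           rho_root \<epsilon> \<Lambda> k 1 \<in> \<real> \<and>
           (\<forall>l\<in>{2, 3}. rho_root \<epsilon> \<Lambda> k l \<in> \<real> \<longleftrightarrow> \<epsilon> * \<Lambda> \<le> - 81 * k\<^sup>2) \<and>
           (\<forall>l\<in>{1, 2, 3}. \<forall>\<rho>\<^sub>0. rho_root \<epsilon> \<Lambda> k l = complex_of_real \<rho>\<^sub>0 \<longrightarrow>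
              (\<exists>J h t\<^sub>0. quaternionic_heisenberg \<epsilon> \<Lambda> J h \<and> t\<^sub>0 \<in> J \<and>
                 adapted_frame \<epsilon> (h t\<^sub>0) k e \<and>
                 takes_model_form \<epsilon> \<Lambda> k e (gamma_of \<epsilon> \<Lambda> \<rho>\<^sub>0) J h t\<^sub>0
                   (rho_interval \<epsilon> \<Lambda> 1 \<rho>\<^sub>0) \<rho>\<^sub>0) \<and>
              (l = 2 \<or> l = 3 \<or> \<epsilon> * \<Lambda> > - 6 * k\<^sup>2 \<longrightarrow>
                 \<not> geodesically_complete (interval_times_heis (rho_interval \<epsilon> \<Lambda> 1 \<rho>\<^sub>0))
                      (model_metric \<epsilon> \<Lambda> k (gamma_of \<epsilon> \<Lambda> \<rho>\<^sub>0) e)) \<and>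
              (l = 1 \<and> \<epsilon> = 1 \<and> \<Lambda> < - 6 * k\<^sup>2 \<longrightarrow>
                 geodesically_complete (interval_times_heis (rho_interval \<epsilon> \<Lambda> 1 \<rho>\<^sub>0))
                   (model_metric \<epsilon> \<Lambda> k (gamma_of \<epsilon> \<Lambda> \<rho>\<^sub>0) e)))) \<and>
        (\<epsilon> * \<Lambda> > 0 \<longrightarrow>
           (\<exists>\<rho>\<^sub>0. rho_root4 \<epsilon> \<Lambda> k = complex_of_real \<rho>\<^sub>0 \<and>
              (\<exists>J h t\<^sub>0. quaternionic_heisenberg \<epsilon> \<Lambda> J h \<and> t\<^sub>0 \<in> J \<and>
                 adapted_frame \<epsilon> (h t\<^sub>0) k e \<and>
                 takes_model_form \<epsilon> \<Lambda> k e (gamma_of \<epsilon> \<Lambda> \<rho>\<^sub>0) J h t\<^sub>0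
                   (rho_interval \<epsilon> \<Lambda> 2 \<rho>\<^sub>0) \<rho>\<^sub>0) \<and>
              \<not> geodesically_complete (interval_times_heis (rho_interval \<epsilon> \<Lambda> 2 \<rho>\<^sub>0))
                   (model_metric \<epsilon> \<Lambda> k (gamma_of \<epsilon> \<Lambda> \<rho>\<^sub>0) e))))"
proof -
  note eps = assms(1) and L0 = assms(2)
  \<comment> \<open>\<open>p\<close> serves the explicit roots and \<open>q\<close> the geometry;
    the two versions of the cubic are equivalent by \<open>cubic_third\<close>.\<close>
  define p where "p = \<epsilon> * \<Lambda>"
  define q where "q = \<epsilon> * \<Lambda> / 3"
  have p0: "p \<noteq> 0" "q \<noteq> 0" using assms by (auto simp: p_def q_def)
  have sign: "q < 0 \<longleftrightarrow> p < 0" "q > 0 \<longleftrightarrow> p > 0" and q_p: "q = p / 3" by (auto simp: p_def q_def)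
  note cubic = cubic_third[of _ p, folded q_p]
  have QH: "quaternionic_heis \<epsilon> \<Lambda> J h t\<^sub>0 k q e"
    if "quaternionic_heisenberg \<epsilon> \<Lambda> J h" "t\<^sub>0 \<in> J" "adapted_frame \<epsilon> (h t\<^sub>0) k e" for J h t\<^sub>0 k e
    using that by (intro quaternionic_heis.intro) (auto simp: q_def)
  have MS: "model_solution \<epsilon> q k (gamma_of \<epsilon> \<Lambda> \<rho>\<^sub>0) e (rho_interval \<epsilon> \<Lambda> j \<rho>\<^sub>0) \<rho>\<^sub>0 \<Lambda>"
    if "k > 0" "heis_frame k e" "4 * k\<^sup>2 * p\<^sup>2 * \<rho>\<^sub>0 ^ 3 + 3 * p * \<rho>\<^sub>0 - 9 = 0" "j = (if q < 0 then 1 else 2)" for k e \<rho>\<^sub>0 j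
    using that cubic by (intro maximal_model_solution[OF eps q_def p0(2)]) auto
  have cubic_r: "4 * k\<^sup>2 * p\<^sup>2 * (quaternionic_heis.r \<epsilon> J h k e t\<^sub>0) ^ 3 + 3 * p * quaternionic_heis.r \<epsilon> J h k e t\<^sub>0 - 9 = 0"
    if "quaternionic_heis \<epsilon> \<Lambda> J h t\<^sub>0 k q e" for J h t\<^sub>0 k e
    using quaternionic_heis.r_cubic[OF that] cubic by blast
  have k_pos: "k > 0" if "adapted_frame \<epsilon> m k e" for m k e
    using that by (simp add: adapted_frame_def)
  note root_iff = real_root_iff[OF eps _ p_def p0(1)]
  have neg_forward: "\<exists>l\<in>{1, 2, 3}. \<exists>\<rho>\<^sub>0 I. rho_root \<epsilon> \<Lambda> k l = complex_of_real \<rho>\<^sub>0 \<and> open I \<and> is_interval I \<and>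
      I \<subseteq> rho_interval \<epsilon> \<Lambda> 1 \<rho>\<^sub>0 \<and> takes_model_form \<epsilon> \<Lambda> k e (gamma_of \<epsilon> \<Lambda> \<rho>\<^sub>0) J h t\<^sub>0 I \<rho>\<^sub>0"
    if "quaternionic_heisenberg \<epsilon> \<Lambda> J h" "t\<^sub>0 \<in> J" and a: "adapted_frame \<epsilon> (h t\<^sub>0) k e" and neg: "p < 0" for J h t\<^sub>0 k e
  proof -
    note Q = QH[OF that(1-3)]
    obtain l where "l \<in> {1, 2, 3}" "rho_root \<epsilon> \<Lambda> k l = complex_of_real (quaternionic_heis.r \<epsilon> J h k e t\<^sub>0)"
      using root_iff[OF k_pos[OF a]] cubic_r[OF Q] by blast
    moreover have "(1::nat) = (if q < 0 then 1 else 2)" using neg sign by simp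
    ultimately show ?thesis using quaternionic_heis.embeds_in_model[OF Q] by blast
  qed
  have pos_forward: "\<exists>\<rho>\<^sub>0 I. rho_root4 \<epsilon> \<Lambda> k = complex_of_real \<rho>\<^sub>0 \<and> open I \<and> is_interval I \<and>
      I \<subseteq> rho_interval \<epsilon> \<Lambda> 2 \<rho>\<^sub>0 \<and> takes_model_form \<epsilon> \<Lambda> k e (gamma_of \<epsilon> \<Lambda> \<rho>\<^sub>0) J h t\<^sub>0 I \<rho>\<^sub>0"
    if "quaternionic_heisenberg \<epsilon> \<Lambda> J h" "t\<^sub>0 \<in> J" and a: "adapted_frame \<epsilon> (h t\<^sub>0) k e" and pos: "p > 0" for J h t\<^sub>0 k e
  proof -
    note Q = QH[OF that(1-3)]
    obtain x where x: "rho_root4 \<epsilon> \<Lambda> k = complex_of_real x" "4 * k\<^sup>2 * p\<^sup>2 * x ^ 3 + 3 * p * x - 9 = 0"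
      using rho_root4_real[OF eps k_pos[OF a] p_def p0(1) pos] by blast
    \<comment> \<open>For positive \<open>p\<close> the cubic has only one real root, so the initial
      value of \<open>r\<close> must be the explicit one.\<close>
    have "x = quaternionic_heis.r \<epsilon> J h k e t\<^sub>0"
      by (rule cubic_unique[OF eps k_pos[OF a] p_def p0(1) pos x(2) cubic_r[OF Q]])
    moreover have "(2::nat) = (if q < 0 then 1 else 2)" using pos sign by simp
    ultimately show ?thesis using quaternionic_heis.embeds_in_model[OF Q] x(1) by blast
  qed
  have pos_incomplete: "\<not> geodesically_complete (interval_times_heis J) (heis_metric \<epsilon> h)"
    if qh: "quaternionic_heisenberg \<epsilon> \<Lambda> J h" "t\<^sub>0 \<in> J" and pos: "p > 0" for J h t\<^sub>0
  proof -
    obtain k e where "adapted_frame \<epsilon> (h t\<^sub>0) k e" using adapted_frame_exists_quaternionic[OF qh] by blast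
    then show ?thesis using quaternionic_heis.incomplete_positive[OF QH[OF qh]] pos sign by blast
  qed
  have neg_roots: "rho_root \<epsilon> \<Lambda> k 1 \<in> \<real>" "\<forall>l\<in>{2, 3}. rho_root \<epsilon> \<Lambda> k l \<in> \<real> \<longleftrightarrow> p \<le> - 81 * k\<^sup>2"
    if k: "k > 0" and neg: "p < 0" for k
  proof -
    note kk = eps k p_def p0(1)
    show "rho_root \<epsilon> \<Lambda> k 1 \<in> \<real>" using rho_root_1_pos[OF kk neg] by (auto simp: Reals_def)
    show "\<forall>l\<in>{2, 3}. rho_root \<epsilon> \<Lambda> k l \<in> \<real> \<longleftrightarrow> p \<le> - 81 * k\<^sup>2"
    proof (intro ballI iffI)
      fix l :: nat assume l: "l \<in> {2, 3}"
      show "p \<le> - 81 * k\<^sup>2" if "rho_root \<epsilon> \<Lambda> k l \<in> \<real>"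
        using that other_roots(2)[OF kk neg l] by (auto elim: Reals_cases)
      show "rho_root \<epsilon> \<Lambda> k l \<in> \<real>" if "p \<le> - 81 * k\<^sup>2" by (rule other_roots_real[OF kk that l])
    qed
  qed
  have neg_models:
    "\<exists>J h t\<^sub>0. quaternionic_heisenberg \<epsilon> \<Lambda> J h \<and> t\<^sub>0 \<in> J \<and> adapted_frame \<epsilon> (h t\<^sub>0) k e \<and>
       takes_model_form \<epsilon> \<Lambda> k e (gamma_of \<epsilon> \<Lambda> \<rho>\<^sub>0) J h t\<^sub>0 (rho_interval \<epsilon> \<Lambda> 1 \<rho>\<^sub>0) \<rho>\<^sub>0"
    "l = 2 \<or> l = 3 \<or> p > - 6 * k\<^sup>2 \<Longrightarrow> \<not> geodesically_complete (interval_times_heis (rho_interval \<epsilon> \<Lambda> 1 \<rho>\<^sub>0))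
       (model_metric \<epsilon> \<Lambda> k (gamma_of \<epsilon> \<Lambda> \<rho>\<^sub>0) e)"
    "l = 1 \<Longrightarrow> \<epsilon> = 1 \<Longrightarrow> \<Lambda> < - 6 * k\<^sup>2 \<Longrightarrow> geodesically_complete (interval_times_heis (rho_interval \<epsilon> \<Lambda> 1 \<rho>\<^sub>0))
       (model_metric \<epsilon> \<Lambda> k (gamma_of \<epsilon> \<Lambda> \<rho>\<^sub>0) e)"
    if k: "k > 0" and e: "heis_frame k e" and neg: "p < 0" and l: "l \<in> {1, 2, 3}" and root: "rho_root \<epsilon> \<Lambda> k l = complex_of_real \<rho>\<^sub>0"
    for k e l \<rho>\<^sub>0
  proof -
    note kk = eps k p_def p0(1)
    have j: "(1::nat) = (if q < 0 then 1 else 2)" and qn: "q < 0" using neg sign by auto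
    have x: "4 * k\<^sup>2 * p\<^sup>2 * \<rho>\<^sub>0 ^ 3 + 3 * p * \<rho>\<^sub>0 - 9 = 0" using root_iff[OF k] l root by blast
    then have x': "4 * k\<^sup>2 * q\<^sup>2 * \<rho>\<^sub>0 ^ 3 + q * \<rho>\<^sub>0 - 1 = 0" using cubic by blast
    define \<gamma> where "\<gamma> = gamma_of \<epsilon> \<Lambda> \<rho>\<^sub>0"
    have \<gamma>: "\<gamma> = - (\<rho>\<^sub>0 * (1 + q * \<rho>\<^sub>0)) / 2" by (simp add: \<gamma>_def gamma_of_def q_def)
    interpret S: model_solution \<epsilon> q k \<gamma> e "rho_interval \<epsilon> \<Lambda> 1 \<rho>\<^sub>0" \<rho>\<^sub>0 \<Lambda>
      unfolding \<gamma>_def by (rule MS[OF k e x j])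
    \<comment> \<open>The sign of the root decides the end of the interval at which the length is
      finite: the roots 2 and 3 are negative, while for root 1 the sign of \<gamma> matters.\<close>
    have pos1: "\<rho>\<^sub>0 > 0" if "l = 1" using rho_root_1_pos[OF kk neg] root that by auto
    have neg23: "\<rho>\<^sub>0 < 0" if "l \<noteq> 1" using other_roots(1)[OF kk neg _ root] l that by auto
    show "\<exists>J h t\<^sub>0. quaternionic_heisenberg \<epsilon> \<Lambda> J h \<and> t\<^sub>0 \<in> J \<and> adapted_frame \<epsilon> (h t\<^sub>0) k e \<and>
       takes_model_form \<epsilon> \<Lambda> k e (gamma_of \<epsilon> \<Lambda> \<rho>\<^sub>0) J h t\<^sub>0 (rho_interval \<epsilon> \<Lambda> 1 \<rho>\<^sub>0) \<rho>\<^sub>0"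
      using S.model_realization unfolding \<gamma>_def .
    show "\<not> geodesically_complete (interval_times_heis (rho_interval \<epsilon> \<Lambda> 1 \<rho>\<^sub>0)) (model_metric \<epsilon> \<Lambda> k (gamma_of \<epsilon> \<Lambda> \<rho>\<^sub>0) e)"
      if c: "l = 2 \<or> l = 3 \<or> p > - 6 * k\<^sup>2"
    proof (fold \<gamma>_def, rule S.model_incomplete, cases "l = 1")
      case True
      then have "q > - 2 * k\<^sup>2" using c by (simp add: q_p)
      then have "1 + q * \<rho>\<^sub>0 > 0" using cubic_root_threshold[OF qn pos1[OF True] k x'] by blast
      then show "\<gamma> < 0 \<or> \<rho>\<^sub>0 < 0" using pos1[OF True] by (simp add: \<gamma>)
    qed (simp add: neg23)
    show "geodesically_complete (interval_times_heis (rho_interval \<epsilon> \<Lambda> 1 \<rho>\<^sub>0)) (model_metric \<epsilon> \<Lambda> k (gamma_of \<epsilon> \<Lambda> \<rho>\<^sub>0) e)"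
      if l1: "l = 1" and e1: "\<epsilon> = 1" and L: "\<Lambda> < - 6 * k\<^sup>2"
    proof (fold \<gamma>_def, rule S.model_complete[OF e1])
      note r0 = pos1[OF l1]
      have "2 * k\<^sup>2 < - q" using L e1 by (simp add: q_def)
      \<comment> \<open>The boundary case is \<gamma> = 0. There the cubic forces
        \<open>q = - 2 k k\<close>, which the strict inequality for \<Lambda> excludes.\<close>
      have "1 + q * \<rho>\<^sub>0 \<noteq> 0"
      proof
        assume "1 + q * \<rho>\<^sub>0 = 0"
        then have q1: "q * \<rho>\<^sub>0 = -1" by simp
        have "4 * k\<^sup>2 * q\<^sup>2 * \<rho>\<^sub>0 ^ 3 = 4 * k\<^sup>2 * (q * \<rho>\<^sub>0)\<^sup>2 * \<rho>\<^sub>0" by (simp add: power2_eq_square power3_eq_cube)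
        then have "4 * k\<^sup>2 * (-1)\<^sup>2 * \<rho>\<^sub>0 + (-1) - 1 = 0" using x' unfolding q1 by (simp only:)
        then have "2 * k\<^sup>2 * \<rho>\<^sub>0 = 1" by (simp add: mult_ac)
        moreover have "2 * k\<^sup>2 * \<rho>\<^sub>0 < - q * \<rho>\<^sub>0" using \<open>2 * k\<^sup>2 < - q\<close> r0 by (rule mult_strict_right_mono)
        ultimately show False using q1 by simp
      qed
      moreover have "\<not> 1 + q * \<rho>\<^sub>0 > 0"
        using cubic_root_threshold[OF qn r0 k x'] \<open>2 * k\<^sup>2 < - q\<close> by simp
      ultimately have "1 + q * \<rho>\<^sub>0 < 0" by simp
      then have "\<rho>\<^sub>0 * (1 + q * \<rho>\<^sub>0) < 0" using r0 by (rule mult_pos_neg[rotated])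
      then show \<gamma>0: "\<gamma> > 0" by (simp add: \<gamma>)
      have rI: "rho_interval \<epsilon> \<Lambda> 1 \<rho>\<^sub>0 = connected_component_set {\<rho>. \<rho> \<noteq> 0 \<and> \<rho> + \<gamma> > 0 \<and> q * (\<rho> + 2 * \<gamma>) < 0} \<rho>\<^sub>0"
        by (rule rho_interval_eq[OF q_def p0(2) j \<gamma>_def])
      \<comment> \<open>For positive \<gamma> and negative \<open>q\<close> all conditions hold on
        the positive reals, and the component cannot cross 0.\<close>
      show "rho_interval \<epsilon> \<Lambda> 1 \<rho>\<^sub>0 = {0<..}"
      proof
        show "{0<..} \<subseteq> rho_interval \<epsilon> \<Lambda> 1 \<rho>\<^sub>0"
          unfolding rI
          by (rule connected_component_maximal) (use r0 \<gamma>0 qn in \<open>auto simp: mult_less_0_iff\<close>)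
        show "rho_interval \<epsilon> \<Lambda> 1 \<rho>\<^sub>0 \<subseteq> {0<..}"
        proof
          fix y assume y: "y \<in> rho_interval \<epsilon> \<Lambda> 1 \<rho>\<^sub>0"
          have "0 \<in> rho_interval \<epsilon> \<Lambda> 1 \<rho>\<^sub>0" if "y \<le> 0"
            using S.I_interval y S.\<rho>0 that r0 unfolding is_interval_1 by (meson less_imp_le)
          then show "y \<in> {0<..}" using S.I_nz by force
        qed
      qed
    qed
  qed
  have pos_models: "\<exists>\<rho>\<^sub>0. rho_root4 \<epsilon> \<Lambda> k = complex_of_real \<rho>\<^sub>0 \<and>
      (\<exists>J h t\<^sub>0. quaternionic_heisenberg \<epsilon> \<Lambda> J h \<and> t\<^sub>0 \<in> J \<and> adapted_frame \<epsilon> (h t\<^sub>0) k e \<and>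
        takes_model_form \<epsilon> \<Lambda> k e (gamma_of \<epsilon> \<Lambda> \<rho>\<^sub>0) J h t\<^sub>0 (rho_interval \<epsilon> \<Lambda> 2 \<rho>\<^sub>0) \<rho>\<^sub>0) \<and>
      \<not> geodesically_complete (interval_times_heis (rho_interval \<epsilon> \<Lambda> 2 \<rho>\<^sub>0)) (model_metric \<epsilon> \<Lambda> k (gamma_of \<epsilon> \<Lambda> \<rho>\<^sub>0) e)"
    if k: "k > 0" and e: "heis_frame k e" and pos: "p > 0" for k e
  proof -
    obtain x where x: "rho_root4 \<epsilon> \<Lambda> k = complex_of_real x" "4 * k\<^sup>2 * p\<^sup>2 * x ^ 3 + 3 * p * x - 9 = 0"
      using rho_root4_real[OF eps k p_def p0(1) pos] by blast
    have j: "(2::nat) = (if q < 0 then 1 else 2)" and qp: "q > 0" using pos sign by auto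
    interpret S: model_solution \<epsilon> q k "gamma_of \<epsilon> \<Lambda> x" e "rho_interval \<epsilon> \<Lambda> 2 x" x \<Lambda>
      by (rule MS[OF k e x(2) j])
    have "x > 0" by (rule cubic_root_positive[OF qp]) (use cubic x(2) in blast)
    then have "gamma_of \<epsilon> \<Lambda> x < 0" by (rule gamma_neg_pos[OF q_def _ qp])
    then show ?thesis using S.model_realization S.model_incomplete x(1) by blast
  qed
  show ?thesis
    unfolding p_def[symmetric]
  proof (intro conjI allI impI; (elim conjE)?)
    fix J h and t\<^sub>0 :: real assume qh: "quaternionic_heisenberg \<epsilon> \<Lambda> J h" "t\<^sub>0 \<in> J"
    show "\<exists>k e. adapted_frame \<epsilon> (h t\<^sub>0) k e" by (rule adapted_frame_exists_quaternionic[OF qh])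
    show "\<not> geodesically_complete (interval_times_heis J) (heis_metric \<epsilon> h)" if "p > 0"
      by (rule pos_incomplete[OF qh that])
    fix k e assume a: "adapted_frame \<epsilon> (h t\<^sub>0) k e"
    show "\<exists>l\<in>{1, 2, 3}. \<exists>\<rho>\<^sub>0 I. rho_root \<epsilon> \<Lambda> k l = complex_of_real \<rho>\<^sub>0 \<and> open I \<and> is_interval I \<and>
      I \<subseteq> rho_interval \<epsilon> \<Lambda> 1 \<rho>\<^sub>0 \<and> takes_model_form \<epsilon> \<Lambda> k e (gamma_of \<epsilon> \<Lambda> \<rho>\<^sub>0) J h t\<^sub>0 I \<rho>\<^sub>0" if "p < 0"
      by (rule neg_forward[OF qh a that])
    show "\<exists>\<rho>\<^sub>0 I. rho_root4 \<epsilon> \<Lambda> k = complex_of_real \<rho>\<^sub>0 \<and> open I \<and> is_interval I \<and>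
      I \<subseteq> rho_interval \<epsilon> \<Lambda> 2 \<rho>\<^sub>0 \<and> takes_model_form \<epsilon> \<Lambda> k e (gamma_of \<epsilon> \<Lambda> \<rho>\<^sub>0) J h t\<^sub>0 I \<rho>\<^sub>0" if "p > 0"
      by (rule pos_forward[OF qh a that])
  next
    fix k e assume k: "k > 0" and e: "heis_frame k e"
    show "rho_root \<epsilon> \<Lambda> k 1 \<in> \<real>" if "p < 0" by (rule neg_roots(1)[OF k that])
    show "\<forall>l\<in>{2, 3}. rho_root \<epsilon> \<Lambda> k l \<in> \<real> \<longleftrightarrow> p \<le> - 81 * k\<^sup>2" if "p < 0" by (rule neg_roots(2)[OF k that])
    show "\<forall>l\<in>{1, 2, 3}. \<forall>\<rho>\<^sub>0. rho_root \<epsilon> \<Lambda> k l = complex_of_real \<rho>\<^sub>0 \<longrightarrow>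
        (\<exists>J h t\<^sub>0. quaternionic_heisenberg \<epsilon> \<Lambda> J h \<and> t\<^sub>0 \<in> J \<and> adapted_frame \<epsilon> (h t\<^sub>0) k e \<and>
           takes_model_form \<epsilon> \<Lambda> k e (gamma_of \<epsilon> \<Lambda> \<rho>\<^sub>0) J h t\<^sub>0 (rho_interval \<epsilon> \<Lambda> 1 \<rho>\<^sub>0) \<rho>\<^sub>0) \<and>
        (l = 2 \<or> l = 3 \<or> p > - 6 * k\<^sup>2 \<longrightarrow>
           \<not> geodesically_complete (interval_times_heis (rho_interval \<epsilon> \<Lambda> 1 \<rho>\<^sub>0)) (model_metric \<epsilon> \<Lambda> k (gamma_of \<epsilon> \<Lambda> \<rho>\<^sub>0) e)) \<and>
        (l = 1 \<and> \<epsilon> = 1 \<and> \<Lambda> < - 6 * k\<^sup>2 \<longrightarrow>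
           geodesically_complete (interval_times_heis (rho_interval \<epsilon> \<Lambda> 1 \<rho>\<^sub>0)) (model_metric \<epsilon> \<Lambda> k (gamma_of \<epsilon> \<Lambda> \<rho>\<^sub>0) e))"
      if "p < 0"
      by (intro ballI allI impI conjI; (elim conjE)?)
        (rule neg_models(1)[OF k e that] neg_models(2)[OF k e that] neg_models(3)[OF k e that]; assumption)+
    show "\<exists>\<rho>\<^sub>0. rho_root4 \<epsilon> \<Lambda> k = complex_of_real \<rho>\<^sub>0 \<and>
      (\<exists>J h t\<^sub>0. quaternionic_heisenberg \<epsilon> \<Lambda> J h \<and> t\<^sub>0 \<in> J \<and> adapted_frame \<epsilon> (h t\<^sub>0) k e \<and>
        takes_model_form \<epsilon> \<Lambda> k e (gamma_of \<epsilon> \<Lambda> \<rho>\<^sub>0) J h t\<^sub>0 (rho_interval \<epsilon> \<Lambda> 2 \<rho>\<^sub>0) \<rho>\<^sub>0) \<and>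
      \<not> geodesically_complete (interval_times_heis (rho_interval \<epsilon> \<Lambda> 2 \<rho>\<^sub>0)) (model_metric \<epsilon> \<Lambda> k (gamma_of \<epsilon> \<Lambda> \<rho>\<^sub>0) e)"
      if "p > 0" by (rule pos_models[OF k e that])
  qed
qed

end
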